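(* Let $c>0$. For every $\eta_0 \in H^1_{\rm per}(\mathbb{T}) \cap W^{1,\infty}(\mathbb{T})$, there exist $\tau_0 > 0$ and a unique solution $$\eta \in C^0\big((-\tau_0,\tau_0),H^1_{\rm per}(\mathbb{T}) \cap W^{1,\infty}(\mathbb{T})\big) \cap C^1\big((-\tau_0,\tau_0),L^2(\mathbb{T}) \cap L^{\infty}(\mathbb{T})\big)$$ of the evolution equation $$2 c\, \partial_t \eta = (c^2 - 2 \eta)\, \partial_x \eta + \Pi_0 \partial_x^{-1} \Pi_0 \left[ (\partial_x \eta)^2 + \eta \right]$$ with $\eta(0,\cdot) = \eta_0$, which is also continuous with respect to the initial data $\eta_0 \in H^1_{\rm per}(\mathbb{T}) \cap W^{1,\infty}(\mathbb{T})$.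
   Context: $\mathbb{T}$ denotes the $2\pi$-periodic domain $\mathbb{R}/2\pi\mathbb{Z}$; the unknown $\eta=\eta(t,x)$ is real-valued and $2\pi$-periodic in $x$. $\Pi_0 : L^2(\mathbb{T}) \to L^2(\mathbb{T})|_{\{1\}^\perp}$ is the projection onto periodic functions with zero mean, $\Pi_0 f = f - \frac{1}{2\pi}\int_{\mathbb{T}} f\,dx$. The operator $\Pi_0\partial_x^{-1}\Pi_0$ maps $f$ to the unique $2\pi$-periodic zero-mean function whose derivative is $\Pi_0 f$; in Fourier series, $\sum_n f_n e^{inx} \mapsto \sum_{n\neq 0} \frac{f_n}{in}e^{inx}$.
   Formalization: Continuity and differentiability in time, and continuity in the data, hold in the norm of H^1 (resp. L^2) plus the weak-* topology of W^{1,∞} (resp. L^∞); with the W^{1,∞} and L^∞ norms the claim fails, since corners of η_0 are transported. *)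

theory Defs
  imports "HOL-Analysis.Analysis" "HOL-Probability.Essential_Supremum"
begin

text \<open>
  Functions on the torus are \<open>2 * pi\<close>-periodic functions on the reals, integrated over one period;
  elements of the Lebesgue and Sobolev spaces are representatives, identified up to null sets.
\<close>

abbreviation torus :: "real measure"
  where "torus \<equiv> lebesgue_on {0..2*pi}"

definition periodic :: "(real \<Rightarrow> real) \<Rightarrow> bool"
  where "periodic f \<longleftrightarrow> (\<forall>x. f (x + 2*pi) = f x)"

definition L1_per :: "(real \<Rightarrow> real) set"
  where "L1_per = {f. periodic f \<and> integrable torus f}"

definition L2_per :: "(real \<Rightarrow> real) set"
  where "L2_per = {f. periodic f \<and> f \<in> borel_measurable torus \<and> integrable torus (\<lambda>x. (f x)\<^sup>2)}"

definition Linf_per :: "(real \<Rightarrow> real) set"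
  where "Linf_per = {f. periodic f \<and> f \<in> borel_measurable torus \<and>
                        esssup torus (\<lambda>x. ereal \<bar>f x\<bar>) < \<infinity>}"

definition L2_norm :: "(real \<Rightarrow> real) \<Rightarrow> real"
  where "L2_norm f = sqrt (\<integral>x. (f x)\<^sup>2 \<partial>torus)"

definition Linf_norm :: "(real \<Rightarrow> real) \<Rightarrow> real"
  where "Linf_norm f = real_of_ereal (esssup torus (\<lambda>x. ereal \<bar>f x\<bar>))"

definition smooth_per :: "(real \<Rightarrow> real) set"
  where "smooth_per = {\<phi>. periodic \<phi> \<and> (\<forall>n x. ((deriv ^^ n) \<phi>) differentiable (at x))}"

definition has_weak_deriv :: "(real \<Rightarrow> real) \<Rightarrow> (real \<Rightarrow> real) \<Rightarrow> bool"
  where "has_weak_deriv u v \<longleftrightarrow> u \<in> L1_per \<and> v \<in> L1_per \<and>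
           (\<forall>\<phi>\<in>smooth_per. (\<integral>x. u x * deriv \<phi> x \<partial>torus) = - (\<integral>x. v x * \<phi> x \<partial>torus))"

text \<open>The weak derivative is unique up to null sets; the choice of representative is immaterial.\<close>

definition weak_deriv :: "(real \<Rightarrow> real) \<Rightarrow> real \<Rightarrow> real"
  where "weak_deriv u = (SOME v. has_weak_deriv u v)"

definition H1_per :: "(real \<Rightarrow> real) set"
  where "H1_per = {u \<in> L2_per. \<exists>v\<in>L2_per. has_weak_deriv u v}"

definition W1inf_per :: "(real \<Rightarrow> real) set"
  where "W1inf_per = {u \<in> Linf_per. \<exists>v\<in>Linf_per. has_weak_deriv u v}"

definition H1_norm :: "(real \<Rightarrow> real) \<Rightarrow> real"
  where "H1_norm u = sqrt ((L2_norm u)\<^sup>2 + (L2_norm (weak_deriv u))\<^sup>2)"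

definition W1inf_norm :: "(real \<Rightarrow> real) \<Rightarrow> real"
  where "W1inf_norm u = max (Linf_norm u) (Linf_norm (weak_deriv u))"

definition mean :: "(real \<Rightarrow> real) \<Rightarrow> real"
  where "mean f = (\<integral>x. f x \<partial>torus) / (2*pi)"

definition Pi0 :: "(real \<Rightarrow> real) \<Rightarrow> real \<Rightarrow> real"
  where "Pi0 f = (\<lambda>x. f x - mean f)"

text \<open>The operator \<open>\<Pi>\<^sub>0 \<partial>\<^sub>x\<^sup>-\<^sup>1 \<Pi>\<^sub>0\<close>; again the function chosen is unique up to null sets.\<close>

definition Pi0_inv_dx_Pi0 :: "(real \<Rightarrow> real) \<Rightarrow> real \<Rightarrow> real"
  where "Pi0_inv_dx_Pi0 f = (SOME g. mean g = 0 \<and> has_weak_deriv g (Pi0 f))"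

text \<open>
  \<open>H\<^sup>1 \<inter> W\<^sup>1\<^sup>,\<^sup>\<infinity>\<close> and \<open>L\<^sup>2 \<inter> L\<^sup>\<infinity>\<close>, as target spaces of curves in time, carry the norm of the Hilbert
  space together with the weak-* topology of \<open>W\<^sup>1\<^sup>,\<^sup>\<infinity>\<close> resp. of \<open>L\<^sup>\<infinity> = (L\<^sup>1)*\<close>.  The norm topology of
  \<open>W\<^sup>1\<^sup>,\<^sup>\<infinity>\<close> is not usable here: a corner of the initial data is transported with the local speed
  of the equation, and a moving jump of the slope is not continuous in time in the norm of \<open>L\<^sup>\<infinity>\<close>.
  Both topologies are given by their generating families of seminorms.
\<close>

definition pairing :: "(real \<Rightarrow> real) \<Rightarrow> (real \<Rightarrow> real) \<Rightarrow> real"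
  where "pairing f g = (\<integral>x. f x * g x \<partial>torus)"

definition seminorms_H1_W1inf :: "((real \<Rightarrow> real) \<Rightarrow> real) set"
  where "seminorms_H1_W1inf =
           {H1_norm} \<union> {(\<lambda>u. \<bar>pairing u g\<bar>) | g. g \<in> L1_per}
                     \<union> {(\<lambda>u. \<bar>pairing (weak_deriv u) g\<bar>) | g. g \<in> L1_per}"

definition seminorms_L2_Linf :: "((real \<Rightarrow> real) \<Rightarrow> real) set"
  where "seminorms_L2_Linf = {L2_norm} \<union> {(\<lambda>u. \<bar>pairing u g\<bar>) | g. g \<in> L1_per}"

definition tendsto_wrt ::
    "((real \<Rightarrow> real) \<Rightarrow> real) set \<Rightarrow> ('a \<Rightarrow> real \<Rightarrow> real) \<Rightarrow> (real \<Rightarrow> real) \<Rightarrow> 'a filter \<Rightarrow> bool"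
  where "tendsto_wrt P u l F \<longleftrightarrow> (\<forall>p\<in>P. ((\<lambda>a. p (\<lambda>x. u a x - l x)) \<longlongrightarrow> 0) F)"

text \<open>In the following, \<open>I\<close> is an open time interval.\<close>

definition C0_H1_W1inf :: "real set \<Rightarrow> (real \<Rightarrow> real \<Rightarrow> real) set"
  where "C0_H1_W1inf I =
           {\<eta>. \<forall>t\<in>I. \<eta> t \<in> H1_per \<inter> W1inf_per \<and> tendsto_wrt seminorms_H1_W1inf \<eta> (\<eta> t) (at t)}"

definition C0_L2_Linf :: "real set \<Rightarrow> (real \<Rightarrow> real \<Rightarrow> real) set"
  where "C0_L2_Linf I =
           {\<eta>. \<forall>t\<in>I. \<eta> t \<in> L2_per \<inter> Linf_per \<and> tendsto_wrt seminorms_L2_Linf \<eta> (\<eta> t) (at t)}"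

definition has_time_deriv :: "(real \<Rightarrow> real \<Rightarrow> real) \<Rightarrow> (real \<Rightarrow> real) \<Rightarrow> real \<Rightarrow> bool"
  where "has_time_deriv \<eta> w t \<longleftrightarrow> w \<in> L2_per \<inter> Linf_per \<and>
           tendsto_wrt seminorms_L2_Linf (\<lambda>s x. (\<eta> s x - \<eta> t x) / (s - t)) w (at t)"

definition time_deriv :: "(real \<Rightarrow> real \<Rightarrow> real) \<Rightarrow> real \<Rightarrow> real \<Rightarrow> real"
  where "time_deriv \<eta> t = (SOME w. has_time_deriv \<eta> w t)"

definition C1_L2_Linf :: "real set \<Rightarrow> (real \<Rightarrow> real \<Rightarrow> real) set"
  where "C1_L2_Linf I =
           {\<eta> \<in> C0_L2_Linf I. \<exists>w\<in>C0_L2_Linf I. \<forall>t\<in>I. has_time_deriv \<eta> (w t) t}"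

definition is_solution ::
    "real \<Rightarrow> real \<Rightarrow> (real \<Rightarrow> real) \<Rightarrow> (real \<Rightarrow> real \<Rightarrow> real) \<Rightarrow> bool"
  where "is_solution c \<tau> \<eta>0 \<eta> \<longleftrightarrow>
           \<eta> \<in> C0_H1_W1inf {-\<tau><..<\<tau>} \<inter> C1_L2_Linf {-\<tau><..<\<tau>} \<and>
           (AE x in torus. \<eta> 0 x = \<eta>0 x) \<and>
           (\<forall>t\<in>{-\<tau><..<\<tau>}. AE x in torus.
              2 * c * time_deriv \<eta> t x =
                (c\<^sup>2 - 2 * \<eta> t x) * weak_deriv (\<eta> t) x +
                Pi0_inv_dx_Pi0 (\<lambda>y. (weak_deriv (\<eta> t) y)\<^sup>2 + \<eta> t y) x)"

text \<open>Uniform convergence on compact subsets of \<open>I\<close>, i.e. convergence in \<open>C\<^sup>0(I)\<close>.\<close>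

definition converges_C0 ::
    "((real \<Rightarrow> real) \<Rightarrow> real) set \<Rightarrow> real set \<Rightarrow>
     (nat \<Rightarrow> real \<Rightarrow> real \<Rightarrow> real) \<Rightarrow> (real \<Rightarrow> real \<Rightarrow> real) \<Rightarrow> bool"
  where "converges_C0 P I \<zeta> \<eta> \<longleftrightarrow>
           (\<forall>p\<in>P. \<forall>K. compact K \<and> K \<subseteq> I \<longrightarrow>
              uniform_limit K (\<lambda>n t. p (\<lambda>x. \<zeta> n t x - \<eta> t x)) (\<lambda>t. 0) sequentially)"

text \<open>
  All data in some norm ball around \<open>\<eta>0\<close> have a solution on the same time interval, and on this ball
  the solution depends continuously on the data.  Convergence of the data is only required in the
  topology of \<open>H\<^sup>1 \<inter> W\<^sup>1\<^sup>,\<^sup>\<infinity>\<close> above, hence norm convergence of the data is covered.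
\<close>

definition continuous_dependence ::
    "real \<Rightarrow> real \<Rightarrow> (real \<Rightarrow> real) \<Rightarrow> (real \<Rightarrow> real \<Rightarrow> real) \<Rightarrow> bool"
  where "continuous_dependence c \<tau> \<eta>0 \<eta> \<longleftrightarrow>
           (\<exists>\<delta>>0.
              let B = {\<zeta>0 \<in> H1_per \<inter> W1inf_per.
                         H1_norm (\<lambda>x. \<zeta>0 x - \<eta>0 x) + W1inf_norm (\<lambda>x. \<zeta>0 x - \<eta>0 x) < \<delta>}
              in (\<forall>\<zeta>0\<in>B. \<exists>\<zeta>. is_solution c \<tau> \<zeta>0 \<zeta>) \<and>
                 (\<forall>\<zeta>0 \<zeta>. (\<forall>n. \<zeta>0 n \<in> B \<and> is_solution c \<tau> (\<zeta>0 n) (\<zeta> n)) \<and>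
                          tendsto_wrt seminorms_H1_W1inf \<zeta>0 \<eta>0 sequentially \<longrightarrow>
                    converges_C0 seminorms_H1_W1inf {-\<tau><..<\<tau>} \<zeta> \<eta> \<and>
                    converges_C0 seminorms_L2_Linf {-\<tau><..<\<tau>} (\<lambda>n. time_deriv (\<zeta> n))
                      (time_deriv \<eta>)))"

end

theory Submission
  imports Defs
begin

text \<open>
  The equation \<open>\<partial>\<^sub>t u + V \<partial>\<^sub>x u = F/(2c)\<close> has the local speed \<open>V = (2u - c\<^sup>2)/(2c)\<close> and the nonlocal source
  \<open>F = \<Pi>\<^sub>0 \<partial>\<^sub>x\<^sup>-\<^sup>1 \<Pi>\<^sub>0 [m\<^sup>2 + u]\<close>, where \<open>m = \<partial>\<^sub>x u\<close>. For \<open>u\<close> in \<open>W\<^sup>1\<^sup>,\<^sup>\<infinity>\<close> the speed is Lipschitz in \<open>x\<close>, so that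
  characteristics exist and do not cross, and the source is Lipschitz as well. Everything rests on the
  behaviour of two quantities along the characteristics \<open>X\<close>.

  The first is the energy. Since \<open>\<partial>\<^sub>x V = m/c\<close> and \<open>\<partial>\<^sub>x F = m\<^sup>2 + u - k\<close> with \<open>k\<close> the average of \<open>m\<^sup>2 + u\<close>, the
  terms of third order in \<open>m\<close> cancel and \<open>\<partial>\<^sub>t m\<^sup>2 + \<partial>\<^sub>x (V m\<^sup>2) = \<partial>\<^sub>x ((u - k)\<^sup>2/(2c))\<close>. Hence the positions of the
  characteristics, the values of \<open>u\<close> on them and the energies \<open>\<integral>m\<^sup>2\<close> between them satisfy a closed system whose
  rates are Lipschitz functions of these quantities (\<open>u_deriv_along\<close>, \<open>energy_deriv\<close>): the source depends on
  the slope only through the primitive of \<open>m\<^sup>2\<close>. The Gronwall lemma gives \<open>stability\<close> in the supremum norm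
  without a loss of derivatives, in particular uniqueness. Both laws have to be derived for a solution of
  minimal regularity, by averaging over short intervals and over partitions that move with the flow.

  The second is the slope. It obeys a Riccati equation along characteristics, which becomes linear in the
  variables \<open>q\<close> and \<open>p = q m\<close> where \<open>q\<^sup>2\<close> is the Jacobian \<open>\<partial>\<^sub>\<xi> X\<close>. In these variables the problem is an ordinary
  differential equation with a locally Lipschitz vector field on a Banach space of bounded periodic
  functions, and the Picard-Lindeloef theorem gives solutions on a common time interval for all data of
  bounded size. Returning to the original variables yields \<open>lipschitz_solution_exists\<close>.

  Neither argument provides convergence of slopes in the original variables, where jumps of the slope
  travel. This is supplied by \<open>slope_convergence\<close>: if \<open>u\<close> converges uniformly and the energy converges, then
  the slopes converge weakly together with their norms in \<open>L\<^sup>2\<close>, hence strongly. On sets that are bounded in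
  \<open>L\<^sup>\<infinity>\<close>, convergence in \<open>L\<^sup>1\<close> controls all seminorms of the spaces involved, so that continuity in time,
  differentiability in time and continuous dependence on the data are all reduced to limits in \<open>L\<^sup>1\<close>.

  Conversely, an arbitrary solution has Lipschitz representatives whose Lipschitz constants are bounded
  locally in time, by weak-* continuity and the uniform boundedness principle
  (\<open>solution_has_lipschitz_version\<close>), and therefore it is covered by the stability estimate.
\<close>

section \<open>Locally bounded functions and their primitives\<close>

text \<open>
  Slopes are handled as functions that are defined everywhere, measurable and locally bounded.
  This class is closed under all operations used below and consists of functions that are
  integrable over every interval, so that null sets enter only at the interface to the function spaces.
\<close>

definition loc_bdd :: "(real \<Rightarrow> real) \<Rightarrow> bool"
  where "loc_bdd f \<longleftrightarrow> f \<in> borel_measurable borel \<and> (\<forall>a b. \<exists>B. \<forall>x\<in>{a..b}. \<bar>f x\<bar> \<le> B)"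

text \<open>
  The bound is an argument because all estimates are uniform on bounded sets of data.
\<close>

definition bper :: "real \<Rightarrow> (real \<Rightarrow> real) \<Rightarrow> bool"
  where "bper B f \<longleftrightarrow> f \<in> borel_measurable borel \<and> periodic f \<and> (\<forall>x. \<bar>f x\<bar> \<le> B)"

text \<open>
  With a primitive on the whole line, integrals over \<open>[a,b]\<close> are differences \<open>prim f b - prim f a\<close> for
  either order of \<open>a\<close> and \<open>b\<close>; translations and telescoping sums of integrals become linear arithmetic.
\<close>

definition prim :: "(real \<Rightarrow> real) \<Rightarrow> real \<Rightarrow> real"
  where "prim f x = (if 0 \<le> x then integral {0..x} f else - integral {x..0} f)"

definition L1_norm :: "(real \<Rightarrow> real) \<Rightarrow> real"
  where "L1_norm f = prim (\<lambda>x. \<bar>f x\<bar>) (2*pi)"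

abbreviation energy :: "(real \<Rightarrow> real) \<Rightarrow> real \<Rightarrow> real"
  where "energy m \<equiv> prim (\<lambda>x. (m x)\<^sup>2)"

abbreviation L1_dist :: "(real \<Rightarrow> real) \<Rightarrow> (real \<Rightarrow> real) \<Rightarrow> real"
  where "L1_dist f g \<equiv> L1_norm (\<lambda>x. f x - g x)"

abbreviation slope_error :: "(real \<Rightarrow> real) \<Rightarrow> real \<Rightarrow> real \<Rightarrow> real \<Rightarrow> real"
  where "slope_error m r a b \<equiv> prim (\<lambda>z. \<bar>m z - r\<bar>) b - prim (\<lambda>z. \<bar>m z - r\<bar>) a"

lemma loc_bdd_measurable[measurable_dest]: "loc_bdd f \<Longrightarrow> f \<in> borel_measurable borel"
  by (simp add: loc_bdd_def)

lemma loc_bdd_bound: "loc_bdd f \<Longrightarrow> \<exists>B. \<forall>x\<in>{a..b}. \<bar>f x\<bar> \<le> B"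
  by (simp add: loc_bdd_def)

lemma loc_bdd_continuous: "continuous_on UNIV f \<Longrightarrow> loc_bdd f"
  unfolding loc_bdd_def
proof (intro conjI allI)
  assume c: "continuous_on UNIV f"
  then show "f \<in> borel_measurable borel" by (rule borel_measurable_continuous_onI)
  fix a b
  have "compact (f ` {a..b})"
    by (rule compact_continuous_image[OF continuous_on_subset[OF c]]) auto
  then have "bounded (f ` {a..b})" by (rule compact_imp_bounded)
  then show "\<exists>B. \<forall>x\<in>{a..b}. \<bar>f x\<bar> \<le> B" by (auto simp: bounded_iff)
qed

lemma loc_bdd_const[simp]: "loc_bdd (\<lambda>x. c)"
  by (rule loc_bdd_continuous) simp

lemma loc_bdd_add[simp]: assumes "loc_bdd f" "loc_bdd g" shows "loc_bdd (\<lambda>x. f x + g x)"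
  unfolding loc_bdd_def
proof (intro conjI allI)
  show "(\<lambda>x. f x + g x) \<in> borel_measurable borel" using assms by measurable
  fix a b
  obtain B C where "\<forall>x\<in>{a..b}. \<bar>f x\<bar> \<le> B" "\<forall>x\<in>{a..b}. \<bar>g x\<bar> \<le> C"
    using loc_bdd_bound[OF assms(1), of a b] loc_bdd_bound[OF assms(2), of a b] by blast
  then have "\<forall>x\<in>{a..b}. \<bar>f x + g x\<bar> \<le> B + C" by fastforce
  then show "\<exists>B. \<forall>x\<in>{a..b}. \<bar>f x + g x\<bar> \<le> B" by blast
qed

lemma loc_bdd_mult[simp]: assumes "loc_bdd f" "loc_bdd g" shows "loc_bdd (\<lambda>x. f x * g x)"
  unfolding loc_bdd_def
proof (intro conjI allI)
  show "(\<lambda>x. f x * g x) \<in> borel_measurable borel" using assms by measurable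
  fix a b
  obtain B C where "\<forall>x\<in>{a..b}. \<bar>f x\<bar> \<le> B" "\<forall>x\<in>{a..b}. \<bar>g x\<bar> \<le> C"
    using loc_bdd_bound[OF assms(1), of a b] loc_bdd_bound[OF assms(2), of a b] by blast
  then have "\<forall>x\<in>{a..b}. \<bar>f x * g x\<bar> \<le> \<bar>B\<bar> * \<bar>C\<bar>"
    unfolding abs_mult by (intro ballI mult_mono) force+
  then show "\<exists>B. \<forall>x\<in>{a..b}. \<bar>f x * g x\<bar> \<le> B" by blast
qed

lemma loc_bdd_cong: "(\<And>x. f x = g x) \<Longrightarrow> loc_bdd f \<Longrightarrow> loc_bdd g"
  by (metis ext)

lemma loc_bdd_minus[simp]: "loc_bdd f \<Longrightarrow> loc_bdd (\<lambda>x. - f x)"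
  using loc_bdd_mult[of "\<lambda>x. -1" f] by simp

lemma loc_bdd_diff[simp]: "loc_bdd f \<Longrightarrow> loc_bdd g \<Longrightarrow> loc_bdd (\<lambda>x. f x - g x)"
  using loc_bdd_add[of f "\<lambda>x. - g x"] by simp

lemma loc_bdd_divide[simp]: "loc_bdd f \<Longrightarrow> loc_bdd (\<lambda>x. f x / c)"
  using loc_bdd_mult[of f "\<lambda>x. 1/c"] by simp

lemma loc_bdd_power2[simp]: "loc_bdd f \<Longrightarrow> loc_bdd (\<lambda>x. (f x)\<^sup>2)"
  using loc_bdd_mult[of f f] by (simp add: power2_eq_square)

lemma loc_bdd_abs[simp]: "loc_bdd f \<Longrightarrow> loc_bdd (\<lambda>x. \<bar>f x\<bar>)"
  by (auto simp: loc_bdd_def)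

lemma loc_bdd_shift[simp]: assumes "loc_bdd f" shows "loc_bdd (\<lambda>x. f (x + h))"
  unfolding loc_bdd_def
proof (intro conjI allI)
  show "(\<lambda>x. f (x + h)) \<in> borel_measurable borel"
    by (rule measurable_compose[OF _ loc_bdd_measurable[OF assms]]) simp
  fix a b
  obtain B where "\<forall>x\<in>{a+h..b+h}. \<bar>f x\<bar> \<le> B" using loc_bdd_bound[OF assms, of "a+h" "b+h"] by blast
  then have "\<forall>x\<in>{a..b}. \<bar>f (x+h)\<bar> \<le> B" by auto
  then show "\<exists>B. \<forall>x\<in>{a..b}. \<bar>f (x+h)\<bar> \<le> B" by blast
qed

lemma bper_loc_bdd: "bper B f \<Longrightarrow> loc_bdd f"
  by (auto simp: bper_def loc_bdd_def)

lemma bper_bound: "bper B f \<Longrightarrow> \<bar>f x\<bar> \<le> B"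
  by (auto simp: bper_def)

lemma bper_nonneg: "bper B f \<Longrightarrow> 0 \<le> B"
  using bper_bound[of B f 0] by linarith

lemma bper_periodic: "bper B f \<Longrightarrow> periodic f"
  by (auto simp: bper_def)

lemma bperI: "loc_bdd f \<Longrightarrow> periodic f \<Longrightarrow> (\<And>x. \<bar>f x\<bar> \<le> B) \<Longrightarrow> bper B f"
  by (auto simp: bper_def loc_bdd_def)

lemma bper_mono: "bper B f \<Longrightarrow> B \<le> C \<Longrightarrow> bper C f"
  unfolding bper_def by (meson order_trans)

lemma loc_bdd_absint: assumes "loc_bdd f" shows "f absolutely_integrable_on {a..b}"
proof -
  obtain B where "\<forall>x\<in>{a..b}. \<bar>f x\<bar> \<le> B" using loc_bdd_bound[OF assms, of a b] by blast
  then show ?thesis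
    by (intro measurable_bounded_by_integrable_imp_absolutely_integrable[where g="\<lambda>_. B"])
      (use assms in \<open>auto intro!: measurable_restrict_space1 measurable_completion dest: loc_bdd_measurable\<close>)
qed

lemma loc_bdd_integrable: "loc_bdd f \<Longrightarrow> f integrable_on {a..b}"
  using loc_bdd_absint set_lebesgue_integral_eq_integral(1) by blast

lemma prim_0[simp]: "prim f 0 = 0"
  by (simp add: prim_def)

lemma integral_prim: assumes "loc_bdd f" "a \<le> b" shows "integral {a..b} f = prim f b - prim f a"
proof -
  note i = loc_bdd_integrable[OF assms(1)]
  consider "0 \<le> a" | "a < 0" "0 \<le> b" | "b < 0" by linarith
  then show ?thesis
  proof cases
    case 1
    then show ?thesis
      using Henstock_Kurzweil_Integration.integral_combine[of 0 a b f] assms(2) i by (simp add: prim_def)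
  next
    case 2
    then show ?thesis
      using Henstock_Kurzweil_Integration.integral_combine[of a 0 b f] assms(2) i by (simp add: prim_def)
  next
    case 3
    then show ?thesis
      using Henstock_Kurzweil_Integration.integral_combine[of a b 0 f] assms(2) i by (simp add: prim_def)
  qed
qed

lemma prim_eqI:
  assumes "loc_bdd f" "P 0 = 0" "\<And>a b. a \<le> b \<Longrightarrow> integral {a..b} f = P b - P a"
  shows "prim f x = P x"
  using assms(2) assms(3)[of 0 x] assms(3)[of x 0] by (auto simp: prim_def)

lemma prim_add: "loc_bdd f \<Longrightarrow> loc_bdd g \<Longrightarrow> prim (\<lambda>x. f x + g x) x = prim f x + prim g x"
  by (auto simp: prim_def Henstock_Kurzweil_Integration.integral_add loc_bdd_integrable)

lemma prim_diff: "loc_bdd f \<Longrightarrow> loc_bdd g \<Longrightarrow> prim (\<lambda>x. f x - g x) x = prim f x - prim g x"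
  by (auto simp: prim_def Henstock_Kurzweil_Integration.integral_diff loc_bdd_integrable)

lemma prim_cmul: "prim (\<lambda>x. c * f x) x = c * prim f x"
  by (auto simp: prim_def)

lemma prim_uminus: "prim (\<lambda>x. - f x) x = - prim f x"
  by (auto simp: prim_def)

lemma prim_const[simp]: "prim (\<lambda>x. c) x = c * x"
  by (auto simp: prim_def)

lemma prim_mono:
  assumes "loc_bdd f" "loc_bdd g" "a \<le> b" "\<And>x. a \<le> x \<Longrightarrow> x \<le> b \<Longrightarrow> f x \<le> g x"
  shows "prim f b - prim f a \<le> prim g b - prim g a"
  using assms
  by (subst (1 2) integral_prim[symmetric]) (auto intro!: integral_le loc_bdd_integrable)

lemma prim_abs_le:
  assumes "loc_bdd f" "a \<le> b"
  shows "\<bar>prim f b - prim f a\<bar> \<le> prim (\<lambda>x. \<bar>f x\<bar>) b - prim (\<lambda>x. \<bar>f x\<bar>) a"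
  using prim_mono[OF assms(1) loc_bdd_abs[OF assms(1)] assms(2)]
    prim_mono[OF loc_bdd_minus[OF assms(1)] loc_bdd_abs[OF assms(1)] assms(2)]
  by (simp add: abs_le_iff prim_uminus)

lemma prim_bound:
  assumes "loc_bdd f" "a \<le> b" "\<And>x. a \<le> x \<Longrightarrow> x \<le> b \<Longrightarrow> \<bar>f x\<bar> \<le> B"
  shows "\<bar>prim f b - prim f a\<bar> \<le> B * (b - a)"
proof -
  have "prim (\<lambda>x. \<bar>f x\<bar>) b - prim (\<lambda>x. \<bar>f x\<bar>) a \<le> prim (\<lambda>x. B) b - prim (\<lambda>x. B) a"
    by (rule prim_mono) (use assms in auto)
  then show ?thesis using prim_abs_le[OF assms(1,2)] by (simp add: algebra_simps)
qed

lemma prim_lip: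
  assumes "loc_bdd f" "\<And>x. \<bar>f x\<bar> \<le> B" shows "\<bar>prim f x - prim f y\<bar> \<le> B * \<bar>x - y\<bar>"
proof (cases "y \<le> x")
  case True then show ?thesis using prim_bound[OF assms(1) True assms(2)] by simp
next
  case False then show ?thesis using prim_bound[OF assms(1) _ assms(2), of x y] by (simp add: abs_minus_commute)
qed

lemma prim_isCont: assumes "loc_bdd f" shows "isCont (prim f) x"
proof -
  obtain B where B: "\<forall>y\<in>{x-1..x+1}. \<bar>f y\<bar> \<le> B" using loc_bdd_bound[OF assms, of "x-1" "x+1"] by blast
  have "\<bar>prim f y - prim f x\<bar> \<le> B * \<bar>y - x\<bar>" if "y \<in> {x-1..x+1}" for y
  proof (cases "x \<le> y")
    case True then show ?thesis using prim_bound[OF assms True, of B] B that by auto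
  next
    case False then show ?thesis using prim_bound[OF assms, of y x B] B that by (auto simp: abs_minus_commute)
  qed
  then have ev: "eventually (\<lambda>y. \<bar>prim f y - prim f x\<bar> \<le> B * \<bar>y - x\<bar>) (at x)"
    unfolding eventually_at by (intro exI[of _ 1]) (auto simp: dist_real_def abs_less_iff)
  have "((\<lambda>y. B * \<bar>y - x\<bar>) \<longlongrightarrow> 0) (at x)"
    by (auto intro!: tendsto_eq_intros)
  then have "((\<lambda>y. prim f y - prim f x) \<longlongrightarrow> 0) (at x)"
    by (rule Lim_null_comparison[rotated]) (use ev in simp)
  then show ?thesis by (simp add: isCont_def LIM_zero_iff)
qed

lemma prim_continuous: "loc_bdd f \<Longrightarrow> continuous_on S (prim f)"
  by (intro continuous_at_imp_continuous_on ballI prim_isCont)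

lemma loc_bdd_prim[simp]: "loc_bdd f \<Longrightarrow> loc_bdd (prim f)"
  by (rule loc_bdd_continuous[OF prim_continuous])

lemma prim_has_derivative:
  assumes "continuous_on UNIV f" shows "(prim f has_real_derivative f x) (at x)"
proof -
  have "((\<lambda>y. integral {x-1..y} f) has_real_derivative f x) (at x within {x-1..x+1})"
    by (rule integral_has_real_derivative) (use assms continuous_on_subset in auto)
  then have "((\<lambda>y. integral {x-1..y} f) has_real_derivative f x) (at x)"
    by (simp add: at_within_Icc_at)
  then have "((\<lambda>y. integral {x-1..y} f + prim f (x-1)) has_real_derivative f x) (at x)"
    by (auto intro!: derivative_eq_intros)
  then show ?thesis
  proof (rule has_field_derivative_transform_within[where d=1])
    show "integral {x - 1..y} f + prim f (x - 1) = prim f y" if "dist y x < 1" for y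
      using that by (subst integral_prim) (auto simp: dist_real_def assms loc_bdd_continuous)
  qed auto
qed

lemma prim_of_derivative:
  assumes "\<And>x. (F has_real_derivative f x) (at x)" "continuous_on UNIV f"
  shows "prim f x = F x - F 0"
proof (rule prim_eqI[where P="\<lambda>x. F x - F 0"])
  fix a b :: real assume "a \<le> b"
  then have "(f has_integral (F b - F a)) {a..b}"
    by (intro fundamental_theorem_of_calculus)
      (auto simp: has_real_derivative_iff_has_vector_derivative[symmetric] intro: has_field_derivative_at_within assms)
  then show "integral {a..b} f = F b - F 0 - (F a - F 0)" by (simp add: integral_unique)
qed (use assms loc_bdd_continuous in auto)

lemma prim_shift: assumes "loc_bdd f" shows "prim (\<lambda>x. f (x + h)) x = prim f (x + h) - prim f h"
proof (rule prim_eqI[where P="\<lambda>x. prim f (x + h) - prim f h"])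
  fix a b :: real assume "a \<le> b"
  then show "integral {a..b} (\<lambda>x. f (x + h)) = prim f (b + h) - prim f h - (prim f (a + h) - prim f h)"
    using integral_shift_real_ivl[of "a+h" h "b+h" f] integral_prim[OF assms, of "a+h" "b+h"] by simp
qed (use assms in auto)

lemma periodicD: "periodic f \<Longrightarrow> f (x + 2*pi) = f x"
  by (simp add: periodic_def)

lemma periodic_nat: "periodic f \<Longrightarrow> f (x + 2*pi*real n) = f x"
proof (induction n)
  case (Suc n)
  then show ?case using periodicD[of f "x + 2*pi*real n"] by (simp add: algebra_simps)
qed simp

lemma periodic_int: assumes "periodic f" shows "f (x + 2*pi* of_int k) = f x"
proof (cases "k \<ge> 0")
  case True then show ?thesis using periodic_nat[OF assms, of x "nat k"] by simp
next
  case False then show ?thesis using periodic_nat[OF assms, of "x + 2*pi* of_int k" "nat (-k)"]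
    by (simp add: algebra_simps)
qed

text \<open>
  The representative of a point of the torus in \<open>[0,2\<pi>)\<close>.
\<close>

definition wrap :: "real \<Rightarrow> real" where "wrap x = x - 2*pi * of_int \<lfloor>x / (2*pi)\<rfloor>"

lemma wrap_range: "0 \<le> wrap x" "wrap x < 2*pi"
proof -
  have "of_int \<lfloor>x / (2*pi)\<rfloor> \<le> x / (2*pi)" "x / (2*pi) < of_int \<lfloor>x / (2*pi)\<rfloor> + 1" by linarith+
  then have "of_int \<lfloor>x / (2*pi)\<rfloor> * (2*pi) \<le> x" "x < (of_int \<lfloor>x / (2*pi)\<rfloor> + 1) * (2*pi)"
    using pos_le_divide_eq[of "2*pi" "of_int \<lfloor>x / (2*pi)\<rfloor>" x] pos_divide_less_eq[of "2*pi" x "of_int \<lfloor>x / (2*pi)\<rfloor> + 1"] by auto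
  then show "0 \<le> wrap x" "wrap x < 2*pi" by (simp_all add: wrap_def algebra_simps)
qed

lemma periodic_wrap: "periodic f \<Longrightarrow> f (wrap x) = f x"
  using periodic_int[of f x "- \<lfloor>x / (2*pi)\<rfloor>"] by (simp add: wrap_def)

lemma wrap_add: "wrap (x + 2*pi) = wrap x"
proof -
  have "(x + 2*pi) / (2*pi) = x / (2*pi) + 1" by (simp add: field_simps)
  then show ?thesis by (simp add: wrap_def algebra_simps)
qed

lemma wrap_id: "0 \<le> x \<Longrightarrow> x < 2*pi \<Longrightarrow> wrap x = x"
proof -
  assume "0 \<le> x" "x < 2*pi"
  then have "\<lfloor>x / (2*pi)\<rfloor> = 0" by (intro floor_unique) auto
  then show ?thesis by (simp add: wrap_def)
qed

lemma wrap_measurable[measurable]: "wrap \<in> borel_measurable borel"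
  unfolding wrap_def[abs_def] by measurable

lemma periodic_mean_shift:
  assumes "periodic f" "loc_bdd f" shows "prim f (x + 2*pi) = prim f x + prim f (2*pi)"
proof -
  have "(\<lambda>x. f (x + 2*pi)) = f" using assms(1) by (auto simp: periodic_def)
  then show ?thesis using prim_shift[OF assms(2), of "2*pi" x] by simp
qed

lemma periodic_binop: "periodic f \<Longrightarrow> periodic g \<Longrightarrow> periodic (\<lambda>x. h (f x) (g x))"
  by (simp add: periodic_def)
lemma periodic_unop: "periodic f \<Longrightarrow> periodic (\<lambda>x. h (f x))"
  by (simp add: periodic_def)

lemma bper_add: "bper B f \<Longrightarrow> bper C g \<Longrightarrow> bper (B + C) (\<lambda>x. f x + g x)"
  by (intro bperI) (auto simp: bper_loc_bdd periodic_binop bper_periodic intro: order_trans[OF abs_triangle_ineq] add_mono bper_bound)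
lemma bper_diff: "bper B f \<Longrightarrow> bper C g \<Longrightarrow> bper (B + C) (\<lambda>x. f x - g x)"
  by (intro bperI) (auto simp: bper_loc_bdd periodic_binop bper_periodic intro: order_trans[OF abs_triangle_ineq4] add_mono bper_bound)
lemma bper_mult: "bper B f \<Longrightarrow> bper C g \<Longrightarrow> bper (B * C) (\<lambda>x. f x * g x)"
  by (intro bperI) (auto simp: bper_loc_bdd periodic_binop bper_periodic abs_mult intro: mult_mono bper_bound bper_nonneg)
lemma bper_square: "bper B f \<Longrightarrow> bper (B\<^sup>2) (\<lambda>x. (f x)\<^sup>2)"
  using bper_mult[of B f B f] by (simp add: power2_eq_square)
lemma bper_const: "\<bar>c\<bar> \<le> B \<Longrightarrow> bper B (\<lambda>x. c)"
  by (intro bperI) (auto simp: periodic_def)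

lemma L1_norm_nonneg: "loc_bdd f \<Longrightarrow> 0 \<le> L1_norm f"
  using prim_mono[of "\<lambda>x. 0" "\<lambda>x. \<bar>f x\<bar>" 0 "2*pi"] by (simp add: L1_norm_def)

lemma L1_norm_mono:
  "loc_bdd f \<Longrightarrow> loc_bdd g \<Longrightarrow> (\<And>x. \<bar>f x\<bar> \<le> \<bar>g x\<bar>) \<Longrightarrow> L1_norm f \<le> L1_norm g"
  using prim_mono[of "\<lambda>x. \<bar>f x\<bar>" "\<lambda>x. \<bar>g x\<bar>" 0 "2*pi"] by (simp add: L1_norm_def)

lemma L1_norm_triangle:
  assumes "loc_bdd f" "loc_bdd g" shows "L1_norm (\<lambda>x. f x + g x) \<le> L1_norm f + L1_norm g"
proof -
  have "prim (\<lambda>x. \<bar>f x + g x\<bar>) (2*pi) - prim (\<lambda>x. \<bar>f x + g x\<bar>) 0 \<le>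
    prim (\<lambda>x. \<bar>f x\<bar> + \<bar>g x\<bar>) (2*pi) - prim (\<lambda>x. \<bar>f x\<bar> + \<bar>g x\<bar>) 0"
    by (rule prim_mono) (use assms in auto)
  then show ?thesis using assms by (simp add: L1_norm_def prim_add)
qed

lemma L1_norm_cmul: "L1_norm (\<lambda>x. c * f x) = \<bar>c\<bar> * L1_norm f"
  by (simp add: L1_norm_def abs_mult prim_cmul)

lemma L1_norm_minus: "L1_dist f g = L1_dist g f"
  by (simp add: L1_norm_def abs_minus_commute)

lemma L1_norm_diff_triangle:
  assumes "loc_bdd f" "loc_bdd g" "loc_bdd h"
  shows "L1_dist f h \<le> L1_dist f g + L1_dist g h"
  using L1_norm_triangle[of "\<lambda>x. f x - g x" "\<lambda>x. g x - h x"] assms by simp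

lemma L1_norm_le_sup:
  assumes "loc_bdd f" "\<And>x. \<bar>f x\<bar> \<le> B" shows "L1_norm f \<le> 2*pi*B"
  using prim_mono[of "\<lambda>x. \<bar>f x\<bar>" "\<lambda>x. B" 0 "2*pi"] assms by (simp add: L1_norm_def mult.commute)

lemma L1_norm_shift:
  assumes "loc_bdd f" "periodic f"
  shows "L1_norm f = prim (\<lambda>x. \<bar>f x\<bar>) (a + 2*pi) - prim (\<lambda>x. \<bar>f x\<bar>) a"
  using periodic_mean_shift[of "\<lambda>x. \<bar>f x\<bar>" a] assms by (simp add: L1_norm_def periodic_unop)

lemma prim_diff_le_L1:
  assumes "loc_bdd f" "periodic f" "\<bar>b - a\<bar> \<le> 2*pi"
  shows "\<bar>prim f b - prim f a\<bar> \<le> L1_norm f"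
proof -
  have *: "\<bar>prim f b - prim f a\<bar> \<le> L1_norm f" if "a \<le> b" "b \<le> a + 2*pi" for a b
  proof -
    have "prim (\<lambda>x. 0) (a+2*pi) - prim (\<lambda>x. 0) b \<le> prim (\<lambda>x. \<bar>f x\<bar>) (a+2*pi) - prim (\<lambda>x. \<bar>f x\<bar>) b"
      by (rule prim_mono) (use assms that in auto)
    then show ?thesis using prim_abs_le[OF assms(1) that(1)] L1_norm_shift[OF assms(1,2), of a] by simp
  qed
  show ?thesis using *[of a b] *[of b a] assms(3) by (cases "a \<le> b") (auto simp: abs_minus_commute)
qed

lemma periodic_sup_bound:
  assumes "periodic f" "\<And>x. 0 \<le> x \<Longrightarrow> x \<le> 2*pi \<Longrightarrow> P (f x)" shows "P (f x)"
  using assms(2)[of "wrap x"] wrap_range[of x] periodic_wrap[OF assms(1), of x] by simp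

lemma periodic_prim: "periodic f \<Longrightarrow> loc_bdd f \<Longrightarrow> prim f (2*pi) = 0 \<Longrightarrow> periodic (prim f)"
  using periodic_mean_shift[of f] by (simp add: periodic_def[of "prim f"])

section \<open>The zero-mean primitive\<close>

definition avg :: "(real \<Rightarrow> real) \<Rightarrow> real" where "avg f = prim f (2*pi) / (2*pi)"

text \<open>
  The zero-mean primitive of \<open>f - avg f\<close>: the operator \<open>\<Pi>\<^sub>0 \<partial>\<^sub>x\<^sup>-\<^sup>1 \<Pi>\<^sub>0\<close> in a form that is
  defined at every point.
\<close>

definition zmp :: "(real \<Rightarrow> real) \<Rightarrow> real \<Rightarrow> real"
  where "zmp f x = prim (\<lambda>y. f y - avg f) x - avg (prim (\<lambda>y. f y - avg f))"

lemma avg_diff: "loc_bdd f \<Longrightarrow> loc_bdd g \<Longrightarrow> avg (\<lambda>x. f x - g x) = avg f - avg g"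
  by (simp add: avg_def prim_diff diff_divide_distrib)

lemma avg_const[simp]: "avg (\<lambda>x. c) = c" by (simp add: avg_def)

lemma avg_abs_le: "loc_bdd f \<Longrightarrow> \<bar>avg f\<bar> \<le> L1_norm f / (2*pi)"
  using prim_abs_le[of f 0 "2*pi"] by (simp add: avg_def L1_norm_def field_simps)

lemma avg_bound: "loc_bdd f \<Longrightarrow> (\<And>x. \<bar>f x\<bar> \<le> B) \<Longrightarrow> \<bar>avg f\<bar> \<le> B"
  using prim_bound[of f 0 "2*pi" B] by (simp add: avg_def field_simps)

lemma zmp_diff_eq:
  assumes "loc_bdd f" shows "zmp f y - zmp f x = prim f y - prim f x - avg f * (y - x)"
  using assms by (simp add: zmp_def prim_diff algebra_simps)

lemma zmp_avg: assumes "loc_bdd f" shows "avg (zmp f) = 0"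
  using assms by (simp add: zmp_def[abs_def] avg_diff)

lemma zmp_lip: assumes "bper B f" shows "\<bar>zmp f x - zmp f y\<bar> \<le> 2*B*\<bar>x - y\<bar>"
proof -
  have l: "loc_bdd f" using assms by (rule bper_loc_bdd)
  have "\<bar>prim f x - prim f y\<bar> \<le> B * \<bar>x-y\<bar>" by (rule prim_lip[OF l bper_bound[OF assms]])
  moreover have "\<bar>avg f * (x - y)\<bar> \<le> B * \<bar>x - y\<bar>"
    unfolding abs_mult by (intro mult_right_mono avg_bound[OF l bper_bound[OF assms]]) auto
  ultimately show ?thesis unfolding zmp_diff_eq[OF l, of x y] by linarith
qed

lemma zmp_periodic: assumes "periodic f" "loc_bdd f" shows "periodic (zmp f)"
  unfolding periodic_def
proof
  fix x
  have "zmp f (x + 2*pi) - zmp f x = prim f (2*pi) - avg f * (2*pi)"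
    using zmp_diff_eq[OF assms(2), of "x+2*pi" x] periodic_mean_shift[OF assms, of x] by simp
  then show "zmp f (x + 2*pi) = zmp f x" by (simp add: avg_def)
qed

lemma zmp_continuous: "loc_bdd f \<Longrightarrow> continuous_on S (zmp f)"
  unfolding zmp_def[abs_def] by (intro continuous_intros prim_continuous) simp

lemma zmp_loc_bdd[simp]: "loc_bdd f \<Longrightarrow> loc_bdd (zmp f)"
  by (rule loc_bdd_continuous[OF zmp_continuous])

lemma zmp_diff:
  assumes "loc_bdd f" "loc_bdd g" shows "zmp (\<lambda>x. f x - g x) x = zmp f x - zmp g x"
proof -
  have "prim (\<lambda>y. f y - g y - avg (\<lambda>x. f x - g x)) = (\<lambda>x. prim (\<lambda>y. f y - avg f) x - prim (\<lambda>y. g y - avg g) x)"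
    using assms by (auto simp: avg_diff prim_diff[of f g] prim_diff left_diff_distrib)
  then show ?thesis using assms by (simp add: zmp_def avg_diff)
qed

lemma zmp_L1: assumes "loc_bdd f" "periodic f" shows "\<bar>zmp f x\<bar> \<le> 4 * L1_norm f"
proof (rule periodic_sup_bound[OF zmp_periodic[OF assms(2,1)], of "\<lambda>z. \<bar>z\<bar> \<le> _"])
  fix x :: real assume x: "0 \<le> x" "x \<le> 2*pi"
  let ?P = "prim (\<lambda>y. f y - avg f)"
  have P: "\<bar>?P y\<bar> \<le> 2 * L1_norm f" if y: "0 \<le> y" "y \<le> 2*pi" for y
  proof -
    have "\<bar>prim f y\<bar> \<le> L1_norm f" using prim_diff_le_L1[OF assms, of y 0] y by simp
    moreover have "\<bar>avg f * y\<bar> \<le> L1_norm f / (2*pi) * (2*pi)"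
      unfolding abs_mult using y avg_abs_le[OF assms(1)] L1_norm_nonneg[OF assms(1)]
      by (intro mult_mono) auto
    ultimately show ?thesis using assms by (simp add: prim_diff)
  qed
  have "\<bar>prim ?P (2*pi) - prim ?P 0\<bar> \<le> 2 * L1_norm f * (2*pi - 0)"
    by (rule prim_bound) (use P assms in auto)
  then have "\<bar>avg ?P\<bar> \<le> 2 * L1_norm f" by (simp add: avg_def field_simps)
  then show "\<bar>zmp f x\<bar> \<le> 4 * L1_norm f" using P[OF x] by (simp add: zmp_def)
qed

lemma zmp_bper: assumes "bper B f" shows "bper (8*pi*B) (zmp f)"
proof -
  have l: "loc_bdd f" "periodic f" using assms bper_loc_bdd bper_periodic by auto
  have "L1_norm f \<le> 2*pi*B" by (rule L1_norm_le_sup[OF l(1) bper_bound[OF assms]])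
  then show ?thesis
  proof (intro bperI)
    fix x show "\<bar>zmp f x\<bar> \<le> 8*pi*B" using zmp_L1[OF l, of x] \<open>L1_norm f \<le> 2*pi*B\<close> by simp
  qed (use l in \<open>auto intro: zmp_periodic\<close>)
qed

text \<open>
  The form in which the nonlocal term is recognised after a change of variables.
\<close>

lemma zmp_unique:
  assumes "loc_bdd f" "loc_bdd F" "avg F = 0" "\<And>x. F x - F 0 = prim f x - avg f * x"
  shows "F x = zmp f x"
proof -
  have eq: "zmp f x - F x = zmp f 0 - F 0" for x using zmp_diff_eq[OF assms(1), of x 0] assms(4)[of x] by simp
  then have "(\<lambda>x. zmp f x - F x) = (\<lambda>x. zmp f 0 - F 0)" by blast
  then have "avg (\<lambda>x. zmp f x - F x) = zmp f 0 - F 0" by simp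
  then have "zmp f 0 - F 0 = 0" using assms by (simp add: avg_diff zmp_avg)
  then show ?thesis using eq[of x] by simp
qed

section \<open>Integration over the torus\<close>

lemma torus_integrable: assumes "loc_bdd f" shows "integrable torus f" "(\<integral>x. f x \<partial>torus) = prim f (2*pi)"
proof -
  have "set_integrable lebesgue {0..2*pi} f" by (rule loc_bdd_absint[OF assms])
  then show 1: "integrable torus f" by (subst integrable_restrict_space) (auto simp: set_integrable_def)
  show "(\<integral>x. f x \<partial>torus) = prim f (2*pi)"
    using lebesgue_integral_eq_integral[OF 1] by (simp add: prim_def)
qed

lemma torus_measurable: "loc_bdd f \<Longrightarrow> f \<in> borel_measurable torus"
  by (rule borel_measurable_integrable[OF torus_integrable(1)])

lemma L1_norm_torus: "loc_bdd f \<Longrightarrow> L1_norm f = (\<integral>x. \<bar>f x\<bar> \<partial>torus)"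
  by (simp add: L1_norm_def torus_integrable)

lemma finite_measure_torus: "finite_measure torus"
  by (rule finite_measureI) (auto simp: emeasure_restrict_space)

lemma integrable_torus_const[simp]: "integrable torus (\<lambda>x. c::real)"
  by (rule torus_integrable) simp

lemma integral_torus_const: "(\<integral>x. (c::real) \<partial>torus) = 2*pi*c"
  by (subst torus_integrable) auto

lemma AE_torus: "(AE x in torus. P x) \<longleftrightarrow> (AE x in lebesgue. x \<in> {0..2*pi} \<longrightarrow> P x)"
  by (rule AE_restrict_space_iff) simp

lemma AE_lebesgue_neq: "AE x in lebesgue. x \<noteq> (c::real)"
  by (rule AE_completion) (rule AE_lborel_singleton)

lemma AE_torus_interior: "(\<And>x. 0 < x \<Longrightarrow> x < 2*pi \<Longrightarrow> P x) \<Longrightarrow> AE x in torus. P x"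
  unfolding AE_torus using AE_lebesgue_neq[of 0] AE_lebesgue_neq[of "2*pi"]
  by eventually_elim force

text \<open>
  A representative in the class of everywhere bounded Borel functions is obtained by truncating a
  Borel version and extending it periodically; only the point \<open>2\<pi>\<close>, a null set, can be in conflict.
\<close>

lemma bounded_borel_representative:
  assumes "periodic f" "f \<in> borel_measurable torus" "AE x in torus. \<bar>f x\<bar> \<le> B" "0 \<le> B"
  obtains g where "bper B g" "AE x in torus. f x = g x"
proof -
  have "(\<lambda>x. if x \<in> {0..2*pi} then f x else 0) \<in> borel_measurable lebesgue"
    by (rule borel_measurable_if_I[OF assms(2)]) simp
  then obtain g where g: "g \<in> borel_measurable lborel" "AE x in lborel. (if x \<in> {0..2*pi} then f x else 0) = g x"
    using completion_ex_borel_measurable_real by blast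
  define h where "h x = max (-B) (min B (g (wrap x)))" for x
  have [measurable]: "g \<in> borel_measurable borel" using g(1) by simp
  have "h \<in> borel_measurable borel" unfolding h_def[abs_def] by measurable
  then have "bper B h" using assms(4) by (auto simp: bper_def h_def periodic_def wrap_add)
  moreover have "AE x in torus. f x = h x"
    using AE_completion[OF g(2)] assms(3) AE_lebesgue_neq[of "2*pi"] unfolding AE_torus
  proof eventually_elim
    case (elim x)
    then show ?case by (cases "x \<in> {0..2*pi}") (auto simp: h_def wrap_id)
  qed
  ultimately show ?thesis by (rule that)
qed

section \<open>Trigonometric polynomials\<close>

text \<open>
  The algebra generated by \<open>sin\<close> and \<open>cos\<close> is closed under derivatives, hence consists of smooth test
  functions; no other smooth functions have to be constructed.
\<close>

inductive_set trig :: "(real \<Rightarrow> real) set" where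
  const: "(\<lambda>x. c) \<in> trig"
| sin: "sin \<in> trig"
| cos: "cos \<in> trig"
| add: "f \<in> trig \<Longrightarrow> g \<in> trig \<Longrightarrow> (\<lambda>x. f x + g x) \<in> trig"
| mult: "f \<in> trig \<Longrightarrow> g \<in> trig \<Longrightarrow> (\<lambda>x. f x * g x) \<in> trig"

lemma trig_deriv: "f \<in> trig \<Longrightarrow> \<exists>f'\<in>trig. \<forall>x. (f has_real_derivative f' x) (at x)"
proof (induction rule: trig.induct)
  case (const c) show ?case by (intro bexI[of _ "\<lambda>x. 0"]) (auto intro: trig.const)
next
  case sin show ?case by (intro bexI[of _ cos]) (auto intro: trig.cos)
next
  case cos show ?case
    using trig.mult[OF trig.const[of "-1"] trig.sin]
    by (intro bexI[of _ "\<lambda>x. (-1) * sin x"]) (auto intro!: derivative_eq_intros)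
next
  case (add f g)
  then obtain f' g' where "f' \<in> trig" "g' \<in> trig" "\<forall>x. (f has_real_derivative f' x) (at x)" "\<forall>x. (g has_real_derivative g' x) (at x)"
    by blast
  then show ?case by (intro bexI[of _ "\<lambda>x. f' x + g' x"]) (auto intro!: trig.add derivative_eq_intros)
next
  case (mult f g)
  then obtain f' g' where "f' \<in> trig" "g' \<in> trig" "\<forall>x. (f has_real_derivative f' x) (at x)" "\<forall>x. (g has_real_derivative g' x) (at x)"
    by blast
  then show ?case using mult.hyps
    by (intro bexI[of _ "\<lambda>x. f' x * g x + f x * g' x"]) (auto intro!: trig.add trig.mult derivative_eq_intros)
qed

lemma trig_periodic: "f \<in> trig \<Longrightarrow> periodic f"
  by (induction rule: trig.induct) (auto simp: periodic_def)

lemma trig_continuous: "f \<in> trig \<Longrightarrow> continuous_on S f"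
  by (induction rule: trig.induct) (auto intro!: continuous_intros)

lemma trig_loc_bdd: "f \<in> trig \<Longrightarrow> loc_bdd f"
  by (rule loc_bdd_continuous[OF trig_continuous])

lemma trig_bper: assumes "f \<in> trig" obtains B where "bper B f"
proof -
  obtain B where "\<forall>x\<in>{0..2*pi}. \<bar>f x\<bar> \<le> B" using loc_bdd_bound[OF trig_loc_bdd[OF assms], of 0 "2*pi"] by blast
  then have "\<bar>f x\<bar> \<le> B" for x using periodic_sup_bound[OF trig_periodic[OF assms], of "\<lambda>z. \<bar>z\<bar> \<le> B"] by auto
  then show ?thesis using assms by (intro that bperI trig_loc_bdd trig_periodic) auto
qed

lemma trig_lipschitz:
  assumes "f \<in> trig" obtains D where "0 \<le> D" "\<And>x y. \<bar>f x - f y\<bar> \<le> D * \<bar>x - y\<bar>"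
proof -
  obtain f' where f': "f' \<in> trig" "\<And>x. (f has_real_derivative f' x) (at x)" using trig_deriv[OF assms] by blast
  obtain D where D: "bper D f'" by (rule trig_bper[OF f'(1)])
  have "\<bar>f x - f y\<bar> \<le> D * \<bar>x - y\<bar>" for x y
    using field_differentiable_bound[of UNIV f f' D x y] f'(2) bper_bound[OF D] by auto
  then show ?thesis using that bper_nonneg[OF D] by blast
qed

lemma trig_deriv_closed: "f \<in> trig \<Longrightarrow> deriv f \<in> trig"
  using trig_deriv[of f] DERIV_imp_deriv[of f] by (metis ext)

lemma trig_iterated_deriv: "f \<in> trig \<Longrightarrow> (deriv ^^ n) f \<in> trig"
  by (induction n) (auto simp: trig_deriv_closed)

lemma trig_differentiable: "f \<in> trig \<Longrightarrow> f differentiable (at x)"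
  using trig_deriv[of f] real_differentiable_def by blast

lemma trig_smooth: "f \<in> trig \<Longrightarrow> f \<in> smooth_per"
  by (simp add: smooth_per_def trig_periodic trig_differentiable[OF trig_iterated_deriv])

lemma trig_primitive_smooth:
  assumes "f \<in> trig" "periodic P" "\<And>x. (P has_real_derivative f x) (at x)"
  shows "P \<in> smooth_per"
proof -
  have d: "deriv P = f" using DERIV_imp_deriv[OF assms(3)] by blast
  have "(deriv ^^ n) P differentiable (at x)" for n x
  proof (cases n)
    case 0 then show ?thesis using assms(3) real_differentiable_def by auto
  next
    case (Suc k)
    have "(deriv ^^ n) P = (deriv ^^ k) f" unfolding Suc funpow_Suc_right by (simp add: d)
    then show ?thesis using trig_differentiable[OF trig_iterated_deriv[OF assms(1)]] by simp
  qed
  then show ?thesis using assms(2) by (simp add: smooth_per_def)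
qed

lemma polynomial_cis_trig: "real_polynomial_function p \<Longrightarrow> (\<lambda>x. p (cis x)) \<in> trig"
proof (induction rule: real_polynomial_function.induct)
  case (linear f)
  then interpret bounded_linear f .
  have "f (cis x) = cos x * f 1 + sin x * f \<i>" for x
  proof -
    have "cis x = cos x *\<^sub>R 1 + sin x *\<^sub>R \<i>" by (simp add: complex_eq_iff)
    then show ?thesis by (simp only: add scaleR real_scaleR_def)
  qed
  moreover have "(\<lambda>x. cos x * f 1 + sin x * f \<i>) \<in> trig" by (intro trig.intros)
  ultimately show ?case by simp
qed (auto intro: trig.intros)

text \<open>
  Continuous approximations of a bounded measurable function on the line are carried to the unit
  circle by the argument. They become continuous there once they are cut off near the point \<open>1\<close>,
  where the argument jumps, and then the Stone-Weierstrass theorem applies.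
\<close>

lemma trig_dense:
  assumes "f \<in> borel_measurable torus" "\<And>x. \<bar>f x\<bar> \<le> B"
  obtains \<phi> where "\<And>n::nat. \<phi> n \<in> trig" "\<And>n x. \<bar>\<phi> n x\<bar> \<le> B + 1" "AE x in torus. (\<lambda>n. \<phi> n x) \<longlonglongrightarrow> f x"
proof -
  have "f measurable_on {0..2*pi}" using assms(1) by (subst measurable_on_iff_borel_measurable) auto
  then obtain N g where N: "negligible N" and gc: "\<And>n. continuous_on UNIV (g n)"
    and gl: "\<And>x. x \<notin> N \<Longrightarrow> (\<lambda>n. g n x) \<longlonglongrightarrow> (if x \<in> {0..2*pi} then f x else 0)"
    unfolding measurable_on_def by blast
  have B: "0 \<le> B" using assms(2)[of 0] by linarith
  define c where "c y = max (-B) (min B y)" for y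
  have c: "\<bar>c y\<bar> \<le> B" for y using B by (auto simp: c_def)
  have cc: "continuous_on UNIV c" unfolding c_def[abs_def] by (intro continuous_intros)
  have cid: "c (f x) = f x" for x using assms(2)[of x] by (auto simp: c_def)
  \<comment> \<open>the second factor vanishes at the jump \<open>z = 1\<close> of the argument and tends to \<open>1\<close> elsewhere\<close>
  define h where "h n z = c (g n (Arg2pi z)) * min 1 (real n * norm (z - 1))" for n z
  have hc: "continuous_on (sphere 0 1) (h n)" for n
  proof (intro continuous_at_imp_continuous_on ballI)
    fix z :: complex assume z: "z \<in> sphere 0 1"
    show "isCont (h n) z"
    proof (cases "z = 1")
      case False
      have "z \<notin> \<real>\<^sub>\<ge>\<^sub>0"
      proof
        assume "z \<in> \<real>\<^sub>\<ge>\<^sub>0"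
        then obtain r where "z = of_real r" "r \<ge> 0" by (auto elim: nonneg_Reals_cases)
        then show False using z False by simp
      qed
      then have A: "isCont Arg2pi z" by (rule continuous_at_Arg2pi)
      have "isCont (\<lambda>y. c (g n y)) y" for y
        using continuous_on_compose2[OF cc gc[of n]] by (simp add: continuous_on_eq_continuous_at)
      then have "isCont (\<lambda>z. c (g n (Arg2pi z))) z" using isCont_o2[OF A] by blast
      then show ?thesis unfolding h_def[abs_def] by (intro continuous_intros)
    next
      case True
      have "(h n \<longlongrightarrow> 0) (at z)"
      proof (rule Lim_null_comparison)
        show "eventually (\<lambda>w. norm (h n w) \<le> B * (real n * norm (w - 1))) (at z)"
          by (intro always_eventually allI) (auto simp: h_def abs_mult B intro!: mult_mono c)
        show "((\<lambda>w. B * (real n * norm (w - 1))) \<longlongrightarrow> 0) (at z)"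
          unfolding True by (auto intro!: tendsto_eq_intros)
      qed
      then show ?thesis by (simp add: isCont_def h_def True)
    qed
  qed
  have "\<exists>p. real_polynomial_function p \<and> (\<forall>z\<in>sphere 0 1. \<bar>h n z - p z\<bar> < 1 / real (Suc n))" for n
    by (rule Stone_Weierstrass_real_polynomial_function[OF compact_sphere hc[of n], of "1 / real (Suc n)"]) auto
  then obtain p where p: "\<And>n. real_polynomial_function (p n)" "\<And>n z. norm z = 1 \<Longrightarrow> \<bar>h n z - p n z\<bar> < 1 / real (Suc n)"
    by (metis mem_sphere_0)
  have hB: "\<bar>h n z\<bar> \<le> B" for n z
  proof -
    have "\<bar>c (g n (Arg2pi z))\<bar> * \<bar>min 1 (real n * norm (z - 1))\<bar> \<le> B * 1" using c B by (intro mult_mono) auto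
    then show ?thesis by (simp add: h_def abs_mult)
  qed
  show ?thesis
  proof (rule that[of "\<lambda>n x. p n (cis x)"])
    show "(\<lambda>x. p n (cis x)) \<in> trig" for n by (rule polynomial_cis_trig[OF p(1)])
    show "\<bar>p n (cis x)\<bar> \<le> B + 1" for n x
    proof -
      have "1 / real (Suc n) \<le> 1" by simp
      then show ?thesis using p(2)[of "cis x" n] hB[of n "cis x"] unfolding norm_cis by linarith
    qed
    have "AE x in lebesgue. x \<notin> N" using N by (simp add: negligible_iff_null_sets AE_not_in)
    then show "AE x in torus. (\<lambda>n. p n (cis x)) \<longlonglongrightarrow> f x"
      unfolding AE_torus using AE_lebesgue_neq[of 0] AE_lebesgue_neq[of "2*pi"]
    proof eventually_elim
      case (elim x)
      show ?case
      proof
        assume x: "x \<in> {0..2*pi}"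
        then have x': "0 < x" "x < 2*pi" using elim by auto
        have A: "Arg2pi (cis x) = x" using x' by (intro Arg2pi_unique[of 1]) (auto simp: cis_conv_exp)
        have "cis x \<noteq> 1"
        proof
          assume "cis x = 1"
          then have "Arg2pi 1 = x" using A by simp
          moreover have "Arg2pi 1 = 0" by (rule Arg2pi_unique[of 1]) auto
          ultimately show False using x' by simp
        qed
        then have pos: "norm (cis x - 1) > 0" by simp
        have "(\<lambda>n. g n x) \<longlonglongrightarrow> f x" using gl[of x] elim x by simp
        then have "(\<lambda>n. c (g n x)) \<longlonglongrightarrow> c (f x)"
          using cc by (intro isCont_tendsto_compose[of "f x" c]) (auto simp: continuous_on_eq_continuous_at)
        moreover have "(\<lambda>n. min 1 (real n * norm (cis x - 1))) \<longlonglongrightarrow> 1"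
        proof (rule tendsto_eventually)
          obtain n0 where n0: "1 < real n0 * norm (cis x - 1)" using ex_less_of_nat_mult[OF pos] by auto
          show "eventually (\<lambda>n. min 1 (real n * norm (cis x - 1)) = 1) sequentially"
            unfolding eventually_sequentially
          proof (intro exI[of _ n0] allI impI)
            fix n assume "n0 \<le> n"
            then have "real n0 * norm (cis x - 1) \<le> real n * norm (cis x - 1)" by (intro mult_right_mono) auto
            then show "min 1 (real n * norm (cis x - 1)) = 1" using n0 by simp
          qed
        qed
        ultimately have "(\<lambda>n. h n (cis x)) \<longlonglongrightarrow> f x * 1" unfolding h_def A cid by (intro tendsto_mult) (auto simp: cid)
        moreover have "(\<lambda>n. h n (cis x) - p n (cis x)) \<longlonglongrightarrow> 0"
          by (rule Lim_null_comparison[OF _ LIMSEQ_Suc[OF lim_inverse_n']])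
            (use p(2)[of "cis x"] in \<open>auto intro!: always_eventually less_imp_le\<close>)
        ultimately show "(\<lambda>n. p n (cis x)) \<longlonglongrightarrow> f x" using tendsto_diff by fastforce
      qed
    qed
  qed
qed

text \<open>
  Testing with bounded trigonometric polynomials that converge to the sign of \<open>r\<close> shows that the
  integral of \<open>\<bar>r\<bar>\<close> vanishes.
\<close>

lemma du_Bois_Reymond:
  assumes r: "integrable torus r" and z: "\<And>\<phi>. \<phi> \<in> trig \<Longrightarrow> (\<integral>x. r x * \<phi> x \<partial>torus) = 0"
  shows "AE x in torus. r x = 0"
proof -
  note [measurable] = borel_measurable_integrable[OF r]
  have "(\<lambda>x. sgn (r x)) \<in> borel_measurable torus" by measurable
  then obtain \<phi> where \<phi>: "\<And>n::nat. \<phi> n \<in> trig" "\<And>n x. \<bar>\<phi> n x\<bar> \<le> 1 + 1" "AE x in torus. (\<lambda>n. \<phi> n x) \<longlonglongrightarrow> sgn (r x)"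
    by (rule trig_dense[of _ 1]) (auto simp: sgn_if)
  have [measurable]: "\<phi> n \<in> borel_measurable torus" for n by (rule torus_measurable[OF trig_loc_bdd[OF \<phi>(1)]])
  have "(\<lambda>n. \<integral>x. r x * \<phi> n x \<partial>torus) \<longlonglongrightarrow> (\<integral>x. r x * sgn (r x) \<partial>torus)"
  proof (rule integral_dominated_convergence[where w="\<lambda>x. 2 * \<bar>r x\<bar>"])
    show "AE x in torus. (\<lambda>n. r x * \<phi> n x) \<longlonglongrightarrow> r x * sgn (r x)"
      using \<phi>(3) by eventually_elim (intro tendsto_intros)
    show "AE x in torus. norm (r x * \<phi> n x) \<le> 2 * \<bar>r x\<bar>" for n
      using mult_left_mono[OF \<phi>(2)[of n], of "\<bar>r x\<bar>" for x] by (intro AE_I2) (auto simp: abs_mult mult.commute)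
  qed (use r in auto)
  then have "(\<integral>x. \<bar>r x\<bar> \<partial>torus) = 0" by (simp add: z[OF \<phi>(1)] LIMSEQ_const_iff abs_sgn)
  then have "AE x in torus. \<bar>r x\<bar> = 0" by (subst (asm) integral_nonneg_eq_0_iff_AE) (use r in auto)
  then show ?thesis by simp
qed

lemma trig_L1_dense:
  assumes "bper B m" "0 < e"
  obtains \<phi> where "\<phi> \<in> trig" "\<And>x. \<bar>\<phi> x\<bar> \<le> B + 1" "L1_dist m \<phi> < e"
proof -
  have l: "loc_bdd m" by (rule bper_loc_bdd[OF assms(1)])
  note [measurable] = torus_measurable[OF l]
  obtain \<phi> where \<phi>: "\<And>n::nat. \<phi> n \<in> trig" "\<And>n x. \<bar>\<phi> n x\<bar> \<le> B + 1" "AE x in torus. (\<lambda>n. \<phi> n x) \<longlonglongrightarrow> m x"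
    by (rule trig_dense[of m B]) (use bper_bound[OF assms(1)] in auto)
  have [measurable]: "\<phi> n \<in> borel_measurable torus" for n by (rule torus_measurable[OF trig_loc_bdd[OF \<phi>(1)]])
  have "(\<lambda>n. \<integral>x. \<bar>m x - \<phi> n x\<bar> \<partial>torus) \<longlonglongrightarrow> (\<integral>x. 0 \<partial>torus)"
  proof (rule integral_dominated_convergence[where w="\<lambda>x. B + (B + 1)"])
    show "AE x in torus. (\<lambda>n. \<bar>m x - \<phi> n x\<bar>) \<longlonglongrightarrow> 0"
      using \<phi>(3) by eventually_elim (auto intro!: tendsto_eq_intros)
    show "AE x in torus. norm \<bar>m x - \<phi> n x\<bar> \<le> B + (B + 1)" for n
    proof (intro AE_I2)
      fix x show "norm \<bar>m x - \<phi> n x\<bar> \<le> B + (B + 1)"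
        using \<phi>(2)[of n x] bper_bound[OF assms(1), of x] abs_triangle_ineq4[of "m x" "\<phi> n x"] by simp
    qed
  qed auto
  then have "(\<lambda>n. L1_dist m (\<phi> n)) \<longlonglongrightarrow> 0"
    using l by (simp add: L1_norm_torus trig_loc_bdd[OF \<phi>(1)])
  from order_tendstoD(2)[OF this assms(2)] obtain n where "L1_dist m (\<phi> n) < e"
    using eventually_sequentially by auto
  then show ?thesis using \<phi> that by blast
qed

text \<open>
  The function \<open>prim m\<close> is only Lipschitz, so the product rule is not available pointwise.
\<close>

lemma prim_by_parts:
  assumes "bper B m" "\<And>x. (\<phi> has_real_derivative \<phi>' x) (at x)" "continuous_on UNIV \<phi>'"
  shows "prim (\<lambda>x. prim m x * \<phi>' x) (2*pi) = prim m (2*pi) * \<phi> (2*pi) - prim (\<lambda>x. m x * \<phi> x) (2*pi)"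
proof -
  have lm: "loc_bdd m" and pm: "periodic m" using assms(1) bper_loc_bdd bper_periodic by auto
  have c\<phi>: "continuous_on UNIV \<phi>" using assms(2) by (meson DERIV_isCont continuous_at_imp_continuous_on)
  have l: "loc_bdd \<phi>" "loc_bdd \<phi>'" using c\<phi> assms(3) loc_bdd_continuous by auto
  obtain C D where C: "\<forall>x\<in>{0..2*pi}. \<bar>\<phi> x\<bar> \<le> C" and D: "\<forall>x\<in>{0..2*pi}. \<bar>\<phi>' x\<bar> \<le> D"
    using loc_bdd_bound[OF l(1), of 0 "2*pi"] loc_bdd_bound[OF l(2), of 0 "2*pi"] by blast
  have C0: "0 \<le> C" and D0: "0 \<le> D" using C D by fastforce+
  define err where "err m = prim (\<lambda>x. prim m x * \<phi>' x) (2*pi) - prim m (2*pi) * \<phi> (2*pi) + prim (\<lambda>x. m x * \<phi> x) (2*pi)" for m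
  have zero: "err f = 0" if f: "f \<in> trig" for f
  proof -
    have cf: "continuous_on UNIV f" by (rule trig_continuous[OF f])
    have lf: "loc_bdd f" by (rule trig_loc_bdd[OF f])
    have "prim (\<lambda>x. prim f x * \<phi>' x + f x * \<phi> x) (2*pi) = prim f (2*pi) * \<phi> (2*pi) - prim f 0 * \<phi> 0"
    proof (rule prim_of_derivative)
      show "((\<lambda>x. prim f x * \<phi> x) has_real_derivative prim f x * \<phi>' x + f x * \<phi> x) (at x)" for x
        by (auto intro!: derivative_eq_intros prim_has_derivative[OF cf] assms(2))
      show "continuous_on UNIV (\<lambda>x. prim f x * \<phi>' x + f x * \<phi> x)"
        by (intro continuous_intros prim_continuous lf cf assms(3) c\<phi>)
    qed
    then show ?thesis unfolding err_def using l lf by (simp add: prim_add)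
  qed
  have lin: "err (\<lambda>x. f x - g x) = err f - err g" if "loc_bdd f" "loc_bdd g" for f g
    using that l by (simp add: err_def prim_diff left_diff_distrib)
  have bnd: "\<bar>err f\<bar> \<le> (2*pi*D + 2*C) * L1_norm f" if f: "loc_bdd f" "periodic f" for f
  proof -
    have p: "\<bar>prim f x\<bar> \<le> L1_norm f" if "0 \<le> x" "x \<le> 2*pi" for x
      using prim_diff_le_L1[OF f, of x 0] that by simp
    have "\<bar>prim (\<lambda>x. prim f x * \<phi>' x) (2*pi) - prim (\<lambda>x. prim f x * \<phi>' x) 0\<bar> \<le> (L1_norm f * D) * (2*pi - 0)"
      by (rule prim_bound) (use f l p D L1_norm_nonneg[OF f(1)] in \<open>auto simp: abs_mult intro!: mult_mono\<close>)
    moreover have "\<bar>prim f (2*pi) * \<phi> (2*pi)\<bar> \<le> L1_norm f * C"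
      unfolding abs_mult using p[of "2*pi"] C L1_norm_nonneg[OF f(1)] by (intro mult_mono) auto
    moreover have "\<bar>prim (\<lambda>x. f x * \<phi> x) (2*pi)\<bar> \<le> L1_norm f * C"
    proof -
      have "prim (\<lambda>x. \<bar>f x * \<phi> x\<bar>) (2*pi) - prim (\<lambda>x. \<bar>f x * \<phi> x\<bar>) 0 \<le> prim (\<lambda>x. C * \<bar>f x\<bar>) (2*pi) - prim (\<lambda>x. C * \<bar>f x\<bar>) 0"
        by (rule prim_mono) (use f l C in \<open>auto simp: abs_mult mult.commute[of C] intro!: mult_left_mono\<close>)
      then show ?thesis using prim_abs_le[of "\<lambda>x. f x * \<phi> x" 0 "2*pi"] f l
        by (simp add: prim_cmul L1_norm_def mult.commute)
    qed
    ultimately show ?thesis unfolding err_def by (simp add: algebra_simps)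
  qed
  define K where "K = 2*pi*D + 2*C"
  have K: "0 \<le> K" using C0 D0 by (simp add: K_def)
  have "\<bar>err m\<bar> \<le> 0 + e" if e: "e > 0" for e
  proof -
    obtain f where f: "f \<in> trig" "L1_dist m f < e / (K + 1)"
      using trig_L1_dense[OF assms(1), of "e/(K+1)"] e K by (metis add_nonneg_pos divide_pos_pos zero_less_one)
    have "err m = err (\<lambda>x. m x - f x)" using lin[OF lm trig_loc_bdd[OF f(1)]] zero[OF f(1)] by simp
    also have "\<bar>\<dots>\<bar> \<le> K * L1_dist m f"
      unfolding K_def by (rule bnd) (use lm pm trig_loc_bdd[OF f(1)] trig_periodic[OF f(1)] in \<open>auto intro: periodic_binop\<close>)
    also have "\<dots> \<le> (K + 1) * (e / (K + 1))"
      using f(2) K by (intro mult_mono) (auto intro!: L1_norm_nonneg loc_bdd_diff lm trig_loc_bdd[OF f(1)])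
    also have "\<dots> = e" using K by simp
    finally show ?thesis by simp
  qed
  then have "\<bar>err m\<bar> \<le> 0" by (rule field_le_epsilon)
  then show ?thesis by (simp add: err_def)
qed

section \<open>Weak derivatives and Lipschitz representatives\<close>

lemma smooth_perD:
  assumes "\<phi> \<in> smooth_per"
  shows "(\<phi> has_real_derivative deriv \<phi> x) (at x)" "continuous_on UNIV (deriv \<phi>)" "continuous_on UNIV \<phi>" "periodic \<phi>"
proof -
  have d: "((deriv ^^ n) \<phi>) differentiable (at x)" for n x using assms by (simp add: smooth_per_def)
  show 1: "(\<phi> has_real_derivative deriv \<phi> x) (at x)" for x
    using d[of 0 x] by (simp add: DERIV_deriv_iff_real_differentiable)
  show "continuous_on UNIV (deriv \<phi>)"
    using d[of 1] by (auto simp: continuous_on_eq_continuous_at intro: differentiable_imp_continuous_within)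
  show "continuous_on UNIV \<phi>"
    using 1 by (meson DERIV_isCont continuous_at_imp_continuous_on)
  show "periodic \<phi>" using assms by (simp add: smooth_per_def)
qed

lemma integrable_times_bounded:
  assumes "integrable torus f" "loc_bdd g" shows "integrable torus (\<lambda>x. f x * g x)"
proof -
  obtain B where B: "\<forall>x\<in>{0..2*pi}. \<bar>g x\<bar> \<le> B" using loc_bdd_bound[OF assms(2), of 0 "2*pi"] by blast
  note [measurable] = torus_measurable[OF assms(2)] borel_measurable_integrable[OF assms(1)]
  show ?thesis
  proof (rule Bochner_Integration.integrable_bound[where f="\<lambda>x. \<bar>f x\<bar> * \<bar>B\<bar>"])
    show "AE x in torus. norm (f x * g x) \<le> norm (\<bar>f x\<bar> * \<bar>B\<bar>)"
      using B by (intro AE_I2) (force simp: abs_mult intro!: mult_left_mono)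
  qed (use assms in auto)
qed

lemma has_weak_deriv_cong:
  assumes w: "has_weak_deriv u v" and "AE x in torus. u x = u' x" "AE x in torus. v x = v' x" and "u' \<in> L1_per" "v' \<in> L1_per"
  shows "has_weak_deriv u' v'"
  unfolding has_weak_deriv_def
proof (intro conjI ballI assms)
  fix \<phi> assume \<phi>: "\<phi> \<in> smooth_per"
  note s = smooth_perD[OF \<phi>]
  note [measurable] = torus_measurable[OF loc_bdd_continuous[OF s(3)]] torus_measurable[OF loc_bdd_continuous[OF s(2)]]
  have [measurable]: "u \<in> borel_measurable torus" "v \<in> borel_measurable torus" "u' \<in> borel_measurable torus" "v' \<in> borel_measurable torus"
    using assms by (auto simp: has_weak_deriv_def L1_per_def)
  have "(\<integral>x. u' x * deriv \<phi> x \<partial>torus) = (\<integral>x. u x * deriv \<phi> x \<partial>torus)"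
    by (rule integral_cong_AE) (use assms(2) in auto)
  moreover have "(\<integral>x. v' x * \<phi> x \<partial>torus) = (\<integral>x. v x * \<phi> x \<partial>torus)"
    by (rule integral_cong_AE) (use assms(3) in auto)
  ultimately show "(\<integral>x. u' x * deriv \<phi> x \<partial>torus) = - (\<integral>x. v' x * \<phi> x \<partial>torus)"
    using w \<phi> by (simp add: has_weak_deriv_def)
qed

lemma bper_L1_per: "bper B f \<Longrightarrow> f \<in> L1_per"
  by (simp add: L1_per_def bper_periodic torus_integrable(1) bper_loc_bdd)

lemma continuous_L1_per: "continuous_on UNIV f \<Longrightarrow> periodic f \<Longrightarrow> f \<in> L1_per"
  by (simp add: L1_per_def torus_integrable(1) loc_bdd_continuous)

lemma weak_deriv_unique:
  assumes "has_weak_deriv u v" "has_weak_deriv u v'" shows "AE x in torus. v x = v' x"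
proof -
  have i: "integrable torus v" "integrable torus v'" using assms by (auto simp: has_weak_deriv_def L1_per_def)
  have "AE x in torus. v x - v' x = 0"
  proof (rule du_Bois_Reymond)
    fix \<phi> assume \<phi>: "\<phi> \<in> trig"
    have "(\<integral>x. v x * \<phi> x \<partial>torus) = (\<integral>x. v' x * \<phi> x \<partial>torus)"
      using assms trig_smooth[OF \<phi>] by (auto simp: has_weak_deriv_def)
    then show "(\<integral>x. (v x - v' x) * \<phi> x \<partial>torus) = 0"
      using integrable_times_bounded[OF i(1) trig_loc_bdd[OF \<phi>]] integrable_times_bounded[OF i(2) trig_loc_bdd[OF \<phi>]]
      by (simp add: left_diff_distrib)
  qed (use i in simp)
  then show ?thesis by simp
qed

lemma has_weak_deriv_weak_deriv: "has_weak_deriv u v \<Longrightarrow> has_weak_deriv u (weak_deriv u)"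
  unfolding weak_deriv_def by (rule someI[of "has_weak_deriv u"])

lemma weak_deriv_AE: "has_weak_deriv u v \<Longrightarrow> AE x in torus. weak_deriv u x = v x"
  by (rule weak_deriv_unique[OF has_weak_deriv_weak_deriv])

text \<open>
  Representatives of \<open>W\<^sup>1\<^sup>,\<^sup>\<infinity>\<close>: a Lipschitz function \<open>u\<close> and a slope \<open>m\<close> that is defined everywhere, bounded
  by \<open>B\<close>, and whose primitive is \<open>u\<close> up to a constant. The slope need not be the derivative of \<open>u\<close> at
  each point.
\<close>

definition per_prim :: "real \<Rightarrow> (real \<Rightarrow> real) \<Rightarrow> (real \<Rightarrow> real) \<Rightarrow> bool"
  where "per_prim B u m \<longleftrightarrow> bper B m \<and> periodic u \<and> (\<forall>x. prim m x = u x - u 0)"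

lemma per_primD:
  assumes "per_prim B u m"
  shows "bper B m" "periodic u" "prim m x = u x - u 0" "loc_bdd m" "periodic m" "prim m (2*pi) = 0" "loc_bdd u"
    "continuous_on S u" "\<bar>u x - u y\<bar> \<le> B * \<bar>x - y\<bar>" "prim m y - prim m x = u y - u x"
proof -
  show 1: "bper B m" "periodic u" using assms by (auto simp: per_prim_def)
  show 2: "prim m x = u x - u 0" for x using assms unfolding per_prim_def by blast
  show l: "loc_bdd m" "periodic m" by (rule bper_loc_bdd[OF 1(1)], rule bper_periodic[OF 1(1)])
  show "prim m (2*pi) = 0" using 2[of "2*pi"] periodicD[OF 1(2), of 0] by simp
  have "u = (\<lambda>x. u 0 + prim m x)" by (auto simp: 2)
  moreover have "continuous_on S (\<lambda>x. u 0 + prim m x)" for S by (intro continuous_intros prim_continuous l)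
  ultimately show c: "continuous_on S u" for S by metis
  show "loc_bdd u" by (rule loc_bdd_continuous[OF c])
  show "\<bar>u x - u y\<bar> \<le> B * \<bar>x - y\<bar>" using prim_lip[OF l(1) bper_bound[OF 1(1)], of x y] 2[of x] 2[of y] by simp
  show "prim m y - prim m x = u y - u x" using 2[of x] 2[of y] by simp
qed

lemma per_prim_diff:
  assumes "per_prim B u m" "per_prim C v n" shows "per_prim (B + C) (\<lambda>x. u x - v x) (\<lambda>x. m x - n x)"
  unfolding per_prim_def
proof (intro conjI allI)
  show "bper (B + C) (\<lambda>x. m x - n x)" by (rule bper_diff[OF per_primD(1)[OF assms(1)] per_primD(1)[OF assms(2)]])
  show "periodic (\<lambda>x. u x - v x)" by (rule periodic_binop[OF per_primD(2)[OF assms(1)] per_primD(2)[OF assms(2)]])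
  show "prim (\<lambda>x. m x - n x) x = u x - v x - (u 0 - v 0)" for x
    using per_primD(3)[OF assms(1), of x] per_primD(3)[OF assms(2), of x]
      prim_diff[OF per_primD(4)[OF assms(1)] per_primD(4)[OF assms(2)], of x] by linarith
qed

lemma per_prim_mono: "per_prim B u m \<Longrightarrow> B \<le> C \<Longrightarrow> per_prim C u m"
  by (auto simp: per_prim_def intro: bper_mono)

lemma per_prim_weak_deriv: assumes "per_prim B u m" shows "has_weak_deriv u m"
  unfolding has_weak_deriv_def
proof (intro conjI ballI)
  note p = per_primD[OF assms]
  show "u \<in> L1_per" by (rule continuous_L1_per[OF p(8,2)])
  show "m \<in> L1_per" by (rule bper_L1_per[OF p(1)])
  fix \<phi> assume \<phi>: "\<phi> \<in> smooth_per"
  note s = smooth_perD[OF \<phi>]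
  have l: "loc_bdd \<phi>" "loc_bdd (deriv \<phi>)" using s loc_bdd_continuous by auto
  have u: "u x * deriv \<phi> x = u 0 * deriv \<phi> x + prim m x * deriv \<phi> x" for x by (simp add: p(3) algebra_simps)
  have "prim (deriv \<phi>) (2*pi) = 0"
    using prim_of_derivative[OF s(1,2)] periodicD[OF s(4), of 0] by simp
  then have "prim (\<lambda>x. u x * deriv \<phi> x) (2*pi) = prim (\<lambda>x. prim m x * deriv \<phi> x) (2*pi)"
    unfolding u using l p(4) by (simp add: prim_add prim_cmul)
  also have "\<dots> = - prim (\<lambda>x. m x * \<phi> x) (2*pi)"
    using prim_by_parts[OF p(1) s(1,2)] p(6) by simp
  finally show "(\<integral>x. u x * deriv \<phi> x \<partial>torus) = - (\<integral>x. m x * \<phi> x \<partial>torus)"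
    using p l by (simp add: torus_integrable)
qed

text \<open>
  The difference \<open>r\<close> of \<open>u\<close> and the primitive of its weak derivative annihilates every trigonometric
  polynomial of mean zero, since such a polynomial is the derivative of a test function. Hence \<open>r\<close> is
  constant.
\<close>

lemma weak_deriv_bounded_primitive:
  assumes w: "has_weak_deriv u v" and "AE x in torus. v x = m x" "bper B m"
  obtains w where "per_prim B w m" "AE x in torus. u x = w x"
proof -
  have iu: "integrable torus u" and wm: "has_weak_deriv u m"
    using w has_weak_deriv_cong[OF w _ assms(2) _ bper_L1_per[OF assms(3)], of u] by (auto simp: has_weak_deriv_def L1_per_def)
  have lm: "loc_bdd m" "periodic m" using assms(3) bper_loc_bdd bper_periodic by auto
  have test: "(\<integral>x. u x * \<phi>' x \<partial>torus) = - prim (\<lambda>x. m x * \<phi> x) (2*pi)"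
    if "\<phi> \<in> smooth_per" "\<phi>' \<in> trig" "\<And>x. (\<phi> has_real_derivative \<phi>' x) (at x)" for \<phi> \<phi>'
  proof -
    have "deriv \<phi> = \<phi>'" using DERIV_imp_deriv[OF that(3)] by blast
    moreover have "loc_bdd \<phi>" using smooth_perD(3)[OF that(1)] loc_bdd_continuous by auto
    moreover have "loc_bdd (\<lambda>x. m x * \<phi> x)" using calculation lm by simp
    ultimately show ?thesis using wm that(1) torus_integrable(2)[of "\<lambda>x. m x * \<phi> x"] unfolding has_weak_deriv_def by metis
  qed
  have "(\<integral>x. u x * 0 \<partial>torus) = - prim (\<lambda>x. m x * 1) (2*pi)"
    by (rule test) (auto intro: trig_smooth trig.const)
  then have m0: "prim m (2*pi) = 0" by simp
  define r where "r x = u x - prim m x" for x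
  have ir: "integrable torus r" unfolding r_def[abs_def] using iu lm by (simp add: torus_integrable)
  define C where "C = (\<integral>x. r x \<partial>torus) / (2*pi)"
  have "AE x in torus. r x - C = 0"
  proof (rule du_Bois_Reymond)
    fix \<psi> assume \<psi>: "\<psi> \<in> trig"
    have l\<psi>: "loc_bdd \<psi>" and p\<psi>: "periodic \<psi>" using \<psi> trig_loc_bdd trig_periodic by auto
    \<comment> \<open>the mean is removed in order that the primitive of \<open>\<phi>'\<close> is periodic\<close>
    define \<phi>' where "\<phi>' x = \<psi> x + (- avg \<psi>)" for x
    have \<phi>': "\<phi>' \<in> trig" unfolding \<phi>'_def[abs_def] by (intro trig.add \<psi> trig.const)
    have l: "loc_bdd \<phi>'" by (rule trig_loc_bdd[OF \<phi>'])
    have c\<phi>: "continuous_on UNIV \<phi>'" by (rule trig_continuous[OF \<phi>'])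
    have 0: "prim \<phi>' (2*pi) = 0" unfolding \<phi>'_def[abs_def] using l\<psi> by (simp add: prim_diff avg_def)
    have d: "(prim \<phi>' has_real_derivative \<phi>' x) (at x)" for x by (rule prim_has_derivative[OF c\<phi>])
    have "prim \<phi>' \<in> smooth_per"
      by (rule trig_primitive_smooth[OF \<phi>' _ d]) (rule periodic_prim[OF trig_periodic[OF \<phi>'] l 0])
    from test[OF this \<phi>' d] have "(\<integral>x. u x * \<phi>' x \<partial>torus) = - prim (\<lambda>x. m x * prim \<phi>' x) (2*pi)" .
    also have "\<dots> = prim (\<lambda>x. prim m x * \<phi>' x) (2*pi)"
      using prim_by_parts[OF assms(3) d c\<phi>] 0 by simp
    also have "\<dots> = (\<integral>x. prim m x * \<phi>' x \<partial>torus)" using l lm by (simp add: torus_integrable)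
    finally have "(\<integral>x. r x * \<phi>' x \<partial>torus) = 0"
      unfolding r_def using integrable_times_bounded[OF iu l] l lm by (simp add: left_diff_distrib torus_integrable(1))
    moreover have "(\<integral>x. r x * \<phi>' x \<partial>torus) = (\<integral>x. r x * \<psi> x \<partial>torus) - avg \<psi> * (\<integral>x. r x \<partial>torus)"
      unfolding \<phi>'_def using integrable_times_bounded[OF ir l\<psi>] ir by (simp add: right_diff_distrib mult.commute)
    moreover have "(\<integral>x. (r x - C) * \<psi> x \<partial>torus) = (\<integral>x. r x * \<psi> x \<partial>torus) - C * prim \<psi> (2*pi)"
      using integrable_times_bounded[OF ir l\<psi>] torus_integrable[OF l\<psi>] by (simp add: left_diff_distrib)
    ultimately show "(\<integral>x. (r x - C) * \<psi> x \<partial>torus) = 0" by (simp add: C_def avg_def)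
  qed (use ir in simp)
  then have "AE x in torus. u x = C + prim m x" by eventually_elim (simp add: r_def)
  moreover have "per_prim B (\<lambda>x. C + prim m x) m"
    unfolding per_prim_def using assms(3) periodic_prim[OF lm(2,1) m0] by (auto simp: periodic_def)
  ultimately show ?thesis by (rule that[rotated])
qed

lemma L2_perI: assumes "bper B f" shows "f \<in> L2_per"
  unfolding L2_per_def using assms
  by (auto simp: bper_periodic torus_measurable bper_loc_bdd torus_integrable(1))

lemma Linf_perI:
  assumes "periodic f" "f \<in> borel_measurable torus" "AE x in torus. \<bar>f x\<bar> \<le> B" shows "f \<in> Linf_per"
proof -
  note [measurable] = assms(2)
  have "esssup torus (\<lambda>x. ereal \<bar>f x\<bar>) \<le> ereal B" by (rule esssup_I) (use assms in auto)
  then have "esssup torus (\<lambda>x. ereal \<bar>f x\<bar>) < \<infinity>" by (rule le_less_trans) simp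
  then show ?thesis using assms by (simp add: Linf_per_def)
qed

lemma bper_Linf_per: "bper B f \<Longrightarrow> f \<in> Linf_per"
  by (rule Linf_perI[where B=B]) (auto simp: bper_periodic torus_measurable bper_loc_bdd bper_bound)

lemma Linf_norm_AE: assumes "f \<in> Linf_per" shows "AE x in torus. \<bar>f x\<bar> \<le> Linf_norm f"
proof -
  let ?e = "esssup torus (\<lambda>x. ereal \<bar>f x\<bar>)"
  have "?e < \<infinity>" using assms by (simp add: Linf_per_def)
  then have "ereal \<bar>f x\<bar> \<le> ?e \<Longrightarrow> \<bar>f x\<bar> \<le> real_of_ereal ?e" for x by (cases ?e) auto
  moreover have "AE x in torus. ereal \<bar>f x\<bar> \<le> ?e" by (rule esssup_AE)
  ultimately show ?thesis unfolding Linf_norm_def by auto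
qed

lemma per_prim_bper: assumes "per_prim B u m" obtains C where "bper C u"
proof -
  note p = per_primD[OF assms]
  obtain C where "\<forall>x\<in>{0..2*pi}. \<bar>u x\<bar> \<le> C" using loc_bdd_bound[OF p(7), of 0 "2*pi"] by blast
  then have "\<bar>u x\<bar> \<le> C" for x using periodic_sup_bound[OF p(2), of "\<lambda>z. \<bar>z\<bar> \<le> C"] by auto
  then show ?thesis using p by (intro that bperI) auto
qed

lemma per_prim_spaces: assumes "per_prim B u m" shows "u \<in> H1_per" "u \<in> W1inf_per"
proof -
  obtain C where "bper C u" by (rule per_prim_bper[OF assms])
  then have "u \<in> L2_per" "u \<in> Linf_per" by (auto intro: L2_perI bper_Linf_per)
  moreover have "m \<in> L2_per" "m \<in> Linf_per" using per_primD(1)[OF assms] by (auto intro: L2_perI bper_Linf_per)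
  ultimately show "u \<in> H1_per" "u \<in> W1inf_per"
    unfolding H1_per_def W1inf_per_def using per_prim_weak_deriv[OF assms] by auto
qed

lemma W1inf_per_weak_deriv:
  assumes "u \<in> W1inf_per"
  shows "has_weak_deriv u (weak_deriv u)" "\<exists>B\<ge>0. AE x in torus. \<bar>weak_deriv u x\<bar> \<le> B"
    "weak_deriv u \<in> Linf_per"
proof -
  obtain v where v: "v \<in> Linf_per" "has_weak_deriv u v" using assms by (auto simp: W1inf_per_def)
  show w: "has_weak_deriv u (weak_deriv u)" by (rule has_weak_deriv_weak_deriv[OF v(2)])
  have ae: "AE x in torus. \<bar>weak_deriv u x\<bar> \<le> max 0 (Linf_norm v)"
    using Linf_norm_AE[OF v(1)] weak_deriv_AE[OF v(2)] by eventually_elim auto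
  then show "\<exists>B\<ge>0. AE x in torus. \<bar>weak_deriv u x\<bar> \<le> B" by (intro exI[of _ "max 0 (Linf_norm v)"]) auto
  show "weak_deriv u \<in> Linf_per"
    by (rule Linf_perI[OF _ _ ae]) (use w in \<open>auto simp: has_weak_deriv_def L1_per_def\<close>)
qed

lemma W1inf_per_representative:
  assumes "u \<in> W1inf_per" "AE x in torus. \<bar>weak_deriv u x\<bar> \<le> B" "0 \<le> B"
  obtains w m where "per_prim B w m" "AE x in torus. u x = w x" "AE x in torus. weak_deriv u x = m x"
proof -
  have w: "has_weak_deriv u (weak_deriv u)" by (rule W1inf_per_weak_deriv[OF assms(1)])
  then have "periodic (weak_deriv u)" "weak_deriv u \<in> borel_measurable torus"
    by (auto simp: has_weak_deriv_def L1_per_def)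
  then obtain m where m: "bper B m" "AE x in torus. weak_deriv u x = m x"
    using bounded_borel_representative[OF _ _ assms(2,3)] by blast
  then show ?thesis using weak_deriv_bounded_primitive[OF w m(2,1)] that by metis
qed

text \<open>
  The oscillation of \<open>u\<close> is at most the integral of the modulus of its slope, hence so is the distance
  of \<open>u\<close> from its mean.
\<close>

lemma per_prim_sup_le:
  assumes "per_prim B u m" shows "\<bar>u x\<bar> \<le> L1_norm u / (2*pi) + L1_norm m"
proof (rule periodic_sup_bound[OF per_primD(2)[OF assms], of "\<lambda>z. \<bar>z\<bar> \<le> _"])
  note p = per_primD[OF assms]
  fix x :: real assume x: "0 \<le> x" "x \<le> 2*pi"
  have "\<bar>prim (\<lambda>y. u x - u y) (2*pi) - prim (\<lambda>y. u x - u y) 0\<bar> \<le> L1_norm m * (2*pi - 0)"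
  proof (rule prim_bound)
    fix y :: real assume "0 \<le> y" "y \<le> 2*pi"
    then show "\<bar>u x - u y\<bar> \<le> L1_norm m"
      using prim_diff_le_L1[OF p(4,5), of x y] p(10)[of x y] x by (simp add: abs_le_iff)
  qed (use p in auto)
  then have "2*pi * \<bar>u x - avg u\<bar> \<le> 2*pi * L1_norm m"
    using p by (simp add: prim_diff avg_def field_simps abs_mult[symmetric])
  then have "\<bar>u x - avg u\<bar> \<le> L1_norm m" by simp
  then show "\<bar>u x\<bar> \<le> L1_norm u / (2*pi) + L1_norm m" using avg_abs_le[OF p(7)] by linarith
qed

section \<open>Strong convergence of slopes\<close>

text \<open>
  The parameter \<open>a\<close> makes this a substitute for the Cauchy-Schwarz inequality: integrating it and
  choosing \<open>a\<close> compares the norms of \<open>L\<^sup>1\<close> and \<open>L\<^sup>2\<close>.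
\<close>

lemma abs_le_quadratic: fixes d a :: real assumes "0 < a" shows "\<bar>d\<bar> \<le> a + d\<^sup>2 / (4*a)"
proof -
  have "0 \<le> (\<bar>d\<bar> - 2*a)\<^sup>2" by simp
  then have "4*a*\<bar>d\<bar> \<le> 4*a*a + d\<^sup>2" by (simp add: power2_eq_square algebra_simps abs_mult[symmetric])
  then show ?thesis using assms by (simp add: field_simps)
qed

lemma L1_norm_le_square:
  assumes "loc_bdd d" "0 < a" shows "L1_norm d \<le> 2*pi*a + energy d (2*pi) / (4*a)"
proof -
  have "prim (\<lambda>x. \<bar>d x\<bar>) (2*pi) - prim (\<lambda>x. \<bar>d x\<bar>) 0 \<le> prim (\<lambda>x. a + (1/(4*a)) * (d x)\<^sup>2) (2*pi) - prim (\<lambda>x. a + (1/(4*a)) * (d x)\<^sup>2) 0"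
    by (rule prim_mono) (use assms abs_le_quadratic[OF assms(2)] in auto)
  moreover have "prim (\<lambda>x. a + (1/(4*a)) * (d x)\<^sup>2) x = a * x + (1/(4*a)) * energy d x" for x
    using prim_add[OF loc_bdd_const loc_bdd_mult[OF loc_bdd_const loc_bdd_power2[OF assms(1)]], of a "1/(4*a)" x]
    unfolding prim_cmul prim_const .
  ultimately show ?thesis by (simp add: L1_norm_def mult.commute)
qed

lemma prim_product_le:
  assumes "loc_bdd f" "loc_bdd g" "\<And>x. 0 \<le> x \<Longrightarrow> x \<le> 2*pi \<Longrightarrow> \<bar>g x\<bar> \<le> C"
  shows "\<bar>prim (\<lambda>x. f x * g x) (2*pi)\<bar> \<le> C * L1_norm f"
proof -
  have "prim (\<lambda>x. \<bar>f x * g x\<bar>) (2*pi) - prim (\<lambda>x. \<bar>f x * g x\<bar>) 0 \<le> prim (\<lambda>x. C * \<bar>f x\<bar>) (2*pi) - prim (\<lambda>x. C * \<bar>f x\<bar>) 0"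
    by (rule prim_mono) (use assms in \<open>auto simp: abs_mult mult.commute[of C] intro!: mult_left_mono\<close>)
  then show ?thesis using prim_abs_le[of "\<lambda>x. f x * g x" 0 "2*pi"] assms
    by (simp add: prim_cmul L1_norm_def)
qed

text \<open>
  Weak convergence together with convergence of the norms is strong convergence. If \<open>u'\<close> is uniformly
  close to \<open>u\<close>, integration by parts against a trigonometric polynomial near \<open>m\<close> shows that \<open>m'\<close> is
  weakly close to \<open>m\<close>; in \<open>\<integral>(m' - m)\<^sup>2 = \<integral>m'\<^sup>2 - \<integral>m\<^sup>2 - 2\<integral>m (m' - m)\<close> all terms on the right are then small.
  Slopes of two solutions are transported differently and cannot be compared pointwise, so that this
  is the only way in which convergence of slopes is ever obtained.
\<close>

lemma slope_convergence:
  assumes "per_prim R u m" "0 < e"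
  obtains \<delta> where "0 < \<delta>"
    "\<And>u' m'. per_prim R u' m' \<Longrightarrow> (\<And>x. \<bar>u' x - u x\<bar> \<le> \<delta>) \<Longrightarrow>
      \<bar>energy m' (2*pi) - energy m (2*pi)\<bar> \<le> \<delta> \<Longrightarrow> L1_dist m' m \<le> e"
proof -
  note p = per_primD[OF assms(1)]
  have R: "0 \<le> R" by (rule bper_nonneg[OF p(1)])
  \<comment> \<open>\<open>k\<close> is the bound for \<open>\<integral>(m' - m)\<^sup>2\<close> that makes the norm in \<open>L\<^sup>1\<close> at most \<open>e\<close>\<close>
  define k where "k = e\<^sup>2 / (2*pi)"
  have k: "0 < k" using assms(2) by (simp add: k_def)
  obtain \<phi> where \<phi>: "\<phi> \<in> trig" "L1_dist m \<phi> < k / (8*(R+1))"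
    using trig_L1_dense[OF p(1), of "k / (8*(R+1))"] k R by (metis add_nonneg_pos divide_pos_pos mult_pos_pos zero_less_numeral zero_less_one)
  obtain \<phi>' where \<phi>': "\<phi>' \<in> trig" "\<And>x. (\<phi> has_real_derivative \<phi>' x) (at x)" using trig_deriv[OF \<phi>(1)] by blast
  obtain D where D: "bper D \<phi>'" by (rule trig_bper[OF \<phi>'(1)])
  have D0: "0 \<le> D" by (rule bper_nonneg[OF D])
  have l: "loc_bdd \<phi>" "loc_bdd \<phi>'" using \<phi> \<phi>' trig_loc_bdd by auto
  define \<delta> where "\<delta> = k / (2 * (1 + 8*pi*D))"
  have "0 < 1 + 8*pi*D" using D0 by (simp add: add_pos_nonneg)
  then have \<delta>: "0 < \<delta>" "\<delta> * (1 + 8*pi*D) = k / 2" using k by (simp_all add: \<delta>_def field_simps)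
  show ?thesis
  proof (rule that[OF \<delta>(1)])
    fix u' m' assume p': "per_prim R u' m'" and u: "\<And>x. \<bar>u' x - u x\<bar> \<le> \<delta>"
      and E: "\<bar>energy m' (2*pi) - energy m (2*pi)\<bar> \<le> \<delta>"
    note q = per_primD[OF p']
    note pd = per_primD[OF per_prim_diff[OF p' assms(1)]]
    define d where "d x = m' x - m x" for x
    have ld: "loc_bdd d" unfolding d_def[abs_def] by (simp add: q p)
    have bd: "bper (R+R) d" unfolding d_def[abs_def] by (rule pd(1))
    have pdz: "prim d (2*pi) = 0" using pd(6) by (simp add: d_def[abs_def])
    have pb: "\<bar>prim d x\<bar> \<le> 2*\<delta>" for x
      using pd(3)[of x] u[of x] u[of 0] by (simp add: d_def[abs_def])
    have "\<bar>prim (\<lambda>x. prim d x * \<phi>' x) (2*pi) - prim (\<lambda>x. prim d x * \<phi>' x) 0\<bar> \<le> (2*\<delta>*D) * (2*pi - 0)"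
      by (rule prim_bound) (use ld l pb bper_bound[OF D] \<delta> in \<open>auto simp: abs_mult intro!: mult_mono\<close>)
    then have 1: "\<bar>prim (\<lambda>x. d x * \<phi> x) (2*pi)\<bar> \<le> 4*pi*D*\<delta>"
      using prim_by_parts[OF bd \<phi>'(2) trig_continuous[OF \<phi>'(1)]] pdz by (simp add: mult_ac)
    have "\<bar>prim (\<lambda>x. (m x - \<phi> x) * d x) (2*pi)\<bar> \<le> (R+R) * L1_dist m \<phi>"
      by (rule prim_product_le) (use p l ld bper_bound[OF bd] in auto)
    also have "\<dots> \<le> (2*(R+1)) * (k / (8*(R+1)))"
      using \<phi>(2) R by (intro mult_mono) (auto intro!: L1_norm_nonneg loc_bdd_diff p l)
    also have "\<dots> = k / 4" using R by (simp add: field_simps)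
    finally have 2: "\<bar>prim (\<lambda>x. (m x - \<phi> x) * d x) (2*pi)\<bar> \<le> k/4" .
    have "(\<lambda>x. (d x)\<^sup>2) = (\<lambda>x. (m' x)\<^sup>2 - (m x)\<^sup>2 - (2 * (d x * \<phi> x) + 2 * ((m x - \<phi> x) * d x)))"
      by (auto simp: d_def power2_eq_square algebra_simps)
    then have "energy d (2*pi) = energy m' (2*pi) - energy m (2*pi)
       - (2 * prim (\<lambda>x. d x * \<phi> x) (2*pi) + 2 * prim (\<lambda>x. (m x - \<phi> x) * d x) (2*pi))"
      using p q l ld by (simp add: prim_diff prim_add prim_cmul)
    then have "energy d (2*pi) \<le> \<delta> + 2 * (4*pi*D*\<delta>) + 2 * (k/4)" using 1 2 E by linarith
    also have "\<dots> = k" using \<delta>(2) by (simp add: algebra_simps)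
    finally have "energy d (2*pi) \<le> k" .
    then have "energy d (2*pi) / (4 * (e/(4*pi))) \<le> k / (4 * (e/(4*pi)))"
      using assms(2) by (intro divide_right_mono) auto
    also have "\<dots> = e/2" using assms(2) by (simp add: k_def power2_eq_square)
    finally have "energy d (2*pi) / (4 * (e/(4*pi))) \<le> e/2" .
    moreover have "L1_norm d \<le> 2*pi*(e/(4*pi)) + energy d (2*pi) / (4 * (e/(4*pi)))"
      by (rule L1_norm_le_square[OF ld]) (use assms(2) in simp)
    moreover have "2*pi*(e/(4*pi)) = e/2" by simp
    ultimately have "L1_norm d \<le> e" by linarith
    then show "L1_dist m' m \<le> e" by (simp add: d_def[abs_def])
  qed
qed

section \<open>Seminorms on bounded sets\<close>

lemma L2_norm_le_L1:
  assumes "f \<in> borel_measurable torus" "AE x in torus. \<bar>f x\<bar> \<le> B"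
  shows "L2_norm f \<le> sqrt (B * (\<integral>x. \<bar>f x\<bar> \<partial>torus))"
proof -
  note [measurable] = assms(1)
  have i: "integrable torus (\<lambda>x. \<bar>f x\<bar>)"
    by (rule Bochner_Integration.integrable_bound[where f="\<lambda>x. B"]) (use assms(2) in auto)
  have "(\<integral>x. (f x)\<^sup>2 \<partial>torus) \<le> (\<integral>x. B * \<bar>f x\<bar> \<partial>torus)"
  proof (rule integral_mono_AE')
    show "AE x in torus. (f x)\<^sup>2 \<le> B * \<bar>f x\<bar>"
      using assms(2)
    proof eventually_elim
      case (elim x)
      have "\<bar>f x\<bar> * \<bar>f x\<bar> \<le> B * \<bar>f x\<bar>" by (rule mult_right_mono[OF elim]) simp
      then show ?case by (simp add: power2_eq_square)
    qed
  qed (use i assms(2) in \<open>auto elim: eventually_mono\<close>)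
  then show ?thesis by (simp add: L2_norm_def)
qed

text \<open>
  The function \<open>g\<close> is bounded up to a remainder that is small in \<open>L\<^sup>1\<close>.
\<close>

lemma pairing_le_L1:
  assumes "integrable torus g" "0 < e" "0 \<le> B"
  obtains K where "0 \<le> K" "\<And>f. f \<in> borel_measurable torus \<Longrightarrow> AE x in torus. \<bar>f x\<bar> \<le> B \<Longrightarrow>
     \<bar>pairing f g\<bar> \<le> e + K * (\<integral>x. \<bar>f x\<bar> \<partial>torus)"
proof -
  note [measurable] = borel_measurable_integrable[OF assms(1)]
  define t where "t n x = (if \<bar>g x\<bar> \<le> real n then 0 else g x)" for n x
  have [measurable]: "t n \<in> borel_measurable torus" for n unfolding t_def[abs_def] by measurable
  have it: "integrable torus (t n)" for n
    by (rule Bochner_Integration.integrable_bound[OF assms(1)]) (auto simp: t_def)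
  have "(\<lambda>n. \<integral>x. \<bar>t n x\<bar> \<partial>torus) \<longlonglongrightarrow> (\<integral>x. 0 \<partial>torus)"
  proof (rule integral_dominated_convergence[where w="\<lambda>x. \<bar>g x\<bar>"])
    show "AE x in torus. (\<lambda>n. \<bar>t n x\<bar>) \<longlonglongrightarrow> 0"
    proof (intro AE_I2 tendsto_eventually)
      fix x
      obtain n0 where "\<bar>g x\<bar> \<le> real n0" using real_arch_simple by blast
      then show "eventually (\<lambda>n. \<bar>t n x\<bar> = 0) sequentially"
        unfolding eventually_sequentially by (intro exI[of _ n0]) (auto simp: t_def)
    qed
  qed (use assms(1) in \<open>auto simp: t_def\<close>)
  then have "(\<lambda>n. \<integral>x. \<bar>t n x\<bar> \<partial>torus) \<longlonglongrightarrow> 0" by simp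
  from order_tendstoD(2)[OF this, of "e/(B+1)"] obtain n where n: "(\<integral>x. \<bar>t n x\<bar> \<partial>torus) < e / (B+1)"
    using assms eventually_sequentially by auto
  show ?thesis
  proof (rule that[of "real n"])
    fix f :: "real \<Rightarrow> real" assume f: "f \<in> borel_measurable torus" and fB: "AE x in torus. \<bar>f x\<bar> \<le> B"
    note [measurable] = f
    have i: "integrable torus (\<lambda>x. \<bar>f x\<bar>)"
      by (rule Bochner_Integration.integrable_bound[where f="\<lambda>x. B"]) (use fB in auto)
    have ae: "AE x in torus. \<bar>f x * g x\<bar> \<le> real n * \<bar>f x\<bar> + B * \<bar>t n x\<bar>"
      using fB
    proof eventually_elim
      case (elim x)
      show ?case
      proof (cases "\<bar>g x\<bar> \<le> real n")
        case True then show ?thesis using mult_left_mono[OF True, of "\<bar>f x\<bar>"] by (simp add: t_def abs_mult mult.commute)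
      next
        case False then show ?thesis using mult_right_mono[OF elim, of "\<bar>g x\<bar>"] mult_nonneg_nonneg[of "real n" "\<bar>f x\<bar>"]
            unfolding t_def abs_mult by (auto intro: order_trans)
      qed
    qed
    have "\<bar>pairing f g\<bar> \<le> (\<integral>x. \<bar>f x * g x\<bar> \<partial>torus)" unfolding pairing_def by (rule integral_abs_bound)
    also have "\<dots> \<le> (\<integral>x. real n * \<bar>f x\<bar> + B * \<bar>t n x\<bar> \<partial>torus)"
      by (rule integral_mono_AE') (use ae i it assms in auto)
    also have "\<dots> = real n * (\<integral>x. \<bar>f x\<bar> \<partial>torus) + B * (\<integral>x. \<bar>t n x\<bar> \<partial>torus)" using i it by simp
    also have "B * (\<integral>x. \<bar>t n x\<bar> \<partial>torus) \<le> (B+1) * (e / (B+1))" using n assms by (intro mult_mono) auto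
    also have "\<dots> = e" using assms by simp
    finally show "\<bar>pairing f g\<bar> \<le> e + real n * (\<integral>x. \<bar>f x\<bar> \<partial>torus)" by simp
  qed simp
qed

text \<open>
  The best choice of \<open>a\<close> in \<open>abs_le_quadratic\<close>, namely \<open>a = s/(2 sqrt(2\<pi>))\<close> for \<open>s\<close> the norm in \<open>L\<^sup>2\<close>,
  gives the Cauchy-Schwarz constant.
\<close>

lemma L1_le_L2_norm:
  assumes "f \<in> borel_measurable torus" "integrable torus (\<lambda>x. (f x)\<^sup>2)"
  shows "integrable torus f" "(\<integral>x. \<bar>f x\<bar> \<partial>torus) \<le> sqrt (2*pi) * L2_norm f"
proof -
  note [measurable] = assms(1)
  show i: "integrable torus f"
  proof (rule Bochner_Integration.integrable_bound[where f="\<lambda>x. 1 + (f x)\<^sup>2 / (4*1)"])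
    show "AE x in torus. norm (f x) \<le> norm (1 + (f x)\<^sup>2 / (4 * 1))"
      using abs_le_quadratic[of 1] by (intro AE_I2) (auto intro: order_trans)
  qed (use assms in auto)
  define s where "s = L2_norm f"
  have s2: "(\<integral>x. (f x)\<^sup>2 \<partial>torus) = s\<^sup>2" "0 \<le> s" by (simp_all add: s_def L2_norm_def)
  have q: "(\<integral>x. \<bar>f x\<bar> \<partial>torus) \<le> 2*pi*a + s\<^sup>2 / (4*a)" if "0 < a" for a
  proof -
    have "(\<integral>x. \<bar>f x\<bar> \<partial>torus) \<le> (\<integral>x. a + (f x)\<^sup>2 / (4*a) \<partial>torus)"
      by (rule integral_mono) (use i assms abs_le_quadratic[OF that] in auto)
    also have "\<dots> = 2*pi*a + s\<^sup>2 / (4*a)"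
      using assms(2) s2 integral_torus_const[of a] by (subst Bochner_Integration.integral_add) auto
    finally show ?thesis .
  qed
  show "(\<integral>x. \<bar>f x\<bar> \<partial>torus) \<le> sqrt (2*pi) * L2_norm f"
  proof (cases "s = 0")
    case True
    have "(\<integral>x. \<bar>f x\<bar> \<partial>torus) \<le> 0 + e" if "0 < e" for e using q[of "e/(2*pi)"] that True by simp
    then have "(\<integral>x. \<bar>f x\<bar> \<partial>torus) \<le> 0" by (rule field_le_epsilon)
    then show ?thesis using True by (simp add: s_def)
  next
    case False
    then have sp: "0 < s" using s2 by simp
    define r where "r = sqrt (2*pi)"
    have r: "0 < r" "2*pi = r\<^sup>2" by (simp_all add: r_def)
    have "2*pi*(s/(2*r)) + s\<^sup>2 / (4*(s/(2*r))) = r * s"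
      unfolding r(2) using r(1) sp by (simp add: power2_eq_square field_simps)
    then show ?thesis using q[of "s/(2*r)"] sp r(1) by (simp add: r_def s_def)
  qed
qed

text \<open>
  On bounded subsets of \<open>L\<^sup>\<infinity>\<close> all the seminorms are controlled by the norm of \<open>L\<^sup>1\<close>, so that it
  suffices to prove limits in \<open>L\<^sup>1\<close>.
\<close>

lemma L2_Linf_seminorm_small:
  assumes "p \<in> seminorms_L2_Linf" "0 < e" "0 \<le> B"
  obtains \<delta> where "0 < \<delta>" "\<And>f. f \<in> borel_measurable torus \<Longrightarrow> AE x in torus. \<bar>f x\<bar> \<le> B \<Longrightarrow>
     (\<integral>x. \<bar>f x\<bar> \<partial>torus) < \<delta> \<Longrightarrow> \<bar>p f\<bar> < e"
proof -
  consider "p = L2_norm" | g where "g \<in> L1_per" "p = (\<lambda>u. \<bar>pairing u g\<bar>)"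
    using assms(1) by (auto simp: seminorms_L2_Linf_def)
  then show ?thesis
  proof cases
    case 1
    show ?thesis
    proof (rule that[of "e\<^sup>2 / (B+1)"])
      fix f :: "real \<Rightarrow> real" assume f: "f \<in> borel_measurable torus" "AE x in torus. \<bar>f x\<bar> \<le> B" and d: "(\<integral>x. \<bar>f x\<bar> \<partial>torus) < e\<^sup>2 / (B+1)"
      have "B * (\<integral>x. \<bar>f x\<bar> \<partial>torus) \<le> (B+1) * (\<integral>x. \<bar>f x\<bar> \<partial>torus)" by (intro mult_right_mono) auto
      also have "\<dots> < (B+1) * (e\<^sup>2 / (B+1))" using d assms by (intro mult_strict_left_mono) auto
      also have "\<dots> = e\<^sup>2" using assms by simp
      finally have "sqrt (B * (\<integral>x. \<bar>f x\<bar> \<partial>torus)) < e" using assms by (simp add: real_sqrt_less_iff real_less_lsqrt)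
      then have "L2_norm f < e" using L2_norm_le_L1[OF f] by linarith
      then show "\<bar>p f\<bar> < e" by (simp add: 1 L2_norm_def)
    qed (use assms in auto)
  next
    case 2
    then have "integrable torus g" by (simp add: L1_per_def)
    then obtain K where K: "0 \<le> K" "\<And>f. f \<in> borel_measurable torus \<Longrightarrow> AE x in torus. \<bar>f x\<bar> \<le> B \<Longrightarrow>
     \<bar>pairing f g\<bar> \<le> e/2 + K * (\<integral>x. \<bar>f x\<bar> \<partial>torus)" using pairing_le_L1[of g "e/2" B] assms by auto
    show ?thesis
    proof (rule that[of "e / (2*(K+1))"])
      fix f :: "real \<Rightarrow> real" assume f: "f \<in> borel_measurable torus" "AE x in torus. \<bar>f x\<bar> \<le> B" and d: "(\<integral>x. \<bar>f x\<bar> \<partial>torus) < e / (2*(K+1))"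
      have "K * (\<integral>x. \<bar>f x\<bar> \<partial>torus) \<le> (K+1) * (\<integral>x. \<bar>f x\<bar> \<partial>torus)" by (intro mult_right_mono) auto
      also have "\<dots> < (K+1) * (e / (2*(K+1)))" using d K by (intro mult_strict_left_mono) auto
      also have "\<dots> = e/2" using K by (simp add: field_simps)
      finally show "\<bar>p f\<bar> < e" using K(2)[OF f] by (simp add: 2)
    qed (use assms K in auto)
  qed
qed

lemma weak_deriv_eq_slope:
  assumes "per_prim B u m" "w \<in> L1_per" "AE x in torus. w x = u x"
  shows "has_weak_deriv w (weak_deriv w)" "AE x in torus. weak_deriv w x = m x"
proof -
  have w: "has_weak_deriv w m"
    by (rule has_weak_deriv_cong[OF per_prim_weak_deriv[OF assms(1)] _ _ assms(2) bper_L1_per[OF per_primD(1)[OF assms(1)]]])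
      (use assms(3) in auto)
  show "has_weak_deriv w (weak_deriv w)" by (rule has_weak_deriv_weak_deriv[OF w])
  show "AE x in torus. weak_deriv w x = m x" by (rule weak_deriv_AE[OF w])
qed

lemma weak_deriv_measurable:
  assumes "per_prim B u m" "w \<in> L1_per" "AE x in torus. w x = u x"
  shows "weak_deriv w \<in> borel_measurable torus"
  using weak_deriv_eq_slope(1)[OF assms] by (auto simp: has_weak_deriv_def L1_per_def)

lemma integral_abs_cong_AE:
  assumes "f \<in> borel_measurable torus" "loc_bdd g" "AE x in torus. f x = g x"
  shows "(\<integral>x. \<bar>f x\<bar> \<partial>torus) = L1_norm g"
  unfolding L1_norm_torus[OF assms(2)]
  by (rule integral_cong_AE) (use assms torus_measurable[OF assms(2)] in auto)

lemma H1_W1inf_seminorm_small: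
  assumes "p \<in> seminorms_H1_W1inf" "0 < e" "0 \<le> B"
  obtains \<delta> where "0 < \<delta>" "\<And>w u m. per_prim B u m \<Longrightarrow> bper B u \<Longrightarrow> w \<in> L1_per \<Longrightarrow> AE x in torus. w x = u x \<Longrightarrow>
     L1_norm u < \<delta> \<Longrightarrow> L1_norm m < \<delta> \<Longrightarrow> \<bar>p w\<bar> < e"
proof -
  have facts: "w \<in> borel_measurable torus" "AE x in torus. \<bar>w x\<bar> \<le> B" "(\<integral>x. \<bar>w x\<bar> \<partial>torus) = L1_norm u"
    "weak_deriv w \<in> borel_measurable torus" "AE x in torus. \<bar>weak_deriv w x\<bar> \<le> B" "(\<integral>x. \<bar>weak_deriv w x\<bar> \<partial>torus) = L1_norm m"
    if "per_prim B u m" "bper B u" "w \<in> L1_per" "AE x in torus. w x = u x" for w u m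
  proof -
    show 1: "w \<in> borel_measurable torus" using that(3) borel_measurable_integrable by (auto simp: L1_per_def)
    show 2: "weak_deriv w \<in> borel_measurable torus" by (rule weak_deriv_measurable[OF that(1,3,4)])
    note ae = weak_deriv_eq_slope(2)[OF that(1,3,4)]
    show "AE x in torus. \<bar>w x\<bar> \<le> B" using that(4) bper_bound[OF that(2)] by auto
    show "AE x in torus. \<bar>weak_deriv w x\<bar> \<le> B" using ae bper_bound[OF per_primD(1)[OF that(1)]] by auto
    show "(\<integral>x. \<bar>w x\<bar> \<partial>torus) = L1_norm u" by (rule integral_abs_cong_AE[OF 1 bper_loc_bdd[OF that(2)] that(4)])
    show "(\<integral>x. \<bar>weak_deriv w x\<bar> \<partial>torus) = L1_norm m" by (rule integral_abs_cong_AE[OF 2 per_primD(4)[OF that(1)] ae])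
  qed
  consider "p = H1_norm" | g where "g \<in> L1_per" "p = (\<lambda>u. \<bar>pairing u g\<bar>)" | g where "g \<in> L1_per" "p = (\<lambda>u. \<bar>pairing (weak_deriv u) g\<bar>)"
    using assms(1) by (auto simp: seminorms_H1_W1inf_def)
  then show ?thesis
  proof cases
    case 1
    obtain \<delta> where \<delta>: "0 < \<delta>" "\<And>f. f \<in> borel_measurable torus \<Longrightarrow> AE x in torus. \<bar>f x\<bar> \<le> B \<Longrightarrow>
       (\<integral>x. \<bar>f x\<bar> \<partial>torus) < \<delta> \<Longrightarrow> \<bar>L2_norm f\<bar> < e/2"
      by (rule L2_Linf_seminorm_small[of L2_norm "e/2" B]) (use assms in \<open>auto simp: seminorms_L2_Linf_def\<close>)
    show ?thesis
    proof (rule that[OF \<delta>(1)])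
      fix w u m assume a: "per_prim B u m" "bper B u" "w \<in> L1_per" "AE x in torus. w x = u x" "L1_norm u < \<delta>" "L1_norm m < \<delta>"
      note F = facts[OF a(1-4)]
      have "\<bar>L2_norm w\<bar> < e/2" "\<bar>L2_norm (weak_deriv w)\<bar> < e/2" using \<delta>(2)[OF F(1,2)] \<delta>(2)[OF F(4,5)] F(3,6) a(5,6) by auto
      moreover have "H1_norm w \<le> \<bar>L2_norm w\<bar> + \<bar>L2_norm (weak_deriv w)\<bar>"
        unfolding H1_norm_def by (rule sqrt_sum_squares_le_sum_abs)
      moreover have "0 \<le> H1_norm w" by (simp add: H1_norm_def)
      ultimately show "\<bar>p w\<bar> < e" unfolding 1 by linarith
    qed
  next
    case 2
    obtain \<delta> where \<delta>: "0 < \<delta>" "\<And>f. f \<in> borel_measurable torus \<Longrightarrow> AE x in torus. \<bar>f x\<bar> \<le> B \<Longrightarrow>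
       (\<integral>x. \<bar>f x\<bar> \<partial>torus) < \<delta> \<Longrightarrow> \<bar>\<bar>pairing f g\<bar>\<bar> < e"
      by (rule L2_Linf_seminorm_small[of "\<lambda>f. \<bar>pairing f g\<bar>" e B]) (use assms 2 in \<open>auto simp: seminorms_L2_Linf_def\<close>)
    show ?thesis
      by (rule that[OF \<delta>(1)]) (use \<delta>(2)[OF facts(1,2)] facts(3) in \<open>auto simp: 2\<close>)
  next
    case 3
    obtain \<delta> where \<delta>: "0 < \<delta>" "\<And>f. f \<in> borel_measurable torus \<Longrightarrow> AE x in torus. \<bar>f x\<bar> \<le> B \<Longrightarrow>
       (\<integral>x. \<bar>f x\<bar> \<partial>torus) < \<delta> \<Longrightarrow> \<bar>\<bar>pairing f g\<bar>\<bar> < e"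
      by (rule L2_Linf_seminorm_small[of "\<lambda>f. \<bar>pairing f g\<bar>" e B]) (use assms 3 in \<open>auto simp: seminorms_L2_Linf_def\<close>)
    show ?thesis
      by (rule that[OF \<delta>(1)]) (use \<delta>(2)[OF facts(4,5)] facts(6) in \<open>auto simp: 3\<close>)
  qed
qed

section \<open>Ordinary differential equations in Banach spaces\<close>

lemma antiderivative_exists:
  fixes g :: "real \<Rightarrow> 'a::banach"
  assumes "continuous_on UNIV g"
  shows "\<exists>P. P 0 = 0 \<and> (\<forall>t. (P has_vector_derivative g t) (at t))"
proof -
  define P where "P t = (if 0 \<le> t then integral {0..t} g else - integral {t..0} g)" for t
  have i: "g integrable_on {a..b}" for a b
    by (rule integrable_continuous_real) (rule continuous_on_subset[OF assms], simp)
  have P: "P s = integral {-N..s} g - integral {-N..0} g" if "-N \<le> s" "0 \<le> N" for s N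
    using Henstock_Kurzweil_Integration.integral_combine[of "-N" 0 s g]
      Henstock_Kurzweil_Integration.integral_combine[of "-N" s 0 g] i that
    by (cases "0 \<le> s") (auto simp: P_def algebra_simps)
  have "(P has_vector_derivative g t) (at t)" for t
  proof -
    define N where "N = \<bar>t\<bar> + 1"
    have "((\<lambda>s. integral {-N..s} g) has_vector_derivative g t) (at t within {-N..N})"
      by (rule integral_has_vector_derivative) (auto intro: continuous_on_subset[OF assms] simp: N_def)
    moreover have "at t within {-N..N} = at t" by (rule at_within_Icc_at) (auto simp: N_def)
    ultimately have "((\<lambda>s. integral {-N..s} g - integral {-N..0} g) has_vector_derivative g t) (at t)"
      by (auto intro!: derivative_eq_intros)
    then show ?thesis
    proof (rule has_vector_derivative_transform_within_open[of _ _ _ "{-N<..<N}"])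
      show "integral {-N..s} g - integral {-N..0} g = P s" if "s \<in> {-N<..<N}" for s
        using P[of N s] that by auto
    qed (auto simp: N_def)
  qed
  moreover have "P 0 = 0" by (simp add: P_def)
  ultimately show ?thesis by blast
qed

text \<open>
  The estimate behind both the contraction argument and the Gronwall lemma: growth is measured with
  the weight \<open>exp (2L\<bar>t\<bar>)\<close>, whose integral gains the factor \<open>1/(2L)\<close>.
\<close>

lemma exp_growth_bound:
  fixes g :: "real \<Rightarrow> 'a::real_normed_vector"
  assumes L: "0 < L" and der: "\<And>t. t \<in> {-T..T} \<Longrightarrow> (g has_vector_derivative g' t) (at t within {-T..T})"
    and b: "\<And>t. t \<in> {-T..T} \<Longrightarrow> norm (g' t) \<le> A + B * exp (2*L*\<bar>t\<bar>)" and t: "t \<in> {-T..T}"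
  shows "norm (g t - g 0) \<le> A * \<bar>t\<bar> + B * (exp (2*L*\<bar>t\<bar>) - 1) / (2*L)"
proof -
  have cont: "continuous_on {-T..T} g"
    unfolding continuous_on_eq_continuous_within by (intro ballI has_vector_derivative_continuous[OF der])
  have int: "(g has_vector_derivative g' s) (at s)" if "-T < s" "s < T" for s
    using der[of s] that at_within_Icc_at[of "-T" s T] by simp
  consider "t = 0" | "0 < t" | "t < 0" by linarith
  then show ?thesis
  proof cases
    case 2
    have "norm (g t - g 0) \<le> (A * t + B * exp (2*L*t) / (2*L)) - (A * 0 + B * exp (2*L*0) / (2*L))"
    proof (rule differentiable_bound_general[OF 2])
      show "continuous_on {0..t} g" by (rule continuous_on_subset[OF cont]) (use t in auto)
      show "((\<lambda>t. A * t + B * exp (2*L*t) / (2*L)) has_vector_derivative A + B * exp (2*L*x)) (at x)" for x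
        unfolding has_real_derivative_iff_has_vector_derivative[symmetric] using L by (auto intro!: derivative_eq_intros)
      show "norm (g' x) \<le> A + B * exp (2*L*x)" if "0 < x" "x < t" for x using b[of x] that t by simp
    qed (use L t int in \<open>auto intro!: continuous_intros\<close>)
    also have "\<dots> = A * \<bar>t\<bar> + B * (exp (2*L*\<bar>t\<bar>) - 1) / (2*L)" using 2 L by (simp add: field_simps)
    finally show ?thesis .
  next
    case 3
    have "norm (g 0 - g t) \<le> (A * 0 - B * exp (- (2*L*0)) / (2*L)) - (A * t - B * exp (- (2*L*t)) / (2*L))"
    proof (rule differentiable_bound_general[OF 3])
      show "continuous_on {t..0} g" by (rule continuous_on_subset[OF cont]) (use t in auto)
      show "((\<lambda>t. A * t - B * exp (-(2*L*t)) / (2*L)) has_vector_derivative A + B * exp (-(2*L*x))) (at x)" for x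
        unfolding has_real_derivative_iff_has_vector_derivative[symmetric] using L by (auto intro!: derivative_eq_intros)
      show "norm (g' x) \<le> A + B * exp (-(2*L*x))" if "t < x" "x < 0" for x using b[of x] that t by simp
    qed (use L t int in \<open>auto intro!: continuous_intros\<close>)
    also have "\<dots> = A * \<bar>t\<bar> + B * (exp (2*L*\<bar>t\<bar>) - 1) / (2*L)" using 3 L by (simp add: field_simps)
    finally show ?thesis by (simp add: norm_minus_commute)
  qed simp
qed

text \<open>
  The solution is sought as \<open>x\<^sub>0 + w y\<close> with the weight \<open>w = exp (2L\<bar>t\<bar>)\<close> and \<open>y\<close> bounded and continuous.
  The integral operator then contracts by \<open>1/2\<close> on the whole time axis, so that one application of the
  fixed point theorem gives a global solution.
\<close>

lemma picard_lindeloef: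
  fixes f :: "real \<Rightarrow> 'a::banach \<Rightarrow> 'a"
  assumes L: "0 < L" "\<And>t x y. norm (f t x - f t y) \<le> L * norm (x - y)"
    and cont: "\<And>x. continuous_on UNIV x \<Longrightarrow> continuous_on UNIV (\<lambda>t. f t (x t))"
    and M: "\<And>t. norm (f t x0) \<le> M"
  obtains x where "x 0 = x0" "\<And>t. (x has_vector_derivative f t (x t)) (at t)"
proof -
  have M0: "0 \<le> M" using M[of 0] norm_ge_zero order_trans by blast
  define w where "w t = exp (2*L*\<bar>t\<bar>)" for t
  have wc: "continuous_on UNIV w" unfolding w_def[abs_def] by (intro continuous_intros)
  have w1: "1 \<le> w t" "0 < w t" "w t \<noteq> 0" for t using L(1) by (auto simp: w_def)
  have wt: "2*L*\<bar>t\<bar> \<le> w t" for t using exp_ge_add_one_self[of "2*L*\<bar>t\<bar>"] unfolding w_def by linarith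
  define A where "A g = (SOME P. P 0 = 0 \<and> (\<forall>t. (P has_vector_derivative g t) (at t)))" for g :: "real \<Rightarrow> 'a"
  have A: "A g 0 = 0" "(A g has_vector_derivative g t) (at t)" if "continuous_on UNIV g" for g t
    using someI_ex[OF antiderivative_exists[OF that]] unfolding A_def by auto
  define G where "G y s = f s (x0 + w s *\<^sub>R apply_bcontfun y s)" for y :: "real \<Rightarrow>\<^sub>C 'a" and s
  have Gc: "continuous_on UNIV (G y)" for y
    unfolding G_def[abs_def] by (intro cont continuous_intros wc) simp
  have Ac: "continuous_on UNIV (A (G y))" for y
    by (meson A(2)[OF Gc] has_vector_derivative_continuous continuous_at_imp_continuous_on)
  define Phi where "Phi y t = (1 / w t) *\<^sub>R A (G y) t" for y t
  \<comment> \<open>the factor \<open>1/2\<close> is the contraction constant\<close>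
  have key: "norm (A (G y) t - A (G z) t) \<le> norm (y - z) * (w t - 1) / 2" for y z t
  proof -
    have "norm ((A (G y) t - A (G z) t) - (A (G y) 0 - A (G z) 0)) \<le> 0 * \<bar>t\<bar> + (L * norm (y - z)) * (exp (2*L*\<bar>t\<bar>) - 1) / (2*L)"
    proof (rule exp_growth_bound[OF L(1), where T="\<bar>t\<bar>" and g'="\<lambda>t. G y t - G z t"])
      fix s assume "s \<in> {-\<bar>t\<bar>..\<bar>t\<bar>}"
      show "((\<lambda>t. A (G y) t - A (G z) t) has_vector_derivative G y s - G z s) (at s within {- \<bar>t\<bar>..\<bar>t\<bar>})"
        by (rule has_vector_derivative_at_within) (intro has_vector_derivative_diff A Gc)
      have "norm (G y s - G z s) \<le> L * norm (w s *\<^sub>R (apply_bcontfun y s - apply_bcontfun z s))"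
        unfolding G_def by (rule order_trans[OF L(2)]) (simp add: algebra_simps)
      also have "\<dots> = L * (w s * norm (apply_bcontfun (y - z) s))" using w1(2)[of s] by (simp add: less_imp_le)
      also have "\<dots> \<le> L * (w s * norm (y - z))"
        using L(1) w1(2)[of s] by (intro mult_left_mono norm_bounded) (auto simp: less_imp_le)
      finally show "norm (G y s - G z s) \<le> 0 + L * norm (y - z) * exp (2*L*\<bar>s\<bar>)" by (simp add: w_def mult_ac)
    qed (simp add: abs_if)
    then show ?thesis using A(1)[OF Gc] L(1) by (simp add: w_def)
  qed
  have base: "norm (A (G 0) t) \<le> M * \<bar>t\<bar>" for t
  proof -
    have "norm (A (G 0) t - A (G 0) 0) \<le> M * \<bar>t\<bar> + 0 * (exp (2*L*\<bar>t\<bar>) - 1) / (2*L)"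
    proof (rule exp_growth_bound[OF L(1), where T="\<bar>t\<bar>" and g'="G 0"])
      show "(A (G 0) has_vector_derivative G 0 s) (at s within {- \<bar>t\<bar>..\<bar>t\<bar>})" for s
        by (rule has_vector_derivative_at_within) (intro A Gc)
    qed (use M in \<open>auto simp: G_def abs_if\<close>)
    then show ?thesis using A(1)[OF Gc] by simp
  qed
  have Phib: "Phi y \<in> bcontfun" for y
  proof (rule bcontfun_normI)
    show "continuous_on UNIV (Phi y)"
      unfolding Phi_def[abs_def] using w1(3) by (intro continuous_intros wc Ac) auto
    show "norm (Phi y t) \<le> M / (2*L) + norm y / 2" for t
    proof -
      have "norm (A (G y) t) \<le> norm (A (G y) t - A (G 0) t) + norm (A (G 0) t)"
        using norm_triangle_ineq[of "A (G y) t - A (G 0) t" "A (G 0) t"] by simp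
      also have "\<dots> \<le> norm y * (w t - 1) / 2 + M * \<bar>t\<bar>" using key[of y t 0] base[of t] by simp
      also have "\<dots> \<le> norm y * w t / 2 + M * (w t / (2*L))"
      proof -
        have "norm y * (w t - 1) \<le> norm y * w t" by (intro mult_left_mono) auto
        moreover have "\<bar>t\<bar> \<le> w t / (2*L)" using wt[of t] L(1) by (simp add: field_simps)
        ultimately show ?thesis using M0 by (intro add_mono mult_left_mono divide_right_mono) auto
      qed
      finally have "norm (A (G y) t) / w t \<le> (norm y * w t / 2 + M * (w t / (2*L))) / w t"
        using w1(2)[of t] by (intro divide_right_mono) auto
      also have "\<dots> = M / (2*L) + norm y / 2" using w1(3)[of t] L(1) by (simp add: field_simps)
      finally have "norm (A (G y) t) / w t \<le> M / (2*L) + norm y / 2" .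
      moreover have "norm (Phi y t) = norm (A (G y) t) / w t" using w1(2)[of t] by (simp add: Phi_def)
      ultimately show ?thesis by simp
    qed
  qed
  have "\<exists>!y. Bcontfun (Phi y) = y"
  proof (rule banach_fix_type[of "1/2"])
    show "\<forall>y z. dist (Bcontfun (Phi y)) (Bcontfun (Phi z)) \<le> 1/2 * dist y z"
    proof (intro allI)
      fix y z
      show "dist (Bcontfun (Phi y)) (Bcontfun (Phi z)) \<le> 1/2 * dist y z"
      proof (rule dist_bound)
        fix t
        have "norm (Phi y t - Phi z t) = norm (A (G y) t - A (G z) t) / w t"
          using w1(2)[of t] by (simp add: Phi_def divide_inverse mult.commute scaleR_diff_right[symmetric])
        also have "\<dots> \<le> (norm (y - z) * w t / 2) / w t"
        proof (rule divide_right_mono)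
          have "norm (y - z) * (w t - 1) \<le> norm (y - z) * w t" by (intro mult_left_mono) auto
          then show "norm (A (G y) t - A (G z) t) \<le> norm (y - z) * w t / 2" using key[of y t z] by linarith
        qed (use w1(2)[of t] in simp)
        also have "\<dots> = 1/2 * dist y z" using w1(3)[of t] by (simp add: dist_norm)
        finally show "dist (apply_bcontfun (Bcontfun (Phi y)) t) (apply_bcontfun (Bcontfun (Phi z)) t) \<le> 1/2 * dist y z"
          using Phib by (simp add: Bcontfun_inverse dist_norm)
      qed
    qed
  qed auto
  then obtain y where "Bcontfun (Phi y) = y" by blast
  then have y: "apply_bcontfun y t = Phi y t" for t using Bcontfun_inverse[OF Phib[of y]] by metis
  have e: "x0 + A (G y) t = x0 + w t *\<^sub>R apply_bcontfun y t" for t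
    using w1(3)[of t] y[of t] by (simp add: Phi_def)
  show ?thesis
  proof (rule that[of "\<lambda>t. x0 + A (G y) t"])
    show "x0 + A (G y) 0 = x0" by (simp add: A(1)[OF Gc])
    have "((\<lambda>t. x0 + A (G y) t) has_vector_derivative 0 + G y t) (at t)" for t
      by (intro has_vector_derivative_add has_vector_derivative_const A Gc)
    then show "((\<lambda>t. x0 + A (G y) t) has_vector_derivative f t (x0 + A (G y) t)) (at t)" for t
      by (simp add: e G_def)
  qed
qed

text \<open>
  The rate of each member is controlled by the largest member of the family. The supremum of an
  infinite family need not be differentiable in time; instead a bound \<open>M w\<close> with \<open>w = exp (2C\<bar>t\<bar>)\<close> is
  improved to \<open>(\<delta> + M/2) w\<close> repeatedly, and the limit of these bounds is \<open>2\<delta> w\<close>.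
\<close>

lemma gronwall_family:
  fixes g :: "'i \<Rightarrow> real \<Rightarrow> real"
  assumes C: "0 < C"
    and der: "\<And>i t. i \<in> I \<Longrightarrow> t \<in> {-T..T} \<Longrightarrow> (g i has_real_derivative g' i t) (at t within {-T..T})"
    and bdd: "\<And>i t. i \<in> I \<Longrightarrow> t \<in> {-T..T} \<Longrightarrow> \<bar>g i t\<bar> \<le> K"
    and init: "\<And>i. i \<in> I \<Longrightarrow> \<bar>g i 0\<bar> \<le> \<delta>"
    and step: "\<And>t N i. t \<in> {-T..T} \<Longrightarrow> 0 \<le> N \<Longrightarrow> (\<And>j. j \<in> I \<Longrightarrow> \<bar>g j t\<bar> \<le> N) \<Longrightarrow> i \<in> I \<Longrightarrow> \<bar>g' i t\<bar> \<le> C * N"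
    and \<delta>: "0 \<le> \<delta>" and t: "t \<in> {-T..T}" and i: "i \<in> I"
  shows "\<bar>g i t\<bar> \<le> 2 * \<delta> * exp (2*C*\<bar>t\<bar>)"
proof -
  define w where "w t = exp (2*C*\<bar>t\<bar>)" for t
  have w1: "1 \<le> w t" for t using C by (simp add: w_def)
  define P where "P M \<longleftrightarrow> 0 \<le> M \<and> (\<forall>i\<in>I. \<forall>t\<in>{-T..T}. \<bar>g i t\<bar> \<le> M * w t)" for M
  have imp: "P (\<delta> + M/2)" if "P M" for M
    unfolding P_def
  proof (intro conjI ballI)
    have M: "0 \<le> M" using that by (simp add: P_def)
    show "0 \<le> \<delta> + M/2" using M \<delta> by simp
    fix i t assume i: "i \<in> I" and t: "t \<in> {-T..T}"
    have "norm (g i t - g i 0) \<le> 0 * \<bar>t\<bar> + (C * M) * (exp (2*C*\<bar>t\<bar>) - 1) / (2*C)"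
    proof (rule exp_growth_bound[OF C, where T=T and g'="g' i"])
      fix s assume s: "s \<in> {-T..T}"
      show "(g i has_vector_derivative g' i s) (at s within {-T..T})"
        using der[OF i s] by (simp add: has_real_derivative_iff_has_vector_derivative)
      have "\<bar>g' i s\<bar> \<le> C * (M * w s)"
        by (rule step[OF s _ _ i]) (use that s M w1[of s] in \<open>auto simp: P_def\<close>)
      then show "norm (g' i s) \<le> 0 + C * M * exp (2*C*\<bar>s\<bar>)" by (simp add: w_def mult_ac)
    qed (rule t)
    then have "\<bar>g i t - g i 0\<bar> \<le> M/2 * (w t - 1)" using C by (simp add: w_def)
    also have "\<dots> \<le> M/2 * w t" using M by (intro mult_left_mono) auto
    finally have "\<bar>g i t\<bar> \<le> \<delta> + M/2 * w t" using init[OF i] by linarith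
    also have "\<delta> \<le> \<delta> * w t" using \<delta> w1[of t] mult_left_mono[of 1 "w t" \<delta>] by simp
    finally show "\<bar>g i t\<bar> \<le> (\<delta> + M/2) * w t" by (simp add: algebra_simps)
  qed
  have P0: "P (max 0 K)"
    unfolding P_def
  proof (intro conjI ballI)
    fix i t assume "i \<in> I" "t \<in> {-T..T}"
    then have "\<bar>g i t\<bar> \<le> max 0 K" using bdd by fastforce
    also have "\<dots> \<le> max 0 K * w t" using mult_left_mono[OF w1[of t], of "max 0 K"] by simp
    finally show "\<bar>g i t\<bar> \<le> max 0 K * w t" .
  qed simp
  have "P (2*\<delta> + max 0 K / 2^n)" for n
  proof (induction n)
    case 0
    have "P M" if "P N" "N \<le> M" for M N
    proof -
      have "N * w t \<le> M * w t" for t using that(2) w1[of t] by (intro mult_right_mono) auto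
      then show ?thesis using that unfolding P_def by (meson order_trans)
    qed
    from this[OF P0] show ?case using \<delta> by simp
  next
    case (Suc n) then show ?case using imp[OF Suc] by (simp add: field_simps)
  qed
  then have "\<bar>g i t\<bar> \<le> (2*\<delta> + max 0 K / 2^n) * w t" for n using i t by (simp add: P_def)
  moreover have "(\<lambda>n. (2*\<delta> + max 0 K / 2^n) * w t) \<longlonglongrightarrow> (2*\<delta> + 0) * w t"
    by (intro tendsto_intros LIMSEQ_divide_realpow_zero) auto
  ultimately show ?thesis unfolding w_def[symmetric] by (metis (no_types, lifting) LIMSEQ_le_const add.right_neutral)
qed

lemma gronwall_single:
  fixes g :: "real \<Rightarrow> real"
  assumes C: "0 < C"
    and der: "\<And>t. t \<in> {-T..T} \<Longrightarrow> (g has_real_derivative g' t) (at t within {-T..T})"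
    and step: "\<And>t. t \<in> {-T..T} \<Longrightarrow> \<bar>g' t\<bar> \<le> C * \<bar>g t\<bar>" and t: "t \<in> {-T..T}"
  shows "\<bar>g t\<bar> \<le> 2 * \<bar>g 0\<bar> * exp (2*C*\<bar>t\<bar>)"
proof -
  have "continuous_on {-T..T} g" using der by (meson DERIV_continuous_on)
  then have "bounded (g ` {-T..T})" by (intro compact_imp_bounded compact_continuous_image) auto
  then obtain K where K: "\<And>t. t \<in> {-T..T} \<Longrightarrow> \<bar>g t\<bar> \<le> K" unfolding bounded_iff by force
  show ?thesis
    by (rule gronwall_family[OF C, where I="{()}" and g="\<lambda>_. g" and g'="\<lambda>_. g'" and T=T and K=K])
     (use der K step t C in \<open>auto intro: order_trans[OF step mult_left_mono]\<close>)
qed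

section \<open>The equation for Lipschitz representatives\<close>

text \<open>
  The bracket under the nonlocal operator.
\<close>

definition src :: "(real \<Rightarrow> real) \<Rightarrow> (real \<Rightarrow> real) \<Rightarrow> real \<Rightarrow> real"
  where "src u m = (\<lambda>y. (m y)\<^sup>2 + u y)"

abbreviation bounded_until :: "real \<Rightarrow> real \<Rightarrow> (real \<Rightarrow> real \<Rightarrow> real) \<Rightarrow> (real \<Rightarrow> real \<Rightarrow> real) \<Rightarrow> bool"
  where "bounded_until T R u m \<equiv> \<forall>t\<in>{-T..T}. per_prim R (u t) (m t) \<and> bper R (u t)"

text \<open>
  The time derivative that the equation prescribes.
\<close>

definition rhs :: "real \<Rightarrow> (real \<Rightarrow> real) \<Rightarrow> (real \<Rightarrow> real) \<Rightarrow> real \<Rightarrow> real"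
  where "rhs c u m x = ((c\<^sup>2 - 2 * u x) * m x + zmp (src u m) x) / (2*c)"

abbreviation rate_error :: "real \<Rightarrow> (real \<Rightarrow> real \<Rightarrow> real) \<Rightarrow> (real \<Rightarrow> real \<Rightarrow> real) \<Rightarrow> real \<Rightarrow> real \<Rightarrow> real"
  where "rate_error c u m t s \<equiv> L1_norm (\<lambda>x. (u s x - u t x) / (s - t) - rhs c (u t) (m t) x)"

text \<open>
  Solutions in terms of representatives: locally in time bounded in \<open>W\<^sup>1\<^sup>,\<^sup>\<infinity>\<close>, with all limits taken
  in \<open>L\<^sup>1\<close>. This is weak enough to be implied by the definition of a solution in the function spaces and
  strong enough for the method of characteristics.
\<close>

definition lipschitz_solution :: "real \<Rightarrow> real \<Rightarrow> (real \<Rightarrow> real \<Rightarrow> real) \<Rightarrow> (real \<Rightarrow> real \<Rightarrow> real) \<Rightarrow> bool"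
  where "lipschitz_solution c \<tau> u m \<longleftrightarrow>
    (\<forall>T<\<tau>. \<exists>R. bounded_until T R u m) \<and>
    (\<forall>t\<in>{-\<tau><..<\<tau>}. ((\<lambda>s. L1_dist (m s) (m t)) \<longlongrightarrow> 0) (at t) \<and>
      ((\<lambda>s. L1_dist (u s) (u t)) \<longlongrightarrow> 0) (at t) \<and>
      ((\<lambda>s. rate_error c u m t s) \<longlongrightarrow> 0) (at t))"

lemma src_loc_bdd: "loc_bdd u \<Longrightarrow> loc_bdd m \<Longrightarrow> loc_bdd (src u m)"
  by (simp add: src_def)

lemma src_bper: "bper R u \<Longrightarrow> bper S m \<Longrightarrow> bper (S\<^sup>2 + R) (src u m)"
  unfolding src_def by (intro bper_add bper_square)

lemma src_periodic: "periodic u \<Longrightarrow> periodic m \<Longrightarrow> periodic (src u m)"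
  unfolding src_def by (simp add: periodic_def)

lemma rhs_loc_bdd: "loc_bdd u \<Longrightarrow> loc_bdd m \<Longrightarrow> loc_bdd (rhs c u m)"
  unfolding rhs_def[abs_def] by (intro loc_bdd_divide loc_bdd_add loc_bdd_mult loc_bdd_diff zmp_loc_bdd src_loc_bdd) auto

lemma src_L1_le:
  assumes "bper R m" "bper R n" "loc_bdd u" "loc_bdd v"
  shows "L1_dist (src u m) (src v n) \<le> 2*R * L1_dist m n + L1_dist u v"
proof -
  have l: "loc_bdd m" "loc_bdd n" using assms bper_loc_bdd by auto
  have "L1_dist (src u m) (src v n) \<le> L1_norm (\<lambda>x. 2*R*(m x - n x) + 0) + L1_dist u v"
  proof -
    have eq: "(\<lambda>x. src u m x - src v n x) = (\<lambda>x. ((m x)\<^sup>2 - (n x)\<^sup>2) + (u x - v x))" by (auto simp: src_def)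
    have "L1_norm (\<lambda>x. (m x)\<^sup>2 - (n x)\<^sup>2) \<le> L1_norm (\<lambda>x. 2*R*(m x - n x) + 0)"
    proof (rule L1_norm_mono)
      fix x
      have "\<bar>m x + n x\<bar> \<le> 2*R" using bper_bound[OF assms(1), of x] bper_bound[OF assms(2), of x] by linarith
      then have "\<bar>m x + n x\<bar> * \<bar>m x - n x\<bar> \<le> \<bar>2*R\<bar> * \<bar>m x - n x\<bar>" by (intro mult_right_mono) auto
      then show "\<bar>(m x)\<^sup>2 - (n x)\<^sup>2\<bar> \<le> \<bar>2*R*(m x - n x) + 0\<bar>"
        by (simp add: abs_mult[symmetric] power2_eq_square algebra_simps)
    qed (use l in auto)
    moreover have "L1_norm (\<lambda>x. ((m x)\<^sup>2 - (n x)\<^sup>2) + (u x - v x)) \<le> L1_norm (\<lambda>x. (m x)\<^sup>2 - (n x)\<^sup>2) + L1_dist u v"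
      by (rule L1_norm_triangle) (use l assms in auto)
    ultimately show ?thesis unfolding eq by linarith
  qed
  then show ?thesis using L1_norm_cmul[of "2*R" "\<lambda>x. m x - n x"] bper_nonneg[OF assms(1)] by simp
qed

section \<open>Differences and averages of Lipschitz functions\<close>

lemma prim_cdivide: "prim (\<lambda>x. f x / c) x = prim f x / c"
  using prim_cmul[of "1/c" f x] by simp

lemma per_prim_lip_le:
  assumes "per_prim R u m" "\<bar>x - y\<bar> \<le> h" shows "\<bar>u x - u y\<bar> \<le> R * h"
proof -
  have "\<bar>u x - u y\<bar> \<le> R * \<bar>x - y\<bar>" by (rule per_primD(9)[OF assms(1)])
  also have "\<dots> \<le> R * h" using bper_nonneg[OF per_primD(1)[OF assms(1)]] assms(2) by (rule mult_left_mono[rotated])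
  finally show ?thesis .
qed

text \<open>
  Uniform convergence in time and continuity in space suffice for continuity along a curve.
\<close>

lemma jointly_continuous:
  fixes g :: "real \<Rightarrow> real \<Rightarrow> real"
  assumes "\<And>t e. t \<in> S \<Longrightarrow> 0 < e \<Longrightarrow> eventually (\<lambda>s. \<forall>x. \<bar>g s x - g t x\<bar> < e) (at t within S)"
    and "\<And>t. t \<in> S \<Longrightarrow> continuous_on UNIV (g t)"
    and y: "continuous_on S y"
  shows "continuous_on S (\<lambda>t. g t (y t))"
  unfolding continuous_on_def
proof (intro ballI tendstoI)
  fix t and e :: real assume t: "t \<in> S" and e: "0 < e"
  have "isCont (g t) (y t)" using assms(2)[OF t] by (simp add: continuous_on_eq_continuous_at)
  moreover have "(y \<longlongrightarrow> y t) (at t within S)" using y t by (simp add: continuous_on_def)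
  ultimately have "((\<lambda>s. g t (y s)) \<longlongrightarrow> g t (y t)) (at t within S)" by (rule isCont_tendsto_compose)
  then have "eventually (\<lambda>s. dist (g t (y s)) (g t (y t)) < e/2) (at t within S)" using e by (intro tendstoD) auto
  moreover have "eventually (\<lambda>s. \<forall>x. \<bar>g s x - g t x\<bar> < e/2) (at t within S)" using assms(1)[OF t, of "e/2"] e by simp
  ultimately show "eventually (\<lambda>s. dist (g s (y s)) (g t (y t)) < e) (at t within S)"
  proof eventually_elim
    case (elim s)
    then have "\<bar>g s (y s) - g t (y s)\<bar> < e/2" by blast
    then show ?case using elim(1) unfolding dist_real_def by linarith
  qed
qed

text \<open>
  Used for identities that hold up to a quadratic error on short intervals, in place of
  differentiation almost everywhere.
\<close>

lemma zero_derivative_if_quadratic: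
  fixes h :: "real \<Rightarrow> real"
  assumes "\<And>x y. x \<le> y \<Longrightarrow> \<bar>h y - h x\<bar> \<le> K * (y - x)\<^sup>2"
  shows "h b = h a"
proof -
  have "(h has_real_derivative 0) (at x)" for x
    unfolding has_field_derivative_iff
  proof (rule Lim_null_comparison)
    have *: "\<bar>h y - h x\<bar> \<le> K * (y - x)\<^sup>2" for y
      using assms[of x y] assms[of y x] by (cases "x \<le> y") (auto simp: abs_minus_commute power2_commute)
    show "eventually (\<lambda>y. norm ((h y - h x) / (y - x)) \<le> K * \<bar>y - x\<bar>) (at x)"
      unfolding eventually_at_filter
    proof (intro always_eventually allI impI)
      fix y assume "y \<noteq> x"
      have "\<bar>h y - h x\<bar> \<le> (K * \<bar>y - x\<bar>) * \<bar>y - x\<bar>" using *[of y] by (simp add: power2_eq_square abs_mult[symmetric])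
      then show "norm ((h y - h x) / (y - x)) \<le> K * \<bar>y - x\<bar>" using \<open>y \<noteq> x\<close> by (simp add: abs_divide pos_divide_le_eq)
    qed
    show "((\<lambda>y. K * \<bar>y - x\<bar>) \<longlongrightarrow> 0) (at x)" by (auto intro!: tendsto_eq_intros)
  qed
  then show ?thesis using DERIV_const_ratio_const DERIV_isconst_all by blast
qed

text \<open>
  The chain rule \<open>(u\<^sup>2/2)' = m u\<close>; on a short interval the factor \<open>u\<close> is replaced by the mean of its
  values at the end points, with a quadratic error.
\<close>

lemma prim_slope_times_self:
  assumes "per_prim R u m"
  shows "prim (\<lambda>x. m x * u x) b - prim (\<lambda>x. m x * u x) a = ((u b)\<^sup>2 - (u a)\<^sup>2) / 2"
proof -
  note p = per_primD[OF assms]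
  have R: "0 \<le> R" by (rule bper_nonneg[OF p(1)])
  define h where "h x = prim (\<lambda>x. m x * u x) x - (u x)\<^sup>2 / 2" for x
  have "h b = h a"
  proof (rule zero_derivative_if_quadratic[where h=h and K="R*R"])
    fix x y :: real assume xy: "x \<le> y"
    have q: "prim (\<lambda>z. m z * u z - K * m z) w = prim (\<lambda>x. m x * u x) w - K * prim m w" for K w
      using p by (simp add: prim_diff prim_cmul)
    have "(u x + u y) / 2 * prim m y - (u x + u y) / 2 * prim m x = (u x + u y) / 2 * (u y - u x)"
      by (simp only: p(10)[symmetric] right_diff_distrib)
    also have "\<dots> = (u y)\<^sup>2 / 2 - (u x)\<^sup>2 / 2" by (simp add: power2_eq_square field_simps)
    finally have "h y - h x = prim (\<lambda>z. m z * u z - (u x + u y) / 2 * m z) y - prim (\<lambda>z. m z * u z - (u x + u y) / 2 * m z) x"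
      unfolding q h_def by linarith
    also have "\<bar>\<dots>\<bar> \<le> (R * (R * (y - x))) * (y - x)"
    proof (rule prim_bound[OF _ xy])
      fix z assume z: "x \<le> z" "z \<le> y"
      have "\<bar>u z - u x\<bar> \<le> R * (y - x)" "\<bar>u z - u y\<bar> \<le> R * (y - x)"
        using per_prim_lip_le[OF assms, of z x "y - x"] per_prim_lip_le[OF assms, of z y "y - x"] z by auto
      then have "\<bar>u z - (u x + u y)/2\<bar> \<le> R * (y - x)" by (simp add: abs_le_iff field_simps)
      then have "\<bar>m z\<bar> * \<bar>u z - (u x + u y)/2\<bar> \<le> R * (R * (y - x))"
        using bper_bound[OF p(1), of z] R by (intro mult_mono) auto
      moreover have "m z * u z - (u x + u y) / 2 * m z = m z * (u z - (u x + u y)/2)" by (simp add: algebra_simps)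
      ultimately show "\<bar>m z * u z - (u x + u y) / 2 * m z\<bar> \<le> R * (R * (y - x))"
        by (simp add: abs_mult)
    qed (use p in simp)
    finally show "\<bar>h y - h x\<bar> \<le> (R*R) * (y - x)\<^sup>2" by (simp add: power2_eq_square mult_ac)
  qed
  then show ?thesis by (simp add: h_def field_simps)
qed

lemma slope_average_bound:
  assumes "per_prim R u m" "a < b" shows "\<bar>(u b - u a) / (b - a)\<bar> \<le> R"
  using per_primD(9)[OF assms(1), of b a] assms(2) by (simp add: abs_divide pos_divide_le_eq)

text \<open>
  Averaging over the intervals of a fine partition converges to the identity in \<open>L\<^sup>1\<close>, uniformly in the
  partition; the partitions used later consist of characteristics and move in time. For a Lipschitz
  function in place of the slope this is clear, and averaging does not increase the norm of \<open>L\<^sup>1\<close>.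
\<close>

lemma piecewise_average_L1:
  assumes "per_prim R u m" "0 < e"
  obtains \<delta> where "0 < \<delta>"
    "\<And>x N. (\<And>i. i < N \<Longrightarrow> x i < x (Suc i) \<and> x (Suc i) \<le> x i + \<delta>) \<Longrightarrow> x N \<le> x 0 + 2*pi \<Longrightarrow>
      (\<Sum>i<N. slope_error m ((u (x (Suc i)) - u (x i)) / (x (Suc i) - x i)) (x i) (x (Suc i))) \<le> e"
proof -
  note p = per_primD[OF assms(1)]
  obtain \<phi> where \<phi>: "\<phi> \<in> trig" "L1_dist m \<phi> < e/4"
    by (rule trig_L1_dense[OF p(1), of "e/4"]) (use assms(2) in auto)
  obtain D where D0: "0 \<le> D" and lip: "\<And>z a. \<bar>\<phi> z - \<phi> a\<bar> \<le> D * \<bar>z - a\<bar>" by (rule trig_lipschitz[OF \<phi>(1)]) blast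
  have l: "loc_bdd \<phi>" "periodic \<phi>" using \<phi> trig_loc_bdd trig_periodic by auto
  define \<delta> where "\<delta> = e / (8*pi*(D+1))"
  have \<delta>: "0 < \<delta>" using assms(2) D0 by (simp add: \<delta>_def)
  define f where "f z = \<bar>m z - \<phi> z\<bar>" for z
  have lf: "loc_bdd f" "periodic f" unfolding f_def[abs_def] using p l by (auto intro: periodic_binop)
  show ?thesis
  proof (rule that[OF \<delta>])
    fix x :: "nat \<Rightarrow> real" and N
    assume x: "\<And>i. i < N \<Longrightarrow> x i < x (Suc i) \<and> x (Suc i) \<le> x i + \<delta>" and xN: "x N \<le> x 0 + 2*pi"
    have x0: "x 0 \<le> x N"
      using x by (induction N) (auto simp: less_Suc_eq intro: order_trans less_imp_le)
    have piece: "slope_error m r a b \<le> 2 * (prim f b - prim f a) + 2 * (D*\<delta>*(b - a))"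
      if "a < b" "b \<le> a + \<delta>" "r = (u b - u a) / (b - a)" for a b r
    proof -
      have \<phi>a: "\<bar>\<phi> z - \<phi> a\<bar> \<le> D * \<delta>" if z: "a \<le> z" "z \<le> b" for z
      proof -
        have "\<bar>\<phi> z - \<phi> a\<bar> \<le> D * \<bar>z - a\<bar>" by (rule lip)
        also have "\<dots> \<le> D * \<delta>" using z \<open>b \<le> a + \<delta>\<close> D0 by (intro mult_left_mono) auto
        finally show ?thesis .
      qed
      have d: "prim (\<lambda>z. f z + D*\<delta>) y = prim f y + D*\<delta>*y" for y using lf by (simp add: prim_add)
      have "\<bar>prim (\<lambda>z. \<phi> a - m z) b - prim (\<lambda>z. \<phi> a - m z) a\<bar> \<le> prim (\<lambda>z. \<bar>\<phi> a - m z\<bar>) b - prim (\<lambda>z. \<bar>\<phi> a - m z\<bar>) a"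
        by (rule prim_abs_le) (use p that in auto)
      also have "\<dots> \<le> prim (\<lambda>z. f z + D*\<delta>) b - prim (\<lambda>z. f z + D*\<delta>) a"
      proof (rule prim_mono)
        show "\<bar>\<phi> a - m z\<bar> \<le> f z + D*\<delta>" if "a \<le> z" "z \<le> b" for z using \<phi>a[OF that] unfolding f_def by linarith
      qed (use p lf that in auto)
      also have "\<dots> = prim f b - prim f a + D*\<delta>*(b-a)" by (simp add: d algebra_simps)
      finally have 0: "\<bar>prim (\<lambda>z. \<phi> a - m z) b - prim (\<lambda>z. \<phi> a - m z) a\<bar> \<le> prim f b - prim f a + D*\<delta>*(b-a)" .
      have "r * (b - a) = u b - u a" using that by simp
      then have "prim (\<lambda>z. \<phi> a - m z) b - prim (\<lambda>z. \<phi> a - m z) a = (\<phi> a - r) * (b - a)"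
        using p(10)[of b a] p(4) by (simp add: prim_diff algebra_simps)
      then have 1: "\<bar>\<phi> a - r\<bar> * (b - a) \<le> prim f b - prim f a + D*\<delta>*(b-a)"
        using 0 that by (simp add: abs_mult)
      have "slope_error m r a b \<le> prim (\<lambda>z. f z + (D*\<delta> + \<bar>\<phi> a - r\<bar>)) b - prim (\<lambda>z. f z + (D*\<delta> + \<bar>\<phi> a - r\<bar>)) a"
      proof (rule prim_mono)
        show "\<bar>m z - r\<bar> \<le> f z + (D*\<delta> + \<bar>\<phi> a - r\<bar>)" if "a \<le> z" "z \<le> b" for z using \<phi>a[OF that] unfolding f_def by linarith
      qed (use p lf that in auto)
      also have "\<dots> = (prim f b - prim f a) + D*\<delta>*(b-a) + \<bar>\<phi> a - r\<bar> * (b-a)"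
        using lf by (simp add: prim_add algebra_simps)
      finally have 2: "slope_error m r a b \<le> (prim f b - prim f a) + D*\<delta>*(b-a) + \<bar>\<phi> a - r\<bar> * (b-a)" .
      have arith: "x \<le> y + k + g \<Longrightarrow> g \<le> y + k \<Longrightarrow> x \<le> 2 * y + 2 * k" for x y k g :: real by linarith
      show ?thesis by (rule arith[OF 2 1])
    qed
    have "(\<Sum>i<N. slope_error m ((u (x (Suc i)) - u (x i)) / (x (Suc i) - x i)) (x i) (x (Suc i)))
        \<le> (\<Sum>i<N. 2 * (prim f (x (Suc i)) - prim f (x i)) + 2 * (D*\<delta>*(x (Suc i) - x i)))"
      by (intro sum_mono piece) (use x in auto)
    also have "\<dots> = 2 * (prim f (x N) - prim f (x 0)) + 2 * (D*\<delta>*(x N - x 0))"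
    proof -
      have t: "(\<Sum>i<N. g (x (Suc i)) - g (x i)) = g (x N) - g (x 0)" for g :: "real \<Rightarrow> real"
        by (rule sum_lessThan_telescope)
      show ?thesis by (simp only: sum.distrib sum_distrib_left[symmetric] t t[of "\<lambda>z. z"])
    qed
    also have "\<dots> \<le> 2 * (e/4) + 2 * (e / 4)"
    proof (intro add_mono mult_left_mono)
      have "prim f (x N) - prim f (x 0) \<le> L1_norm f"
        using prim_diff_le_L1[OF lf, of "x N" "x 0"] x0 xN by simp
      also have "\<dots> = L1_dist m \<phi>" by (simp add: L1_norm_def f_def)
      finally show "prim f (x N) - prim f (x 0) \<le> e/4" using \<phi>(2) by simp
      have "D*\<delta>*(x N - x 0) \<le> (D+1)*\<delta>*(2*pi)" using x0 xN D0 \<delta> by (intro mult_mono) auto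
      also have "\<dots> = e/4"
      proof -
        have "E * (e / (8*pi*E)) * (2*pi) = e/4" if "E \<noteq> 0" for E using that by simp
        then show ?thesis unfolding \<delta>_def using D0 by simp
      qed
      finally show "D*\<delta>*(x N - x 0) \<le> e/4" .
    qed auto
    finally show "(\<Sum>i<N. slope_error m ((u (x (Suc i)) - u (x i)) / (x (Suc i) - x i)) (x i) (x (Suc i))) \<le> e" by simp
  qed
qed

section \<open>Characteristics\<close>

text \<open>
  Up to the factor \<open>2c\<close>, the equation is a transport equation with the local speed \<open>V\<close> and the source
  \<open>F\<close>; a \<open>curve\<close> is a characteristic. The average \<open>k\<close> is the constant removed by \<open>\<Pi>\<^sub>0\<close>, so that
  \<open>\<partial>\<^sub>x F = m\<^sup>2 + u - k\<close>.
\<close>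

locale bounded_solution =
  fixes c \<tau> T R :: real and u m :: "real \<Rightarrow> real \<Rightarrow> real"
  assumes c: "0 < c" and T: "0 \<le> T" "T < \<tau>" and sol: "lipschitz_solution c \<tau> u m"
    and pp: "\<And>t. t \<in> {-T..T} \<Longrightarrow> per_prim R (u t) (m t)"
    and ub: "\<And>t. t \<in> {-T..T} \<Longrightarrow> bper R (u t)"
begin

definition "F t = zmp (src (u t) (m t))"
definition "k t = avg (src (u t) (m t))"
definition "V t x = (2 * u t x - c\<^sup>2) / (2*c)"
definition "L = R / c + 1"
definition "curve y \<longleftrightarrow> (\<forall>t\<in>{-T..T}. (y has_real_derivative V t (y t)) (at t within {-T..T}))"

lemma R: "0 \<le> R" using pp[of 0] T per_primD(1) bper_nonneg by force
lemma L: "0 < L" using R c by (simp add: L_def add_nonneg_pos)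

lemma srcb: "t \<in> {-T..T} \<Longrightarrow> bper (R\<^sup>2 + R) (src (u t) (m t))"
  by (intro src_bper ub per_primD(1)[OF pp])

lemma srcl: "t \<in> {-T..T} \<Longrightarrow> loc_bdd (src (u t) (m t))"
  by (rule bper_loc_bdd[OF srcb])

lemma srcp: "t \<in> {-T..T} \<Longrightarrow> periodic (src (u t) (m t))"
  by (rule bper_periodic[OF srcb])

lemma time_limits:
  assumes "t \<in> {-T..T}"
  shows "((\<lambda>s. L1_dist (m s) (m t)) \<longlongrightarrow> 0) (at t within {-T..T})"
    "((\<lambda>s. L1_dist (u s) (u t)) \<longlongrightarrow> 0) (at t within {-T..T})"
    "((\<lambda>s. rate_error c u m t s) \<longlongrightarrow> 0) (at t within {-T..T})"
  using sol assms T unfolding lipschitz_solution_def by (auto intro: tendsto_within_subset[of _ _ _ UNIV])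

lemma ev_in: "eventually (\<lambda>s. s \<in> {-T..T}) (at t within {-T..T})"
  by (simp add: eventually_at_filter)

lemma u_sup:
  assumes t: "t \<in> {-T..T}" and "0 < e"
  shows "eventually (\<lambda>s. \<forall>x. \<bar>u s x - u t x\<bar> < e) (at t within {-T..T})"
proof -
  have "((\<lambda>s. L1_dist (u s) (u t) / (2*pi) + L1_dist (m s) (m t)) \<longlongrightarrow> 0 / (2*pi) + 0) (at t within {-T..T})"
    by (intro tendsto_intros time_limits t) simp
  then have "eventually (\<lambda>s. L1_dist (u s) (u t) / (2*pi) + L1_dist (m s) (m t) < e) (at t within {-T..T})"
    using assms(2) by (intro order_tendstoD(2)[where a=e]) auto
  then show ?thesis using ev_in
  proof eventually_elim
    case (elim s)
    show ?case using per_prim_sup_le[OF per_prim_diff[OF pp[OF elim(2)] pp[OF t]]] elim(1) by (meson le_less_trans)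
  qed
qed

lemma src_lim:
  assumes t: "t \<in> {-T..T}"
  shows "((\<lambda>s. L1_dist (src (u s) (m s)) (src (u t) (m t))) \<longlongrightarrow> 0) (at t within {-T..T})"
proof (rule Lim_null_comparison)
  show "eventually (\<lambda>s. norm (L1_dist (src (u s) (m s)) (src (u t) (m t))) \<le>
     2*R * L1_dist (m s) (m t) + L1_dist (u s) (u t)) (at t within {-T..T})"
    using ev_in
  proof eventually_elim
    case (elim s)
    have "0 \<le> L1_dist (src (u s) (m s)) (src (u t) (m t))"
      by (intro L1_norm_nonneg loc_bdd_diff srcl elim t)
    then show ?case
      using src_L1_le[OF per_primD(1)[OF pp[OF elim]] per_primD(1)[OF pp[OF t]] per_primD(7)[OF pp[OF elim]] per_primD(7)[OF pp[OF t]]]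
      by simp
  qed
  show "((\<lambda>s. 2*R * L1_dist (m s) (m t) + L1_dist (u s) (u t)) \<longlongrightarrow> 0) (at t within {-T..T})"
    using time_limits[OF t] by (auto intro!: tendsto_eq_intros)
qed

lemma F_sup:
  assumes t: "t \<in> {-T..T}" and "0 < e"
  shows "eventually (\<lambda>s. \<forall>x. \<bar>F s x - F t x\<bar> < e) (at t within {-T..T})"
proof -
  have "eventually (\<lambda>s. L1_dist (src (u s) (m s)) (src (u t) (m t)) < e/4) (at t within {-T..T})"
    using assms(2) src_lim[OF t] by (intro order_tendstoD(2)) auto
  then show ?thesis using ev_in
  proof eventually_elim
    case (elim s)
    show ?case
    proof
      fix x
      have "\<bar>zmp (\<lambda>x. src (u s) (m s) x - src (u t) (m t) x) x\<bar> \<le> 4 * L1_dist (src (u s) (m s)) (src (u t) (m t))"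
        by (rule zmp_L1) (rule loc_bdd_diff[OF srcl[OF elim(2)] srcl[OF t]], rule periodic_binop[OF srcp[OF elim(2)] srcp[OF t]])
      then show "\<bar>F s x - F t x\<bar> < e" using elim(1) unfolding F_def zmp_diff[OF srcl[OF elim(2)] srcl[OF t]] by linarith
    qed
  qed
qed

lemma k_cont: "continuous_on {-T..T} k"
  unfolding continuous_on_def
proof (intro ballI)
  fix t assume t: "t \<in> {-T..T}"
  have "((\<lambda>s. k s - k t) \<longlongrightarrow> 0) (at t within {-T..T})"
  proof (rule Lim_null_comparison)
    show "eventually (\<lambda>s. norm (k s - k t) \<le> L1_dist (src (u s) (m s)) (src (u t) (m t)) / (2*pi)) (at t within {-T..T})"
      using ev_in
    proof eventually_elim
      case (elim s)
      show ?case using avg_abs_le[of "\<lambda>x. src (u s) (m s) x - src (u t) (m t) x"] srcl[OF elim] srcl[OF t]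
        by (simp add: k_def avg_diff)
    qed
    show "((\<lambda>s. L1_dist (src (u s) (m s)) (src (u t) (m t)) / (2*pi)) \<longlongrightarrow> 0) (at t within {-T..T})"
      using src_lim[OF t] by (auto intro!: tendsto_eq_intros)
  qed
  then show "(k \<longlongrightarrow> k t) (at t within {-T..T})" by (simp add: LIM_zero_iff)
qed

lemma u_along: "continuous_on {-T..T} y \<Longrightarrow> continuous_on {-T..T} (\<lambda>t. u t (y t))"
  by (rule jointly_continuous[OF u_sup]) (auto intro: per_primD(8)[OF pp])

lemma F_along: "continuous_on {-T..T} y \<Longrightarrow> continuous_on {-T..T} (\<lambda>t. F t (y t))"
  by (rule jointly_continuous[OF F_sup]) (auto simp only: F_def intro: zmp_continuous[OF srcl])

lemma V_lip: "t \<in> {-T..T} \<Longrightarrow> \<bar>V t x - V t y\<bar> \<le> L * \<bar>x - y\<bar>"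
proof -
  assume t: "t \<in> {-T..T}"
  have "\<bar>u t x - u t y\<bar> / c \<le> (R * \<bar>x - y\<bar>) / c"
    using per_primD(9)[OF pp[OF t], of x y] c by (intro divide_right_mono) auto
  moreover have "V t x - V t y = (u t x - u t y) / c" using c by (simp add: V_def field_simps)
  ultimately show ?thesis using c by (simp add: L_def distrib_right abs_divide)
qed

lemma curve_cont: "curve y \<Longrightarrow> continuous_on {-T..T} y"
  unfolding curve_def by (rule DERIV_continuous_on) blast

text \<open>
  The velocity is Lipschitz in space with constant \<open>R/c\<close>. Freezing it outside \<open>[-T,T]\<close> makes it defined
  for all times.
\<close>

lemma flow_exists: "\<exists>y. y 0 = \<xi> \<and> curve y"
proof -
  define cl where "cl t = max (-T) (min T t)" for t
  have cl: "cl t \<in> {-T..T}" "continuous_on UNIV cl" for t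
    unfolding cl_def[abs_def] using T by (auto intro!: continuous_intros)
  obtain y where y: "y 0 = \<xi>" "\<And>t. (y has_vector_derivative V (cl t) (y t)) (at t)"
  proof (rule picard_lindeloef[of L "\<lambda>t. V (cl t)" \<xi> "(2*R + c\<^sup>2) / (2*c)"])
    show "norm (V (cl t) x - V (cl t) y) \<le> L * norm (x - y)" for t x y using V_lip[OF cl(1)] by simp
    have "eventually (\<lambda>s. \<forall>x. \<bar>u (cl s) x - u (cl t) x\<bar> < e) (at t)" if e: "0 < e" for t e
    proof -
      have ev: "eventually (\<lambda>s. \<forall>x. \<bar>u s x - u (cl t) x\<bar> < e) (at (cl t) within {-T..T})"
        by (rule u_sup[OF cl(1) e])
      have "filterlim cl (nhds (cl t)) (at t)" using cl(2) by (simp add: continuous_on_eq_continuous_at isCont_def)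
      moreover have "eventually (\<lambda>s. (s \<in> {-T..T} \<longrightarrow> (\<forall>x. \<bar>u s x - u (cl t) x\<bar> < e))) (nhds (cl t))"
        using ev unfolding eventually_at_filter by eventually_elim (use e in auto)
      ultimately have "eventually (\<lambda>s. (cl s \<in> {-T..T} \<longrightarrow> (\<forall>x. \<bar>u (cl s) x - u (cl t) x\<bar> < e))) (at t)"
        by (rule eventually_compose_filterlim[rotated])
      then show ?thesis using cl(1) by simp
    qed
    from jointly_continuous[where g="\<lambda>t. u (cl t)" and S=UNIV, OF this per_primD(8)[OF pp[OF cl(1)]]]
    have "continuous_on UNIV x \<Longrightarrow> continuous_on UNIV (\<lambda>t. u (cl t) (x t))" for x .
    then show "continuous_on UNIV x \<Longrightarrow> continuous_on UNIV (\<lambda>t. V (cl t) (x t))" for x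
      unfolding V_def using c by (intro continuous_intros) auto
    show "norm (V (cl t) \<xi>) \<le> (2*R + c\<^sup>2) / (2*c)" for t
      using bper_bound[OF ub[OF cl(1)], of t \<xi>] c
      by (auto simp: V_def abs_divide intro!: divide_right_mono order_trans[OF abs_triangle_ineq4])
    show "0 < L" by (rule L)
    fix y assume "y 0 = \<xi>" "\<And>t. (y has_vector_derivative V (cl t) (y t)) (at t)"
    then show thesis by (rule that)
  qed
  have "curve y"
    unfolding curve_def
  proof
    fix t assume "t \<in> {-T..T}"
    then have "cl t = t" by (auto simp: cl_def)
    then show "(y has_real_derivative V t (y t)) (at t within {-T..T})"
      using y(2)[of t] by (simp add: has_real_derivative_iff_has_vector_derivative has_vector_derivative_at_within)
  qed
  then show ?thesis using y(1) by blast
qed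

lemma curve_diff:
  assumes "curve y" "curve z" and t: "t \<in> {-T..T}"
  shows "\<bar>y t - z t\<bar> \<le> 2 * \<bar>y 0 - z 0\<bar> * exp (2*L*\<bar>t\<bar>)"
proof (rule gronwall_single[OF L _ _ t, where g="\<lambda>t. y t - z t" and g'="\<lambda>t. V t (y t) - V t (z t)"])
  fix t assume t: "t \<in> {-T..T}"
  show "((\<lambda>t. y t - z t) has_real_derivative V t (y t) - V t (z t)) (at t within {-T..T})"
    using assms t unfolding curve_def by (auto intro!: derivative_eq_intros)
qed (rule V_lip)

text \<open>
  Characteristics do not meet: the square of their distance \<open>d\<close> satisfies \<open>\<bar>(d\<^sup>2)'\<bar> \<le> 2L d\<^sup>2\<close> and
  therefore decays at most exponentially.
\<close>

lemma curve_order: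
  assumes yz: "curve y" "curve z" and t: "t \<in> {-T..T}" and "y 0 < z 0"
  shows "y t < z t"
proof (rule ccontr)
  define d where "d s = z s - y s" for s
  define d' where "d' s = V s (z s) - V s (y s)" for s
  have dd: "(d has_real_derivative d' s) (at s within {-T..T})" if "s \<in> {-T..T}" for s
    unfolding d_def[abs_def] d'_def using yz that unfolding curve_def by (auto intro!: derivative_eq_intros)
  have cd: "continuous_on {-T..T} d" by (rule DERIV_continuous_on[OF dd])
  have dl: "\<bar>d' s\<bar> \<le> L * \<bar>d s\<bar>" if "s \<in> {-T..T}" for s unfolding d'_def d_def by (rule V_lip[OF that])
  have di: "(d has_real_derivative d' s) (at s)" if "-T < s" "s < T" for s
    using dd[of s] that at_within_Icc_at[of "-T" s T] by simp
  have d2: "\<bar>2 * d s * d' s\<bar> \<le> 2*L*(d s)\<^sup>2" if "s \<in> {-T..T}" for s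
    using mult_left_mono[OF dl[OF that], of "2*\<bar>d s\<bar>"] by (simp add: abs_mult power2_eq_square mult_ac)
  have ne: "d s \<noteq> 0" if s: "s \<in> {-T..T}" for s
  proof -
    have d0: "(d 0)\<^sup>2 > 0" using assms(4) by (simp add: d_def)
    consider "s = 0" | "0 < s" | "s < 0" by linarith
    then have "(d 0)\<^sup>2 \<le> (d s)\<^sup>2 * exp (2*L*\<bar>s\<bar>)"
    proof cases
      case 2
      have "(d 0)\<^sup>2 * exp (2*L*0) \<le> (d s)\<^sup>2 * exp (2*L * s)"
      proof (rule DERIV_nonneg_imp_increasing_open[OF less_imp_le[OF 2]])
        fix x assume x: "0 < x" "x < s"
        have "((\<lambda>s. (d s)\<^sup>2 * exp (2*L * s)) has_real_derivative (2 * d x * d' x + 2*L*(d x)\<^sup>2) * exp (2*L*x)) (at x)"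
          using di[of x] x s by (auto intro!: derivative_eq_intros simp: algebra_simps)
        moreover have "0 \<le> (2 * d x * d' x + 2*L*(d x)\<^sup>2) * exp (2*L*x)" using d2[of x] x s by (intro mult_nonneg_nonneg) auto
        ultimately show "\<exists>y. ((\<lambda>s. (d s)\<^sup>2 * exp (2*L * s)) has_real_derivative y) (at x) \<and> 0 \<le> y" by blast
      qed (use s in \<open>auto intro!: continuous_intros continuous_on_subset[OF cd]\<close>)
      then show ?thesis using 2 by simp
    next
      case 3
      have "(d s)\<^sup>2 * exp (-(2*L * s)) \<ge> (d 0)\<^sup>2 * exp (-(2*L*0))"
      proof (rule DERIV_nonpos_imp_decreasing_open[OF less_imp_le[OF 3]])
        fix x assume x: "s < x" "x < 0"
        have "((\<lambda>s. (d s)\<^sup>2 * exp (-(2*L * s))) has_real_derivative (2 * d x * d' x - 2*L*(d x)\<^sup>2) * exp (-(2*L*x))) (at x)"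
          using di[of x] x s by (auto intro!: derivative_eq_intros simp: algebra_simps)
        moreover have "(2 * d x * d' x - 2*L*(d x)\<^sup>2) * exp (-(2*L*x)) \<le> 0" using d2[of x] x s by (intro mult_nonpos_nonneg) auto
        ultimately show "\<exists>y. ((\<lambda>s. (d s)\<^sup>2 * exp (-(2*L * s))) has_real_derivative y) (at x) \<and> y \<le> 0" by blast
      qed (use s in \<open>auto intro!: continuous_intros continuous_on_subset[OF cd]\<close>)
      then show ?thesis using 3 by simp
    qed simp
    then show ?thesis using d0 by auto
  qed
  assume "\<not> y t < z t"
  then have "d t \<le> 0" by (simp add: d_def)
  moreover have "0 \<le> d 0" using assms(4) by (simp add: d_def)
  ultimately have "\<exists>x\<in>{-T..T}. d x = 0"
  proof (cases "0 \<le> t")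
    case True
    have "\<exists>x\<ge>0. x \<le> t \<and> d x = 0"
      by (rule IVT2'[where f=d, OF \<open>d t \<le> 0\<close> \<open>0 \<le> d 0\<close> True]) (use t in \<open>auto intro: continuous_on_subset[OF cd]\<close>)
    then show ?thesis using t by force
  next
    case False
    have "\<exists>x\<ge>t. x \<le> 0 \<and> d x = 0"
      by (rule IVT'[where f=d, OF \<open>d t \<le> 0\<close> \<open>0 \<le> d 0\<close>]) (use t False in \<open>auto intro: continuous_on_subset[OF cd]\<close>)
    then show ?thesis using t by force
  qed
  then show False using ne by blast
qed

definition "KS = R*R/c + (R\<^sup>2 + R)/c"

text \<open>
  On an interval of length \<open>h\<close> starting at \<open>x\<close> the velocity and the source may be replaced by their
  values at \<open>x\<close>; the transport terms then cancel.
\<close>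

lemma steklov_rate:
  assumes t: "t \<in> {-T..T}" and h: "0 < h"
  shows "\<bar>prim (rhs c (u t) (m t)) (x + h) - prim (rhs c (u t) (m t)) x + V t x * (u t (x + h) - u t x) - F t x / (2*c) * h\<bar> \<le> KS * h * h"
proof -
  note p = per_primD[OF pp[OF t]]
  have lr: "loc_bdd (rhs c (u t) (m t))" by (rule rhs_loc_bdd[OF p(7,4)])
  let ?f = "\<lambda>z. rhs c (u t) (m t) z + V t x * m t z - F t x / (2*c)"
  have "prim (rhs c (u t) (m t)) (x + h) - prim (rhs c (u t) (m t)) x + V t x * (u t (x + h) - u t x) - F t x / (2*c) * h
     = prim ?f (x + h) - prim ?f x"
  proof -
    have q: "prim (\<lambda>z. rhs c (u t) (m t) z + K * m t z - K') w = prim (rhs c (u t) (m t)) w + K * prim (m t) w - K' * w" for K K' w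
      using lr p(4) by (simp add: prim_diff prim_add prim_cmul)
    have "(A - B) + K*(C - D) - K'*h = (A + K*C - K'*(x+h)) - (B + K*D - K'*x)" for A B C D K K'
      by (simp add: algebra_simps)
    then show ?thesis unfolding q p(10)[of "x+h" x, symmetric] by blast
  qed
  also have "\<bar>\<dots>\<bar> \<le> (KS * h) * (x + h - x)"
  proof (rule prim_bound)
    fix z assume z: "x \<le> z" "z \<le> x + h"
    have e: "?f z = (u t x - u t z) / c * m t z + (F t z - F t x) / (2*c)"
      using c by (simp add: rhs_def V_def F_def field_simps power2_eq_square)
    have "\<bar>u t x - u t z\<bar> \<le> R * h" by (rule per_prim_lip_le[OF pp[OF t]]) (use z in auto)
    then have "\<bar>(u t x - u t z) / c\<bar> * \<bar>m t z\<bar> \<le> (R * h / c) * R"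
      using c R h bper_bound[OF p(1), of z] by (intro mult_mono) (auto simp: abs_divide divide_right_mono)
    moreover have "\<bar>F t z - F t x\<bar> / (2*c) \<le> (2 * (R\<^sup>2 + R) * h) / (2*c)"
    proof (rule divide_right_mono)
      have "\<bar>F t z - F t x\<bar> \<le> 2 * (R\<^sup>2 + R) * \<bar>z - x\<bar>" unfolding F_def by (rule zmp_lip[OF srcb[OF t]])
      also have "\<dots> \<le> 2 * (R\<^sup>2 + R) * h" using z R by (intro mult_left_mono) auto
      finally show "\<bar>F t z - F t x\<bar> \<le> 2 * (R\<^sup>2 + R) * h" .
    qed (use c in simp)
    ultimately have "\<bar>(u t x - u t z) / c * m t z\<bar> + \<bar>(F t z - F t x) / (2*c)\<bar> \<le> (R * h / c) * R + (2 * (R\<^sup>2 + R) * h) / (2*c)"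
      using c by (simp add: abs_mult abs_divide)
    also have "\<dots> = KS * h" using c by (simp add: KS_def field_simps)
    finally show "\<bar>?f z\<bar> \<le> KS * h" unfolding e by linarith
  qed (use lr p h in auto)
  finally show ?thesis by simp
qed

abbreviation "steklov_slope y h t \<equiv>
  prim (rhs c (u t) (m t)) (y t + h) - prim (rhs c (u t) (m t)) (y t) + V t (y t) * (u t (y t + h) - u t (y t))"

text \<open>
  The time derivative of \<open>u\<close> exists only in \<open>L\<^sup>1\<close>, which gives no information at a single moving point.
  The integral of \<open>u\<close> over an interval of fixed length \<open>h\<close> that moves with a characteristic is
  differentiable, however.
\<close>

lemma steklov_deriv:
  assumes y: "curve y" and t: "t \<in> {-T..T}" and h: "0 < h" "h \<le> 2*pi"
  shows "((\<lambda>s. prim (u s) (y s + h) - prim (u s) (y s)) has_real_derivative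
     steklov_slope y h t) (at t within {-T..T})"
proof -
  note p = per_primD[OF pp[OF t]]
  define Q where "Q s x = prim (u s) (x + h) - prim (u s) x" for s x
  define r where "r = rhs c (u t) (m t)"
  have lr: "loc_bdd r" unfolding r_def by (rule rhs_loc_bdd[OF p(7,4)])
  have pr: "periodic r" unfolding r_def rhs_def[abs_def] periodic_def
    using periodicD[OF p(2)] periodicD[OF p(5)] periodicD[OF zmp_periodic[OF srcp[OF t] srcl[OF t]]] by simp
  have cy: "(y \<longlongrightarrow> y t) (at t within {-T..T})" using curve_cont[OF y] t by (simp add: continuous_on_def)
  have A: "((\<lambda>s. (Q s (y s) - Q t (y s)) / (s - t)) \<longlongrightarrow> prim r (y t + h) - prim r (y t)) (at t within {-T..T})"
  proof -
    have pc: "isCont (prim r) x" for x by (rule prim_isCont[OF lr])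
    have J: "((\<lambda>s. prim r (y s + h) - prim r (y s)) \<longlongrightarrow> prim r (y t + h) - prim r (y t)) (at t within {-T..T})"
      by (intro tendsto_diff isCont_tendsto_compose[OF pc] tendsto_add cy tendsto_const)
    have "((\<lambda>s. (Q s (y s) - Q t (y s)) / (s - t) - (prim r (y s + h) - prim r (y s))) \<longlongrightarrow> 0) (at t within {-T..T})"
    proof (rule Lim_null_comparison[OF _ time_limits(3)[OF t]])
      show "eventually (\<lambda>s. norm ((Q s (y s) - Q t (y s)) / (s - t) - (prim r (y s + h) - prim r (y s))) \<le>
         rate_error c u m t s) (at t within {-T..T})"
        using ev_in
      proof eventually_elim
        case (elim s)
        note q = per_primD[OF pp[OF elim]]
        define f where "f x = (u s x - u t x) / (s - t) - r x" for x
        have lf: "loc_bdd f" unfolding f_def[abs_def] by (intro loc_bdd_diff loc_bdd_divide lr q p)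
        have pf: "periodic f" using periodicD[OF q(2)] periodicD[OF p(2)] periodicD[OF pr] by (simp add: periodic_def f_def)
        have "prim f x = (prim (u s) x - prim (u t) x) / (s - t) - prim r x" for x
          unfolding f_def[abs_def]
          by (subst prim_diff[OF loc_bdd_divide[OF loc_bdd_diff[OF q(7) p(7)]] lr])
             (simp add: prim_cdivide prim_diff[OF q(7) p(7)])
        then have e1: "(Q s (y s) - Q t (y s)) / (s - t) - (prim r (y s + h) - prim r (y s)) = prim f (y s + h) - prim f (y s)"
          unfolding Q_def by (simp add: diff_divide_distrib)
        have "\<bar>prim f (y s + h) - prim f (y s)\<bar> \<le> L1_norm f"
          by (rule prim_diff_le_L1[OF lf pf]) (use h in simp)
        then show ?case unfolding real_norm_def e1 by (simp only: f_def[abs_def] r_def)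
      qed
    qed
    from tendsto_add[OF this J] show ?thesis by simp
  qed
  have "(Q t has_real_derivative (u t (x + h) - u t x)) (at x)" for x
    unfolding Q_def[abs_def]
    by (intro DERIV_diff prim_has_derivative per_primD(8)[OF pp[OF t]])
       (simp add: DERIV_shift[symmetric] prim_has_derivative per_primD(8)[OF pp[OF t]])
  then have "((\<lambda>s. Q t (y s)) has_real_derivative (u t (y t + h) - u t (y t)) * V t (y t)) (at t within {-T..T})"
    using y t unfolding curve_def by (intro DERIV_chain2) auto
  then have B: "((\<lambda>s. (Q t (y s) - Q t (y t)) / (s - t)) \<longlongrightarrow> (u t (y t + h) - u t (y t)) * V t (y t)) (at t within {-T..T})"
    by (simp add: has_field_derivative_iff)
  have "((\<lambda>s. (Q s (y s) - Q t (y s)) / (s - t) + (Q t (y s) - Q t (y t)) / (s - t)) \<longlongrightarrow>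
     prim r (y t + h) - prim r (y t) + (u t (y t + h) - u t (y t)) * V t (y t)) (at t within {-T..T})"
    by (rule tendsto_add[OF A B])
  moreover have "(Q s (y s) - Q t (y s)) / (s - t) + (Q t (y s) - Q t (y t)) / (s - t) = (Q s (y s) - Q t (y t)) / (s - t)" for s
    by (simp add: add_divide_distrib[symmetric])
  ultimately show ?thesis
    unfolding has_field_derivative_iff by (simp add: Q_def r_def mult.commute)
qed

text \<open>
  The characteristic form of the equation, obtained from the averages over \<open>[y,y+h]\<close>. After division by
  \<open>h\<close> their rate differs from \<open>F/(2c)\<close> by a multiple of \<open>h\<close>, and \<open>h \<rightarrow> 0\<close> is possible because \<open>u\<close> is Lipschitz.
\<close>

theorem u_deriv_along:
  assumes y: "curve y" and t: "t \<in> {-T..T}"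
  shows "((\<lambda>t. u t (y t)) has_real_derivative F t (y t) / (2*c)) (at t within {-T..T})"
proof -
  define P where "P t = integral {-T..t} (\<lambda>s. F s (y s) / (2*c))" for t
  have Pd: "(P has_real_derivative F t (y t) / (2*c)) (at t within {-T..T})" if "t \<in> {-T..T}" for t
    unfolding P_def[abs_def]
    by (rule integral_has_real_derivative)
      (use c that F_along[OF curve_cont[OF y]] in \<open>auto intro!: continuous_intros\<close>)
  have est: "\<bar>(u t (y t) - P t) - (u s (y s) - P s)\<bar> \<le> h * (KS * \<bar>t - s\<bar> + 2*R)"
    if ts: "t \<in> {-T..T}" "s \<in> {-T..T}" and h: "0 < h" "h \<le> 2*pi" for t s h
  proof -
    define G where "G s = (prim (u s) (y s + h) - prim (u s) (y s)) / h - P s" for s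
    have "norm (G t - G s) \<le> (KS * h) * norm (t - s)"
    proof (rule field_differentiable_bound[of "{-T..T}" G "\<lambda>t. steklov_slope y h t / h - F t (y t) / (2*c)"])
      fix z assume z: "z \<in> {-T..T}"
      show "(G has_real_derivative steklov_slope y h z / h - F z (y z) / (2*c)) (at z within {-T..T})"
        unfolding G_def[abs_def] by (intro DERIV_diff DERIV_cdivide steklov_deriv y z h Pd)
      have "\<bar>steklov_slope y h z - F z (y z) / (2*c) * h\<bar> / h \<le> (KS * h * h) / h"
        using steklov_rate[OF z h(1), of "y z"] h by (intro divide_right_mono) auto
      also have "\<dots> = KS * h" using h by simp
      also have "\<bar>steklov_slope y h z - F z (y z) / (2*c) * h\<bar> / h =
         \<bar>(steklov_slope y h z - F z (y z) / (2*c) * h) / h\<bar>"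
        using h by (simp add: abs_divide)
      finally show "norm (steklov_slope y h z / h - F z (y z) / (2*c)) \<le> KS * h"
        using h by (simp add: diff_divide_distrib)
    qed (use ts in auto)
    moreover have "\<bar>G s - (u s (y s) - P s)\<bar> \<le> R * h" if s: "s \<in> {-T..T}" for s
    proof -
      note p = per_primD[OF pp[OF s]]
      have "\<bar>prim (\<lambda>z. u s z - u s (y s)) (y s + h) - prim (\<lambda>z. u s z - u s (y s)) (y s)\<bar> \<le> (R * h) * (y s + h - y s)"
      proof (rule prim_bound)
        fix z assume "y s \<le> z" "z \<le> y s + h"
        then show "\<bar>u s z - u s (y s)\<bar> \<le> R * h" by (intro per_prim_lip_le[OF pp[OF s]]) auto
      qed (use p h in auto)
      then have "\<bar>prim (u s) (y s + h) - prim (u s) (y s) - u s (y s) * h\<bar> / h \<le> (R * h * h) / h"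
        using p h by (intro divide_right_mono) (auto simp: prim_diff algebra_simps)
      then have "\<bar>(prim (u s) (y s + h) - prim (u s) (y s) - u s (y s) * h) / h\<bar> \<le> R * h"
        using h by (simp add: abs_divide)
      then show ?thesis using h by (simp add: G_def diff_divide_distrib)
    qed
    from this[OF ts(1)] this[OF ts(2)] have "\<bar>(u t (y t) - P t) - (u s (y s) - P s)\<bar> \<le> \<bar>G t - G s\<bar> + 2 * (R*h)" by linarith
    ultimately have "\<bar>(u t (y t) - P t) - (u s (y s) - P s)\<bar> \<le> (KS * h) * \<bar>t - s\<bar> + 2 * (R*h)" by simp
    then show ?thesis by (simp add: algebra_simps)
  qed
  have const: "u t (y t) = P t + (u 0 (y 0) - P 0)" if t: "t \<in> {-T..T}" for t
  proof -
    let ?K = "KS * \<bar>t - 0\<bar> + 2*R"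
    have K: "0 \<le> ?K" using R c by (simp add: KS_def)
    have "\<bar>(u t (y t) - P t) - (u 0 (y 0) - P 0)\<bar> \<le> 0 + e" if e: "0 < e" for e
    proof -
      define h where "h = min (2*pi) (e / (?K + 1))"
      have h: "0 < h" "h \<le> 2*pi" "h \<le> e / (?K + 1)" using e K by (auto simp: h_def)
      have "\<bar>(u t (y t) - P t) - (u 0 (y 0) - P 0)\<bar> \<le> h * ?K" by (rule est[OF t _ h(1,2)]) (use T in auto)
      also have "\<dots> \<le> (e / (?K + 1)) * (?K + 1)" using h K by (intro mult_mono) auto
      also have "\<dots> = e" using K by simp
      finally show ?thesis by simp
    qed
    then have "\<bar>(u t (y t) - P t) - (u 0 (y 0) - P 0)\<bar> \<le> 0" by (rule field_le_epsilon)
    then show ?thesis by simp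
  qed
  have "((\<lambda>t. P t + (u 0 (y 0) - P 0)) has_real_derivative F t (y t) / (2*c) + 0) (at t within {-T..T})"
    by (intro DERIV_add Pd t DERIV_const)
  then have "((\<lambda>t. P t + (u 0 (y 0) - P 0)) has_real_derivative F t (y t) / (2*c)) (at t within {-T..T})" by simp
  then show ?thesis
    by (rule has_field_derivative_transform_within[OF _ zero_less_one t]) (rule const[symmetric])
qed

end

section \<open>The energy between two characteristics\<close>

lemma prim_weighted_bound:
  assumes "loc_bdd f" "loc_bdd g" "a \<le> b" "\<And>z. \<bar>f z\<bar> \<le> K * g z"
  shows "\<bar>prim f b - prim f a\<bar> \<le> K * (prim g b - prim g a)"
proof -
  have "prim (\<lambda>x. \<bar>f x\<bar>) b - prim (\<lambda>x. \<bar>f x\<bar>) a \<le> prim (\<lambda>x. K * g x) b - prim (\<lambda>x. K * g x) a"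
    by (rule prim_mono) (use assms in auto)
  then show ?thesis using prim_abs_le[OF assms(1,3)] by (simp add: prim_cmul right_diff_distrib)
qed

text \<open>
  The energy of the linear interpolation on \<open>[a,b]\<close> differs from that of \<open>u\<close> by at most the \<open>L\<^sup>1\<close> distance
  of the slopes, up to a constant.
\<close>

lemma slope_piece_energy:
  assumes "per_prim R u m" "a < b" "r = (u b - u a) / (b - a)"
  shows "\<bar>(u b - u a)\<^sup>2 / (b - a) - (energy m b - energy m a)\<bar>
    \<le> 2*R * slope_error m r a b"
proof -
  note p = per_primD[OF assms(1)]
  have r: "\<bar>r\<bar> \<le> R" unfolding assms(3) by (rule slope_average_bound[OF assms(1,2)])
  have "(u b - u a)\<^sup>2 / (b - a) = r\<^sup>2 * b - r\<^sup>2 * a"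
  proof -
    have "u b - u a = r * (b - a)" using assms(2,3) by simp
    moreover have "(r * d)\<^sup>2 / d = r\<^sup>2 * d" if "d \<noteq> 0" for d using that by (simp add: power2_eq_square)
    ultimately have "(u b - u a)\<^sup>2 / (b - a) = r\<^sup>2 * (b - a)" using assms(2) by simp
    then show ?thesis by (simp only: right_diff_distrib)
  qed
  then have "(u b - u a)\<^sup>2 / (b - a) - (energy m b - energy m a)
     = prim (\<lambda>z. r\<^sup>2 - (m z)\<^sup>2) b - prim (\<lambda>z. r\<^sup>2 - (m z)\<^sup>2) a"
    using p(4) by (simp add: prim_diff)
  also have "\<bar>\<dots>\<bar> \<le> 2*R * slope_error m r a b"
  proof (rule prim_weighted_bound)
    fix z
    have "\<bar>m z + r\<bar> \<le> 2*R" using r bper_bound[OF p(1), of z] by linarith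
    then have "\<bar>m z + r\<bar> * \<bar>m z - r\<bar> \<le> 2*R * \<bar>m z - r\<bar>" by (rule mult_right_mono) simp
    moreover have "\<bar>r\<^sup>2 - (m z)\<^sup>2\<bar> = \<bar>m z + r\<bar> * \<bar>m z - r\<bar>"
      unfolding abs_mult[symmetric] by (subst abs_minus_commute) (simp add: power2_eq_square algebra_simps)
    ultimately show "\<bar>r\<^sup>2 - (m z)\<^sup>2\<bar> \<le> 2*R * \<bar>m z - r\<bar>" by simp
  qed (use p(4) assms(2) in auto)
  finally show ?thesis .
qed

text \<open>
  The same comparison for the rate of change of the energy of the linear interpolation. With the
  constant slope \<open>r\<close> the cubic terms cancel and a total derivative remains.
\<close>

lemma slope_piece_rate:
  assumes "per_prim R u m" "a < b" "r = (u b - u a) / (b - a)" "\<And>z. \<bar>u z - k\<bar> \<le> W"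
  shows "\<bar>(r * (prim (src u m) b - prim (src u m) a - k * (b - a)) - r\<^sup>2 * (u b - u a)) - ((u b - k)\<^sup>2 - (u a - k)\<^sup>2) / 2\<bar>
    \<le> (2*R*R + W) * slope_error m r a b"
proof -
  note p = per_primD[OF assms(1)]
  have r: "\<bar>r\<bar> \<le> R" unfolding assms(3) by (rule slope_average_bound[OF assms(1,2)])
  have W: "0 \<le> W" using assms(4)[of 0] by linarith
  let ?g = "\<lambda>z. (r * (src u m z - k) - r\<^sup>2 * r) - (m z * u z - k * m z)"
  have ls: "loc_bdd (src u m)" by (rule src_loc_bdd[OF p(7,4)])
  have q: "prim ?g x = r * (prim (src u m) x - k * x) - r\<^sup>2 * r * x - (prim (\<lambda>z. m z * u z) x - k * prim m x)" for x
    using ls p by (simp add: prim_diff prim_cmul)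
  have rb: "r * (b - a) = u b - u a" using assms(2,3) by simp
  have pm: "prim m b - prim m a = u b - u a" by (rule p(10))
  have E: "prim ?g b - prim ?g a = (r * (prim (src u m) b - prim (src u m) a - k * (b - a)) - r\<^sup>2 * (r * (b - a)))
      - ((prim (\<lambda>z. m z * u z) b - prim (\<lambda>z. m z * u z) a) - k * (prim m b - prim m a))"
  proof -
    have "(r * (Sb - k * b) - r\<^sup>2 * r * b - (Mb - k * mb)) - (r * (Sa - k * a) - r\<^sup>2 * r * a - (Ma - k * ma))
      = (r * (Sb - Sa - k * (b - a)) - r\<^sup>2 * (r * (b - a))) - ((Mb - Ma) - k * (mb - ma))" for Sa Sb Ma Mb ma mb
      by (simp add: algebra_simps)
    then show ?thesis unfolding q .
  qed
  have sq: "((u b)\<^sup>2 - (u a)\<^sup>2) / 2 - k * (u b - u a) = ((u b - k)\<^sup>2 - (u a - k)\<^sup>2) / 2"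
    by (simp add: power2_eq_square field_simps)
  have eq: "(r * (prim (src u m) b - prim (src u m) a - k * (b - a)) - r\<^sup>2 * (u b - u a)) - ((u b - k)\<^sup>2 - (u a - k)\<^sup>2) / 2
     = prim ?g b - prim ?g a"
    unfolding E rb pm prim_slope_times_self[OF assms(1), of b a] sq ..
  have "\<bar>prim ?g b - prim ?g a\<bar> \<le> (2*R*R + W) * slope_error m r a b"
  proof (rule prim_weighted_bound)
    fix z
    have e: "?g z = (r * (m z + r)) * (m z - r) - (u z - k) * (m z - r)"
      by (simp add: src_def power2_eq_square algebra_simps)
    have "\<bar>m z + r\<bar> \<le> 2*R" using r bper_bound[OF p(1), of z] by linarith
    then have "\<bar>r\<bar> * \<bar>m z + r\<bar> \<le> R * (2*R)" using r by (intro mult_mono) auto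
    then have 1: "\<bar>r * (m z + r)\<bar> * \<bar>m z - r\<bar> \<le> (2*R*R) * \<bar>m z - r\<bar>"
      by (intro mult_right_mono) (auto simp: abs_mult)
    have 2: "\<bar>u z - k\<bar> * \<bar>m z - r\<bar> \<le> W * \<bar>m z - r\<bar>" by (rule mult_right_mono[OF assms(4)]) simp
    have "\<bar>?g z\<bar> \<le> \<bar>r * (m z + r)\<bar> * \<bar>m z - r\<bar> + \<bar>u z - k\<bar> * \<bar>m z - r\<bar>"
      unfolding e abs_mult[symmetric] by (rule abs_triangle_ineq4)
    also have "\<dots> \<le> (2*R*R) * \<bar>m z - r\<bar> + W * \<bar>m z - r\<bar>" by (rule add_mono[OF 1 2])
    finally show "\<bar>?g z\<bar> \<le> (2*R*R + W) * \<bar>m z - r\<bar>"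
      by (simp only: distrib_right)
  qed (use p(4,7) ls assms(2) in auto)
  then show ?thesis by (simp only: eq)
qed

lemma quotient_rate:
  fixes U G d c :: real
  assumes "d \<noteq> 0" "c \<noteq> 0"
  shows "((2 * U * (G / (2*c))) * d - U\<^sup>2 * (U / c)) / (d * d) = ((U / d) * G - (U / d)\<^sup>2 * U) / c"
  using assms by (simp add: field_simps power2_eq_square)

context bounded_solution
begin

lemma k_bound: "t \<in> {-T..T} \<Longrightarrow> \<bar>k t\<bar> \<le> R\<^sup>2 + R"
  unfolding k_def by (rule avg_bound[OF srcl bper_bound[OF srcb]])

definition "W = 2*R + R\<^sup>2"

lemma uk_bound: "t \<in> {-T..T} \<Longrightarrow> \<bar>u t x - k t\<bar> \<le> W"
  using k_bound[of t] bper_bound[OF ub[of t], of x] unfolding W_def by linarith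

lemma V_shift: "t \<in> {-T..T} \<Longrightarrow> V t (x + 2*pi) = V t x"
  unfolding V_def using periodicD[OF per_primD(2)[OF pp[of t]]] by simp

lemma curve_period:
  assumes "curve y" "curve z" "z 0 = y 0 + 2*pi" "t \<in> {-T..T}" shows "z t = y t + 2*pi"
proof -
  have "curve (\<lambda>t. y t + 2*pi)"
    unfolding curve_def
  proof
    fix s assume s: "s \<in> {-T..T}"
    then have "(y has_real_derivative V s (y s)) (at s within {-T..T})" using assms(1) by (simp add: curve_def)
    from DERIV_add[OF this DERIV_const, of "2*pi"] show "((\<lambda>t. y t + 2*pi) has_real_derivative V s (y s + 2*pi)) (at s within {-T..T})"
      unfolding V_shift[OF s] by simp
  qed
  from curve_diff[OF assms(2) this assms(4)] assms(3) show ?thesis by simp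
qed

text \<open>
  Formally, \<open>m\<close> satisfies \<open>\<partial>\<^sub>t m + V \<partial>\<^sub>x m = (u - k - m\<^sup>2)/(2c)\<close>, and since \<open>\<partial>\<^sub>x V = m/c\<close> the cubic terms
  cancel in \<open>\<partial>\<^sub>t m\<^sup>2 + \<partial>\<^sub>x (V m\<^sup>2) = m (u - k)/c = \<partial>\<^sub>x ((u - k)\<^sup>2/(2c))\<close>: the energy between two
  characteristics changes at a rate that does not contain the slope. As \<open>m\<close> is merely bounded, the
  energy is approximated by the sum of \<open>(\<Delta>u)\<^sup>2/\<Delta>x\<close> over a partition into characteristics, which by
  \<open>u_deriv_along\<close> can be differentiated in time.
\<close>

theorem energy_deriv:
  assumes X: "\<And>\<xi>. X \<xi> 0 = \<xi>" "\<And>\<xi>. curve (X \<xi>)" and \<xi>: "0 \<le> \<xi>" "\<xi> \<le> 2*pi" and t: "t \<in> {-T..T}"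
  shows "((\<lambda>t. energy (m t) (X \<xi> t) - energy (m t) (X 0 t)) has_real_derivative
    ((u t (X \<xi> t) - k t)\<^sup>2 - (u t (X 0 t) - k t)\<^sup>2) / (2*c)) (at t within {-T..T})"
proof (cases "\<xi> = 0")
  case True then show ?thesis by simp
next
  case False
  \<comment> \<open>partition by \<open>Suc N\<close> characteristics with equidistant labels; \<open>U\<close>, \<open>d\<close> and \<open>G\<close> are the increments of \<open>u\<close>, of the position and of \<open>F\<close>, and \<open>A\<close> is the \<open>L\<^sup>1\<close> distance of the slope from its piecewise averages\<close>
  define x where "x N i t = X (\<xi> * real i / real (Suc N)) t" for N i t
  define d where "d N i t = x N (Suc i) t - x N i t" for N i t
  define U where "U N i t = u t (x N (Suc i) t) - u t (x N i t)" for N i t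
  define G where "G N i t = F t (x N (Suc i) t) - F t (x N i t)" for N i t
  define S where "S N t = (\<Sum>i<Suc N. (U N i t)\<^sup>2 / d N i t)" for N t
  define S' where "S' N t = (\<Sum>i<Suc N. (U N i t / d N i t * G N i t - (U N i t / d N i t)\<^sup>2 * U N i t) / c)" for N t
  define A where "A N t = (\<Sum>i<Suc N. slope_error (m t) (U N i t / d N i t) (x N i t) (x N (Suc i) t))" for N t
  define E where "E t = energy (m t) (X \<xi> t) - energy (m t) (X 0 t)" for t
  define e where "e t = ((u t (X \<xi> t) - k t)\<^sup>2 - (u t (X 0 t) - k t)\<^sup>2) / (2*c)" for t
  have xc: "curve (x N i)" for N i unfolding x_def[abs_def] by (rule X)
  have x0: "x N 0 t = X 0 t" "x N (Suc N) t = X \<xi> t" for N t by (simp_all add: x_def)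
  have xini: "x N (Suc i) 0 - x N i 0 = \<xi> / real (Suc N)" "x N i 0 < x N (Suc i) 0" for N i
  proof -
    have "\<xi> * real (Suc i) - \<xi> * real i = \<xi>" by (simp add: algebra_simps)
    then show e: "x N (Suc i) 0 - x N i 0 = \<xi> / real (Suc N)"
      unfolding x_def X diff_divide_distrib[symmetric] by simp
    have "0 < \<xi> / real (Suc N)" using False \<xi> by simp
    then show "x N i 0 < x N (Suc i) 0" unfolding e[symmetric] by simp
  qed
  \<comment> \<open>the partition stays a partition, and its mesh stays of order \<open>1/N\<close>\<close>
  have dpos: "0 < d N i t" if "t \<in> {-T..T}" for N i t
    using curve_order[OF xc xc that xini(2)] by (simp add: d_def)
  have dle: "d N i t \<le> 2 * (\<xi> / real (Suc N)) * exp (2*L*T)" if t: "t \<in> {-T..T}" for N i t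
  proof -
    have "\<bar>x N (Suc i) t - x N i t\<bar> \<le> 2 * \<bar>x N (Suc i) 0 - x N i 0\<bar> * exp (2*L*\<bar>t\<bar>)" by (rule curve_diff[OF xc xc t])
    also have "\<dots> \<le> 2 * \<bar>x N (Suc i) 0 - x N i 0\<bar> * exp (2*L*T)"
      using t L by (intro mult_left_mono) auto
    finally show ?thesis using \<xi> unfolding xini(1) d_def by simp
  qed
  have xx: "X \<xi> t \<le> X 0 t + 2*pi" "X 0 t \<le> X \<xi> t" if t: "t \<in> {-T..T}" for t
  proof -
    have "X (2*pi) t = X 0 t + 2*pi" by (rule curve_period[OF X(2) X(2) _ t]) (simp add: X)
    moreover have "X \<xi> t \<le> X (2*pi) t"
      using curve_order[OF X(2) X(2) t, of \<xi> "2*pi"] \<xi> X by (cases "\<xi> = 2*pi") auto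
    moreover have "X 0 t < X \<xi> t" using curve_order[OF X(2) X(2) t, of 0 \<xi>] \<xi> False X by simp
    ultimately show "X \<xi> t \<le> X 0 t + 2*pi" "X 0 t \<le> X \<xi> t" by simp_all
  qed
  have tel: "(\<Sum>i<Suc N. g (x N (Suc i) t) - g (x N i t)) = g (X \<xi> t) - g (X 0 t)" for g :: "real \<Rightarrow> real" and N t
    by (subst sum_lessThan_telescope) (simp add: x0)
  have A0: "0 \<le> A N t" if t: "t \<in> {-T..T}" for N t
    unfolding A_def
  proof (rule sum_nonneg)
    fix i
    have "x N i t \<le> x N (Suc i) t" using dpos[OF t, of N i] by (simp add: d_def)
    then have "prim (\<lambda>z. 0) (x N (Suc i) t) - prim (\<lambda>z. 0) (x N i t) \<le> slope_error (m t) (U N i t / d N i t) (x N i t) (x N (Suc i) t)"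
      by (intro prim_mono) (auto simp: per_primD(4)[OF pp[OF t]])
    then show "0 \<le> slope_error (m t) (U N i t / d N i t) (x N i t) (x N (Suc i) t)" by simp
  qed
  have AB: "A N t \<le> 2*R * (2*pi)" if t: "t \<in> {-T..T}" for N t
  proof -
    note p = per_primD[OF pp[OF t]]
    have "A N t \<le> (\<Sum>i<Suc N. 2*R * x N (Suc i) t - 2*R * x N i t)"
      unfolding A_def
    proof (rule sum_mono)
      fix i
      have le: "x N i t < x N (Suc i) t" using dpos[OF t, of N i] by (simp add: d_def)
      have r: "\<bar>U N i t / d N i t\<bar> \<le> R" unfolding U_def d_def by (rule slope_average_bound[OF pp[OF t] le])
      have "slope_error (m t) (U N i t / d N i t) (x N i t) (x N (Suc i) t)
        \<le> prim (\<lambda>z. 2*R) (x N (Suc i) t) - prim (\<lambda>z. 2*R) (x N i t)"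
      proof (rule prim_mono)
        fix z show "\<bar>m t z - U N i t / d N i t\<bar> \<le> 2*R" using r bper_bound[OF p(1), of z] by linarith
      qed (use p le in auto)
      then show "slope_error (m t) (U N i t / d N i t) (x N i t) (x N (Suc i) t)
        \<le> 2*R * x N (Suc i) t - 2*R * x N i t" by simp
    qed
    also have "\<dots> = 2*R * (X \<xi> t - X 0 t)" using tel[of "\<lambda>z. 2*R*z" N t] by (simp add: right_diff_distrib)
    also have "\<dots> \<le> 2*R * (2*pi)" using xx[OF t] R by (intro mult_left_mono) auto
    finally show ?thesis .
  qed
  have Alim: "(\<lambda>N. A N t) \<longlonglongrightarrow> 0" if t: "t \<in> {-T..T}" for t
  proof (rule tendstoI)
    fix \<epsilon> :: real assume \<epsilon>: "0 < \<epsilon>"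
    obtain \<delta> where \<delta>: "0 < \<delta>" and est: "\<And>y N. (\<And>i. i < N \<Longrightarrow> y i < y (Suc i) \<and> y (Suc i) \<le> y i + \<delta>) \<Longrightarrow> y N \<le> y 0 + 2*pi \<Longrightarrow>
      (\<Sum>i<N. slope_error (m t) ((u t (y (Suc i)) - u t (y i)) / (y (Suc i) - y i)) (y i) (y (Suc i))) \<le> \<epsilon>/2"
      by (rule piecewise_average_L1[OF pp[OF t], of "\<epsilon>/2"]) (use \<epsilon> in auto)
    have "(\<lambda>N. (2 * \<xi> * exp (2*L*T)) * inverse (real (Suc N))) \<longlonglongrightarrow> (2 * \<xi> * exp (2*L*T)) * 0"
      by (intro tendsto_intros LIMSEQ_inverse_real_of_nat)
    then have "eventually (\<lambda>N. (2 * \<xi> * exp (2*L*T)) * inverse (real (Suc N)) < \<delta>) sequentially"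
      using \<delta> by (intro order_tendstoD(2)[where a=\<delta>]) auto
    then show "eventually (\<lambda>N. dist (A N t) 0 < \<epsilon>) sequentially"
    proof eventually_elim
      case (elim N)
      have "A N t \<le> \<epsilon>/2"
        unfolding A_def U_def d_def
      proof (rule est)
        fix i
        have "2 * (\<xi> / real (Suc N)) * exp (2*L*T) < \<delta>" using elim by (simp add: divide_inverse mult_ac)
        then show "x N i t < x N (Suc i) t \<and> x N (Suc i) t \<le> x N i t + \<delta>"
          using dpos[OF t, of N i] dle[OF t, of N i] unfolding d_def by linarith
        show "x N (Suc N) t \<le> x N 0 t + 2*pi" unfolding x0 by (rule xx[OF t])
      qed
      then show ?case using A0[OF t, of N] \<epsilon> by (simp add: dist_real_def)
    qed
  qed
  \<comment> \<open>both the approximate energy and its rate are within a multiple of \<open>A\<close> of their limits\<close>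
  have SE: "\<bar>S N t - E t\<bar> \<le> 2*R * A N t" if t: "t \<in> {-T..T}" for N t
  proof -
    have eq: "S N t - E t = (\<Sum>i<Suc N. (U N i t)\<^sup>2 / d N i t - (energy (m t) (x N (Suc i) t) - energy (m t) (x N i t)))"
      unfolding S_def E_def tel[symmetric, of _ _ N] sum_subtractf[symmetric] ..
    have "\<bar>S N t - E t\<bar> \<le> (\<Sum>i<Suc N. 2*R * slope_error (m t) (U N i t / d N i t) (x N i t) (x N (Suc i) t))"
      unfolding eq
    proof (rule order_trans[OF sum_abs sum_mono])
      fix i
      have le: "x N i t < x N (Suc i) t" using dpos[OF t, of N i] by (simp add: d_def)
      show "\<bar>(U N i t)\<^sup>2 / d N i t - (energy (m t) (x N (Suc i) t) - energy (m t) (x N i t))\<bar> \<le>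
        2*R * slope_error (m t) (U N i t / d N i t) (x N i t) (x N (Suc i) t)"
        unfolding U_def d_def by (rule slope_piece_energy[OF pp[OF t] le refl])
    qed
    also have "\<dots> = 2*R * A N t" unfolding A_def sum_distrib_left[symmetric] ..
    finally show ?thesis .
  qed
  have S'e: "\<bar>S' N t - e t\<bar> \<le> (2*R*R + W) / c * A N t" if t: "t \<in> {-T..T}" for N t
  proof -
    have eq: "S' N t - e t = (\<Sum>i<Suc N. (U N i t / d N i t * G N i t - (U N i t / d N i t)\<^sup>2 * U N i t) / c - ((u t (x N (Suc i) t) - k t)\<^sup>2 / (2*c) - (u t (x N i t) - k t)\<^sup>2 / (2*c)))"
      unfolding S'_def e_def diff_divide_distrib[of "(u t (X \<xi> t) - k t)\<^sup>2"] tel[symmetric, where g="\<lambda>y. (u t y - k t)\<^sup>2 / (2*c)" and N=N and t=t]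
        sum_subtractf[symmetric] ..
    have "\<bar>S' N t - e t\<bar> \<le> (\<Sum>i<Suc N. (2*R*R + W) / c * slope_error (m t) (U N i t / d N i t) (x N i t) (x N (Suc i) t))"
      unfolding eq
    proof (rule order_trans[OF sum_abs sum_mono])
      fix i
      have le: "x N i t < x N (Suc i) t" using dpos[OF t, of N i] by (simp add: d_def)
      let ?P = "slope_error (m t) (U N i t / d N i t) (x N i t) (x N (Suc i) t)"
      have Geq: "G N i t = prim (src (u t) (m t)) (x N (Suc i) t) - prim (src (u t) (m t)) (x N i t) - k t * (x N (Suc i) t - x N i t)"
        unfolding G_def F_def k_def by (rule zmp_diff_eq[OF srcl[OF t]])
      have "\<bar>(U N i t / d N i t * G N i t - (U N i t / d N i t)\<^sup>2 * U N i t) - ((u t (x N (Suc i) t) - k t)\<^sup>2 - (u t (x N i t) - k t)\<^sup>2) / 2\<bar> / c \<le> ((2*R*R + W) * ?P) / c"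
        unfolding Geq unfolding U_def d_def
        by (intro divide_right_mono slope_piece_rate[OF pp[OF t] le refl] uk_bound t less_imp_le c)
      moreover have "\<bar>Z - Q / 2\<bar> / c = \<bar>Z / c - Q / (2*c)\<bar>" for Z Q
      proof -
        have "Z / c - Q / (2*c) = (Z - Q/2) / c" using c by (simp add: field_simps)
        then show ?thesis using c by (simp add: abs_divide)
      qed
      ultimately show "\<bar>(U N i t / d N i t * G N i t - (U N i t / d N i t)\<^sup>2 * U N i t) / c - ((u t (x N (Suc i) t) - k t)\<^sup>2 / (2*c) - (u t (x N i t) - k t)\<^sup>2 / (2*c))\<bar> \<le> (2*R*R + W) / c * ?P"
        by (simp only: diff_divide_distrib[symmetric] times_divide_eq_left)
    qed
    also have "\<dots> = (2*R*R + W) / c * A N t" unfolding A_def sum_distrib_left[symmetric] ..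
    finally show ?thesis .
  qed
  have Sd: "(S N has_real_derivative S' N t) (at t within {-T..T})" if t: "t \<in> {-T..T}" for N t
    unfolding S_def[abs_def] S'_def
  proof (rule DERIV_sum)
    fix i
    have Ud: "(U N i has_real_derivative (G N i t) / (2*c)) (at t within {-T..T})"
      unfolding U_def[abs_def] G_def diff_divide_distrib by (intro DERIV_diff u_deriv_along xc t)
    have "V t (x N (Suc i) t) - V t (x N i t) = U N i t / c" using c by (simp add: V_def U_def field_simps)
    moreover have "(d N i has_real_derivative V t (x N (Suc i) t) - V t (x N i t)) (at t within {-T..T})"
      unfolding d_def[abs_def] by (intro DERIV_diff) (use xc t in \<open>auto simp: curve_def\<close>)
    ultimately have dd: "(d N i has_real_derivative U N i t / c) (at t within {-T..T})" by simp
    have "((\<lambda>s. (U N i s)\<^sup>2 / d N i s) has_real_derivative ((2 * U N i t * (G N i t / (2*c))) * d N i t - (U N i t)\<^sup>2 * (U N i t / c)) / (d N i t * d N i t)) (at t within {-T..T})"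
    proof (rule DERIV_divide[OF _ dd])
      show "((\<lambda>s. (U N i s)\<^sup>2) has_real_derivative 2 * U N i t * (G N i t / (2*c))) (at t within {-T..T})"
        using DERIV_power[OF Ud, of 2] by (simp add: mult_ac)
    qed (use dpos[OF t, of N i] in simp)
    then show "((\<lambda>s. (U N i s)\<^sup>2 / d N i s) has_real_derivative (U N i t / d N i t * G N i t - (U N i t / d N i t)\<^sup>2 * U N i t) / c) (at t within {-T..T})"
      by (subst (asm) quotient_rate) (use dpos[OF t, of N i] c in auto)
  qed
  have ec: "continuous_on {-T..T} e"
    unfolding e_def[abs_def] using c by (intro continuous_intros u_along curve_cont X k_cont) auto
  \<comment> \<open>the limit is taken in the integrated identity, with \<open>A\<close> bounded by \<open>AB\<close> and tending to zero\<close>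
  have int: "E t - E (-T) = integral {-T..t} e" if t: "t \<in> {-T..T}" for t
  proof -
    have sub: "s \<in> {-T..T}" if "s \<in> {-T..t}" for s using that t by auto
    have hi: "(S' N has_integral (S N t - S N (-T))) {-T..t}" for N
    proof (rule fundamental_theorem_of_calculus)
      show "(S N has_vector_derivative S' N s) (at s within {-T..t})" if "s \<in> {-T..t}" for s
        unfolding has_real_derivative_iff_has_vector_derivative[symmetric]
        by (rule DERIV_subset[OF Sd[OF sub[OF that]]]) (use t in auto)
    qed (use t in simp)
    have Wn: "0 \<le> (2*R*R + W) / c" using R c by (simp add: W_def)
    have "(\<lambda>N. integral {-T..t} (S' N)) \<longlonglongrightarrow> integral {-T..t} e"
    proof (rule dominated_convergence(2))
      show "S' N integrable_on {-T..t}" for N using hi by (rule has_integral_integrable)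
      have "(\<lambda>s. \<bar>e s\<bar> + (2*R*R + W) / c * (2*R*(2*pi))) integrable_on {-T..t}"
        by (intro integrable_continuous_real continuous_intros continuous_on_subset[OF ec]) (use t in auto)
      then show "(\<lambda>s. \<bar>e s\<bar> + (2*R*R + W) / c * (2*R*(2*pi))) integrable_on {-T..t}" .
      fix s assume s: "s \<in> {-T..t}"
      show "norm (S' N s) \<le> \<bar>e s\<bar> + (2*R*R + W) / c * (2*R*(2*pi))" for N
        using S'e[OF sub[OF s], of N] mult_left_mono[OF AB[OF sub[OF s], of N] Wn] unfolding real_norm_def by linarith
      have "(\<lambda>N. S' N s - e s) \<longlonglongrightarrow> 0"
        by (rule Lim_null_comparison[OF _ tendsto_mult_right_zero[OF Alim[OF sub[OF s]], of "(2*R*R + W) / c"]])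
          (intro always_eventually allI, unfold real_norm_def, rule S'e[OF sub[OF s]])
      then show "(\<lambda>N. S' N s) \<longlonglongrightarrow> e s" by (simp add: LIM_zero_iff)
    qed
    moreover have "integral {-T..t} (S' N) = S N t - S N (-T)" for N by (rule integral_unique[OF hi])
    moreover have SL: "(\<lambda>N. S N s) \<longlonglongrightarrow> E s" if s: "s \<in> {-T..T}" for s
    proof -
      have "(\<lambda>N. S N s - E s) \<longlonglongrightarrow> 0"
        by (rule Lim_null_comparison[OF _ tendsto_mult_right_zero[OF Alim[OF s], of "2*R"]])
          (intro always_eventually allI, unfold real_norm_def, rule SE[OF s])
      then show ?thesis by (simp add: LIM_zero_iff)
    qed
    moreover have "(\<lambda>N. S N t - S N (-T)) \<longlonglongrightarrow> E t - E (-T)" by (intro tendsto_diff SL t) (use T in auto)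
    ultimately show ?thesis by (metis (no_types, lifting) LIMSEQ_unique ext)
  qed
  have "((\<lambda>t. E (-T) + integral {-T..t} e) has_real_derivative 0 + e t) (at t within {-T..T})"
    by (intro DERIV_add DERIV_const integral_has_real_derivative ec t)
  then have "((\<lambda>t. E (-T) + integral {-T..t} e) has_real_derivative e t) (at t within {-T..T})" by simp
  then have "(E has_real_derivative e t) (at t within {-T..T})"
    by (rule has_field_derivative_transform_within[OF _ zero_less_one t]) (use int in force)
  then show ?thesis unfolding E_def[abs_def] e_def .
qed

lemma flow_continuous:
  assumes X: "\<And>\<xi>. X \<xi> 0 = \<xi>" "\<And>\<xi>. curve (X \<xi>)" and t: "t \<in> {-T..T}"
  shows "continuous_on UNIV (\<lambda>\<xi>. X \<xi> t)"
proof -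
  have "dist (X \<xi> t) (X \<xi>' t) \<le> (2 * exp (2*L*\<bar>t\<bar>)) * dist \<xi> \<xi>'" for \<xi> \<xi>'
    using curve_diff[OF X(2) X(2) t, of \<xi> \<xi>'] X(1) by (simp add: dist_real_def mult_ac)
  then have "(2 * exp (2*L*\<bar>t\<bar>))-lipschitz_on UNIV (\<lambda>\<xi>. X \<xi> t)" by (intro lipschitz_onI) auto
  then show ?thesis by (rule lipschitz_on_continuous_on)
qed

lemma flow_reaches:
  assumes X: "\<And>\<xi>. X \<xi> 0 = \<xi>" "\<And>\<xi>. curve (X \<xi>)" and t: "t \<in> {-T..T}"
    and y: "X 0 t \<le> y" "y \<le> X 0 t + 2*pi"
  obtains \<xi> where "0 \<le> \<xi>" "\<xi> \<le> 2*pi" "X \<xi> t = y"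
proof -
  have "X (2*pi) t = X 0 t + 2*pi" by (rule curve_period[OF X(2) X(2) _ t]) (simp add: X)
  then have "\<exists>\<xi>\<ge>0. \<xi> \<le> 2*pi \<and> X \<xi> t = y"
    by (intro IVT'[where f="\<lambda>\<xi>. X \<xi> t"] continuous_on_subset[OF flow_continuous[OF X t]]) (use y in auto)
  then show ?thesis using that by blast
qed

lemma flow_displacement:
  assumes y: "curve y" and t: "t \<in> {-T..T}" shows "\<bar>y t - y 0\<bar> \<le> (2*R + c\<^sup>2) / (2*c) * T"
proof -
  have "norm (y t - y 0) \<le> (2*R + c\<^sup>2) / (2*c) * norm (t - 0)"
  proof (rule field_differentiable_bound[where f'="\<lambda>t. V t (y t)" and S="{-T..T}"])
    show "norm (V t (y t)) \<le> (2*R + c\<^sup>2) / (2*c)" if "t \<in> {-T..T}" for t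
      using bper_bound[OF ub[OF that], of "y t"] c
      by (auto simp: V_def abs_divide intro!: divide_right_mono order_trans[OF abs_triangle_ineq4])
  qed (use y t T in \<open>auto simp: curve_def\<close>)
  also have "\<dots> \<le> (2*R + c\<^sup>2) / (2*c) * T" using t c R by (intro mult_left_mono) auto
  finally show ?thesis by simp
qed

end

section \<open>Stability\<close>

text \<open>
  The zero-mean primitive of \<open>h\<close> is controlled by the oscillation of any primitive of \<open>h\<close>, even if \<open>h\<close>
  itself is not small.
\<close>

lemma zmp_oscillation:
  assumes "periodic h" "loc_bdd h" and S: "\<And>y. a \<le> y \<Longrightarrow> y \<le> a + 2*pi \<Longrightarrow> \<bar>prim h y - prim h a\<bar> \<le> S"
  shows "\<bar>zmp h x\<bar> \<le> 4*S" "\<bar>avg h\<bar> \<le> S"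
proof -
  have per: "prim h (a + 2*pi) - prim h a = avg h * (2*pi)"
    using periodic_mean_shift[OF assms(1,2), of a] by (simp add: avg_def)
  have av: "\<bar>avg h\<bar> * (2*pi) \<le> S" using S[of "a + 2*pi"] unfolding per by (simp add: abs_mult)
  have "\<bar>avg h\<bar> * 1 \<le> \<bar>avg h\<bar> * (2*pi)" using pi_ge_two by (intro mult_left_mono) auto
  then show "\<bar>avg h\<bar> \<le> S" using av by simp
  have 1: "\<bar>zmp h y - zmp h a\<bar> \<le> 2*S" if "a \<le> y" "y \<le> a + 2*pi" for y
  proof -
    have "\<bar>avg h * (y - a)\<bar> \<le> \<bar>avg h\<bar> * (2*pi)" unfolding abs_mult using that by (intro mult_left_mono) auto
    then show ?thesis using S[OF that] av unfolding zmp_diff_eq[OF assms(2)] by linarith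
  qed
  have 2: "\<bar>zmp h y - zmp h a\<bar> \<le> 2*S" for y
  proof -
    have "zmp h (wrap (y - a) + a) = zmp h y"
    proof -
      have "periodic (\<lambda>z. zmp h (z + a))"
        unfolding periodic_def using periodicD[OF zmp_periodic[OF assms(1,2)]] by (metis add.commute add.left_commute)
      from periodic_wrap[OF this, of "y - a"] show ?thesis by simp
    qed
    then show ?thesis using 1[of "wrap (y - a) + a"] wrap_range[of "y - a"] by simp
  qed
  have "\<bar>avg (\<lambda>y. zmp h x - zmp h y)\<bar> \<le> 4*S"
  proof (rule avg_bound)
    show "\<bar>zmp h x - zmp h y\<bar> \<le> 4*S" for y using 2[of x] 2[of y] by linarith
  qed (use assms in simp)
  then show "\<bar>zmp h x\<bar> \<le> 4*S" using assms by (simp add: avg_diff zmp_avg)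
qed

lemma square_diff_bound: fixes a b :: real assumes "\<bar>a\<bar> \<le> W" "\<bar>b\<bar> \<le> W" shows "\<bar>a\<^sup>2 - b\<^sup>2\<bar> \<le> 2*W*\<bar>a - b\<bar>"
proof -
  have "\<bar>a + b\<bar> * \<bar>a - b\<bar> \<le> 2*W*\<bar>a - b\<bar>" using assms by (intro mult_right_mono) auto
  moreover have "\<bar>a\<^sup>2 - b\<^sup>2\<bar> = \<bar>a + b\<bar> * \<bar>a - b\<bar>" unfolding abs_mult[symmetric] by (simp add: power2_eq_square algebra_simps)
  ultimately show ?thesis by simp
qed

locale two_solutions = A: bounded_solution c \<tau> T R u m + B: bounded_solution c \<tau> T R v n
  for c \<tau> T R :: real and u m v n :: "real \<Rightarrow> real \<Rightarrow> real"
begin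

definition "C1 = (1 + R\<^sup>2) + R\<^sup>2 + 2*pi*(1+R)"
definition "C2 = 1/c + (4*C1 + 2*(R\<^sup>2 + R))/(2*c) + 4*A.W*(1 + C1)/(2*c)"

lemma C1: "0 \<le> C1" using A.R by (simp add: C1_def)

lemma C2: "0 < C2"
proof -
  have "0 < 1/c" using A.c by simp
  moreover have "0 \<le> (4*C1 + 2*(R\<^sup>2 + R))/(2*c)" using A.c A.R C1 by simp
  moreover have "0 \<le> 4*A.W*(1 + C1)/(2*c)" using A.c A.R C1 by (simp add: A.W_def)
  ultimately show ?thesis unfolding C2_def by linarith
qed

text \<open>
  Positions of characteristics, values of \<open>u\<close> along them and the energies between them determine \<open>u\<close>,
  the source \<open>F\<close> and the average \<open>k\<close> at fixed points with Lipschitz dependence: \<open>F\<close> involves the slope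
  only through the primitive of \<open>m\<^sup>2\<close>, that is, through these energies.
\<close>

lemma eulerian_bounds:
  assumes X: "\<And>\<xi>. X \<xi> 0 = \<xi>" "\<And>\<xi>. A.curve (X \<xi>)" and Y: "\<And>\<xi>. Y \<xi> 0 = \<xi>" "\<And>\<xi>. B.curve (Y \<xi>)"
    and t: "t \<in> {-T..T}"
    and g0: "\<And>\<xi>. 0 \<le> \<xi> \<Longrightarrow> \<xi> \<le> 2*pi \<Longrightarrow> \<bar>X \<xi> t - Y \<xi> t\<bar> \<le> N"
    and g1: "\<And>\<xi>. 0 \<le> \<xi> \<Longrightarrow> \<xi> \<le> 2*pi \<Longrightarrow> \<bar>u t (X \<xi> t) - v t (Y \<xi> t)\<bar> \<le> N"
    and g2: "\<And>\<xi>. 0 \<le> \<xi> \<Longrightarrow> \<xi> \<le> 2*pi \<Longrightarrow> \<bar>(energy (m t) (X \<xi> t) - energy (m t) (X 0 t))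
       - (energy (n t) (Y \<xi> t) - energy (n t) (Y 0 t))\<bar> \<le> N"
  shows "\<bar>u t x - v t x\<bar> \<le> (1 + R) * N" "\<bar>A.F t x - B.F t x\<bar> \<le> 4 * (C1 * N)" "\<bar>A.k t - B.k t\<bar> \<le> C1 * N"
proof -
  note p = per_primD[OF A.pp[OF t]] and q = per_primD[OF B.pp[OF t]]
  have N: "0 \<le> N" using g0[of 0] by simp
  have R: "0 \<le> R" by (rule A.R)
  have sup0: "\<bar>u t y - v t y\<bar> \<le> (1 + R) * N" if y: "X 0 t \<le> y" "y \<le> X 0 t + 2*pi" for y
  proof -
    obtain \<xi> where \<xi>: "0 \<le> \<xi>" "\<xi> \<le> 2*pi" "X \<xi> t = y" using A.flow_reaches[OF X t y] by blast
    have "\<bar>v t (Y \<xi> t) - v t (X \<xi> t)\<bar> \<le> R * N"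
      by (rule per_prim_lip_le[OF B.pp[OF t]]) (use g0[OF \<xi>(1,2)] in \<open>simp add: abs_minus_commute\<close>)
    then show ?thesis using g1[OF \<xi>(1,2)] \<xi>(3) by (simp add: distrib_right)
  qed
  show sup: "\<bar>u t x - v t x\<bar> \<le> (1 + R) * N" for x
  proof -
    have "periodic (\<lambda>z. u t (z + X 0 t) - v t (z + X 0 t))"
      unfolding periodic_def using periodicD[OF p(2)] periodicD[OF q(2)] by (metis add.commute add.left_commute)
    from periodic_wrap[OF this, of "x - X 0 t"] show ?thesis
      using sup0[of "wrap (x - X 0 t) + X 0 t"] wrap_range[of "x - X 0 t"] by simp
  qed
  let ?h = "\<lambda>x. src (u t) (m t) x - src (v t) (n t) x"
  have ls: "loc_bdd (src (u t) (m t))" "loc_bdd (src (v t) (n t))" using A.srcl[OF t] B.srcl[OF t] by auto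
  have lh: "loc_bdd ?h" using ls by (rule loc_bdd_diff)
  have ph: "periodic ?h" by (rule periodic_binop[OF A.srcp[OF t] B.srcp[OF t]])
  have n2: "\<bar>energy (n t) a - energy (n t) b\<bar> \<le> R\<^sup>2 * N" if "\<bar>a - b\<bar> \<le> N" for a b
  proof -
    have "\<bar>energy (n t) a - energy (n t) b\<bar> \<le> R\<^sup>2 * \<bar>a - b\<bar>"
      by (rule prim_lip) (use q bper_bound[OF bper_square[OF q(1)]] in auto)
    also have "\<dots> \<le> R\<^sup>2 * N" using that by (intro mult_left_mono) auto
    finally show ?thesis .
  qed
  have osc: "\<bar>prim ?h y - prim ?h (X 0 t)\<bar> \<le> C1 * N" if y: "X 0 t \<le> y" "y \<le> X 0 t + 2*pi" for y
  proof -
    obtain \<xi> where \<xi>: "0 \<le> \<xi>" "\<xi> \<le> 2*pi" "X \<xi> t = y" using A.flow_reaches[OF X t y] by blast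
    have d: "prim ?h z = (energy (m t) z - energy (n t) z) + prim (\<lambda>y. u t y - v t y) z" for z
      unfolding src_def using p(4,7) q(4,7) by (simp add: prim_diff prim_add)
    have 1: "\<bar>prim (\<lambda>y. u t y - v t y) y - prim (\<lambda>y. u t y - v t y) (X 0 t)\<bar> \<le> 2*pi*(1+R)*N"
    proof -
      have "\<bar>prim (\<lambda>y. u t y - v t y) y - prim (\<lambda>y. u t y - v t y) (X 0 t)\<bar> \<le> ((1 + R) * N) * (y - X 0 t)"
        by (rule prim_bound) (use p(7) q(7) sup y in auto)
      also have "\<dots> \<le> ((1 + R) * N) * (2*pi)" using y R N by (intro mult_left_mono) auto
      finally show ?thesis by (simp add: mult_ac)
    qed
    have 2: "\<bar>energy (n t) (Y \<xi> t) - energy (n t) y\<bar> \<le> R\<^sup>2 * N"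
      by (rule n2) (use g0[OF \<xi>(1,2)] \<xi>(3) in \<open>simp add: abs_minus_commute\<close>)
    have 3: "\<bar>energy (n t) (X 0 t) - energy (n t) (Y 0 t)\<bar> \<le> R\<^sup>2 * N"
      by (rule n2) (use g0[of 0] in simp)
    have "C1 * N = N + R\<^sup>2 * N + R\<^sup>2 * N + 2*pi*(1+R)*N" by (simp add: C1_def algebra_simps)
    then show ?thesis using 1 2 3 g2[OF \<xi>(1,2)] unfolding d \<xi>(3) by linarith
  qed
  have "\<bar>zmp ?h x\<bar> \<le> 4 * (C1 * N)" "\<bar>avg ?h\<bar> \<le> C1 * N" by (rule zmp_oscillation[OF ph lh osc]; assumption)+
  then show "\<bar>A.F t x - B.F t x\<bar> \<le> 4 * (C1 * N)" "\<bar>A.k t - B.k t\<bar> \<le> C1 * N"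
    unfolding A.F_def B.F_def A.k_def B.k_def zmp_diff[OF ls] avg_diff[OF ls] .
qed

text \<open>
  The differences of positions, of values and of energies form a family to which the Gronwall lemma
  applies, because the rates of all three are Lipschitz functions of these quantities by
  \<open>u_deriv_along\<close>, \<open>energy_deriv\<close> and \<open>eulerian_bounds\<close>. Differences of slopes do not appear in the
  family, so no derivative is lost.
\<close>

theorem stability:
  assumes \<delta>: "0 \<le> \<delta>" "\<And>x. \<bar>u 0 x - v 0 x\<bar> \<le> \<delta>"
    "\<And>x. 0 \<le> x \<Longrightarrow> x \<le> 2*pi \<Longrightarrow> \<bar>energy (m 0) x - energy (n 0) x\<bar> \<le> \<delta>"
    and t: "t \<in> {-T..T}"
  shows "\<bar>u t x - v t x\<bar> \<le> (1 + R) * (2 * \<delta> * exp (2*C2*\<bar>t\<bar>))"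
    "\<bar>energy (m t) (2*pi) - energy (n t) (2*pi)\<bar> \<le> 2 * \<delta> * exp (2*C2*\<bar>t\<bar>)"
proof -
  obtain X where X: "\<And>\<xi>. X \<xi> 0 = \<xi>" "\<And>\<xi>. A.curve (X \<xi>)" using A.flow_exists by metis
  obtain Y where Y: "\<And>\<xi>. Y \<xi> 0 = \<xi>" "\<And>\<xi>. B.curve (Y \<xi>)" using B.flow_exists by metis
  define EA where "EA \<xi> t = energy (m t) (X \<xi> t) - energy (m t) (X 0 t)" for \<xi> t
  define EB where "EB \<xi> t = energy (n t) (Y \<xi> t) - energy (n t) (Y 0 t)" for \<xi> t
  \<comment> \<open>index \<open>(j, \<xi>)\<close>: for \<open>j = 0, 1, 2\<close> the difference of positions, values and energies at the label \<open>\<xi>\<close>\<close>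
  define g where "g i t = (let \<xi> = snd i in if fst i = (0::nat) then X \<xi> t - Y \<xi> t
     else if fst i = 1 then u t (X \<xi> t) - v t (Y \<xi> t) else EA \<xi> t - EB \<xi> t)" for i t
  define sqA where "sqA \<xi> t = (u t (X \<xi> t) - A.k t)\<^sup>2 - (u t (X 0 t) - A.k t)\<^sup>2" for \<xi> t
  define sqB where "sqB \<xi> t = (v t (Y \<xi> t) - B.k t)\<^sup>2 - (v t (Y 0 t) - B.k t)\<^sup>2" for \<xi> t
  define g' where "g' i t = (let \<xi> = snd i in if fst i = (0::nat) then A.V t (X \<xi> t) - B.V t (Y \<xi> t)
     else if fst i = 1 then A.F t (X \<xi> t) / (2*c) - B.F t (Y \<xi> t) / (2*c)
     else sqA \<xi> t / (2*c) - sqB \<xi> t / (2*c))" for i t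
  define I where "I = {0,1,2::nat} \<times> {0..2*pi}"
  have R: "0 \<le> R" by (rule A.R)
  \<comment> \<open>\<open>D\<close> bounds the displacement of characteristics, hence the family is bounded a priori\<close>
  define D where "D = (2*R + c\<^sup>2) / (2*c) * T"
  have EAb: "\<bar>EA \<xi> t\<bar> \<le> R\<^sup>2 * (2*pi + 2*D)" if "t \<in> {-T..T}" "0 \<le> \<xi>" "\<xi> \<le> 2*pi" for \<xi> t
  proof -
    note p = per_primD[OF A.pp[OF that(1)]]
    have "\<bar>EA \<xi> t\<bar> \<le> R\<^sup>2 * \<bar>X \<xi> t - X 0 t\<bar>" unfolding EA_def
      by (rule prim_lip) (use p bper_bound[OF bper_square[OF p(1)]] in auto)
    also have "\<dots> \<le> R\<^sup>2 * (2*pi + 2*D)"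
      using A.flow_displacement[OF X(2) that(1), of \<xi>] A.flow_displacement[OF X(2) that(1), of 0] that
      unfolding X D_def[symmetric] by (intro mult_left_mono) auto
    finally show ?thesis .
  qed
  have EBb: "\<bar>EB \<xi> t\<bar> \<le> R\<^sup>2 * (2*pi + 2*D)" if "t \<in> {-T..T}" "0 \<le> \<xi>" "\<xi> \<le> 2*pi" for \<xi> t
  proof -
    note p = per_primD[OF B.pp[OF that(1)]]
    have "\<bar>EB \<xi> t\<bar> \<le> R\<^sup>2 * \<bar>Y \<xi> t - Y 0 t\<bar>" unfolding EB_def
      by (rule prim_lip) (use p bper_bound[OF bper_square[OF p(1)]] in auto)
    also have "\<dots> \<le> R\<^sup>2 * (2*pi + 2*D)"
      using B.flow_displacement[OF Y(2) that(1), of \<xi>] B.flow_displacement[OF Y(2) that(1), of 0] that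
      unfolding Y D_def[symmetric] by (intro mult_left_mono) auto
    finally show ?thesis .
  qed
  have main: "\<bar>g i t\<bar> \<le> 2 * \<delta> * exp (2*C2*\<bar>t\<bar>)" if i: "i \<in> I" for i
  proof (rule gronwall_family[OF C2, where I=I and g=g and g'=g' and T=T and K="2*D + 2*R + 2*(R\<^sup>2 * (2*pi + 2*D))"])
    fix i s assume i: "i \<in> I" and s: "s \<in> {-T..T}"
    obtain j \<xi> where ij: "i = (j, \<xi>)" "j = 0 \<or> j = 1 \<or> j = 2" "0 \<le> \<xi>" "\<xi> \<le> 2*pi" using i by (auto simp: I_def)
    have d0: "((\<lambda>t. X \<xi> t - Y \<xi> t) has_real_derivative A.V s (X \<xi> s) - B.V s (Y \<xi> s)) (at s within {-T..T})"
      using X(2)[of \<xi>] Y(2)[of \<xi>] s unfolding A.curve_def B.curve_def by (intro DERIV_diff) auto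
    have d1: "((\<lambda>t. u t (X \<xi> t) - v t (Y \<xi> t)) has_real_derivative A.F s (X \<xi> s) / (2*c) - B.F s (Y \<xi> s) / (2*c)) (at s within {-T..T})"
      by (intro DERIV_diff A.u_deriv_along B.u_deriv_along X Y s)
    have d2: "((\<lambda>t. EA \<xi> t - EB \<xi> t) has_real_derivative sqA \<xi> s / (2*c) - sqB \<xi> s / (2*c)) (at s within {-T..T})"
      unfolding EA_def EB_def sqA_def sqB_def
      by (intro DERIV_diff A.energy_deriv[OF X ij(3,4) s] B.energy_deriv[OF Y ij(3,4) s])
    show "(g i has_real_derivative g' i s) (at s within {-T..T})"
      using ij(2) d0 d1 d2 unfolding g_def[abs_def] g'_def Let_def ij(1) fst_conv snd_conv by auto
    have b0: "\<bar>X \<xi> s - Y \<xi> s\<bar> \<le> 2*D"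
      using A.flow_displacement[OF X(2) s, of \<xi>] B.flow_displacement[OF Y(2) s, of \<xi>] unfolding X Y D_def by linarith
    have b1: "\<bar>u s (X \<xi> s) - v s (Y \<xi> s)\<bar> \<le> 2*R"
      using bper_bound[OF A.ub[OF s], of "X \<xi> s"] bper_bound[OF B.ub[OF s], of "Y \<xi> s"] by linarith
    have b2: "\<bar>EA \<xi> s - EB \<xi> s\<bar> \<le> 2*(R\<^sup>2 * (2*pi + 2*D))"
      using EAb[OF s ij(3,4)] EBb[OF s ij(3,4)] by linarith
    have "0 \<le> D" using A.T A.c R by (simp add: D_def)
    then have "0 \<le> 2*(R\<^sup>2 * (2*pi + 2*D))" by simp
    then show "\<bar>g i s\<bar> \<le> 2*D + 2*R + 2*(R\<^sup>2 * (2*pi + 2*D))"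
      using ij(2) b0 b1 b2 R \<open>0 \<le> D\<close> unfolding g_def[abs_def] Let_def ij(1) fst_conv snd_conv by auto
  next
    fix i assume i: "i \<in> I"
    obtain j \<xi> where ij: "i = (j, \<xi>)" "j = 0 \<or> j = 1 \<or> j = 2" "0 \<le> \<xi>" "\<xi> \<le> 2*pi" using i by (auto simp: I_def)
    show "\<bar>g i 0\<bar> \<le> \<delta>"
      using ij(2) \<delta>(1) \<delta>(2)[of \<xi>] \<delta>(3)[OF ij(3,4)] unfolding g_def Let_def ij(1) fst_conv snd_conv EA_def EB_def X Y by auto
  next
    fix s N i assume s: "s \<in> {-T..T}" and N: "0 \<le> N" and gN: "\<And>j. j \<in> I \<Longrightarrow> \<bar>g j s\<bar> \<le> N" and i: "i \<in> I"
    obtain j \<xi> where ij: "i = (j, \<xi>)" "j = 0 \<or> j = 1 \<or> j = 2" "0 \<le> \<xi>" "\<xi> \<le> 2*pi" using i by (auto simp: I_def)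
    have h0: "\<bar>X \<xi> s - Y \<xi> s\<bar> \<le> N" if "0 \<le> \<xi>" "\<xi> \<le> 2*pi" for \<xi> using gN[of "(0,\<xi>)"] that by (simp add: I_def g_def)
    have h1: "\<bar>u s (X \<xi> s) - v s (Y \<xi> s)\<bar> \<le> N" if "0 \<le> \<xi>" "\<xi> \<le> 2*pi" for \<xi> using gN[of "(1,\<xi>)"] that by (simp add: I_def g_def)
    have h2: "\<bar>EA \<xi> s - EB \<xi> s\<bar> \<le> N" if "0 \<le> \<xi>" "\<xi> \<le> 2*pi" for \<xi> using gN[of "(2,\<xi>)"] that by (simp add: I_def g_def)
    note eb = eulerian_bounds[OF X Y s h0 h1 h2[unfolded EA_def EB_def]]
    have ebF: "\<bar>A.F s x - B.F s x\<bar> \<le> 4 * (C1 * N)" for x by (rule eb(2))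
    have ebk: "\<bar>A.k s - B.k s\<bar> \<le> C1 * N" by (rule eb(3))
    have Nc: "0 \<le> N / c" "0 \<le> (4*C1 + 2*(R\<^sup>2 + R))/(2*c) * N" "0 \<le> 4*A.W*(1 + C1)/(2*c) * N"
      using N A.c C1 R by (simp_all add: A.W_def)
    have CN: "C2 * N = N / c + (4*C1 + 2*(R\<^sup>2 + R))/(2*c) * N + 4*A.W*(1 + C1)/(2*c) * N"
      by (simp add: C2_def distrib_right)
    have k0: "\<bar>A.V s (X \<xi> s) - B.V s (Y \<xi> s)\<bar> \<le> N / c"
    proof -
      have "A.V s (X \<xi> s) - B.V s (Y \<xi> s) = (u s (X \<xi> s) - v s (Y \<xi> s)) / c"
        using A.c by (simp add: A.V_def B.V_def field_simps)
      then show ?thesis using h1[OF ij(3,4)] A.c by (simp add: abs_divide divide_right_mono)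
    qed
    have k1: "\<bar>A.F s (X \<xi> s) / (2*c) - B.F s (Y \<xi> s) / (2*c)\<bar> \<le> (4*C1 + 2*(R\<^sup>2 + R))/(2*c) * N"
    proof -
      have "\<bar>B.F s (X \<xi> s) - B.F s (Y \<xi> s)\<bar> \<le> 2*(R\<^sup>2 + R) * \<bar>X \<xi> s - Y \<xi> s\<bar>"
        unfolding B.F_def by (rule zmp_lip[OF B.srcb[OF s]])
      also have "\<dots> \<le> 2*(R\<^sup>2 + R) * N" using h0[OF ij(3,4)] R by (intro mult_left_mono) auto
      finally have "\<bar>A.F s (X \<xi> s) - B.F s (Y \<xi> s)\<bar> \<le> 4 * (C1 * N) + 2*(R\<^sup>2 + R) * N"
        using ebF[of "X \<xi> s"] by linarith
      also have "\<dots> = (4*C1 + 2*(R\<^sup>2 + R)) * N" by (simp add: algebra_simps)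
      finally have "\<bar>A.F s (X \<xi> s) - B.F s (Y \<xi> s)\<bar> / (2*c) \<le> ((4*C1 + 2*(R\<^sup>2 + R)) * N) / (2*c)"
        using A.c by (intro divide_right_mono) auto
      then show ?thesis using A.c by (simp add: abs_divide diff_divide_distrib[symmetric])
    qed
    have sq: "\<bar>(u s (X \<zeta> s) - A.k s)\<^sup>2 - (v s (Y \<zeta> s) - B.k s)\<^sup>2\<bar> \<le> 2*A.W*((1+C1)*N)" if "0 \<le> \<zeta>" "\<zeta> \<le> 2*pi" for \<zeta>
    proof -
      have "\<bar>(u s (X \<zeta> s) - A.k s)\<^sup>2 - (v s (Y \<zeta> s) - B.k s)\<^sup>2\<bar> \<le> 2*A.W*\<bar>(u s (X \<zeta> s) - A.k s) - (v s (Y \<zeta> s) - B.k s)\<bar>"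
        by (rule square_diff_bound[OF A.uk_bound[OF s]]) (use B.uk_bound[OF s] in \<open>simp add: A.W_def B.W_def\<close>)
      also have "\<dots> \<le> 2*A.W*((1+C1)*N)"
      proof (rule mult_left_mono)
        show "\<bar>(u s (X \<zeta> s) - A.k s) - (v s (Y \<zeta> s) - B.k s)\<bar> \<le> (1+C1)*N"
          using h1[OF that] ebk unfolding distrib_right by linarith
      qed (use R in \<open>simp add: A.W_def\<close>)
      finally show ?thesis .
    qed
    have k2: "\<bar>sqA \<xi> s / (2*c) - sqB \<xi> s / (2*c)\<bar> \<le> 4*A.W*(1 + C1)/(2*c) * N"
    proof -
      have "\<bar>sqA \<xi> s - sqB \<xi> s\<bar> \<le> 2 * (2*A.W*((1+C1)*N))"
        using sq[OF ij(3,4)] sq[of 0] unfolding sqA_def sqB_def by simp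
      also have "\<dots> = 4*A.W*(1 + C1) * N" by simp
      finally have "\<bar>sqA \<xi> s - sqB \<xi> s\<bar> / (2*c) \<le> (4*A.W*(1 + C1) * N) / (2*c)"
        using A.c by (intro divide_right_mono) auto
      moreover have "\<bar>sqA \<xi> s - sqB \<xi> s\<bar> / (2*c) = \<bar>sqA \<xi> s / (2*c) - sqB \<xi> s / (2*c)\<bar>"
        using A.c by (simp add: abs_divide diff_divide_distrib[symmetric])
      ultimately show ?thesis by (simp only: times_divide_eq_left)
    qed
    show "\<bar>g' i s\<bar> \<le> C2 * N"
      using ij(2) k0 k1 k2 Nc unfolding CN g'_def Let_def ij(1) fst_conv snd_conv by (elim disjE) simp_all
  qed (use \<delta> t i in auto)
  have h0: "\<bar>X \<xi> t - Y \<xi> t\<bar> \<le> 2 * \<delta> * exp (2*C2*\<bar>t\<bar>)" if "0 \<le> \<xi>" "\<xi> \<le> 2*pi" for \<xi> using main[of "(0,\<xi>)"] that by (simp add: I_def g_def)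
  have h1: "\<bar>u t (X \<xi> t) - v t (Y \<xi> t)\<bar> \<le> 2 * \<delta> * exp (2*C2*\<bar>t\<bar>)" if "0 \<le> \<xi>" "\<xi> \<le> 2*pi" for \<xi> using main[of "(1,\<xi>)"] that by (simp add: I_def g_def)
  have h2: "\<bar>EA \<xi> t - EB \<xi> t\<bar> \<le> 2 * \<delta> * exp (2*C2*\<bar>t\<bar>)" if "0 \<le> \<xi>" "\<xi> \<le> 2*pi" for \<xi> using main[of "(2,\<xi>)"] that by (simp add: I_def g_def)
  show "\<bar>u t x - v t x\<bar> \<le> (1 + R) * (2 * \<delta> * exp (2*C2*\<bar>t\<bar>))"
    by (rule eulerian_bounds(1)[OF X Y t h0 h1 h2[unfolded EA_def EB_def]])
  note p = per_primD[OF A.pp[OF t]] and q = per_primD[OF B.pp[OF t]]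
  \<comment> \<open>the energy between the labels \<open>0\<close> and \<open>2\<pi>\<close> is the total energy\<close>
  have e1: "X (2*pi) t = X 0 t + 2*pi" by (rule A.curve_period[OF X(2) X(2) _ t]) (simp add: X)
  have e2: "Y (2*pi) t = Y 0 t + 2*pi" by (rule B.curve_period[OF Y(2) Y(2) _ t]) (simp add: Y)
  have "EA (2*pi) t = energy (m t) (2*pi)"
    unfolding EA_def e1 by (subst periodic_mean_shift) (use p periodic_unop in auto)
  moreover have "EB (2*pi) t = energy (n t) (2*pi)"
    unfolding EB_def e2 by (subst periodic_mean_shift) (use q periodic_unop in auto)
  ultimately show "\<bar>energy (m t) (2*pi) - energy (n t) (2*pi)\<bar> \<le> 2 * \<delta> * exp (2*C2*\<bar>t\<bar>)"
    using h2[of "2*pi"] by simp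
qed

end

section \<open>The Banach space of bounded periodic functions\<close>

text \<open>
  Functions rather than classes of functions, with the supremum norm, so that evaluation at a point
  is continuous.
\<close>

typedef bp = "{f. \<exists>B. bper B f}" morphisms ev mkbp
  by (intro exI[of _ "\<lambda>x. 0"]) (auto intro!: exI[of _ 0] bper_const)

lemma bp_eqI: "(\<And>x. ev f x = ev g x) \<Longrightarrow> f = g"
  by (metis ev_inject ext)

lemma ev_mkbp: "bper B f \<Longrightarrow> ev (mkbp f) = f"
  by (rule mkbp_inverse) blast

lemma ev_bper: obtains B where "bper B (ev f)"
  using ev[of f] by blast

lemma ev_loc_bdd[simp]: "loc_bdd (ev f)"
  by (rule ev_bper[of f]) (rule bper_loc_bdd)

lemma ev_periodic: "periodic (ev f)"
  by (rule ev_bper[of f]) (rule bper_periodic)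

instantiation bp :: real_normed_vector
begin

definition zero_bp :: bp where "zero_bp = mkbp (\<lambda>x. 0)"
definition plus_bp :: "bp \<Rightarrow> bp \<Rightarrow> bp" where "plus_bp f g = mkbp (\<lambda>x. ev f x + ev g x)"
definition minus_bp :: "bp \<Rightarrow> bp \<Rightarrow> bp" where "minus_bp f g = mkbp (\<lambda>x. ev f x - ev g x)"
definition uminus_bp :: "bp \<Rightarrow> bp" where "uminus_bp f = mkbp (\<lambda>x. - ev f x)"
definition scaleR_bp :: "real \<Rightarrow> bp \<Rightarrow> bp" where "scaleR_bp a f = mkbp (\<lambda>x. a * ev f x)"
definition norm_bp :: "bp \<Rightarrow> real" where "norm_bp f = (SUP x. \<bar>ev f x\<bar>)"
definition dist_bp :: "bp \<Rightarrow> bp \<Rightarrow> real" where "dist_bp f g = norm (minus f g)"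
definition sgn_bp :: "bp \<Rightarrow> bp" where "sgn_bp f = scaleR (inverse (norm f)) f"
definition uniformity_bp :: "(bp \<times> bp) filter" where "uniformity_bp = (INF e\<in>{0<..}. principal {(x, y). dist x y < e})"
definition open_bp :: "bp set \<Rightarrow> bool" where "open_bp U = (\<forall>x\<in>U. \<forall>\<^sub>F (x', y) in uniformity. x' = x \<longrightarrow> y \<in> U)"

lemma ev_ops: "ev 0 x = 0" "ev (f + g) x = ev f x + ev g x" "ev (f - g) x = ev f x - ev g x"
  "ev (- f) x = - ev f x" "ev (a *\<^sub>R f) x = a * ev f x"
proof -
  obtain B C where B: "bper B (ev f)" "bper C (ev g)" using ev_bper by metis
  show "ev 0 x = 0" unfolding zero_bp_def by (subst ev_mkbp[of 0]) (auto intro: bper_const)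
  show "ev (f + g) x = ev f x + ev g x" unfolding plus_bp_def by (subst ev_mkbp[OF bper_add[OF B]]) simp
  show "ev (f - g) x = ev f x - ev g x" unfolding minus_bp_def by (subst ev_mkbp[OF bper_diff[OF B]]) simp
  have m: "bper (\<bar>a\<bar> * B) (\<lambda>x. a * ev f x)" for a by (rule bper_mult[OF bper_const[OF order_refl] B(1)])
  show "ev (a *\<^sub>R f) x = a * ev f x" unfolding scaleR_bp_def by (subst ev_mkbp[OF m]) simp
  show "ev (- f) x = - ev f x" unfolding uminus_bp_def using m[of "-1"] by (subst ev_mkbp) auto
qed

lemma ev_norm_le: "\<bar>ev f x\<bar> \<le> norm f"
proof -
  obtain B where B: "bper B (ev f)" by (rule ev_bper)
  have "bdd_above (range (\<lambda>x. \<bar>ev f x\<bar>))" by (rule bdd_aboveI2[of _ _ B]) (rule bper_bound[OF B])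
  then show ?thesis unfolding norm_bp_def by (intro cSUP_upper) auto
qed

lemma bp_norm_leI: "(\<And>x. \<bar>ev f x\<bar> \<le> B) \<Longrightarrow> norm f \<le> B"
  unfolding norm_bp_def by (intro cSUP_least) auto

instance
proof
  fix f g h :: bp and a b :: real
  show "f + g + h = f + (g + h)" "f + g = g + f" "0 + f = f" "- f + f = 0" "f - g = f + - g"
    "a *\<^sub>R (f + g) = a *\<^sub>R f + a *\<^sub>R g" "(a + b) *\<^sub>R f = a *\<^sub>R f + b *\<^sub>R f" "a *\<^sub>R b *\<^sub>R f = (a * b) *\<^sub>R f" "1 *\<^sub>R f = f"
    by (rule bp_eqI; simp add: ev_ops algebra_simps)+
  show "dist f g = norm (f - g)" "sgn f = inverse (norm f) *\<^sub>R f" by (simp_all add: dist_bp_def sgn_bp_def)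
  show "uniformity = (INF e\<in>{0<..}. principal {(x::bp, y). dist x y < e})" by (rule uniformity_bp_def)
  show "open U = (\<forall>x\<in>U. \<forall>\<^sub>F (x', y) in uniformity. x' = x \<longrightarrow> y \<in> U)" for U :: "bp set" by (rule open_bp_def)
  show "(norm f = 0) = (f = 0)"
  proof
    assume "norm f = 0"
    then show "f = 0" using ev_norm_le[of f] by (intro bp_eqI) (simp add: ev_ops)
  next
    assume "f = 0"
    then have "norm f \<le> 0" by (intro bp_norm_leI) (simp add: ev_ops)
    then show "norm f = 0" using ev_norm_le[of f 0] by linarith
  qed
  show "norm (f + g) \<le> norm f + norm g"
    by (rule bp_norm_leI) (simp add: ev_ops, rule order_trans[OF abs_triangle_ineq add_mono[OF ev_norm_le ev_norm_le]])
  have le: "norm (a *\<^sub>R f) \<le> \<bar>a\<bar> * norm f" for a and f :: bp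
    by (rule bp_norm_leI) (simp add: ev_ops abs_mult ev_norm_le mult_left_mono)
  show "norm (a *\<^sub>R f) = \<bar>a\<bar> * norm f"
  proof (cases "a = 0")
    case True
    then have "norm (a *\<^sub>R f) \<le> 0" using le[of a f] by simp
    then show ?thesis using ev_norm_le[of "a *\<^sub>R f" 0] True by simp
  next
    case False
    have "(1/a) *\<^sub>R (a *\<^sub>R f) = f" using False by (intro bp_eqI) (simp add: ev_ops)
    then have "norm f \<le> \<bar>1/a\<bar> * norm (a *\<^sub>R f)" using le[of "1/a" "a *\<^sub>R f"] by simp
    then show ?thesis using le[of a f] False by (simp add: field_simps abs_divide)
  qed
qed

end

instance bp :: banach
proof
  fix F :: "nat \<Rightarrow> bp" assume C: "Cauchy F"
  have pc: "Cauchy (\<lambda>n. ev (F n) x)" for x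
    unfolding Cauchy_def
  proof (intro allI impI)
    fix e :: real assume "0 < e"
    then obtain M where "\<forall>m\<ge>M. \<forall>n\<ge>M. dist (F m) (F n) < e" using C unfolding Cauchy_def by blast
    then show "\<exists>M. \<forall>m\<ge>M. \<forall>n\<ge>M. dist (ev (F m) x) (ev (F n) x) < e"
    proof (intro exI[of _ M] allI impI)
      fix m n assume "M \<le> m" "M \<le> n"
      then have "norm (F m - F n) < e" using \<open>\<forall>m\<ge>M. \<forall>n\<ge>M. dist (F m) (F n) < e\<close> by (simp add: dist_norm)
      then show "dist (ev (F m) x) (ev (F n) x) < e"
        using ev_norm_le[of "F m - F n" x] by (simp add: dist_norm ev_ops)
    qed
  qed
  define L where "L x = lim (\<lambda>n. ev (F n) x)" for x
  have L: "(\<lambda>n. ev (F n) x) \<longlonglongrightarrow> L x" for x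
    unfolding L_def using pc[of x] by (simp add: Cauchy_convergent_iff convergent_LIMSEQ_iff)
  obtain B where B: "\<And>n. norm (F n) \<le> B" using Cauchy_Bseq[OF C] by (auto simp: Bseq_def)
  have bL: "bper B L"
    unfolding bper_def
  proof (intro conjI allI)
    show "L \<in> borel_measurable borel"
      by (rule borel_measurable_LIMSEQ_real[OF L]) (rule loc_bdd_measurable[OF ev_loc_bdd])
    show "periodic L" unfolding periodic_def L_def using periodicD[OF ev_periodic] by simp
    show "\<bar>L x\<bar> \<le> B" for x
      by (rule tendsto_upperbound[OF tendsto_rabs[OF L]]) (auto intro!: always_eventually order_trans[OF ev_norm_le B])
  qed
  have "F \<longlonglongrightarrow> mkbp L"
  proof (rule LIMSEQ_I)
    fix r :: real assume r: "0 < r"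
    then obtain M where M: "\<forall>m\<ge>M. \<forall>n\<ge>M. dist (F m) (F n) < r/2" using C unfolding Cauchy_def by (meson half_gt_zero)
    show "\<exists>M. \<forall>n\<ge>M. norm (F n - mkbp L) < r"
    proof (intro exI allI impI)
      fix n assume n: "M \<le> n"
      have "norm (F n - mkbp L) \<le> r/2"
      proof (rule bp_norm_leI)
        fix x
        have "(\<lambda>m. \<bar>ev (F n) x - ev (F m) x\<bar>) \<longlonglongrightarrow> \<bar>ev (F n) x - L x\<bar>" by (intro tendsto_intros L)
        moreover have "eventually (\<lambda>m. \<bar>ev (F n) x - ev (F m) x\<bar> \<le> r/2) sequentially"
          unfolding eventually_sequentially
        proof (intro exI allI impI)
          fix m assume "M \<le> m"
          then have "norm (F n - F m) < r/2" using M n by (simp add: dist_norm)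
          then show "\<bar>ev (F n) x - ev (F m) x\<bar> \<le> r/2" using ev_norm_le[of "F n - F m" x] by (simp add: ev_ops)
        qed
        ultimately show "\<bar>ev (F n - mkbp L) x\<bar> \<le> r/2"
          unfolding ev_ops ev_mkbp[OF bL] by (intro tendsto_upperbound) auto
      qed
      then show "norm (F n - mkbp L) < r" using r by simp
    qed
  qed
  then show "convergent F" by (rule convergentI)
qed

lemma ev_mkbp_bounded:
  assumes "f \<in> borel_measurable borel" "periodic f" "\<And>x. \<bar>f x\<bar> \<le> B" shows "ev (mkbp f) = f" "norm (mkbp f) \<le> B"
proof -
  have "bper B f" using assms by (simp add: bper_def)
  then show "ev (mkbp f) = f" by (rule ev_mkbp)
  then show "norm (mkbp f) \<le> B" using assms by (intro bp_norm_leI) simp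
qed

text \<open>
  Operations of the Lagrangian vector field on the space of bounded periodic functions. The primitive
  \<open>Iop\<close> is forced to be periodic, so that it is a bounded linear operator on the whole space; on
  functions of mean zero it is the true primitive (\<open>Iop_zero_mean\<close>).
\<close>

definition bmul :: "bp \<Rightarrow> bp \<Rightarrow> bp" where "bmul f g = mkbp (\<lambda>x. ev f x * ev g x)"
definition cst :: "real \<Rightarrow> bp" where "cst r = mkbp (\<lambda>x. r)"
definition Iop :: "bp \<Rightarrow> bp" where "Iop f = mkbp (\<lambda>x. prim (ev f) (wrap x))"
definition Aop :: "bp \<Rightarrow> real" where "Aop f = prim (ev f) (2*pi)"

lemma ev_bmul: "ev (bmul f g) x = ev f x * ev g x"
proof -
  obtain B C where B: "bper B (ev f)" "bper C (ev g)" using ev_bper by metis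
  show ?thesis unfolding bmul_def by (subst ev_mkbp[OF bper_mult[OF B]]) simp
qed

lemma ev_cst: "ev (cst r) x = r"
  unfolding cst_def by (subst ev_mkbp[OF bper_const[OF order_refl]]) simp

lemma ev_Iop: "ev (Iop f) x = prim (ev f) (wrap x)" "norm (Iop f) \<le> 2*pi * norm f"
proof -
  have b: "\<bar>prim (ev f) (wrap x)\<bar> \<le> 2*pi * norm f" for x
  proof -
    have "\<bar>prim (ev f) (wrap x) - prim (ev f) 0\<bar> \<le> norm f * \<bar>wrap x - 0\<bar>" by (rule prim_lip) (auto simp: ev_norm_le)
    also have "\<dots> \<le> norm f * (2*pi)" using wrap_range[of x] by (intro mult_left_mono) auto
    finally show ?thesis by (simp add: mult.commute)
  qed
  have m: "(\<lambda>x. prim (ev f) (wrap x)) \<in> borel_measurable borel"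
    by (rule measurable_compose[OF wrap_measurable loc_bdd_measurable]) simp
  have p: "periodic (\<lambda>x. prim (ev f) (wrap x))" by (simp add: periodic_def wrap_add)
  show "ev (Iop f) x = prim (ev f) (wrap x)" "norm (Iop f) \<le> 2*pi * norm f"
    using ev_mkbp_bounded[OF m p b] unfolding Iop_def by simp_all
qed

lemma Aop_bound: "\<bar>Aop f\<bar> \<le> 2*pi * norm f"
  using prim_lip[of "ev f" "norm f" "2*pi" 0] ev_norm_le[of f] by (simp add: Aop_def mult.commute)

lemma bounded_bilinear_bmul: "bounded_bilinear bmul"
proof (rule bounded_bilinear.intro)
  fix f g f' g' :: bp and r :: real
  show "bmul (f + f') g = bmul f g + bmul f' g" "bmul f (g + g') = bmul f g + bmul f g'"
    "bmul (r *\<^sub>R f) g = r *\<^sub>R bmul f g" "bmul f (r *\<^sub>R g) = r *\<^sub>R bmul f g"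
    by (rule bp_eqI; simp add: ev_ops ev_bmul algebra_simps)+
  show "\<exists>K. \<forall>f g. norm (bmul f g) \<le> norm f * norm g * K"
  proof (intro exI[of _ 1] allI)
    fix f g show "norm (bmul f g) \<le> norm f * norm g * 1"
      by (rule bp_norm_leI) (simp add: ev_bmul abs_mult mult_mono ev_norm_le)
  qed
qed

lemma bounded_linear_cst: "bounded_linear cst"
proof (rule bounded_linear_intro[of _ 1])
  show "norm (cst x) \<le> norm x * 1" for x by (rule bp_norm_leI) (simp add: ev_cst)
qed (rule bp_eqI; simp add: ev_ops ev_cst)+

lemma prim_ev_ops: "prim (ev (f + g)) x = prim (ev f) x + prim (ev g) x" "prim (ev (a *\<^sub>R f)) x = a * prim (ev f) x"
  "prim (ev (f - g)) x = prim (ev f) x - prim (ev g) x" "prim (ev (cst a)) x = a * x"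
proof -
  have "ev (f + g) = (\<lambda>x. ev f x + ev g x)" "ev (a *\<^sub>R f) = (\<lambda>x. a * ev f x)" "ev (f - g) = (\<lambda>x. ev f x - ev g x)" "ev (cst a) = (\<lambda>x. a)"
    by (auto simp: ev_ops ev_cst)
  then show "prim (ev (f + g)) x = prim (ev f) x + prim (ev g) x" "prim (ev (a *\<^sub>R f)) x = a * prim (ev f) x"
    "prim (ev (f - g)) x = prim (ev f) x - prim (ev g) x" "prim (ev (cst a)) x = a * x"
    by (simp_all add: prim_add prim_diff prim_cmul)
qed

lemma bounded_linear_Iop: "bounded_linear Iop"
proof (rule bounded_linear_intro[of _ "2*pi"])
  show "norm (Iop f) \<le> norm f * (2*pi)" for f using ev_Iop(2)[of f] by (simp add: mult.commute)
qed (rule bp_eqI; simp add: ev_ops ev_Iop prim_ev_ops)+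

lemma bounded_linear_Aop: "bounded_linear Aop"
proof (rule bounded_linear_intro[of _ "2*pi"])
  show "norm (Aop f) \<le> norm f * (2*pi)" for f using Aop_bound[of f] by (simp add: mult.commute)
qed (simp_all add: Aop_def prim_ev_ops)

lemma Iop_zero_mean: assumes "Aop f = 0" shows "ev (Iop f) x = prim (ev f) x"
  using periodic_wrap[OF periodic_prim[OF ev_periodic ev_loc_bdd]] assms unfolding ev_Iop(1) Aop_def by blast

section \<open>Flows of locally Lipschitz vector fields\<close>

definition loc_lip :: "('a::real_normed_vector \<Rightarrow> 'b::real_normed_vector) \<Rightarrow> bool"
  where "loc_lip f \<longleftrightarrow> (\<forall>R. \<exists>L\<ge>0. \<forall>x y. norm x \<le> R \<longrightarrow> norm y \<le> R \<longrightarrow> norm (f x - f y) \<le> L * norm (x - y))"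

lemma loc_lip_bound: assumes "loc_lip f" "0 \<le> R" shows "\<exists>M\<ge>0. \<forall>x. norm x \<le> R \<longrightarrow> norm (f x) \<le> M"
proof -
  obtain L where L: "L \<ge> 0" "\<And>x y. norm x \<le> R \<Longrightarrow> norm y \<le> R \<Longrightarrow> norm (f x - f y) \<le> L * norm (x - y)"
    using assms(1) unfolding loc_lip_def by metis
  have "norm (f x) \<le> L * R + norm (f 0)" if "norm x \<le> R" for x
  proof -
    have "norm (f x - f 0) \<le> L * norm (x - 0)" by (rule L(2)) (use that assms in auto)
    also have "\<dots> \<le> L * R" using that L(1) by (simp add: mult_left_mono)
    finally show ?thesis using norm_triangle_sub[of "f x" "f 0"] by linarith
  qed
  then show ?thesis using L(1) assms(2) by (intro exI[of _ "L * R + norm (f 0)"]) simp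
qed

lemma loc_lip_linear:
  fixes f :: "'a::real_normed_vector \<Rightarrow> 'b::real_normed_vector"
  assumes g: "bounded_linear g" and f: "loc_lip f" shows "loc_lip (\<lambda>x. g (f x))"
  unfolding loc_lip_def
proof
  fix R
  interpret g: bounded_linear g by fact
  obtain L where L: "L \<ge> 0" "\<And>x y. norm x \<le> R \<Longrightarrow> norm y \<le> R \<Longrightarrow> norm (f x - f y) \<le> L * norm (x - y)"
    using f unfolding loc_lip_def by metis
  obtain K where K: "0 \<le> K" "\<And>x. norm (g x) \<le> norm x * K" using g.nonneg_bounded by blast
  show "\<exists>L\<ge>0. \<forall>x y. norm x \<le> R \<longrightarrow> norm y \<le> R \<longrightarrow> norm (g (f x) - g (f y)) \<le> L * norm (x - y)"
  proof (intro exI[of _ "L * K"] conjI allI impI)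
    fix x y :: 'a assume "norm x \<le> R" "norm y \<le> R"
    then have "norm (f x - f y) * K \<le> L * norm (x - y) * K" by (intro mult_right_mono L K)
    then show "norm (g (f x) - g (f y)) \<le> L * K * norm (x - y)" using K(2)[of "f x - f y"] by (simp add: g.diff mult_ac)
  qed (use L K in simp)
qed

lemma loc_lip_bilinear:
  fixes f :: "'a::real_normed_vector \<Rightarrow> 'b::real_normed_vector" and g :: "'a \<Rightarrow> 'c::real_normed_vector"
  assumes h: "bounded_bilinear h" and f: "loc_lip f" and g: "loc_lip g" shows "loc_lip (\<lambda>x. h (f x) (g x))"
  unfolding loc_lip_def
proof
  fix R
  interpret h: bounded_bilinear h by fact
  obtain L where L: "L \<ge> 0" "\<And>x y. norm x \<le> R \<Longrightarrow> norm y \<le> R \<Longrightarrow> norm (f x - f y) \<le> L * norm (x - y)"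
    using f unfolding loc_lip_def by metis
  obtain L' where L': "L' \<ge> 0" "\<And>x y. norm x \<le> R \<Longrightarrow> norm y \<le> R \<Longrightarrow> norm (g x - g y) \<le> L' * norm (x - y)"
    using g unfolding loc_lip_def by metis
  obtain K where K: "0 \<le> K" "\<And>x y. norm (h x y) \<le> norm x * norm y * K" using h.nonneg_bounded by blast
  show "\<exists>L\<ge>0. \<forall>x y. norm x \<le> R \<longrightarrow> norm y \<le> R \<longrightarrow> norm (h (f x) (g x) - h (f y) (g y)) \<le> L * norm (x - y)"
  proof (cases "0 \<le> R")
    case False
    then have "\<not> norm x \<le> R" for x :: 'a using norm_ge_zero[of x] by linarith
    then show ?thesis by (intro exI[of _ 0]) simp
  next
    case True
    obtain M where M: "0 \<le> M" "\<And>x. norm x \<le> R \<Longrightarrow> norm (f x) \<le> M" using loc_lip_bound[OF f True] by blast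
    obtain M' where M': "0 \<le> M'" "\<And>x. norm x \<le> R \<Longrightarrow> norm (g x) \<le> M'" using loc_lip_bound[OF g True] by blast
    show ?thesis
    proof (intro exI[of _ "L * M' * K + M * L' * K"] conjI allI impI)
      fix x y :: 'a assume xy: "norm x \<le> R" "norm y \<le> R"
      have "norm (h (f x) (g x) - h (f y) (g y)) = norm (h (f x - f y) (g x) + h (f y) (g x - g y))"
        by (simp add: h.diff_left h.diff_right)
      also have "\<dots> \<le> norm (f x - f y) * norm (g x) * K + norm (f y) * norm (g x - g y) * K"
        by (rule order_trans[OF norm_triangle_ineq add_mono[OF K(2) K(2)]])
      also have "\<dots> \<le> (L * norm (x - y)) * M' * K + M * (L' * norm (x - y)) * K"
        using xy L L' M M' K by (intro add_mono mult_right_mono mult_mono) auto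
      also have "\<dots> = (L * M' * K + M * L' * K) * norm (x - y)" by (simp add: algebra_simps)
      finally show "norm (h (f x) (g x) - h (f y) (g y)) \<le> (L * M' * K + M * L' * K) * norm (x - y)" .
    qed (use L L' M M' K in simp)
  qed
qed

lemma loc_lip_add:
  fixes f :: "'a::real_normed_vector \<Rightarrow> 'b::real_normed_vector"
  assumes "loc_lip f" "loc_lip g" shows "loc_lip (\<lambda>x. f x + g x)"
  unfolding loc_lip_def
proof
  fix R
  obtain L where L: "L \<ge> 0" "\<And>x y. norm x \<le> R \<Longrightarrow> norm y \<le> R \<Longrightarrow> norm (f x - f y) \<le> L * norm (x - y)"
    using assms(1) unfolding loc_lip_def by metis
  obtain L' where L': "L' \<ge> 0" "\<And>x y. norm x \<le> R \<Longrightarrow> norm y \<le> R \<Longrightarrow> norm (g x - g y) \<le> L' * norm (x - y)"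
    using assms(2) unfolding loc_lip_def by metis
  show "\<exists>L\<ge>0. \<forall>x y. norm x \<le> R \<longrightarrow> norm y \<le> R \<longrightarrow> norm ((f x + g x) - (f y + g y)) \<le> L * norm (x - y)"
  proof (intro exI[of _ "L + L'"] conjI allI impI)
    fix x y :: 'a assume xy: "norm x \<le> R" "norm y \<le> R"
    have "norm ((f x + g x) - (f y + g y)) \<le> norm (f x - f y) + norm (g x - g y)"
      unfolding add_diff_add by (rule norm_triangle_ineq)
    then show "norm ((f x + g x) - (f y + g y)) \<le> (L + L') * norm (x - y)" using L(2)[OF xy] L'(2)[OF xy] by (simp add: distrib_right)
  qed (use L L' in simp)
qed

lemma loc_lip_id: "loc_lip (\<lambda>x. x)"
  unfolding loc_lip_def by (intro allI exI[of _ 1]) simp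

lemma loc_lip_const: "loc_lip (\<lambda>x. a)"
  unfolding loc_lip_def by (intro allI exI[of _ 0]) simp

lemma loc_lip_uminus: "loc_lip f \<Longrightarrow> loc_lip (\<lambda>x. - f x)"
  using loc_lip_linear[OF bounded_linear_minus[OF bounded_linear_ident]] by blast

lemma loc_lip_diff: "loc_lip f \<Longrightarrow> loc_lip g \<Longrightarrow> loc_lip (\<lambda>x. f x - g x)"
  using loc_lip_add[OF _ loc_lip_uminus] by force

lemma loc_lip_Pair: "loc_lip f \<Longrightarrow> loc_lip g \<Longrightarrow> loc_lip (\<lambda>x. (f x, g x))"
  using loc_lip_add[OF loc_lip_linear[of "\<lambda>x. (x, 0)" f] loc_lip_linear[of "\<lambda>x. (0, x)" g]]
  by (simp add: bounded_linear_Pair bounded_linear_ident bounded_linear_zero)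

text \<open>
  Composition with the retraction onto a ball turns locally Lipschitz maps into Lipschitz maps.
\<close>

definition retr :: "real \<Rightarrow> 'a::real_normed_vector \<Rightarrow> 'a"
  where "retr r x = (r / max r (norm x)) *\<^sub>R x"

lemma retr_id: "0 < r \<Longrightarrow> norm x \<le> r \<Longrightarrow> retr r x = x"
  by (simp add: retr_def max_absorb1)

lemma retr_norm: assumes "0 < r" shows "norm (retr r x) \<le> r"
proof -
  have "r / max r (norm x) * norm x \<le> r / max r (norm x) * max r (norm x)"
    using assms by (intro mult_left_mono) auto
  also have "\<dots> = r" using assms by auto
  finally show ?thesis using assms by (simp add: retr_def)
qed

lemma retr_lip: assumes r: "0 < r" shows "norm (retr r x - retr r y) \<le> 2 * norm (x - y)"
proof -
  define a where "a = max r (norm x)"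
  define b where "b = max r (norm y)"
  have ab: "0 < a" "0 < b" "r \<le> a" "norm y \<le> b" using r by (auto simp: a_def b_def)
  have d: "\<bar>a - b\<bar> \<le> norm (x - y)" using norm_triangle_ineq3[of x y] unfolding a_def b_def by linarith
  have "retr r x - retr r y = (r / a) *\<^sub>R (x - y) + (r / a - r / b) *\<^sub>R y"
    by (simp add: retr_def a_def b_def algebra_simps)
  then have "norm (retr r x - retr r y) \<le> \<bar>r / a\<bar> * norm (x - y) + \<bar>r / a - r / b\<bar> * norm y"
    by (metis norm_scaleR norm_triangle_ineq)
  also have "\<bar>r / a - r / b\<bar> * norm y \<le> (r / a) * norm (x - y)"
  proof -
    have "r / a - r / b = (r / a) * ((b - a) / b)" using ab by (simp add: field_simps)
    then have "\<bar>r / a - r / b\<bar> = (r / a) * (\<bar>a - b\<bar> / b)" using ab r by (simp add: abs_mult abs_divide abs_minus_commute)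
    then have "\<bar>r / a - r / b\<bar> * norm y = (r / a) * (\<bar>a - b\<bar> * (norm y / b))" by simp
    also have "\<dots> \<le> (r / a) * (norm (x - y) * 1)"
      using ab r d by (intro mult_left_mono mult_mono) (auto simp: divide_le_eq)
    finally show ?thesis by simp
  qed
  also have "\<bar>r / a\<bar> * norm (x - y) + (r / a) * norm (x - y) \<le> 1 * norm (x - y) + 1 * norm (x - y)"
    using ab r by (intro add_mono mult_right_mono) (auto simp: divide_le_eq)
  finally show ?thesis by simp
qed

text \<open>
  The time depends only on the size of the data, which gives a common interval of existence for
  all data in a ball. It is chosen so that the solution cannot move by more than \<open>1/2\<close>.
\<close>

lemma local_flow:
  fixes f :: "'a::banach \<Rightarrow> 'a"
  assumes f: "loc_lip f" and R0: "0 \<le> R0"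
  obtains T where "0 < T" "\<And>z0. norm z0 \<le> R0 \<Longrightarrow> \<exists>z. z 0 = z0 \<and>
     (\<forall>t\<in>{-T..T}. (z has_vector_derivative f (z t)) (at t) \<and> norm (z t - z0) \<le> 1/2)"
proof -
  define r where "r = R0 + 1"
  have r: "0 < r" using R0 by (simp add: r_def)
  obtain L where L: "L \<ge> 0" "\<And>x y. norm x \<le> r \<Longrightarrow> norm y \<le> r \<Longrightarrow> norm (f x - f y) \<le> L * norm (x - y)"
    using f unfolding loc_lip_def by metis
  obtain M where M: "0 \<le> M" "\<And>x. norm x \<le> r \<Longrightarrow> norm (f x) \<le> M" using loc_lip_bound[OF f, of r] r by auto
  define h where "h x = f (retr r x)" for x
  have hl: "norm (h x - h y) \<le> (2*L+1) * norm (x - y)" for x y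
  proof -
    have "norm (h x - h y) \<le> L * norm (retr r x - retr r y)" unfolding h_def by (intro L retr_norm r)
    also have "\<dots> \<le> L * (2 * norm (x - y))" by (intro mult_left_mono retr_lip r L)
    also have "\<dots> \<le> (2*L+1) * norm (x - y)" by (simp add: distrib_right)
    finally show ?thesis .
  qed
  have hc: "continuous_on UNIV h"
  proof (rule lipschitz_on_continuous_on)
    show "(2*L+1)-lipschitz_on UNIV h" using hl L by (intro lipschitz_onI) (auto simp: dist_norm)
  qed
  define T where "T = 1 / (2*(M+1))"
  have T: "0 < T" using M by (simp add: T_def)
  have "\<exists>z. z 0 = z0 \<and> (\<forall>t\<in>{-T..T}. (z has_vector_derivative f (z t)) (at t) \<and> norm (z t - z0) \<le> 1/2)" if z0: "norm z0 \<le> R0" for z0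
  proof -
    obtain z where z: "z 0 = z0" "\<And>t. (z has_vector_derivative h (z t)) (at t)"
    proof (rule picard_lindeloef[of "2*L+1" "\<lambda>t. h" z0 M])
      show "continuous_on UNIV x \<Longrightarrow> continuous_on UNIV (\<lambda>t. h (x t))" for x :: "real \<Rightarrow> 'a"
        by (rule continuous_on_compose2[OF hc]) auto
      show "norm (h z0) \<le> M" unfolding h_def by (intro M retr_norm r)
      show "0 < 2*L+1" using L by simp
      show "norm (h x - h y) \<le> (2*L+1) * norm (x - y)" for x y by (rule hl)
      fix z assume "z 0 = z0" "\<And>t. (z has_vector_derivative h (z t)) (at t)"
      then show thesis by (rule that)
    qed
    have near: "norm (z t - z0) \<le> 1/2" if t: "t \<in> {-T..T}" for t
    proof -
      have "norm (z t - z 0) \<le> M * \<bar>t\<bar> + 0 * (exp (2*1*\<bar>t\<bar>) - 1) / (2*1)"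
      proof (rule exp_growth_bound[where T=T and g'="\<lambda>t. h (z t)"])
        show "norm (h (z s)) \<le> M + 0 * exp (2*1*\<bar>s\<bar>)" for s unfolding h_def using M(2)[OF retr_norm[OF r]] by simp
      qed (use z t in \<open>auto intro: has_vector_derivative_at_within\<close>)
      also have "\<dots> \<le> M * T" using t M by (auto intro!: mult_left_mono)
      also have "\<dots> \<le> (M+1) * T" using T by simp
      also have "\<dots> = 1/2" using M by (simp add: T_def)
      finally show ?thesis using z(1) by simp
    qed
    have "h (z t) = f (z t)" if "t \<in> {-T..T}" for t
    proof -
      have "norm (z t) \<le> r" using near[OF that] z0 norm_triangle_sub[of "z t" z0] unfolding r_def by linarith
      then show ?thesis by (simp add: h_def retr_id r)
    qed
    then show ?thesis using z near by metis
  qed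
  then show ?thesis using that T by blast
qed

section \<open>Change of variables and moving averages\<close>

lemma set_integral_loc_bdd:
  assumes "loc_bdd f"
  shows "integrable lborel (\<lambda>x. indicator {a<..<b} x * f x)" "(\<integral>x. indicator {a<..<b} x * f x \<partial>lborel) = integral {a..b} f"
proof -
  note [measurable] = loc_bdd_measurable[OF assms]
  have ai: "f absolutely_integrable_on {a<..<b}" using loc_bdd_absint[OF assms] by (simp add: absolutely_integrable_on_Icc_iff_Ioo[symmetric])
  then have "integrable (completion lborel) (\<lambda>x. indicator {a<..<b} x * f x)" by (simp add: set_integrable_def)
  then show "integrable lborel (\<lambda>x. indicator {a<..<b} x * f x)" by (subst (asm) integrable_completion) auto
  have "(\<integral>x. indicator {a<..<b} x * f x \<partial>lborel) = (\<integral>x. indicator {a<..<b} x * f x \<partial>lebesgue)"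
    by (rule integral_completion[symmetric]) simp
  also have "\<dots> = integral {a<..<b} f"
    using set_lebesgue_integral_eq_integral(2)[OF ai] by (simp add: set_lebesgue_integral_def)
  finally show "(\<integral>x. indicator {a<..<b} x * f x \<partial>lborel) = integral {a..b} f" by (simp add: integral_open_interval_real)
qed

text \<open>
  The image of the measure with density \<open>r\<close> under \<open>X\<close> is Lebesgue measure, since both agree on intervals.
\<close>

lemma change_of_variables:
  assumes r: "loc_bdd r" "\<And>x. 0 \<le> r x" and X: "\<And>a b. X b - X a = prim r b - prim r a"
    and XY: "\<And>x. X (Y x) = x" "\<And>\<xi>. Y (X \<xi>) = \<xi>" and mono: "strict_mono X" and Y: "continuous_on UNIV Y"
    and h: "loc_bdd h"
  shows "prim (\<lambda>x. h (Y x)) (X b) - prim (\<lambda>x. h (Y x)) (X a) = prim (\<lambda>\<xi>. h \<xi> * r \<xi>) b - prim (\<lambda>\<xi>. h \<xi> * r \<xi>) a"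
proof -
  have Xc: "continuous_on UNIV X"
  proof -
    have "continuous_on UNIV (\<lambda>x. X 0 + prim r x)" by (intro continuous_intros prim_continuous r(1))
    then show ?thesis
    proof (rule continuous_on_eq)
      show "X 0 + prim r x = X x" for x using X[of x 0] by simp
    qed
  qed
  note [measurable] = loc_bdd_measurable[OF r(1)] loc_bdd_measurable[OF h] borel_measurable_continuous_onI[OF Xc] borel_measurable_continuous_onI[OF Y]
  have less: "X a < X b \<longleftrightarrow> a < b" for a b using mono by (simp add: strict_mono_less)
  have lr: "l < X \<xi> \<longleftrightarrow> Y l < \<xi>" "X \<xi> < l \<longleftrightarrow> \<xi> < Y l" for l \<xi> using less[of "Y l" \<xi>] less[of \<xi> "Y l"] XY by simp_all
  have M: "lborel = distr (density lborel (\<lambda>\<xi>. ennreal (r \<xi>))) borel X"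
  proof (rule lborel_eqI)
    fix l u :: real assume lu: "\<And>b. b \<in> Basis \<Longrightarrow> l \<bullet> b \<le> u \<bullet> b"
    have lu: "l \<le> u" using lu[of 1] by simp
    have Yle: "Y l \<le> Y u" using less[of "Y u" "Y l"] lu unfolding XY by linarith
    have "emeasure (distr (density lborel (\<lambda>\<xi>. ennreal (r \<xi>))) borel X) (box l u) = emeasure (density lborel (\<lambda>\<xi>. ennreal (r \<xi>))) (X -` {l<..<u})"
      by (subst emeasure_distr) auto
    also have "X -` {l<..<u} = {Y l<..<Y u}" using lr by auto
    also have "emeasure (density lborel (\<lambda>\<xi>. ennreal (r \<xi>))) {Y l<..<Y u} = (\<integral>\<^sup>+x. ennreal (r x) * indicator {Y l<..<Y u} x \<partial>lborel)"
      by (subst emeasure_density) auto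
    also have "\<dots> = (\<integral>\<^sup>+x. ennreal (indicator {Y l<..<Y u} x * r x) \<partial>lborel)"
      by (intro nn_integral_cong) (auto split: split_indicator)
    also have "\<dots> = ennreal (\<integral>x. indicator {Y l<..<Y u} x * r x \<partial>lborel)"
      by (rule nn_integral_eq_integral[OF set_integral_loc_bdd(1)[OF r(1)]]) (use r(2) in auto)
    also have "\<dots> = ennreal (prim r (Y u) - prim r (Y l))" by (simp add: set_integral_loc_bdd(2)[OF r(1)] integral_prim[OF r(1) Yle])
    also have "\<dots> = ennreal (u - l)" using X[of "Y u" "Y l"] XY by simp
    finally show "emeasure (distr (density lborel (\<lambda>\<xi>. ennreal (r \<xi>))) borel X) (box l u) = (\<Prod>b\<in>Basis. (u - l) \<bullet> b)" by simp
  qed simp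
  have lhY: "loc_bdd (\<lambda>x. h (Y x))"
    unfolding loc_bdd_def
  proof (intro conjI allI)
    show "(\<lambda>x. h (Y x)) \<in> borel_measurable borel" by measurable
    fix a b
    obtain B where B: "\<forall>x\<in>{Y a..Y b}. \<bar>h x\<bar> \<le> B" using loc_bdd_bound[OF h, of "Y a" "Y b"] by blast
    have "Y x \<in> {Y a..Y b}" if "x \<in> {a..b}" for x
      using lr(2)[where \<xi>="Y x" and l=a] lr(1)[where \<xi>="Y x" and l=b] that unfolding XY by auto
    then show "\<exists>B. \<forall>x\<in>{a..b}. \<bar>h (Y x)\<bar> \<le> B" using B by blast
  qed
  have le: "prim (\<lambda>x. h (Y x)) (X b) - prim (\<lambda>x. h (Y x)) (X a) = prim (\<lambda>\<xi>. h \<xi> * r \<xi>) b - prim (\<lambda>\<xi>. h \<xi> * r \<xi>) a" if ab: "a \<le> b" for a b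
  proof -
    have Xle: "X a \<le> X b" using less[of b a] ab by linarith
    have "prim (\<lambda>x. h (Y x)) (X b) - prim (\<lambda>x. h (Y x)) (X a) = (\<integral>x. indicator {X a<..<X b} x * h (Y x) \<partial>lborel)"
      by (simp add: set_integral_loc_bdd(2)[OF lhY] integral_prim[OF lhY Xle])
    also have "\<dots> = (\<integral>x. indicator {X a<..<X b} x * h (Y x) \<partial>distr (density lborel (\<lambda>\<xi>. ennreal (r \<xi>))) borel X)"
      using M by simp
    also have "\<dots> = (\<integral>\<xi>. indicator {X a<..<X b} (X \<xi>) * h (Y (X \<xi>)) \<partial>density lborel (\<lambda>\<xi>. ennreal (r \<xi>)))"
      by (rule integral_distr) auto
    also have "\<dots> = (\<integral>\<xi>. r \<xi> *\<^sub>R (indicator {X a<..<X b} (X \<xi>) * h (Y (X \<xi>))) \<partial>lborel)"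
      by (rule integral_density) (use r(2) in auto)
    also have "\<dots> = (\<integral>\<xi>. indicator {a<..<b} \<xi> * (h \<xi> * r \<xi>) \<partial>lborel)"
      by (intro Bochner_Integration.integral_cong) (auto simp: XY less split: split_indicator)
    also have "\<dots> = prim (\<lambda>\<xi>. h \<xi> * r \<xi>) b - prim (\<lambda>\<xi>. h \<xi> * r \<xi>) a"
      using h r(1) by (simp add: set_integral_loc_bdd(2) integral_prim ab)
    finally show ?thesis .
  qed
  show ?thesis using le[of a b] le[of b a] by linarith
qed

text \<open>
  The integral over \<open>x\<close> of the mass in the window \<open>[x-\<delta>,x+\<delta>]\<close>; exchanging the integrations amounts to the
  periodicity of the primitive.
\<close>

lemma window_L1:
  assumes "loc_bdd e" "periodic e" "0 \<le> \<delta>"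
  shows "L1_norm (\<lambda>x. prim (\<lambda>z. \<bar>e z\<bar>) (x + \<delta>) - prim (\<lambda>z. \<bar>e z\<bar>) (x + - \<delta>)) = 2 * \<delta> * L1_norm e"
proof -
  let ?G = "prim (\<lambda>z. \<bar>e z\<bar>)"
  have lG: "loc_bdd ?G" using assms by simp
  have per: "?G (x + 2*pi) = ?G x + L1_norm e" for x
    using periodic_mean_shift[of "\<lambda>z. \<bar>e z\<bar>" x] assms by (simp add: periodic_unop L1_norm_def)
  have D: "prim ?G (x + 2*pi) - prim ?G x = L1_norm e * x + prim ?G (2*pi)" for x
    using prim_shift[OF lG, of "2*pi" x] lG unfolding per by (simp add: prim_add)
  have nn: "0 \<le> ?G (x + \<delta>) - ?G (x + - \<delta>)" for x
    using prim_mono[of "\<lambda>z. 0" "\<lambda>z. \<bar>e z\<bar>" "x + - \<delta>" "x + \<delta>"] assms by simp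
  have "L1_norm (\<lambda>x. ?G (x + \<delta>) - ?G (x + - \<delta>)) = prim (\<lambda>x. ?G (x + \<delta>) - ?G (x + - \<delta>)) (2*pi)"
    using nn by (simp add: L1_norm_def)
  also have "\<dots> = (prim ?G (\<delta> + 2*pi) - prim ?G \<delta>) - (prim ?G (- \<delta> + 2*pi) - prim ?G (- \<delta>))"
    using prim_shift[OF lG, of \<delta> "2*pi"] prim_shift[OF lG, of "- \<delta>" "2*pi"]
    by (subst prim_diff[OF loc_bdd_shift[OF lG] loc_bdd_shift[OF lG]]) (simp only: add.commute[of "2*pi"])
  also have "\<dots> = 2 * \<delta> * L1_norm e" unfolding D by (simp add: algebra_simps)
  finally show ?thesis .
qed

text \<open>
  Here \<open>h s x\<close> is a displacement with velocity \<open>w\<close>, and the average of \<open>ms s\<close> between \<open>x\<close> and the displaced point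
  has to converge in \<open>L\<^sup>1\<close> although the functions \<open>ms s\<close> converge only in \<open>L\<^sup>1\<close> themselves. Replacing them by a
  trigonometric polynomial produces an error that is bounded, uniformly in the window, by \<open>window_L1\<close>.
\<close>

lemma moving_average:
  fixes ms :: "real \<Rightarrow> real \<Rightarrow> real"
  assumes m: "bper B mt" and ms: "eventually (\<lambda>s. bper B (ms s)) (at t)"
    and lim: "((\<lambda>s. L1_dist (ms s) mt) \<longlongrightarrow> 0) (at t)"
    and hc: "eventually (\<lambda>s. continuous_on UNIV (h s)) (at t)"
    and \<rho>: "(\<rho> \<longlongrightarrow> 0) (at t)" "eventually (\<lambda>s. \<forall>x. \<bar>h s x / (s - t) - w x\<bar> \<le> \<rho> s) (at t)"
    and w: "continuous_on UNIV w" "\<And>x. \<bar>w x\<bar> \<le> W"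
  shows "((\<lambda>s. L1_norm (\<lambda>x. (prim (ms s) (x + h s x) - prim (ms s) x) / (s - t) - w x * mt x)) \<longlongrightarrow> 0) (at t)"
proof (rule tendstoI)
  fix \<epsilon> :: real assume \<epsilon>: "0 < \<epsilon>"
  have W: "0 \<le> W" using w(2)[of 0] by linarith
  have lw: "loc_bdd w" using w loc_bdd_continuous by blast
  \<comment> \<open>the displacement \<open>h s x\<close> is at most \<open>C \<bar>s - t\<bar>\<close> for \<open>s\<close> near \<open>t\<close>\<close>
  define C where "C = W + 1"
  have C: "0 < C" using W by (simp add: C_def)
  define K where "K = 2*C + W + 1"
  have K: "0 < K" using C W by (simp add: K_def)
  obtain \<phi> where \<phi>: "\<phi> \<in> trig" "\<And>x. \<bar>\<phi> x\<bar> \<le> B + 1" "L1_dist mt \<phi> < \<epsilon> / (2*K)"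
    by (rule trig_L1_dense[OF m, of "\<epsilon> / (2*K)"]) (use \<epsilon> K in auto)
  obtain D where D0: "0 \<le> D" and lip: "\<And>z a. \<bar>\<phi> z - \<phi> a\<bar> \<le> D * \<bar>z - a\<bar>" by (rule trig_lipschitz[OF \<phi>(1)]) blast
  have B0: "0 \<le> B" by (rule bper_nonneg[OF m])
  have l: "loc_bdd \<phi>" "periodic \<phi>" using \<phi> trig_loc_bdd trig_periodic by auto
  have lm: "loc_bdd mt" "periodic mt" using m bper_loc_bdd bper_periodic by auto
  define r where "r s = 2*C * L1_dist (ms s) mt + 2*pi * (D*C*C*\<bar>s - t\<bar> + (B+1) * \<rho> s)" for s
  have "(r \<longlongrightarrow> 2*C * 0 + 2*pi * (D*C*C*\<bar>t - t\<bar> + (B+1) * 0)) (at t)"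
    unfolding r_def[abs_def] by (intro tendsto_intros lim \<rho>)
  then have "eventually (\<lambda>s. r s < \<epsilon>/2) (at t)" using \<epsilon> by (intro order_tendstoD(2)) auto
  moreover have "eventually (\<lambda>s. \<rho> s < 1) (at t)" using \<rho>(1) by (intro order_tendstoD(2)) auto
  moreover have "eventually (\<lambda>s. s \<noteq> t) (at t)" by (simp add: eventually_at_filter)
  ultimately show "eventually (\<lambda>s. dist (L1_norm (\<lambda>x. (prim (ms s) (x + h s x) - prim (ms s) x) / (s - t) - w x * mt x)) 0 < \<epsilon>) (at t)"
    using ms hc \<rho>(2)
  proof eventually_elim
    case (elim s)
    have ls: "loc_bdd (ms s)" "periodic (ms s)" using elim bper_loc_bdd bper_periodic by auto
    define \<delta> where "\<delta> = C * \<bar>s - t\<bar>"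
    have \<delta>: "0 \<le> \<delta>" using C by (simp add: \<delta>_def)
    define a where "a = \<bar>s - t\<bar>"
    have a: "0 < a" using elim by (simp add: a_def)
    have hq: "\<bar>h s x / (s - t)\<bar> \<le> C" for x
    proof -
      have "\<bar>h s x / (s - t) - w x\<bar> \<le> 1" using elim(6) elim(2) by (meson less_imp_le order_trans)
      then show ?thesis using w(2)[of x] unfolding C_def by linarith
    qed
    have h\<delta>: "\<bar>h s x\<bar> \<le> \<delta>" for x
    proof -
      have "\<bar>h s x\<bar> / a \<le> C" using hq[of x] by (simp add: a_def abs_divide)
      then show ?thesis using a by (simp add: \<delta>_def a_def[symmetric] divide_le_eq)
    qed
    define e where "e x = ms s x - \<phi> x" for x
    have le: "loc_bdd e" "periodic e" unfolding e_def[abs_def] using ls l by (auto intro: periodic_binop)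
    let ?G = "prim (\<lambda>z. \<bar>e z\<bar>)"
    let ?win = "\<lambda>x. (1/a) * (?G (x + \<delta>) - ?G (x + - \<delta>))"
    let ?E = "\<lambda>x. (prim (ms s) (x + h s x) - prim (ms s) x) / (s - t) - w x * mt x"
    let ?c = "D*C*C*a + (B+1) * \<rho> s"
    have pcomp: "loc_bdd (\<lambda>x. prim f (x + h s x))" if "loc_bdd f" for f
      by (rule loc_bdd_continuous, rule continuous_on_compose2[OF prim_continuous[OF that, of UNIV]])
        (use elim(5) in \<open>auto intro!: continuous_intros\<close>)
    have lE: "loc_bdd ?E" using ls lw lm pcomp by simp
    have lwin: "loc_bdd ?win" using le by (intro loc_bdd_mult loc_bdd_const loc_bdd_diff loc_bdd_shift loc_bdd_prim loc_bdd_abs) auto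
    have pw: "\<bar>?E x\<bar> \<le> \<bar>(?win x + ?c) + W * \<bar>mt x - \<phi> x\<bar>\<bar>" for x
    proof -
      have est: "\<bar>prim f (x + h s x) - prim f x\<bar> \<le> M * \<delta>" if "loc_bdd f" "\<And>z. \<bar>z - x\<bar> \<le> \<delta> \<Longrightarrow> \<bar>f z\<bar> \<le> M" for f M
      proof (cases "0 \<le> h s x")
        case True
        have "\<bar>prim f (x + h s x) - prim f x\<bar> \<le> M * (x + h s x - x)" by (rule prim_bound) (use that h\<delta>[of x] True in auto)
        also have "\<dots> \<le> M * \<delta>" using h\<delta>[of x] that(2)[of x] \<delta> True by (intro mult_left_mono) auto
        finally show ?thesis .
      next
        case False
        have "\<bar>prim f x - prim f (x + h s x)\<bar> \<le> M * (x - (x + h s x))" by (rule prim_bound) (use that h\<delta>[of x] False in auto)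
        also have "\<dots> \<le> M * \<delta>" using h\<delta>[of x] that(2)[of x] \<delta> False by (intro mult_left_mono) auto
        finally show ?thesis by (simp add: abs_minus_commute)
      qed
      have 1: "\<bar>prim e (x + h s x) - prim e x\<bar> \<le> ?G (x + \<delta>) - ?G (x + - \<delta>)"
      proof -
        have mono: "?G z \<le> ?G z'" if "z \<le> z'" for z z' using prim_mono[of "\<lambda>z. 0" "\<lambda>z. \<bar>e z\<bar>" z z'] le that by simp
        have "\<bar>prim e (x + h s x) - prim e x\<bar> \<le> \<bar>?G (x + h s x) - ?G x\<bar>"
          using prim_abs_le[OF le(1), of x "x + h s x"] prim_abs_le[OF le(1), of "x + h s x" x]
          by (cases "0 \<le> h s x") auto
        then show ?thesis using mono[of "x + h s x" "x + \<delta>"] mono[of "x + - \<delta>" "x + h s x"] mono[of x "x + \<delta>"] mono[of "x + - \<delta>" x] h\<delta>[of x] \<delta>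
          by (auto simp: abs_le_iff)
      qed
      have 2: "\<bar>(prim \<phi> (x + h s x) - prim \<phi> x) - h s x * \<phi> x\<bar> \<le> (D * \<delta>) * \<delta>"
      proof -
        have "(prim \<phi> (x + h s x) - prim \<phi> x) - h s x * \<phi> x = prim (\<lambda>z. \<phi> z - \<phi> x) (x + h s x) - prim (\<lambda>z. \<phi> z - \<phi> x) x"
          using l by (simp add: prim_diff algebra_simps)
        moreover have "\<bar>prim (\<lambda>z. \<phi> z - \<phi> x) (x + h s x) - prim (\<lambda>z. \<phi> z - \<phi> x) x\<bar> \<le> (D * \<delta>) * \<delta>"
        proof (rule est)
          show "\<bar>\<phi> z - \<phi> x\<bar> \<le> D * \<delta>" if "\<bar>z - x\<bar> \<le> \<delta>" for z
            using lip[of z x] mult_left_mono[OF that D0] by linarith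
        qed (use l in simp)
        ultimately show ?thesis by simp
      qed
      \<comment> \<open>four errors: replacing \<open>ms s\<close> by \<open>\<phi>\<close>, the variation of \<open>\<phi>\<close> over the window, the velocity, and replacing \<open>\<phi>\<close> by \<open>mt\<close>\<close>
      have dec: "?E x = (prim e (x + h s x) - prim e x) / (s - t) + ((prim \<phi> (x + h s x) - prim \<phi> x) - h s x * \<phi> x) / (s - t)
         + (h s x / (s - t) - w x) * \<phi> x + w x * (\<phi> x - mt x)"
      proof -
        have "prim e z = prim (ms s) z - prim \<phi> z" for z unfolding e_def[abs_def] by (rule prim_diff[OF ls(1) l(1)])
        moreover have "(M - M') / d - w' * t' = ((M - P) - (M' - P')) / d + ((P - P') - h' * f) / d + (h' / d - w') * f + w' * (f - t')"
          for M M' P P' d w' t' h' f :: real by (simp add: diff_divide_distrib add_divide_distrib algebra_simps)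
        ultimately show ?thesis by simp
      qed
      have d1: "\<bar>(prim e (x + h s x) - prim e x) / (s - t)\<bar> \<le> ?win x"
        using divide_right_mono[OF 1, of a] a by (simp add: abs_divide a_def)
      have d2: "\<bar>((prim \<phi> (x + h s x) - prim \<phi> x) - h s x * \<phi> x) / (s - t)\<bar> \<le> D*C*C*a"
      proof -
        have "\<bar>((prim \<phi> (x + h s x) - prim \<phi> x) - h s x * \<phi> x)\<bar> / a \<le> ((D * \<delta>) * \<delta>) / a" using divide_right_mono[OF 2, of a] a by simp
        also have "\<dots> = D*C*C*a" using a by (simp add: \<delta>_def a_def[symmetric])
        finally show ?thesis by (simp add: abs_divide a_def)
      qed
      have d3: "\<bar>(h s x / (s - t) - w x) * \<phi> x\<bar> \<le> (B+1) * \<rho> s"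
      proof -
        have "\<bar>h s x / (s - t) - w x\<bar> * \<bar>\<phi> x\<bar> \<le> \<rho> s * (B+1)"
          using elim(6) \<phi>(2)[of x] by (intro mult_mono) (auto intro: order_trans[OF abs_ge_zero])
        then show ?thesis by (simp add: abs_mult mult.commute)
      qed
      have d4: "\<bar>w x * (\<phi> x - mt x)\<bar> \<le> W * \<bar>mt x - \<phi> x\<bar>"
        unfolding abs_mult abs_minus_commute[of "\<phi> x"] by (rule mult_right_mono[OF w(2)]) simp
      have "\<bar>?E x\<bar> \<le> (?win x + ?c) + W * \<bar>mt x - \<phi> x\<bar>"
        unfolding dec using d1 d2 d3 d4 by linarith
      then show ?thesis by linarith
    qed
    have c0: "0 \<le> ?c"
    proof -
      have "0 \<le> \<rho> s" using elim(6) abs_ge_zero order_trans by blast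
      then show ?thesis using D0 C a B0 by simp
    qed
    have l3: "loc_bdd (\<lambda>x. W * \<bar>mt x - \<phi> x\<bar>)" using lm l by simp
    have l2: "loc_bdd (\<lambda>x. ?win x + ?c)" by (rule loc_bdd_add[OF lwin loc_bdd_const])
    have "L1_norm ?E \<le> L1_norm (\<lambda>x. (?win x + ?c) + W * \<bar>mt x - \<phi> x\<bar>)"
      by (rule L1_norm_mono[OF lE loc_bdd_add[OF l2 l3] pw])
    also have "\<dots> \<le> L1_norm (\<lambda>x. ?win x + ?c) + L1_norm (\<lambda>x. W * \<bar>mt x - \<phi> x\<bar>)"
      by (rule L1_norm_triangle[OF l2 l3])
    also have "L1_norm (\<lambda>x. ?win x + ?c) \<le> L1_norm ?win + L1_norm (\<lambda>x. ?c)"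
      by (rule L1_norm_triangle[OF lwin loc_bdd_const])
    also have "L1_norm ?win = (1/a) * (2 * \<delta> * L1_norm e)"
      unfolding L1_norm_cmul window_L1[OF le \<delta>] using a by simp
    also have "\<dots> = 2 * C * L1_norm e" using a by (simp add: \<delta>_def a_def[symmetric])
    also have "L1_norm (\<lambda>x. ?c) = 2*pi * ?c" using c0 by (simp add: L1_norm_def mult.commute)
    also have "L1_norm (\<lambda>x. W * \<bar>mt x - \<phi> x\<bar>) = W * L1_dist mt \<phi>"
      unfolding L1_norm_cmul using W by (simp add: L1_norm_def)
    also have "2 * C * L1_norm e + 2*pi * ?c + W * L1_dist mt \<phi> \<le> r s + (2*C + W) * L1_dist mt \<phi>"
    proof -
      have "L1_norm e \<le> L1_dist (ms s) mt + L1_dist mt \<phi>"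
        unfolding e_def[abs_def] by (rule L1_norm_diff_triangle) (use ls lm l in auto)
      then have "2*C * L1_norm e \<le> 2*C * (L1_dist (ms s) mt + L1_dist mt \<phi>)" using C by (intro mult_left_mono) auto
      then show ?thesis unfolding r_def a_def by (simp add: algebra_simps)
    qed
    also have "(2*C + W) * L1_dist mt \<phi> \<le> K * (\<epsilon> / (2*K))"
      using \<phi>(3) C W lm l by (intro mult_mono) (auto simp: K_def intro!: L1_norm_nonneg)
    also have "K * (\<epsilon> / (2*K)) = \<epsilon>/2" using K by simp
    finally have "L1_norm ?E < \<epsilon>" using elim(1) by linarith
    then show ?case using L1_norm_nonneg[OF lE] by simp
  qed
qed

section \<open>Existence in Lagrangian coordinates\<close>

text \<open>
  Lagrangian coordinates. Along characteristics the slope solves the Riccati equation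
  \<open>2c m' = u - k - m\<^sup>2\<close>, and the Jacobian of the flow \<open>X\<close> satisfies \<open>(\<partial>\<^sub>\<xi> X)' = m (\<partial>\<^sub>\<xi> X)/c\<close>. With the square root
  \<open>q\<close> of the Jacobian and \<open>p = q m\<close> this becomes \<open>2c q' = p\<close>, \<open>2c p' = (u - k) q\<close>: the cubic nonlinearity and
  the transport have disappeared, and the vector field is a polynomial expression in \<open>q\<close>, \<open>p\<close>, \<open>v\<close> built from
  bounded operators. Position and value are recovered from \<open>\<partial>\<^sub>\<xi> X = q\<^sup>2\<close> and \<open>\<partial>\<^sub>\<xi> u = q p\<close>; the numbers \<open>y\<close> and \<open>v\<close> are
  their values at the label \<open>0\<close>. The constant \<open>lagkap\<close> normalises the source to mean zero.
\<close>

definition lagU :: "bp \<Rightarrow> bp \<Rightarrow> real \<Rightarrow> bp" where "lagU q p v = cst v + Iop (bmul q p)"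
definition lagsrc :: "bp \<Rightarrow> bp \<Rightarrow> real \<Rightarrow> bp" where "lagsrc q p v = bmul p p + bmul (lagU q p v) (bmul q q)"
definition lagk :: "bp \<Rightarrow> bp \<Rightarrow> real \<Rightarrow> real" where "lagk q p v = Aop (lagsrc q p v) / (2*pi)"
definition lagg :: "bp \<Rightarrow> bp \<Rightarrow> real \<Rightarrow> bp" where "lagg q p v = lagsrc q p v - lagk q p v *\<^sub>R bmul q q"
definition lagkap :: "bp \<Rightarrow> bp \<Rightarrow> real \<Rightarrow> real"
  where "lagkap q p v = Aop (bmul (Iop (lagg q p v)) (bmul q q)) / (2*pi)"

definition lagf :: "real \<Rightarrow> bp \<times> bp \<times> real \<times> real \<Rightarrow> bp \<times> bp \<times> real \<times> real"
  where "lagf c z = (let q = fst z; p = fst (snd z); v = fst (snd (snd z)) in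
    ((1/(2*c)) *\<^sub>R p, (1/(2*c)) *\<^sub>R bmul (lagU q p v - cst (lagk q p v)) q,
     - lagkap q p v / (2*c), v / c - c / 2))"

lemma bounded_linear_divide_const: "bounded_linear (\<lambda>x::real. x / a)"
  using bounded_linear_mult_left[of "1/a"] by simp

lemma lagf_loc_lip: "loc_lip (lagf c)"
proof -
  let ?q = "\<lambda>z::bp \<times> bp \<times> real \<times> real. fst z" and ?p = "\<lambda>z::bp \<times> bp \<times> real \<times> real. fst (snd z)"
    and ?v = "\<lambda>z::bp \<times> bp \<times> real \<times> real. fst (snd (snd z))"
  note lin = loc_lip_linear[OF bounded_linear_cst] loc_lip_linear[OF bounded_linear_Iop] loc_lip_linear[OF bounded_linear_Aop]
  have q: "loc_lip ?q" by (rule loc_lip_linear[OF bounded_linear_fst loc_lip_id])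
  have p: "loc_lip ?p" by (rule loc_lip_linear[OF bounded_linear_fst loc_lip_linear[OF bounded_linear_snd loc_lip_id]])
  have v: "loc_lip ?v"
    by (rule loc_lip_linear[OF bounded_linear_fst loc_lip_linear[OF bounded_linear_snd loc_lip_linear[OF bounded_linear_snd loc_lip_id]]])
  note mul = loc_lip_bilinear[OF bounded_bilinear_bmul]
  have U: "loc_lip (\<lambda>z. lagU (?q z) (?p z) (?v z))"
    unfolding lagU_def by (intro loc_lip_add lin mul q p v)
  have src: "loc_lip (\<lambda>z. lagsrc (?q z) (?p z) (?v z))"
    unfolding lagsrc_def by (intro loc_lip_add mul U q p)
  have k: "loc_lip (\<lambda>z. lagk (?q z) (?p z) (?v z))"
    unfolding lagk_def by (rule loc_lip_linear[OF bounded_linear_divide_const]) (intro lin src)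
  have g: "loc_lip (\<lambda>z. lagg (?q z) (?p z) (?v z))"
    unfolding lagg_def by (intro loc_lip_diff src loc_lip_bilinear[OF bounded_bilinear_scaleR] k mul q)
  have kap: "loc_lip (\<lambda>z. lagkap (?q z) (?p z) (?v z))"
    unfolding lagkap_def by (rule loc_lip_linear[OF bounded_linear_divide_const]) (intro lin mul g q)
  show ?thesis
    unfolding lagf_def Let_def
    by (intro loc_lip_Pair loc_lip_linear[OF bounded_linear_scaleR_right] p mul loc_lip_diff U lin k q
        loc_lip_linear[OF bounded_linear_divide_const] loc_lip_uminus kap v loc_lip_const)
qed

lemma norm_bmul: "norm (bmul f g) \<le> norm f * norm g"
  by (rule bp_norm_leI) (simp add: ev_bmul abs_mult mult_mono ev_norm_le)

lemma norm_cst: "norm (cst a) \<le> \<bar>a\<bar>"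
  by (rule bp_norm_leI) (simp add: ev_cst)

lemma Aop_ops: "Aop (f + g) = Aop f + Aop g" "Aop (f - g) = Aop f - Aop g" "Aop (r *\<^sub>R f) = r * Aop f"
  by (simp_all add: Aop_def prim_ev_ops)

lemma norm_fst: "norm (fst w) \<le> norm w" and norm_snd: "norm (snd w) \<le> norm w"
  using norm_fst_le[of "fst w" "snd w"] norm_snd_le[of "snd w" "fst w"] by simp_all

lemma vector_derivative_quotient:
  assumes "(f has_vector_derivative f') (at t)"
  shows "((\<lambda>s. norm ((1/(s - t)) *\<^sub>R (f s - f t) - f')) \<longlongrightarrow> 0) (at t)"
proof -
  have "((\<lambda>s. norm ((f s - f t) - (s - t) *\<^sub>R f') / norm (s - t)) \<longlongrightarrow> 0) (at t)"
    using assms unfolding has_vector_derivative_def has_derivative_iff_norm by simp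
  moreover have "eventually (\<lambda>s. norm ((f s - f t) - (s - t) *\<^sub>R f') / norm (s - t) = norm ((1/(s - t)) *\<^sub>R (f s - f t) - f')) (at t)"
    unfolding eventually_at_filter
  proof (intro always_eventually allI impI)
    fix s assume s: "s \<noteq> t"
    have "(1/(s - t)) *\<^sub>R (f s - f t) - f' = (1/(s - t)) *\<^sub>R ((f s - f t) - (s - t) *\<^sub>R f')"
      using s by (simp add: scaleR_diff_right)
    then show "norm ((f s - f t) - (s - t) *\<^sub>R f') / norm (s - t) = norm ((1/(s - t)) *\<^sub>R (f s - f t) - f')" by simp
  qed
  ultimately show ?thesis by (rule Lim_transform_eventually)
qed

text \<open>
  The bound \<open>1/2\<close> from below for \<open>q\<close> keeps the flow invertible. It holds because \<open>q\<close> starts at \<open>1\<close> and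
  moves by at most \<open>1/2\<close>.
\<close>

locale lagrangian =
  fixes c T R :: real and q p :: "real \<Rightarrow> bp" and v y :: "real \<Rightarrow> real" and u0 m0 :: "real \<Rightarrow> real" and S :: real
  assumes c: "0 < c" and T: "0 < T"
    and dq: "\<And>t. t \<in> {-T..T} \<Longrightarrow> (q has_vector_derivative (1/(2*c)) *\<^sub>R p t) (at t)"
    and dp: "\<And>t. t \<in> {-T..T} \<Longrightarrow> (p has_vector_derivative (1/(2*c)) *\<^sub>R bmul (lagU (q t) (p t) (v t) - cst (lagk (q t) (p t) (v t))) (q t)) (at t)"
    and dv: "\<And>t. t \<in> {-T..T} \<Longrightarrow> (v has_vector_derivative - lagkap (q t) (p t) (v t) / (2*c)) (at t)"
    and dy: "\<And>t. t \<in> {-T..T} \<Longrightarrow> (y has_vector_derivative v t / c - c / 2) (at t)"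
    and ini: "q 0 = cst 1" "p 0 = mkbp m0" "v 0 = u0 0" "y 0 = 0" and data: "per_prim S u0 m0"
    and low: "\<And>t x. t \<in> {-T..T} \<Longrightarrow> 1/2 \<le> ev (q t) x"
    and nb: "\<And>t. t \<in> {-T..T} \<Longrightarrow> norm (q t) \<le> R" "\<And>t. t \<in> {-T..T} \<Longrightarrow> norm (p t) \<le> R" "\<And>t. t \<in> {-T..T} \<Longrightarrow> \<bar>v t\<bar> \<le> R"
begin

definition "U t = lagU (q t) (p t) (v t)"
definition "sr t = lagsrc (q t) (p t) (v t)"
definition "k t = lagk (q t) (p t) (v t)"
definition "g t = lagg (q t) (p t) (v t)"
definition "kap t = lagkap (q t) (p t) (v t)"
definition "Phi t = Iop (g t) - cst (kap t)"
definition "BU = R + 2*pi*(R*R)"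
definition "BK = R*R + BU*(R*R)"

lemma T0: "0 \<in> {-T..T}" using T by simp
lemma R: "0 \<le> R" using nb(1)[OF T0] norm_ge_zero order_trans by blast

lemma U_bound: assumes "t \<in> {-T..T}" shows "norm (U t) \<le> BU"
proof -
  have "norm (bmul (q t) (p t)) \<le> R * R"
    by (rule order_trans[OF norm_bmul mult_mono[OF nb(1)[OF assms] nb(2)[OF assms]]]) (auto simp: R)
  then have "norm (Iop (bmul (q t) (p t))) \<le> 2*pi*(R*R)"
    by (intro order_trans[OF ev_Iop(2)] mult_left_mono) auto
  moreover have "norm (cst (v t)) \<le> R" using norm_cst[of "v t"] nb(3)[OF assms] by linarith
  ultimately show ?thesis unfolding U_def lagU_def BU_def by (meson add_mono norm_triangle_ineq order_trans)
qed

lemma k_bound: assumes "t \<in> {-T..T}" shows "\<bar>k t\<bar> \<le> BK"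
proof -
  have BU: "0 \<le> BU" using R by (simp add: BU_def)
  have "norm (bmul (q t) (q t)) \<le> R*R" "norm (bmul (p t) (p t)) \<le> R*R"
    by (rule order_trans[OF norm_bmul mult_mono]; use nb[OF assms] R in simp)+
  then have "norm (bmul (U t) (bmul (q t) (q t))) \<le> BU*(R*R)" "norm (bmul (p t) (p t)) \<le> R*R"
    by (auto intro!: order_trans[OF norm_bmul] mult_mono U_bound[OF assms] BU)
  then have "norm (sr t) \<le> BK"
    unfolding sr_def lagsrc_def BK_def U_def[symmetric] by (meson add_mono add.commute norm_triangle_ineq order_trans)
  then have "\<bar>Aop (sr t)\<bar> \<le> 2*pi*BK" by (intro order_trans[OF Aop_bound] mult_left_mono) auto
  then show ?thesis by (simp add: k_def lagk_def sr_def[symmetric] field_simps)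
qed

lemma g_eq: "g t = sr t - k t *\<^sub>R bmul (q t) (q t)"
  by (simp add: g_def lagg_def sr_def k_def)

lemma dqp: assumes "t \<in> {-T..T}"
  shows "((\<lambda>t. bmul (q t) (p t)) has_vector_derivative (1/(2*c)) *\<^sub>R g t) (at t)"
proof -
  have "((\<lambda>t. bmul (q t) (p t)) has_vector_derivative
    (bmul (q t) ((1/(2*c)) *\<^sub>R bmul (U t - cst (k t)) (q t)) + bmul ((1/(2*c)) *\<^sub>R p t) (p t))) (at t)"
    unfolding U_def k_def
    by (rule bounded_bilinear.has_vector_derivative[OF bounded_bilinear_bmul dq[OF assms] dp[OF assms]])
  moreover have "bmul (q t) ((1/(2*c)) *\<^sub>R bmul (U t - cst (k t)) (q t)) + bmul ((1/(2*c)) *\<^sub>R p t) (p t) = (1/(2*c)) *\<^sub>R g t"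
    by (rule bp_eqI) (simp add: g_eq sr_def lagsrc_def U_def[symmetric] ev_ops ev_bmul ev_cst algebra_simps add_divide_distrib diff_divide_distrib)
  ultimately show ?thesis by simp
qed

lemma dqq: assumes "t \<in> {-T..T}"
  shows "((\<lambda>t. bmul (q t) (q t)) has_vector_derivative (1/c) *\<^sub>R bmul (q t) (p t)) (at t)"
proof -
  have "((\<lambda>t. bmul (q t) (q t)) has_vector_derivative (bmul (q t) ((1/(2*c)) *\<^sub>R p t) + bmul ((1/(2*c)) *\<^sub>R p t) (q t))) (at t)"
    by (rule bounded_bilinear.has_vector_derivative[OF bounded_bilinear_bmul dq[OF assms] dq[OF assms]])
  moreover have "bmul (q t) ((1/(2*c)) *\<^sub>R p t) + bmul ((1/(2*c)) *\<^sub>R p t) (q t) = (1/c) *\<^sub>R bmul (q t) (p t)"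
    by (rule bp_eqI) (simp add: ev_ops ev_bmul)
  ultimately show ?thesis by simp
qed

lemma p0: "ev (p 0) = m0"
  unfolding ini by (rule ev_mkbp[OF per_primD(1)[OF data]])

text \<open>
  The two integrals express that \<open>u\<close> and \<open>X - id\<close> are periodic. Their deviations from the right
  values satisfy a linear system of differential equations and vanish initially.
\<close>

lemma conserved:
  assumes t: "t \<in> {-T..T}" shows "Aop (bmul (q t) (p t)) = 0" "Aop (bmul (q t) (q t)) = 2*pi"
proof -
  \<comment> \<open>the two deviations \<open>a\<close> and \<open>b\<close>, indexed by a truth value\<close>
  define a where "a t = Aop (bmul (q t) (p t))" for t
  define b where "b t = Aop (bmul (q t) (q t)) - 2*pi" for t
  define G where "G i = (if i then a else b)" for i
  define G' where "G' i t = (if i then - k t / (2*c) * b t else a t / c)" for i t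
  define C where "C = BK/(2*c) + 1/c"
  have BK: "0 \<le> BK" using k_bound[OF T0] by linarith
  have C: "0 < C" using BK c by (simp add: C_def add_nonneg_pos)
  have sc: "Aop (r *\<^sub>R f) = r * Aop f" "Aop (f - h) = Aop f - Aop h" for r f h by (simp_all add: Aop_def prim_ev_ops)
  have da: "(a has_real_derivative - k t / (2*c) * b t) (at t)" if t: "t \<in> {-T..T}" for t
  proof -
    have "(a has_vector_derivative Aop ((1/(2*c)) *\<^sub>R g t)) (at t)"
      unfolding a_def[abs_def] by (rule bounded_linear.has_vector_derivative[OF bounded_linear_Aop dqp[OF t]])
    moreover have "Aop ((1/(2*c)) *\<^sub>R g t) = - k t / (2*c) * b t"
    proof -
      have S: "Aop (sr t) = k t * (2*pi)" by (simp add: k_def lagk_def sr_def)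
      show ?thesis unfolding sc g_eq S b_def using c by (simp add: field_simps)
    qed
    ultimately show ?thesis by (simp add: has_real_derivative_iff_has_vector_derivative)
  qed
  have db: "(b has_real_derivative a t / c) (at t)" if t: "t \<in> {-T..T}" for t
  proof -
    have "((\<lambda>t. Aop (bmul (q t) (q t))) has_vector_derivative Aop ((1/c) *\<^sub>R bmul (q t) (p t))) (at t)"
      by (rule bounded_linear.has_vector_derivative[OF bounded_linear_Aop dqq[OF t]])
    then have "((\<lambda>t. Aop (bmul (q t) (q t))) has_real_derivative a t / c) (at t)"
      by (simp add: has_real_derivative_iff_has_vector_derivative a_def sc)
    from DERIV_diff[OF this DERIV_const, of "2*pi"] show ?thesis by (simp add: b_def[abs_def])
  qed
  have nab: "\<bar>a t\<bar> \<le> 2*pi*(R*R)" "\<bar>b t\<bar> \<le> 2*pi*(R*R) + 2*pi" if t: "t \<in> {-T..T}" for t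
  proof -
    have "norm (bmul (q t) (q t)) \<le> R*R" "norm (bmul (q t) (p t)) \<le> R*R"
      by (rule order_trans[OF norm_bmul mult_mono]; use nb[OF t] R in simp)+
    then have 1: "2*pi * norm (bmul (q t) (q t)) \<le> 2*pi*(R*R)" "2*pi * norm (bmul (q t) (p t)) \<le> 2*pi*(R*R)"
      by (intro mult_left_mono; simp)+
    show "\<bar>a t\<bar> \<le> 2*pi*(R*R)" using Aop_bound[of "bmul (q t) (p t)"] 1 unfolding a_def by linarith
    have "\<bar>b t\<bar> \<le> \<bar>Aop (bmul (q t) (q t))\<bar> + \<bar>2*pi\<bar>" unfolding b_def by (rule abs_triangle_ineq4)
    then show "\<bar>b t\<bar> \<le> 2*pi*(R*R) + 2*pi" using Aop_bound[of "bmul (q t) (q t)"] 1 pi_gt_zero by linarith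
  qed
  have "\<bar>G i t\<bar> \<le> 2 * 0 * exp (2*C*\<bar>t\<bar>)" for i
  proof (rule gronwall_family[OF C, where I=UNIV and g=G and g'=G' and T=T and K="2*pi*(R*R) + 2*pi"])
    fix i s assume s: "s \<in> {-T..T}"
    show "(G i has_real_derivative G' i s) (at s within {-T..T})"
      unfolding G_def G'_def using da[OF s] db[OF s] by (cases i) (auto intro: has_field_derivative_at_within)
    show "\<bar>G i s\<bar> \<le> 2*pi*(R*R) + 2*pi"
      unfolding G_def using nab[OF s] by (cases i) (auto intro: order_trans)
  next
    fix i
    have "ev (bmul (q 0) (p 0)) = m0" by (rule ext) (simp add: ini(1) ev_bmul ev_cst p0)
    moreover have "ev (bmul (q 0) (q 0)) = (\<lambda>x. 1)" by (rule ext) (simp add: ini(1) ev_bmul ev_cst)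
    ultimately show "\<bar>G i 0\<bar> \<le> 0"
      unfolding G_def a_def b_def Aop_def using per_primD(6)[OF data] by (cases i) auto
  next
    fix s N i assume s: "s \<in> {-T..T}" and N: "0 \<le> N" and le: "\<And>j. j \<in> UNIV \<Longrightarrow> \<bar>G j s\<bar> \<le> N"
    have ab: "\<bar>a s\<bar> \<le> N" "\<bar>b s\<bar> \<le> N" using le[of True] le[of False] by (simp_all add: G_def)
    have CN: "C * N = BK/(2*c) * N + N/c" by (simp add: C_def distrib_right)
    have "\<bar>- k s / (2*c)\<bar> * \<bar>b s\<bar> \<le> BK/(2*c) * N"
      using ab k_bound[OF s] c BK by (intro mult_mono) (auto simp: abs_divide intro!: divide_right_mono)
    moreover have "\<bar>a s / c\<bar> \<le> N/c" using ab c by (simp add: abs_divide divide_right_mono)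
    moreover have "0 \<le> BK/(2*c) * N" "0 \<le> N/c" using BK N c by simp_all
    ultimately show "\<bar>G' i s\<bar> \<le> C * N" unfolding CN G'_def by (cases i) (simp_all add: abs_mult)
  qed (use t in auto)
  then have "G True t = 0" "G False t = 0" by (simp_all add: abs_le_zero_iff)
  then show "Aop (bmul (q t) (p t)) = 0" "Aop (bmul (q t) (q t)) = 2*pi" by (simp_all add: G_def a_def b_def)
qed

lemma U_val: assumes "t \<in> {-T..T}" shows "ev (U t) \<xi> = v t + prim (ev (bmul (q t) (p t))) \<xi>"
  by (simp add: U_def lagU_def ev_ops ev_cst Iop_zero_mean[OF conserved(1)[OF assms]])

lemma g_zero_mean: assumes "t \<in> {-T..T}" shows "Aop (g t) = 0"
proof -
  have "Aop (g t) = Aop (sr t) - k t * Aop (bmul (q t) (q t))" unfolding g_eq by (simp add: Aop_def prim_ev_ops)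
  then show ?thesis using conserved(2)[OF assms] by (simp add: k_def lagk_def sr_def)
qed

definition "X t \<xi> = y t + prim (ev (bmul (q t) (q t))) \<xi>"
definition "XD t = cst (y t) + Iop (bmul (q t) (q t) - cst 1)"

lemma X_val: assumes "t \<in> {-T..T}" shows "X t \<xi> = \<xi> + ev (XD t) \<xi>"
proof -
  have "Aop (bmul (q t) (q t) - cst 1) = 0" using conserved(2)[OF assms] by (simp add: Aop_def prim_ev_ops)
  then show ?thesis by (simp add: X_def XD_def ev_ops ev_cst Iop_zero_mean prim_ev_ops)
qed

lemma dU: assumes "t \<in> {-T..T}" shows "(U has_vector_derivative (1/(2*c)) *\<^sub>R Phi t) (at t)"
proof -
  have "((\<lambda>t. cst (v t) + Iop (bmul (q t) (p t))) has_vector_derivative cst (- kap t / (2*c)) + Iop ((1/(2*c)) *\<^sub>R g t)) (at t)"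
    using dv[OF assms] unfolding kap_def[symmetric]
    by (intro has_vector_derivative_add bounded_linear.has_vector_derivative[OF bounded_linear_cst]
        bounded_linear.has_vector_derivative[OF bounded_linear_Iop] dqp assms)
  moreover have "cst (- kap t / (2*c)) + Iop ((1/(2*c)) *\<^sub>R g t) = (1/(2*c)) *\<^sub>R Phi t"
    by (rule bp_eqI) (simp add: Phi_def ev_ops ev_cst ev_Iop prim_ev_ops diff_divide_distrib)
  ultimately show ?thesis by (simp add: U_def[abs_def] lagU_def)
qed

lemma dXD: assumes "t \<in> {-T..T}" shows "(XD has_vector_derivative (1/c) *\<^sub>R U t - cst (c/2)) (at t)"
proof -
  have "((\<lambda>t. bmul (q t) (q t) - cst 1) has_vector_derivative (1/c) *\<^sub>R bmul (q t) (p t) - 0) (at t)"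
    by (intro has_vector_derivative_diff dqq assms has_vector_derivative_const)
  then have "(XD has_vector_derivative cst (v t / c - c / 2) + Iop ((1/c) *\<^sub>R bmul (q t) (p t))) (at t)"
    unfolding XD_def[abs_def]
    by (intro has_vector_derivative_add bounded_linear.has_vector_derivative[OF bounded_linear_cst dy[OF assms]]
        bounded_linear.has_vector_derivative[OF bounded_linear_Iop]) simp
  moreover have "cst (v t / c - c / 2) + Iop ((1/c) *\<^sub>R bmul (q t) (p t)) = (1/c) *\<^sub>R U t - cst (c/2)"
    by (rule bp_eqI) (simp add: U_def lagU_def ev_ops ev_cst ev_Iop prim_ev_ops add_divide_distrib)
  ultimately show ?thesis by simp
qed

lemma qq_bounds: assumes "t \<in> {-T..T}" shows "1/4 \<le> ev (bmul (q t) (q t)) x"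
proof -
  have "1/2 * (1/2) \<le> ev (q t) x * ev (q t) x" using low[OF assms, of x] by (intro mult_mono) auto
  then show ?thesis by (simp add: ev_bmul)
qed

lemma X_lower: assumes "t \<in> {-T..T}" "a \<le> b" shows "(b - a) / 4 \<le> X t b - X t a"
proof -
  have "prim (\<lambda>x. 1/4) b - prim (\<lambda>x. 1/4) a \<le> prim (ev (bmul (q t) (q t))) b - prim (ev (bmul (q t) (q t))) a"
    by (rule prim_mono[OF loc_bdd_const ev_loc_bdd assms(2) qq_bounds[OF assms(1)]])
  then show ?thesis by (simp add: X_def diff_divide_distrib)
qed

lemma X_mono: assumes "t \<in> {-T..T}" shows "strict_mono (X t)"
proof (rule strict_monoI)
  fix a b :: real assume "a < b"
  then have "a \<le> b" "0 < (b - a)/4" by simp_all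
  then show "X t a < X t b" using X_lower[OF assms, of a b] by linarith
qed

lemma X_cont: "continuous_on UNIV (X t)"
  unfolding X_def[abs_def] by (intro continuous_intros prim_continuous) simp

lemma X_surj: assumes t: "t \<in> {-T..T}" shows "\<exists>\<xi>. X t \<xi> = x"
proof -
  define N where "N = 4 * \<bar>x - X t 0\<bar>"
  have N: "0 \<le> N" by (simp add: N_def)
  have "X t (-N) \<le> x" "x \<le> X t N" using X_lower[OF t, of "-N" 0] X_lower[OF t, of 0 N] N unfolding N_def by auto
  then have "\<exists>\<xi>\<ge>-N. \<xi> \<le> N \<and> X t \<xi> = x"
    by (intro IVT'[where f="X t"] continuous_on_subset[OF X_cont]) (use N in auto)
  then show ?thesis by blast
qed

definition "Y t = inv (X t)"

lemma XY: assumes t: "t \<in> {-T..T}" shows "X t (Y t x) = x" "Y t (X t \<xi>) = \<xi>"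
proof -
  have "inj (X t)" using X_mono[OF t] by (meson injI strict_mono_eq)
  moreover have "surj (X t)" using X_surj[OF t] by (metis surj_def)
  ultimately show "X t (Y t x) = x" "Y t (X t \<xi>) = \<xi>" by (simp_all add: Y_def surj_f_inv_f)
qed

lemma Y_cont: assumes t: "t \<in> {-T..T}" shows "continuous_on UNIV (Y t)"
proof -
  have "\<bar>a - b\<bar> \<le> 4 * \<bar>X t a - X t b\<bar>" for a b
    using X_lower[OF t, of a b] X_lower[OF t, of b a] by (cases "a \<le> b") auto
  from this[of "Y t x" "Y t x'" for x x'] have "4-lipschitz_on UNIV (Y t)"
    unfolding XY[OF t] by (intro lipschitz_onI) (auto simp: dist_real_def)
  then show ?thesis by (rule lipschitz_on_continuous_on)
qed

lemma X_period: assumes t: "t \<in> {-T..T}" shows "X t (\<xi> + 2*pi) = X t \<xi> + 2*pi"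
  using periodic_mean_shift[OF ev_periodic ev_loc_bdd, of "bmul (q t) (q t)" \<xi>] conserved(2)[OF t]
  by (simp add: X_def Aop_def)

lemma Y_period: assumes t: "t \<in> {-T..T}" shows "Y t (x + 2*pi) = Y t x + 2*pi"
  using X_period[OF t, of "Y t x"] XY[OF t] by metis

definition "u t x = ev (U t) (Y t x)"
definition "m t x = ev (p t) (Y t x) / ev (q t) (Y t x)"

lemma lagrangian_integral:
  assumes t: "t \<in> {-T..T}" and h: "loc_bdd h"
  shows "prim (\<lambda>x. h (Y t x)) (X t b) - prim (\<lambda>x. h (Y t x)) (X t a) =
    prim (\<lambda>\<xi>. h \<xi> * ev (bmul (q t) (q t)) \<xi>) b - prim (\<lambda>\<xi>. h \<xi> * ev (bmul (q t) (q t)) \<xi>) a"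
proof (rule change_of_variables[OF ev_loc_bdd _ _ XY[OF t] X_mono[OF t] Y_cont[OF t] h])
  show "0 \<le> ev (bmul (q t) (q t)) x" for x using qq_bounds[OF t, of x] by linarith
  show "X t b - X t a = prim (ev (bmul (q t) (q t))) b - prim (ev (bmul (q t) (q t))) a" for a b by (simp add: X_def)
qed

lemma bper_compose_Y:
  assumes t: "t \<in> {-T..T}" and h: "bper B h" shows "bper B (\<lambda>x. h (Y t x))"
  unfolding bper_def
proof (intro conjI allI)
  show "(\<lambda>x. h (Y t x)) \<in> borel_measurable borel"
    by (rule measurable_compose[OF borel_measurable_continuous_onI[OF Y_cont[OF t]] loc_bdd_measurable[OF bper_loc_bdd[OF h]]])
  show "periodic (\<lambda>x. h (Y t x))" using periodicD[OF bper_periodic[OF h]] by (simp add: periodic_def Y_period[OF t])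
  show "\<bar>h (Y t x)\<bar> \<le> B" for x by (rule bper_bound[OF h])
qed

lemma ev_bperI: "norm f \<le> B \<Longrightarrow> bper B (ev f)"
  by (rule bperI) (auto simp: ev_periodic intro: order_trans[OF ev_norm_le])

lemma slope_bper: assumes t: "t \<in> {-T..T}" shows "bper (2*R) (\<lambda>\<xi>. ev (p t) \<xi> / ev (q t) \<xi>)"
  unfolding bper_def
proof (intro conjI allI)
  show "(\<lambda>\<xi>. ev (p t) \<xi> / ev (q t) \<xi>) \<in> borel_measurable borel"
    using loc_bdd_measurable[OF ev_loc_bdd] by (intro borel_measurable_divide) auto
  show "periodic (\<lambda>\<xi>. ev (p t) \<xi> / ev (q t) \<xi>)" by (rule periodic_binop[OF ev_periodic ev_periodic])
  fix \<xi>
  have "\<bar>ev (p t) \<xi>\<bar> / ev (q t) \<xi> \<le> R / (1/2)"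
    using low[OF t, of \<xi>] order_trans[OF ev_norm_le nb(2)[OF t], of \<xi>] R by (intro frac_le) auto
  then show "\<bar>ev (p t) \<xi> / ev (q t) \<xi>\<bar> \<le> 2*R" using low[OF t, of \<xi>] by (simp add: abs_divide)
qed

lemma q_nz: "t \<in> {-T..T} \<Longrightarrow> ev (q t) \<xi> \<noteq> 0"
  using low[of t \<xi>] by auto

lemma u_per_prim: assumes t: "t \<in> {-T..T}" shows "per_prim (2*R) (u t) (m t)" "bper BU (u t)"
proof -
  show bu: "bper BU (u t)" unfolding u_def[abs_def] by (rule bper_compose_Y[OF t ev_bperI[OF U_bound[OF t]]])
  have "prim (m t) (X t b) - prim (m t) (X t a) = ev (U t) b - ev (U t) a" for a b
  proof -
    have "prim (m t) (X t b) - prim (m t) (X t a) = prim (\<lambda>\<xi>. ev (p t) \<xi> / ev (q t) \<xi> * ev (bmul (q t) (q t)) \<xi>) b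
       - prim (\<lambda>\<xi>. ev (p t) \<xi> / ev (q t) \<xi> * ev (bmul (q t) (q t)) \<xi>) a"
      unfolding m_def[abs_def] by (rule lagrangian_integral[OF t bper_loc_bdd[OF slope_bper[OF t]]])
    also have "(\<lambda>\<xi>. ev (p t) \<xi> / ev (q t) \<xi> * ev (bmul (q t) (q t)) \<xi>) = ev (bmul (q t) (p t))"
      using q_nz[OF t] by (auto simp: ev_bmul)
    finally show ?thesis by (simp add: U_val[OF t])
  qed
  from this[of "Y t x" "Y t 0" for x] have "prim (m t) x = u t x - u t 0" for x
    unfolding XY[OF t] u_def by simp
  moreover have "bper (2*R) (m t)" unfolding m_def[abs_def] by (rule bper_compose_Y[OF t slope_bper[OF t]])
  ultimately show "per_prim (2*R) (u t) (m t)" using bper_periodic[OF bu] by (simp add: per_prim_def)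
qed

lemma src_along:
  assumes t: "t \<in> {-T..T}"
  shows "prim (src (u t) (m t)) (X t b) - prim (src (u t) (m t)) (X t a) = prim (ev (sr t)) b - prim (ev (sr t)) a"
proof -
  let ?h = "\<lambda>\<xi>. (ev (p t) \<xi> / ev (q t) \<xi>)\<^sup>2 + ev (U t) \<xi>"
  have "src (u t) (m t) = (\<lambda>x. ?h (Y t x))" by (auto simp: src_def u_def m_def)
  moreover have "prim (\<lambda>x. ?h (Y t x)) (X t b) - prim (\<lambda>x. ?h (Y t x)) (X t a) =
    prim (\<lambda>\<xi>. ?h \<xi> * ev (bmul (q t) (q t)) \<xi>) b - prim (\<lambda>\<xi>. ?h \<xi> * ev (bmul (q t) (q t)) \<xi>) a"
    by (rule lagrangian_integral[OF t loc_bdd_add[OF loc_bdd_power2[OF bper_loc_bdd[OF slope_bper[OF t]]] ev_loc_bdd]])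
  moreover have "(\<lambda>\<xi>. ?h \<xi> * ev (bmul (q t) (q t)) \<xi>) = ev (sr t)"
  proof
    fix \<xi>
    have "(P / Q)\<^sup>2 * (Q * Q) = P * P" if "Q \<noteq> 0" for P Q :: real using that by (simp add: power2_eq_square)
    from this[OF q_nz[OF t, of \<xi>], of "ev (p t) \<xi>"]
    show "?h \<xi> * ev (bmul (q t) (q t)) \<xi> = ev (sr t) \<xi>"
      by (simp add: sr_def lagsrc_def U_def[symmetric] ev_ops ev_bmul distrib_right)
  qed
  ultimately show ?thesis by simp
qed

lemma total_energy: assumes t: "t \<in> {-T..T}" shows "energy (m t) (2*pi) = Aop (bmul (p t) (p t))"
proof -
  let ?h = "\<lambda>\<xi>. (ev (p t) \<xi> / ev (q t) \<xi>)\<^sup>2"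
  note pp = per_primD[OF u_per_prim(1)[OF t]]
  have "energy (m t) (2*pi) = energy (m t) (X t 0 + 2*pi) - energy (m t) (X t 0)"
    using periodic_mean_shift[OF periodic_unop[OF pp(5)] loc_bdd_power2[OF pp(4)], of "X t 0"] by simp
  also have "\<dots> = prim (\<lambda>x. ?h (Y t x)) (X t (2*pi)) - prim (\<lambda>x. ?h (Y t x)) (X t 0)"
    using X_period[OF t, of 0] by (simp add: m_def)
  also have "\<dots> = prim (\<lambda>\<xi>. ?h \<xi> * ev (bmul (q t) (q t)) \<xi>) (2*pi) - prim (\<lambda>\<xi>. ?h \<xi> * ev (bmul (q t) (q t)) \<xi>) 0"
    by (rule lagrangian_integral[OF t loc_bdd_power2[OF bper_loc_bdd[OF slope_bper[OF t]]]])
  also have "(\<lambda>\<xi>. ?h \<xi> * ev (bmul (q t) (q t)) \<xi>) = ev (bmul (p t) (p t))"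
    using q_nz[OF t] by (auto simp: ev_bmul power2_eq_square)
  finally show ?thesis by (simp add: Aop_def)
qed

lemma avg_src: assumes t: "t \<in> {-T..T}" shows "avg (src (u t) (m t)) = k t"
proof -
  note pp = per_primD[OF u_per_prim(1)[OF t]]
  have l: "loc_bdd (src (u t) (m t))" "periodic (src (u t) (m t))"
    by (rule src_loc_bdd[OF pp(7,4)], rule src_periodic[OF pp(2,5)])
  have "prim (src (u t) (m t)) (2*pi) = prim (src (u t) (m t)) (X t 0 + 2*pi) - prim (src (u t) (m t)) (X t 0)"
    using periodic_mean_shift[OF l(2,1), of "X t 0"] by simp
  also have "\<dots> = Aop (sr t)" using src_along[OF t, of "2*pi" 0] X_period[OF t, of 0] by (simp add: Aop_def)
  finally show ?thesis by (simp add: avg_def k_def lagk_def sr_def)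
qed

lemma zmp_src: assumes t: "t \<in> {-T..T}" shows "zmp (src (u t) (m t)) x = ev (Phi t) (Y t x)"
proof -
  note pp = per_primD[OF u_per_prim(1)[OF t]]
  have l: "loc_bdd (src (u t) (m t))" by (rule src_loc_bdd[OF pp(7,4)])
  obtain B where "bper B (ev (Phi t))" by (rule ev_bper)
  note bP = bper_compose_Y[OF t this]
  have lP: "loc_bdd (\<lambda>x. ev (Phi t) (Y t x))" by (rule bper_loc_bdd[OF bP])
  have "ev (Phi t) (Y t x) = zmp (src (u t) (m t)) x"
  proof (rule zmp_unique[OF l lP])
    have "prim (\<lambda>x. ev (Phi t) (Y t x)) (2*pi) = prim (\<lambda>x. ev (Phi t) (Y t x)) (X t 0 + 2*pi) - prim (\<lambda>x. ev (Phi t) (Y t x)) (X t 0)"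
      using periodic_mean_shift[OF bper_periodic[OF bP] lP, of "X t 0"] by simp
    also have "\<dots> = prim (\<lambda>\<xi>. ev (Phi t) \<xi> * ev (bmul (q t) (q t)) \<xi>) (2*pi)"
      using lagrangian_integral[OF t ev_loc_bdd, of "Phi t" "2*pi" 0] X_period[OF t, of 0] by simp
    also have "(\<lambda>\<xi>. ev (Phi t) \<xi> * ev (bmul (q t) (q t)) \<xi>) = ev (bmul (Iop (g t)) (bmul (q t) (q t)) - kap t *\<^sub>R bmul (q t) (q t))"
      by (auto simp: Phi_def ev_ops ev_bmul ev_cst left_diff_distrib)
    also have "prim \<dots> (2*pi) = 0"
      by (simp add: Aop_def[symmetric] Aop_ops conserved(2)[OF t] kap_def lagkap_def g_def)
    finally show "avg (\<lambda>x. ev (Phi t) (Y t x)) = 0" by (simp add: avg_def)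
    show "ev (Phi t) (Y t x) - ev (Phi t) (Y t 0) = prim (src (u t) (m t)) x - avg (src (u t) (m t)) * x" for x
    proof -
      have "ev (Phi t) (Y t x) - ev (Phi t) (Y t 0) = prim (ev (g t)) (Y t x) - prim (ev (g t)) (Y t 0)"
        by (simp add: Phi_def ev_ops ev_cst Iop_zero_mean[OF g_zero_mean[OF t]])
      also have "\<dots> = (prim (ev (sr t)) (Y t x) - prim (ev (sr t)) (Y t 0)) - k t * (X t (Y t x) - X t (Y t 0))"
        by (simp add: g_eq prim_ev_ops X_def algebra_simps)
      also have "\<dots> = prim (src (u t) (m t)) x - k t * x"
        unfolding src_along[OF t, symmetric] XY[OF t] by simp
      finally show ?thesis unfolding avg_src[OF t] .
    qed
  qed
  then show ?thesis by simp
qed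

text \<open>
  At a fixed point the change of \<open>u\<close> consists of the displacement of the characteristic, multiplied by
  the Lipschitz constant, and the change along the characteristic.
\<close>

lemma u_time_bound: assumes t: "t \<in> {-T..T}" and s: "s \<in> {-T..T}"
  shows "\<bar>u s x - u t x\<bar> \<le> 2*R * norm (XD s - XD t) + norm (U s - U t)"
proof -
  define \<xi> where "\<xi> = Y t x"
  have x: "X t \<xi> = x" unfolding \<xi>_def by (rule XY[OF t])
  have "\<bar>u s x - u s (X s \<xi>)\<bar> \<le> 2*R * norm (XD s - XD t)"
  proof (rule per_prim_lip_le[OF u_per_prim(1)[OF s]])
    have "x - X s \<xi> = ev (XD t - XD s) \<xi>" unfolding x[symmetric] X_val[OF t] X_val[OF s] by (simp add: ev_ops)
    then show "\<bar>x - X s \<xi>\<bar> \<le> norm (XD s - XD t)" using ev_norm_le[of "XD t - XD s" \<xi>] by (simp add: norm_minus_commute)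
  qed
  moreover have "u s (X s \<xi>) - u t x = ev (U s - U t) \<xi>" unfolding u_def \<xi>_def[symmetric] XY[OF s] by (simp add: ev_ops)
  ultimately show ?thesis using ev_norm_le[of "U s - U t" \<xi>] by linarith
qed

lemma has_vector_derivative_norm_tendsto: "(f has_vector_derivative f') (at t) \<Longrightarrow> ((\<lambda>s. norm (f s - f t)) \<longlongrightarrow> 0) (at t)"
  using has_vector_derivative_continuous[of f f' t UNIV] by (intro tendsto_norm_zero) (simp add: isCont_def LIM_zero_iff continuous_within)

lemma ev_near: assumes "t \<in> {-T<..<T}" shows "eventually (\<lambda>s. s \<in> {-T..T}) (at t)"
proof -
  have "eventually (\<lambda>s. s \<in> {-T<..<T}) (nhds t)" by (rule eventually_nhds_in_open) (use assms in auto)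
  then show ?thesis unfolding eventually_at_filter by eventually_elim auto
qed

lemma u_lim:
  assumes t: "t \<in> {-T<..<T}"
  shows "((\<lambda>s. 2*R * norm (XD s - XD t) + norm (U s - U t)) \<longlongrightarrow> 0) (at t)"
proof -
  have t': "t \<in> {-T..T}" using t by auto
  have "((\<lambda>s. 2*R * norm (XD s - XD t) + norm (U s - U t)) \<longlongrightarrow> 2*R*0 + 0) (at t)"
    by (intro tendsto_intros has_vector_derivative_norm_tendsto[OF dXD[OF t']] has_vector_derivative_norm_tendsto[OF dU[OF t']])
  then show ?thesis by simp
qed

lemma u_L1_lim: assumes t: "t \<in> {-T<..<T}" shows "((\<lambda>s. L1_dist (u s) (u t)) \<longlongrightarrow> 0) (at t)"
proof (rule Lim_null_comparison[OF _ tendsto_mult_right_zero[OF u_lim[OF t], of "2*pi"]])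
  have t': "t \<in> {-T..T}" using t by auto
  show "eventually (\<lambda>s. norm (L1_dist (u s) (u t)) \<le> 2*pi * (2*R * norm (XD s - XD t) + norm (U s - U t))) (at t)"
    using ev_near[OF t]
  proof eventually_elim
    case (elim s)
    have l: "loc_bdd (\<lambda>x. u s x - u t x)" by (intro loc_bdd_diff bper_loc_bdd[OF u_per_prim(2)] elim t')
    show ?case using L1_norm_le_sup[OF l u_time_bound[OF t' elim]] L1_norm_nonneg[OF l] by simp
  qed
qed

text \<open>
  In Lagrangian coordinates the energy is the integral of \<open>p\<^sup>2\<close> and thus continuous in time, which is what
  \<open>slope_convergence\<close> requires.
\<close>

lemma m_L1_lim: assumes t: "t \<in> {-T<..<T}" shows "((\<lambda>s. L1_dist (m s) (m t)) \<longlongrightarrow> 0) (at t)"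
proof (rule tendstoI)
  fix e :: real assume e: "0 < e"
  have t': "t \<in> {-T..T}" using t by auto
  obtain \<delta> where \<delta>: "0 < \<delta>" "\<And>u' m'. per_prim (2*R) u' m' \<Longrightarrow> (\<And>x. \<bar>u' x - u t x\<bar> \<le> \<delta>) \<Longrightarrow>
      \<bar>energy m' (2*pi) - energy (m t) (2*pi)\<bar> \<le> \<delta> \<Longrightarrow> L1_dist m' (m t) \<le> e/2"
    by (rule slope_convergence[OF u_per_prim(1)[OF t'], of "e/2"]) (use e in auto)
  have "((\<lambda>s. Aop (bmul (p s) (p s)) - Aop (bmul (p t) (p t))) \<longlongrightarrow> 0) (at t)"
    using tendsto_norm_zero_cancel[OF has_vector_derivative_norm_tendsto[OF bounded_linear.has_vector_derivative[OF bounded_linear_Aop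
       bounded_bilinear.has_vector_derivative[OF bounded_bilinear_bmul dp[OF t'] dp[OF t']]]]] .
  then have "eventually (\<lambda>s. \<bar>Aop (bmul (p s) (p s)) - Aop (bmul (p t) (p t))\<bar> < \<delta>) (at t)"
    using \<delta>(1) by (auto dest: tendstoD[where e=\<delta>] simp: dist_real_def)
  moreover have "eventually (\<lambda>s. 2*R * norm (XD s - XD t) + norm (U s - U t) < \<delta>) (at t)"
    using u_lim[OF t] \<delta>(1) by (intro order_tendstoD(2)) auto
  ultimately show "eventually (\<lambda>s. dist (L1_dist (m s) (m t)) 0 < e) (at t)" using ev_near[OF t]
  proof eventually_elim
    case (elim s)
    have "L1_dist (m s) (m t) \<le> e/2"
    proof (rule \<delta>(2)[OF u_per_prim(1)[OF elim(3)]])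
      show "\<bar>u s x - u t x\<bar> \<le> \<delta>" for x using u_time_bound[OF t' elim(3), of x] elim(2) by linarith
      show "\<bar>energy (m s) (2*pi) - energy (m t) (2*pi)\<bar> \<le> \<delta>"
        unfolding total_energy[OF t'] total_energy[OF elim(3)] using elim(1) by simp
    qed
    moreover have "0 \<le> L1_dist (m s) (m t)"
      by (intro L1_norm_nonneg loc_bdd_diff per_primD(4)[OF u_per_prim(1)] elim t')
    ultimately show ?case using e by simp
  qed
qed

text \<open>
  The increment of \<open>u\<close> at a fixed point \<open>x\<close> is its increment along the characteristic through \<open>x\<close>, minus
  the increment of \<open>u s\<close> in space between \<open>x\<close> and the new position. The first has the limit
  \<open>F/(2c)\<close>, and the second is an average of the slope over a moving interval.
\<close>

lemma rate_lim:
  assumes t: "t \<in> {-T<..<T}"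
  shows "((\<lambda>s. rate_error c u m t s) \<longlongrightarrow> 0) (at t)"
proof -
  have t': "t \<in> {-T..T}" using t by auto
  note pt = per_primD[OF u_per_prim(1)[OF t']]
  define \<rho> where "\<rho> s = norm ((1/(s - t)) *\<^sub>R (XD s - XD t) - ((1/c) *\<^sub>R U t - cst (c/2)))" for s
  define \<sigma> where "\<sigma> s = norm ((1/(s - t)) *\<^sub>R (U s - U t) - (1/(2*c)) *\<^sub>R Phi t)" for s
  have \<rho>0: "(\<rho> \<longlongrightarrow> 0) (at t)" unfolding \<rho>_def[abs_def] by (rule vector_derivative_quotient[OF dXD[OF t']])
  have \<sigma>0: "(\<sigma> \<longlongrightarrow> 0) (at t)" unfolding \<sigma>_def[abs_def] by (rule vector_derivative_quotient[OF dU[OF t']])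
  define h where "h s x = X s (Y t x) - x" for s x
  define w where "w x = (2 * u t x - c\<^sup>2) / (2*c)" for x
  have w_eq: "w x = ev ((1/c) *\<^sub>R U t - cst (c/2)) (Y t x)" for x
    using c by (simp add: w_def u_def ev_ops ev_cst diff_divide_distrib power2_eq_square)
  have h_eq: "h s x = ev (XD s - XD t) (Y t x)" if "s \<in> {-T..T}" for s x
  proof -
    have "x = Y t x + ev (XD t) (Y t x)" using X_val[OF t', of "Y t x"] XY[OF t'] by simp
    then show ?thesis unfolding h_def X_val[OF that] by (simp add: ev_ops)
  qed
  have mov: "((\<lambda>s. L1_norm (\<lambda>x. (prim (m s) (x + h s x) - prim (m s) x) / (s - t) - w x * m t x)) \<longlongrightarrow> 0) (at t)"
  proof (rule moving_average[OF pt(1)])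
    show "eventually (\<lambda>s. bper (2*R) (m s)) (at t)"
      using ev_near[OF t] by eventually_elim (rule per_primD(1)[OF u_per_prim(1)])
    show "((\<lambda>s. L1_dist (m s) (m t)) \<longlongrightarrow> 0) (at t)" by (rule m_L1_lim[OF t])
    have "continuous_on UNIV (h s)" for s
      unfolding h_def[abs_def] by (intro continuous_intros continuous_on_compose2[OF X_cont Y_cont[OF t']]) auto
    then show "eventually (\<lambda>s. continuous_on UNIV (h s)) (at t)" by simp
    show "(\<rho> \<longlongrightarrow> 0) (at t)" by (rule \<rho>0)
    show "eventually (\<lambda>s. \<forall>x. \<bar>h s x / (s - t) - w x\<bar> \<le> \<rho> s) (at t)"
      using ev_near[OF t]
    proof eventually_elim
      case (elim s)
      show ?case
      proof
        fix x
        have "h s x / (s - t) - w x = ev ((1/(s - t)) *\<^sub>R (XD s - XD t) - ((1/c) *\<^sub>R U t - cst (c/2))) (Y t x)"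
          unfolding h_eq[OF elim] w_eq by (simp add: ev_ops)
        then show "\<bar>h s x / (s - t) - w x\<bar> \<le> \<rho> s" unfolding \<rho>_def by (simp only: ev_norm_le)
      qed
    qed
    show "continuous_on UNIV w" unfolding w_def[abs_def] using c by (intro continuous_intros pt(8)) auto
    show "\<bar>w x\<bar> \<le> norm ((1/c) *\<^sub>R U t - cst (c/2))" for x unfolding w_eq by (rule ev_norm_le)
  qed
  show ?thesis
  proof (rule Lim_null_comparison)
    show "((\<lambda>s. 2*pi * \<sigma> s + L1_norm (\<lambda>x. (prim (m s) (x + h s x) - prim (m s) x) / (s - t) - w x * m t x)) \<longlongrightarrow> 0) (at t)"
      using tendsto_add[OF tendsto_mult_right_zero[OF \<sigma>0, of "2*pi"] mov] by simp
    show "eventually (\<lambda>s. norm (rate_error c u m t s) \<le>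
       2*pi * \<sigma> s + L1_norm (\<lambda>x. (prim (m s) (x + h s x) - prim (m s) x) / (s - t) - w x * m t x)) (at t)"
      using ev_near[OF t]
    proof eventually_elim
      case (elim s)
      note ps = per_primD[OF u_per_prim(1)[OF elim]]
      \<comment> \<open>\<open>E1\<close> is the error along the characteristic, \<open>E2\<close> the error of the moving average\<close>
      define E1 where "E1 x = ev ((1/(s - t)) *\<^sub>R (U s - U t) - (1/(2*c)) *\<^sub>R Phi t) (Y t x)" for x
      define E2 where "E2 x = (prim (m s) (x + h s x) - prim (m s) x) / (s - t) - w x * m t x" for x
      have dec: "(u s x - u t x) / (s - t) - rhs c (u t) (m t) x = E1 x - E2 x" for x
      proof -
        define \<xi> where "\<xi> = Y t x"
        have 1: "prim (m s) (x + h s x) - prim (m s) x = ev (U s) \<xi> - u s x"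
        proof -
          have "u s (x + h s x) = ev (U s) \<xi>" unfolding u_def h_def \<xi>_def by (simp add: XY[OF elim])
          then show ?thesis using ps(10)[of "x + h s x" x] by simp
        qed
        have 2: "rhs c (u t) (m t) x = - (w x * m t x) + ev (Phi t) \<xi> / (2*c)"
          using c unfolding rhs_def zmp_src[OF t'] w_def \<xi>_def by (simp add: field_simps)
        have 3: "u t x = ev (U t) \<xi>" by (simp add: u_def \<xi>_def)
        have "(us - ut) / d - (- wm + ph) = (ut' / d - ut / d - ph) - ((ut' - us) / d - wm)" for us ut ut' d wm ph :: real
          by (simp add: diff_divide_distrib)
        then show ?thesis unfolding E1_def E2_def 1 2 3 \<xi>_def[symmetric]
          by (simp add: ev_ops diff_divide_distrib)
      qed
      obtain B where B: "bper B (ev ((1/(s - t)) *\<^sub>R (U s - U t) - (1/(2*c)) *\<^sub>R Phi t))" by (rule ev_bper)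
      have l1: "loc_bdd E1" unfolding E1_def[abs_def] by (rule bper_loc_bdd[OF bper_compose_Y[OF t' B]])
      have lr: "loc_bdd (\<lambda>x. (u s x - u t x) / (s - t) - rhs c (u t) (m t) x)"
        by (intro loc_bdd_diff loc_bdd_divide ps pt rhs_loc_bdd)
      have l2: "loc_bdd E2"
      proof (rule loc_bdd_cong)
        show "loc_bdd (\<lambda>x. E1 x - ((u s x - u t x) / (s - t) - rhs c (u t) (m t) x))" by (rule loc_bdd_diff[OF l1 lr])
      qed (simp add: dec)
      have "L1_norm (\<lambda>x. E1 x + (- 1) * E2 x) \<le> L1_norm E1 + L1_norm (\<lambda>x. (-1) * E2 x)"
        by (rule L1_norm_triangle) (use l1 l2 in auto)
      also have "L1_norm (\<lambda>x. (-1) * E2 x) = L1_norm E2" unfolding L1_norm_cmul by simp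
      also have "L1_norm E1 \<le> 2*pi * \<sigma> s"
        by (rule L1_norm_le_sup[OF l1]) (simp only: E1_def \<sigma>_def ev_norm_le)
      finally have "rate_error c u m t s \<le> 2*pi * \<sigma> s + L1_norm E2" by (simp add: dec)
      then show ?case using L1_norm_nonneg[OF lr] by (simp add: E2_def[abs_def])
    qed
  qed
qed

lemma lipschitz_solution_u: "lipschitz_solution c T u m"
  unfolding lipschitz_solution_def
proof (intro conjI allI impI ballI)
  fix T' assume "T' < T"
  show "\<exists>R'. bounded_until T' R' u m"
  proof (intro exI[of _ "2*R + BU"] ballI)
    fix t assume "t \<in> {-T'..T'}"
    then have t: "t \<in> {-T..T}" using \<open>T' < T\<close> by auto
    have "0 \<le> BU" using R by (simp add: BU_def)
    then show "per_prim (2*R + BU) (u t) (m t) \<and> bper (2*R + BU) (u t)"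
      using u_per_prim[OF t] R by (auto intro: per_prim_mono bper_mono)
  qed
qed (auto intro!: m_L1_lim u_L1_lim rate_lim)

lemma initial: "u 0 x = u0 x"
proof -
  have "ev (bmul (q 0) (q 0)) = (\<lambda>x. 1)" "ev (bmul (q 0) (p 0)) = m0" by (auto simp: ini(1) ev_bmul ev_cst p0)
  then have "X 0 \<xi> = \<xi>" "ev (U 0) \<xi> = u0 0 + prim m0 \<xi>" for \<xi>
    by (simp_all add: X_def U_val[OF T0] ini)
  then show ?thesis using XY(1)[OF T0, of x] per_primD(3)[OF data, of x] by (simp add: u_def)
qed

end

text \<open>
  The Lagrangian initial value is \<open>(1, m\<^sub>0, u\<^sub>0(0), 0)\<close>; its norm is at most \<open>1 + 2S\<close>.
\<close>

theorem lipschitz_solution_exists: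
  assumes c: "0 < c" and S: "0 \<le> S"
  obtains T R where "0 < T" "\<And>u0 m0. per_prim S u0 m0 \<Longrightarrow> bper S u0 \<Longrightarrow>
    \<exists>u m. lipschitz_solution c T u m \<and> (\<forall>x. u 0 x = u0 x) \<and> bounded_until T R u m"
proof -
  \<comment> \<open>\<open>R0\<close> bounds the initial value, \<open>R\<close> the Lagrangian solution and \<open>R'\<close> the solution in the original variables\<close>
  define R0 where "R0 = 1 + 2*S"
  have R0: "0 \<le> R0" using S by (simp add: R0_def)
  define R where "R = R0 + 1/2"
  define R' where "R' = 2*R + (R + 2*pi*(R*R))"
  obtain T where T: "0 < T" and flow: "\<And>z0. norm z0 \<le> R0 \<Longrightarrow> \<exists>z. z 0 = z0 \<and>
     (\<forall>t\<in>{-T..T}. (z has_vector_derivative lagf c (z t)) (at t) \<and> norm (z t - z0) \<le> 1/2)"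
    using local_flow[OF lagf_loc_lip R0] by metis
  show ?thesis
  proof (rule that[OF T])
    fix u0 m0 assume d: "per_prim S u0 m0" and b: "bper S u0"
    define z0 where "z0 = (cst 1, mkbp m0, u0 0, 0::real)"
    have "norm z0 \<le> norm (cst 1) + (norm (mkbp m0) + (norm (u0 0) + norm (0::real)))"
      unfolding z0_def by (intro order_trans[OF norm_Pair_le] add_left_mono) simp
    also have "\<dots> \<le> 1 + (S + (S + 0))"
    proof (intro add_mono)
      show "norm (cst 1) \<le> 1" using norm_cst[of 1] by simp
      show "norm (mkbp m0) \<le> S"
        by (rule bp_norm_leI) (simp add: ev_mkbp[OF per_primD(1)[OF d]] bper_bound[OF per_primD(1)[OF d]])
    qed (use bper_bound[OF b] in auto)
    finally have nz: "norm z0 \<le> R0" by (simp add: R0_def)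
    obtain z where z: "z 0 = z0" and dz: "\<And>t. t \<in> {-T..T} \<Longrightarrow> (z has_vector_derivative lagf c (z t)) (at t)"
      and near: "\<And>t. t \<in> {-T..T} \<Longrightarrow> norm (z t - z0) \<le> 1/2"
      using flow[OF nz] by blast
    define q where "q t = fst (z t)" for t
    define p where "p t = fst (snd (z t))" for t
    define v where "v t = fst (snd (snd (z t)))" for t
    define y where "y t = snd (snd (snd (z t)))" for t
    have zn: "norm (z t) \<le> R" if "t \<in> {-T..T}" for t
      using near[OF that] nz norm_triangle_sub[of "z t" z0] by (simp add: R_def)
    note fstd = bounded_linear.has_vector_derivative[OF bounded_linear_fst]
    note sndd = bounded_linear.has_vector_derivative[OF bounded_linear_snd]
    interpret L: lagrangian c T R q p v y u0 m0 S
    proof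
      fix t assume t: "t \<in> {-T..T}"
      show "(q has_vector_derivative (1/(2*c)) *\<^sub>R p t) (at t)"
        using fstd[OF dz[OF t]] by (simp add: q_def[abs_def] lagf_def Let_def p_def)
      show "(p has_vector_derivative (1/(2*c)) *\<^sub>R bmul (lagU (q t) (p t) (v t) - cst (lagk (q t) (p t) (v t))) (q t)) (at t)"
        using fstd[OF sndd[OF dz[OF t]]] by (simp add: q_def p_def[abs_def] v_def lagf_def Let_def)
      show "(v has_vector_derivative - lagkap (q t) (p t) (v t) / (2*c)) (at t)"
        using fstd[OF sndd[OF sndd[OF dz[OF t]]]] by (simp add: q_def p_def v_def[abs_def] lagf_def Let_def)
      show "(y has_vector_derivative v t / c - c / 2) (at t)"
        using sndd[OF sndd[OF sndd[OF dz[OF t]]]] by (simp add: y_def[abs_def] v_def lagf_def Let_def)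
      show "norm (q t) \<le> R" unfolding q_def by (rule order_trans[OF norm_fst zn[OF t]])
      show "norm (p t) \<le> R" unfolding p_def by (rule order_trans[OF norm_fst order_trans[OF norm_snd zn[OF t]]])
      have "norm (v t) \<le> R" unfolding v_def
        by (rule order_trans[OF norm_fst order_trans[OF norm_snd order_trans[OF norm_snd zn[OF t]]]])
      then show "\<bar>v t\<bar> \<le> R" by simp
      fix x
      have "norm (fst (z t - z0)) \<le> 1/2" by (rule order_trans[OF norm_fst near[OF t]])
      then have "norm (q t - cst 1) \<le> 1/2" by (simp add: q_def z0_def)
      then have "\<bar>ev (q t - cst 1) x\<bar> \<le> 1/2" using ev_norm_le order_trans by blast
      then show "1/2 \<le> ev (q t) x" unfolding ev_ops ev_cst by linarith
    qed (use c T d in \<open>simp_all add: q_def p_def v_def y_def z z0_def\<close>)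
    have R: "0 \<le> R" using R0 by (simp add: R_def)
    have "per_prim R' (L.u t) (L.m t) \<and> bper R' (L.u t)" if t: "t \<in> {-T..T}" for t
    proof
      show "per_prim R' (L.u t) (L.m t)" by (rule per_prim_mono[OF L.u_per_prim(1)[OF t]]) (use R in \<open>simp add: R'_def\<close>)
      show "bper R' (L.u t)" by (rule bper_mono[OF L.u_per_prim(2)[OF t]]) (use R in \<open>simp add: R'_def L.BU_def\<close>)
    qed
    then show "\<exists>u m. lipschitz_solution c T u m \<and> (\<forall>x. u 0 x = u0 x) \<and> bounded_until T R' u m"
      using L.lipschitz_solution_u L.initial by blast
  qed
qed

section \<open>The uniform boundedness principle\<close>

lemma Linf_norm_leI:
  assumes "f \<in> borel_measurable torus" "AE x in torus. \<bar>f x\<bar> \<le> K" "0 \<le> K" shows "Linf_norm f \<le> K"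
proof -
  note [measurable] = assms(1)
  have "esssup torus (\<lambda>x. ereal \<bar>f x\<bar>) \<le> ereal K" by (rule esssup_I) (use assms(2) in auto)
  then show ?thesis using assms(3) unfolding Linf_norm_def by (cases "esssup torus (\<lambda>x. ereal \<bar>f x\<bar>)") auto
qed

text \<open>
  The normalised sign of \<open>f\<close> on the set where \<open>\<bar>f\<bar>\<close> exceeds two thirds of its norm.
\<close>

lemma norming_function:
  assumes "bper B f" "0 < Linf_norm f"
  obtains g where "integrable torus g" "(\<integral>x. \<bar>g x\<bar> \<partial>torus) = 1" "2/3 * Linf_norm f \<le> (\<integral>x. f x * g x \<partial>torus)"
proof -
  have l: "loc_bdd f" by (rule bper_loc_bdd[OF assms(1)])
  note [measurable] = torus_measurable[OF l]
  define K where "K = 2/3 * Linf_norm f"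
  have K: "0 < K" "K < Linf_norm f" using assms(2) by (simp_all add: K_def)
  define A where "A = {x \<in> space torus. K < \<bar>f x\<bar>}"
  have A[measurable]: "A \<in> sets torus" unfolding A_def by measurable
  interpret finite_measure torus by (rule finite_measure_torus)
  define a where "a = measure torus A"
  have a: "0 < a"
  proof (rule ccontr)
    assume "\<not> 0 < a"
    then have "a = 0" unfolding a_def by (simp add: zero_less_measure_iff)
    then have "emeasure torus A = 0" unfolding a_def by (simp add: emeasure_eq_measure)
    then have "AE x in torus. x \<notin> A" using A by (intro AE_not_in) (auto simp: null_sets_def)
    then have "AE x in torus. \<bar>f x\<bar> \<le> K" using AE_space by eventually_elim (auto simp: A_def)
    then have "Linf_norm f \<le> K" using K by (intro Linf_norm_leI) auto
    then show False using K by simp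
  qed
  define g where "g x = sgn (f x) * (indicator A x / a)" for x
  have iA: "integrable torus (\<lambda>x. indicator A x / a)"
    by (intro integrable_divide integrable_real_indicator A) (simp add: emeasure_eq_measure)
  have nz: "f x \<noteq> 0" if "x \<in> A" for x using that K by (auto simp: A_def)
  have ab: "\<bar>g x\<bar> = indicator A x / a" for x
    using a nz[of x] by (auto simp: g_def abs_mult abs_sgn_eq split: split_indicator)
  have ig: "integrable torus g"
  proof (rule Bochner_Integration.integrable_bound[OF iA])
    show "g \<in> borel_measurable torus" unfolding g_def[abs_def] by measurable
  qed (use a in \<open>simp add: ab\<close>)
  have i1: "(\<integral>x. \<bar>g x\<bar> \<partial>torus) = 1"
  proof -
    have "A \<inter> space torus = A" unfolding A_def by auto
    then show ?thesis unfolding ab using a by (simp add: a_def)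
  qed
  have "K * (\<integral>x. \<bar>g x\<bar> \<partial>torus) = (\<integral>x. K * \<bar>g x\<bar> \<partial>torus)" by simp
  also have "\<dots> \<le> (\<integral>x. f x * g x \<partial>torus)"
  proof (rule integral_mono)
    show "integrable torus (\<lambda>x. K * \<bar>g x\<bar>)" using ig by simp
    show "integrable torus (\<lambda>x. f x * g x)" using integrable_times_bounded[OF ig l] by (simp add: mult.commute)
    fix x
    have "f x * g x = \<bar>f x\<bar> * \<bar>g x\<bar>" unfolding ab unfolding g_def by (simp add: abs_sgn mult.assoc[symmetric])
    moreover have "K * \<bar>g x\<bar> \<le> \<bar>f x\<bar> * \<bar>g x\<bar>"
      unfolding ab using a by (cases "x \<in> A") (auto simp: A_def intro!: divide_right_mono)
    ultimately show "K * \<bar>g x\<bar> \<le> f x * g x" by simp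
  qed
  finally have "K \<le> (\<integral>x. f x * g x \<partial>torus)" unfolding i1 by simp
  then show ?thesis using that ig i1 by (simp add: K_def)
qed

lemma pairing_bound_Linf:
  assumes f: "bper B f" and g: "integrable torus g"
  shows "integrable torus (\<lambda>x. f x * g x)" "\<bar>\<integral>x. f x * g x \<partial>torus\<bar> \<le> Linf_norm f * (\<integral>x. \<bar>g x\<bar> \<partial>torus)"
proof -
  show i: "integrable torus (\<lambda>x. f x * g x)"
    using integrable_times_bounded[OF g bper_loc_bdd[OF f]] by (simp add: mult.commute)
  have "\<bar>\<integral>x. f x * g x \<partial>torus\<bar> \<le> (\<integral>x. \<bar>f x * g x\<bar> \<partial>torus)" by (rule integral_abs_bound)
  also have "\<dots> \<le> (\<integral>x. Linf_norm f * \<bar>g x\<bar> \<partial>torus)"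
  proof (rule integral_mono_AE)
    show "AE x in torus. \<bar>f x * g x\<bar> \<le> Linf_norm f * \<bar>g x\<bar>"
      using Linf_norm_AE[OF bper_Linf_per[OF f]] by eventually_elim (auto simp: abs_mult intro: mult_right_mono)
  qed (use i g in auto)
  finally show "\<bar>\<integral>x. f x * g x \<partial>torus\<bar> \<le> Linf_norm f * (\<integral>x. \<bar>g x\<bar> \<partial>torus)" by simp
qed

text \<open>
  The function is \<open>\<Sum>\<^sub>j \<sigma>\<^sub>j 3\<^sup>-\<^sup>j g\<^sub>j\<close> with norming functions \<open>g\<^sub>j\<close> and signs \<open>\<sigma>\<^sub>j\<close>. The sign is chosen such that the \<open>j\<close>-th
  term does not cancel against the preceding ones in the pairing with \<open>f\<^sub>j\<close>; it contributes
  \<open>(2/3) 3\<^sup>-\<^sup>j\<close> times the norm of \<open>f\<^sub>j\<close>, while all later terms together contribute at most \<open>(1/2) 3\<^sup>-\<^sup>j\<close> times this norm.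
\<close>

lemma gliding_hump:
  assumes f: "\<And>j. bper (B j) (f j)" and big: "\<And>j. 4 ^ j < Linf_norm (f j)"
  shows "\<exists>g. integrable torus g \<and> (\<forall>j. (1/6) * (4/3) ^ j \<le> \<bar>\<integral>x. f j x * g x \<partial>torus\<bar>)"
proof -
  have pos: "0 < Linf_norm (f j)" for j by (rule less_trans[OF _ big]) simp
  have "\<forall>j. \<exists>g. integrable torus g \<and> (\<integral>x. \<bar>g x\<bar> \<partial>torus) = 1 \<and> 2/3 * Linf_norm (f j) \<le> (\<integral>x. f j x * g x \<partial>torus)"
    by (intro allI, rule norming_function[OF f pos]) blast
  from choice[OF this] obtain g where
    "\<forall>j. integrable torus (g j) \<and> (\<integral>x. \<bar>g j x\<bar> \<partial>torus) = 1 \<and> 2/3 * Linf_norm (f j) \<le> (\<integral>x. f j x * g j x \<partial>torus)" ..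
  then have g: "\<And>j. integrable torus (g j)" "\<And>j. (\<integral>x. \<bar>g j x\<bar> \<partial>torus) = 1" "\<And>j. 2/3 * Linf_norm (f j) \<le> (\<integral>x. f j x * g j x \<partial>torus)"
    by simp_all
  define P where "P j h = (\<integral>x. f j x * h x \<partial>torus)" for j h
  define b where "b j = (1/3::real) ^ j" for j
  have b: "0 < b j" for j by (simp add: b_def)
  \<comment> \<open>\<open>s j\<close> fixes the signs with index below \<open>j\<close>\<close>
  define s where "s = rec_nat (\<lambda>i::nat. 1::real) (\<lambda>j \<sigma>. \<sigma>(j := (if 0 \<le> P j (\<lambda>x. \<Sum>i<j. \<sigma> i * b i * g i x) then 1 else -1)))"
  define \<sigma> where "\<sigma> j = s (Suc j) j" for j
  have s_stable: "s (j + k) i = s j i" if "i < j" for i j k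
    by (induction k) (use that in \<open>auto simp: s_def\<close>)
  have \<sigma>_eq: "s j i = \<sigma> i" if "i < j" for i j
    using s_stable[of i "Suc i" "j - Suc i"] that by (simp add: \<sigma>_def)
  have \<sigma>_val: "\<sigma> j = (if 0 \<le> P j (\<lambda>x. \<Sum>i<j. \<sigma> i * b i * g i x) then 1 else -1)" for j
  proof -
    have "\<sigma> j = (if 0 \<le> P j (\<lambda>x. \<Sum>i<j. s j i * b i * g i x) then 1 else -1)" by (simp add: \<sigma>_def s_def)
    then show ?thesis by (simp add: \<sigma>_eq)
  qed
  have \<sigma>1: "\<bar>\<sigma> j\<bar> = 1" for j using \<sigma>_val[of j] by (auto split: if_splits)
  define d where "d j x = \<sigma> j * b j * g j x" for j x
  have id: "integrable torus (d j)" for j unfolding d_def[abs_def] using g(1) by simp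
  have nd: "(\<integral>x. \<bar>d j x\<bar> \<partial>torus) = b j" for j
    unfolding d_def abs_mult using g(2)[of j] \<sigma>1[of j] b[of j] by simp
  have sb: "summable b" unfolding b_def[abs_def] by (rule summable_geometric) simp
  have AEs: "AE x in torus. summable (\<lambda>j. \<bar>d j x\<bar>)"
  proof -
    have [measurable]: "d j \<in> borel_measurable torus" for j using id by auto
    have "(\<integral>\<^sup>+x. (\<Sum>j. ennreal \<bar>d j x\<bar>) \<partial>torus) = (\<Sum>j. \<integral>\<^sup>+x. ennreal \<bar>d j x\<bar> \<partial>torus)"
      by (rule nn_integral_suminf) measurable
    also have "\<dots> = (\<Sum>j. ennreal (b j))"
    proof (rule suminf_cong)
      fix j
      have "(\<integral>\<^sup>+x. ennreal \<bar>d j x\<bar> \<partial>torus) = ennreal (\<integral>x. \<bar>d j x\<bar> \<partial>torus)"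
        by (rule nn_integral_eq_integral) (use id in auto)
      then show "(\<integral>\<^sup>+x. ennreal \<bar>d j x\<bar> \<partial>torus) = ennreal (b j)" by (simp only: nd)
    qed
    also have "\<dots> = ennreal (\<Sum>j. b j)" by (rule suminf_ennreal2) (use b sb in \<open>auto intro: less_imp_le\<close>)
    finally have "(\<integral>\<^sup>+x. (\<Sum>j. ennreal \<bar>d j x\<bar>) \<partial>torus) \<noteq> \<infinity>" by simp
    then have "AE x in torus. (\<Sum>j. ennreal \<bar>d j x\<bar>) \<noteq> \<infinity>"
      by (intro nn_integral_PInf_AE) measurable
    then show ?thesis
      by eventually_elim (auto intro: summable_suminf_not_top)
  qed
  define G where "G x = (\<Sum>j. d j x)" for x
  have iG: "integrable torus G"
    unfolding G_def[abs_def]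
    by (rule integrable_suminf[OF id]) (use AEs sb in \<open>auto simp: nd\<close>)
  have main: "(1/6) * (4/3) ^ j \<le> \<bar>P j G\<bar>" for j
  proof -
    define N where "N = Linf_norm (f j)"
    have N: "0 < N" "4 ^ j < N" using pos big by (simp_all add: N_def)
    have ifd: "integrable torus (\<lambda>x. f j x * d i x)" for i by (rule pairing_bound_Linf(1)[OF f id])
    have Pd: "\<bar>P j (d i)\<bar> \<le> N * b i" for i
      using pairing_bound_Linf(2)[OF f id, of j i] by (simp add: P_def N_def nd)
    have sP: "summable (\<lambda>i. P j (d i))"
      by (rule summable_comparison_test'[where N=0 and g="\<lambda>i. N * b i"]) (use sb Pd in \<open>auto intro: summable_mult\<close>)
    have "P j G = (\<Sum>i. P j (d i))"
    proof -
      have "(\<lambda>i. \<integral>x. f j x * d i x \<partial>torus) sums (\<integral>x. (\<Sum>i. f j x * d i x) \<partial>torus)"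
      proof (rule sums_integral[OF ifd])
        show "AE x in torus. summable (\<lambda>i. norm (f j x * d i x))"
          using AEs by eventually_elim (auto simp: abs_mult intro: summable_mult)
        show "summable (\<lambda>i. \<integral>x. norm (f j x * d i x) \<partial>torus)"
        proof (rule summable_comparison_test'[where N=0 and g="\<lambda>i. B j * b i"])
          show "summable (\<lambda>i. B j * b i)" using sb by (rule summable_mult)
          fix i
          have "(\<integral>x. \<bar>f j x * d i x\<bar> \<partial>torus) \<le> (\<integral>x. B j * \<bar>d i x\<bar> \<partial>torus)"
          proof (rule integral_mono)
            show "integrable torus (\<lambda>x. \<bar>f j x * d i x\<bar>)" by (rule integrable_abs[OF ifd])
            show "integrable torus (\<lambda>x. B j * \<bar>d i x\<bar>)" using id by simp
            show "\<bar>f j x * d i x\<bar> \<le> B j * \<bar>d i x\<bar>" for x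
              unfolding abs_mult by (rule mult_right_mono[OF bper_bound[OF f]]) simp
          qed
          then show "norm (\<integral>x. norm (f j x * d i x) \<partial>torus) \<le> B j * b i" by (simp add: nd)
        qed
      qed
      then have "(\<Sum>i. P j (d i)) = (\<integral>x. (\<Sum>i. f j x * d i x) \<partial>torus)" unfolding P_def by (rule sums_unique[symmetric])
      also have "\<dots> = P j G"
        unfolding P_def
      proof (rule integral_cong_AE)
        have fm: "f j \<in> borel_measurable torus" by (rule torus_measurable[OF bper_loc_bdd[OF f]])
        have dm: "d i \<in> borel_measurable torus" for i using id by auto
        show "(\<lambda>x. \<Sum>i. f j x * d i x) \<in> borel_measurable torus" using fm dm by measurable
        show "(\<lambda>x. f j x * G x) \<in> borel_measurable torus" using fm iG by auto
        show "AE x in torus. (\<Sum>i. f j x * d i x) = f j x * G x"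
          using AEs by eventually_elim (auto simp: G_def intro!: suminf_mult summable_rabs_cancel)
      qed
      finally show ?thesis by simp
    qed
    also have "\<dots> = (\<Sum>i. P j (d (i + Suc j))) + (\<Sum>i<Suc j. P j (d i))" by (rule suminf_split_initial_segment[OF sP])
    finally have split: "P j G = (\<Sum>i. P j (d (i + Suc j))) + (\<Sum>i<Suc j. P j (d i))" .
    have tail: "\<bar>\<Sum>i. P j (d (i + Suc j))\<bar> \<le> N * b j / 2"
    proof -
      have sums: "(\<lambda>i. N * b (i + Suc j)) sums (N * b j / 2)"
      proof -
        have "(\<lambda>i. (N * b (Suc j)) * (1/3) ^ i) sums ((N * b (Suc j)) * (1 / (1 - 1/3)))"
          by (intro sums_mult geometric_sums) simp
        then show ?thesis by (simp add: b_def power_add mult_ac)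
      qed
      have "norm (\<Sum>i. P j (d (i + Suc j))) \<le> (\<Sum>i. N * b (i + Suc j))"
        by (rule norm_suminf_le) (use Pd sums in \<open>auto simp: sums_iff\<close>)
      then show ?thesis using sums by (simp add: sums_iff)
    qed
    have head: "2/3 * N * b j \<le> \<bar>\<Sum>i<Suc j. P j (d i)\<bar>"
    proof -
      have Psum: "(\<Sum>i<j. P j (d i)) = P j (\<lambda>x. \<Sum>i<j. \<sigma> i * b i * g i x)"
        unfolding P_def d_def[symmetric] sum_distrib_left by (subst Bochner_Integration.integral_sum) (use ifd in auto)
      have "P j (d j) = \<sigma> j * b j * P j (g j)"
        unfolding P_def d_def by (simp add: mult_ac flip: integral_mult_right_zero)
      moreover have "2/3 * N \<le> P j (g j)" using g(3)[of j] by (simp add: P_def N_def)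
      then have "b j * (2/3 * N) \<le> b j * P j (g j)" using b[of j] by (intro mult_left_mono) auto
      ultimately have dj: "P j (d j) = \<sigma> j * (b j * P j (g j))" "2/3 * N * b j \<le> b j * P j (g j)" by (simp_all add: mult_ac)
      show ?thesis
      proof (cases "0 \<le> P j (\<lambda>x. \<Sum>i<j. \<sigma> i * b i * g i x)")
        case True
        then have "\<sigma> j = 1" using \<sigma>_val[of j] by simp
        then show ?thesis using dj(2) True unfolding sum.lessThan_Suc Psum dj(1) \<open>\<sigma> j = 1\<close> by linarith
      next
        case False
        then have "\<sigma> j = -1" using \<sigma>_val[of j] by simp
        then show ?thesis using dj(2) False unfolding sum.lessThan_Suc Psum dj(1) \<open>\<sigma> j = -1\<close> by linarith
      qed
    qed
    have "(1/6) * (4/3) ^ j = (1/6) * (b j * 4 ^ j)" by (simp add: b_def power_divide)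
    also have "\<dots> \<le> (1/6) * (b j * N)" using N b[of j] by (intro mult_left_mono) auto
    also have "\<dots> = 2/3 * N * b j - N * b j / 2" by (simp add: field_simps)
    also have "\<dots> \<le> \<bar>P j G\<bar>" unfolding split using head tail by linarith
    finally show ?thesis .
  qed
  then show ?thesis using iG unfolding P_def by blast
qed

text \<open>
  The uniform boundedness principle for functionals on \<open>L\<^sup>1\<close>. It turns weak-* continuity of the slope of
  a solution into a bound in \<open>L\<^sup>\<infinity>\<close> that is locally uniform in time.
\<close>

lemma uniform_boundedness:
  assumes f: "\<And>i. i \<in> I \<Longrightarrow> bper (B i) (f i)"
    and bd: "\<And>g. integrable torus g \<Longrightarrow> \<exists>K. \<forall>i\<in>I. \<bar>\<integral>x. f i x * g x \<partial>torus\<bar> \<le> K"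
  shows "\<exists>K. \<forall>i\<in>I. Linf_norm (f i) \<le> K"
proof (rule ccontr)
  assume "\<not> ?thesis"
  then have "\<forall>j::nat. \<exists>i\<in>I. 4 ^ j < Linf_norm (f i)" by (meson not_le)
  then obtain i where i: "\<And>j. i j \<in> I" "\<And>j. 4 ^ j < Linf_norm (f (i j))" by metis
  obtain g where g: "integrable torus g" "\<And>j. (1/6) * (4/3) ^ j \<le> \<bar>\<integral>x. f (i j) x * g x \<partial>torus\<bar>"
    using gliding_hump[where f="\<lambda>j. f (i j)" and B="\<lambda>j. B (i j)"] f i by blast
  obtain K where K: "\<forall>i\<in>I. \<bar>\<integral>x. f i x * g x \<partial>torus\<bar> \<le> K" using bd[OF g(1)] by blast
  have "\<exists>j. 6 * K < (4/3::real) ^ j" by (rule real_arch_pow) simp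
  then obtain j where "6 * K < (4/3::real) ^ j" by blast
  moreover have "(1/6) * (4/3) ^ j \<le> K" using g(2)[of j] K i(1)[of j] by (meson order_trans)
  ultimately show False by simp
qed

section \<open>Bounds in time and for the right-hand side\<close>

context bounded_solution
begin

lemma time_lipschitz:
  assumes t: "t \<in> {-T..T}" and s: "s \<in> {-T..T}"
  shows "\<bar>u s x - u t x\<bar> \<le> (R * ((2*R + c\<^sup>2) / (2*c)) + 8*pi*(R\<^sup>2 + R) / (2*c)) * \<bar>s - t\<bar>"
proof -
  obtain X where X: "\<And>\<xi>. X \<xi> 0 = \<xi>" "\<And>\<xi>. curve (X \<xi>)" using flow_exists by metis
  define x' where "x' = X 0 t + wrap (x - X 0 t)"
  have same: "u r x = u r x'" if "r \<in> {-T..T}" for r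
    using periodic_int[OF per_primD(2)[OF pp[OF that]], of x "- \<lfloor>(x - X 0 t) / (2*pi)\<rfloor>"] by (simp add: x'_def wrap_def)
  obtain \<xi> where \<xi>: "X \<xi> t = x'"
    using flow_reaches[OF X t, of x'] wrap_range[of "x - X 0 t"] by (auto simp: x'_def)
  have Vb: "norm (X \<xi> s - X \<xi> t) \<le> (2*R + c\<^sup>2) / (2*c) * norm (s - t)"
  proof (rule field_differentiable_bound[where f'="\<lambda>t. V t (X \<xi> t)" and S="{-T..T}"])
    show "norm (V r (X \<xi> r)) \<le> (2*R + c\<^sup>2) / (2*c)" if "r \<in> {-T..T}" for r
      using bper_bound[OF ub[OF that], of "X \<xi> r"] c
      by (auto simp: V_def abs_divide intro!: divide_right_mono order_trans[OF abs_triangle_ineq4])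
  qed (use X t s in \<open>auto simp: curve_def\<close>)
  have Fb: "norm (u s (X \<xi> s) - u t (X \<xi> t)) \<le> 8*pi*(R\<^sup>2 + R) / (2*c) * norm (s - t)"
  proof (rule field_differentiable_bound[where f'="\<lambda>t. F t (X \<xi> t) / (2*c)" and S="{-T..T}"])
    show "norm (F r (X \<xi> r) / (2*c)) \<le> 8*pi*(R\<^sup>2 + R) / (2*c)" if "r \<in> {-T..T}" for r
    proof -
      have "\<bar>F r (X \<xi> r)\<bar> / (2*c) \<le> 8*pi*(R\<^sup>2 + R) / (2*c)"
        unfolding F_def using bper_bound[OF zmp_bper[OF srcb[OF that]], of "X \<xi> r"] c by (intro divide_right_mono) auto
      then show ?thesis using c by (simp only: real_norm_def abs_divide)
    qed
  qed (use X t s u_deriv_along in auto)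
  have "\<bar>u s x' - u s (X \<xi> s)\<bar> \<le> R * ((2*R + c\<^sup>2) / (2*c) * \<bar>s - t\<bar>)"
    by (rule per_prim_lip_le[OF pp[OF s]]) (use Vb \<xi> in \<open>simp add: abs_minus_commute\<close>)
  then have "\<bar>u s x' - u t x'\<bar> \<le> R * ((2*R + c\<^sup>2) / (2*c) * \<bar>s - t\<bar>) + 8*pi*(R\<^sup>2 + R) / (2*c) * \<bar>s - t\<bar>"
    using Fb unfolding \<xi> real_norm_def by linarith
  then show ?thesis unfolding same[OF t] same[OF s] by (simp add: distrib_right mult.assoc)
qed

end

definition "rhs_bound c R = ((c\<^sup>2 + 2*R) * R + 8*pi*(R\<^sup>2 + R)) / (2*c)"

lemma rhs_bper:
  assumes c: "0 < c" and "bper R u" "bper R m" shows "bper (rhs_bound c R) (rhs c u m)"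
proof -
  have l: "loc_bdd u" "loc_bdd m" using assms bper_loc_bdd by auto
  have s: "bper (R\<^sup>2 + R) (src u m)" by (rule src_bper[OF assms(2,3)])
  show ?thesis
  proof (rule bperI)
    show "loc_bdd (rhs c u m)" by (rule rhs_loc_bdd[OF l])
    show "periodic (rhs c u m)"
      using periodicD[OF bper_periodic[OF assms(2)]] periodicD[OF bper_periodic[OF assms(3)]]
        periodicD[OF zmp_periodic[OF bper_periodic[OF s] bper_loc_bdd[OF s]]] by (simp add: periodic_def rhs_def)
    fix x
    have "\<bar>c\<^sup>2 - 2 * u x\<bar> \<le> c\<^sup>2 + 2*R" using bper_bound[OF assms(2), of x] zero_le_power2[of c] unfolding abs_le_iff by linarith
    then have "\<bar>(c\<^sup>2 - 2 * u x) * m x\<bar> \<le> (c\<^sup>2 + 2*R) * R"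
      unfolding abs_mult using bper_bound[OF assms(3), of x] bper_nonneg[OF assms(2)] by (intro mult_mono) auto
    then have "\<bar>(c\<^sup>2 - 2 * u x) * m x + zmp (src u m) x\<bar> \<le> (c\<^sup>2 + 2*R) * R + 8*pi*(R\<^sup>2 + R)"
      using bper_bound[OF zmp_bper[OF s], of x] by linarith
    then show "\<bar>rhs c u m x\<bar> \<le> rhs_bound c R" using c by (simp add: rhs_def rhs_bound_def abs_divide divide_right_mono)
  qed
qed

definition "rhs_lip c R = (c\<^sup>2 + 4*R + 8*pi*(2*R + 1)) / (2*c)"

text \<open>
  The local term is Lipschitz in \<open>L\<^sup>1\<close> on bounded sets, and the nonlocal one even maps \<open>L\<^sup>1\<close> to bounded functions.
\<close>

lemma rhs_L1:
  assumes c: "0 < c" and b: "bper R u" "bper R m" "bper R v" "bper R n"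
  shows "L1_dist (rhs c u m) (rhs c v n) \<le> rhs_lip c R * (L1_dist m n + L1_dist u v)"
proof -
  have l: "loc_bdd u" "loc_bdd m" "loc_bdd v" "loc_bdd n" using b bper_loc_bdd by auto
  have R: "0 \<le> R" by (rule bper_nonneg[OF b(1)])
  have ls: "loc_bdd (src u m)" "loc_bdd (src v n)" by (intro src_loc_bdd l)+
  have ps: "periodic (src u m)" "periodic (src v n)" by (intro src_periodic bper_periodic[OF b(1)] bper_periodic[OF b(2)] bper_periodic[OF b(3)] bper_periodic[OF b(4)])+
  let ?A = "\<lambda>x. (c\<^sup>2 + 2*R) * (m x - n x)" and ?B = "\<lambda>x. 2*R * (u x - v x)"
  define a where "a = L1_dist m n"
  define d where "d = L1_dist u v"
  have ad: "0 \<le> a" "0 \<le> d" unfolding a_def d_def using l by (auto intro: L1_norm_nonneg)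
  have Z: "\<bar>zmp (src u m) x - zmp (src v n) x\<bar> \<le> 4 * (2*R*a + d)" for x
  proof -
    have "\<bar>zmp (\<lambda>x. src u m x - src v n x) x\<bar> \<le> 4 * L1_dist (src u m) (src v n)"
      by (rule zmp_L1[OF loc_bdd_diff[OF ls] periodic_binop[OF ps]])
    also have "\<dots> \<le> 4 * (2*R*a + d)"
      unfolding a_def d_def by (rule mult_left_mono[OF src_L1_le[OF b(2,4) l(1,3)]]) simp
    finally show ?thesis unfolding zmp_diff[OF ls] .
  qed
  have "L1_norm (\<lambda>x. (2*c) * (rhs c u m x - rhs c v n x)) \<le> L1_norm (\<lambda>x. (\<bar>?A x\<bar> + \<bar>?B x\<bar>) + 4 * (2*R*a + d))"
  proof (rule L1_norm_mono)
    fix x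
    have e: "(2*c) * (rhs c u m x - rhs c v n x) = (c\<^sup>2 - 2 * u x) * (m x - n x) - 2 * n x * (u x - v x) + (zmp (src u m) x - zmp (src v n) x)"
      using c by (simp add: rhs_def field_simps)
    have "\<bar>c\<^sup>2 - 2 * u x\<bar> \<le> \<bar>c\<^sup>2 + 2*R\<bar>" using bper_bound[OF b(1), of x] R zero_le_power2[of c] unfolding abs_le_iff by linarith
    then have 1: "\<bar>(c\<^sup>2 - 2 * u x) * (m x - n x)\<bar> \<le> \<bar>?A x\<bar>" unfolding abs_mult by (rule mult_right_mono) simp
    have 2: "\<bar>2 * n x * (u x - v x)\<bar> \<le> \<bar>?B x\<bar>" unfolding abs_mult using bper_bound[OF b(4), of x] R by (intro mult_mono) auto
    have "0 \<le> 4 * (2*R*a + d)" using ad R by simp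
    then show "\<bar>(2*c) * (rhs c u m x - rhs c v n x)\<bar> \<le> \<bar>(\<bar>?A x\<bar> + \<bar>?B x\<bar>) + 4 * (2*R*a + d)\<bar>"
      unfolding e using 1 2 Z[of x] by linarith
  qed (use l rhs_loc_bdd in \<open>auto intro!: loc_bdd_add loc_bdd_mult loc_bdd_abs loc_bdd_diff rhs_loc_bdd loc_bdd_const\<close>)
  also have "\<dots> \<le> (L1_norm (\<lambda>x. \<bar>?A x\<bar>) + L1_norm (\<lambda>x. \<bar>?B x\<bar>)) + L1_norm (\<lambda>x. 4 * (2*R*a + d))"
    using L1_norm_triangle[of "\<lambda>x. \<bar>?A x\<bar> + \<bar>?B x\<bar>" "\<lambda>x. 4 * (2*R*a + d)"] L1_norm_triangle[of "\<lambda>x. \<bar>?A x\<bar>" "\<lambda>x. \<bar>?B x\<bar>"] l by simp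
  also have "\<dots> = ((c\<^sup>2 + 2*R) * a + 2*R * d) + 2*pi * (4 * (2*R*a + d))"
  proof -
    have "L1_norm (\<lambda>x. \<bar>h x\<bar>) = L1_norm h" for h by (simp add: L1_norm_def)
    moreover have "L1_norm (\<lambda>x. 4 * (2*R*a + d)) = 2*pi * (4 * (2*R*a + d))" using ad R by (simp add: L1_norm_def mult.commute)
    ultimately show ?thesis using R unfolding a_def d_def by (simp only: L1_norm_cmul) simp
  qed
  also have "\<dots> \<le> (c\<^sup>2 + 4*R + 8*pi*(2*R + 1)) * (a + d)"
  proof -
    have "0 \<le> c\<^sup>2 * d + 2*R*a + 2*R*d + 8*pi*a + 8*pi*(2*R*d)" using ad R by simp
    then show ?thesis by (simp add: algebra_simps)
  qed
  finally have "2*c * L1_dist (rhs c u m) (rhs c v n) \<le> (c\<^sup>2 + 4*R + 8*pi*(2*R + 1)) * (a + d)"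
    unfolding L1_norm_cmul using c by simp
  then show ?thesis using c by (simp add: rhs_lip_def a_def d_def field_simps)
qed

section \<open>From representatives to the function spaces\<close>

lemma L1_norm_le_L2_norm:
  assumes "w \<in> borel_measurable torus" "bper B g" "AE x in torus. w x = g x"
  shows "L1_norm g \<le> sqrt (2*pi) * L2_norm w"
proof -
  have l: "loc_bdd g" by (rule bper_loc_bdd[OF assms(2)])
  note [measurable] = assms(1) torus_measurable[OF l]
  have "(\<integral>x. (w x)\<^sup>2 \<partial>torus) = (\<integral>x. (g x)\<^sup>2 \<partial>torus)"
    by (rule integral_cong_AE) (use assms(3) in auto)
  then have "L2_norm w = L2_norm g" by (simp add: L2_norm_def)
  then show ?thesis using L1_le_L2_norm(2)[of g] l by (simp add: torus_integrable(1) torus_measurable L1_norm_torus)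
qed

lemma per_prim_AE_eq:
  assumes "per_prim B u m" "per_prim C v n" "AE x in torus. u x = v x"
  shows "u x = v x" "AE x in torus. m x = n x" "L1_dist m n = 0"
proof -
  note p = per_primD[OF assms(1)] and q = per_primD[OF assms(2)]
  have "has_weak_deriv v m"
    by (rule has_weak_deriv_cong[OF per_prim_weak_deriv[OF assms(1)] assms(3) _ continuous_L1_per[OF q(8,2)] bper_L1_per[OF p(1)]]) simp
  then show ae: "AE x in torus. m x = n x" by (rule weak_deriv_unique) (rule per_prim_weak_deriv[OF assms(2)])
  show z: "L1_dist m n = 0"
  proof -
    have "(\<integral>x. \<bar>m x - n x\<bar> \<partial>torus) = (\<integral>x. 0 \<partial>torus)"
      by (rule integral_cong_AE) (use ae p(4) q(4) in \<open>auto intro!: borel_measurable_abs borel_measurable_diff torus_measurable\<close>)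
    then show ?thesis using p(4) q(4) by (simp add: L1_norm_torus)
  qed
  have "L1_dist u v = 0"
  proof -
    have "(\<integral>x. \<bar>u x - v x\<bar> \<partial>torus) = (\<integral>x. 0 \<partial>torus)"
      by (rule integral_cong_AE) (use assms(3) p(7) q(7) in \<open>auto intro!: borel_measurable_abs borel_measurable_diff torus_measurable\<close>)
    then show ?thesis using p(7) q(7) by (simp add: L1_norm_torus)
  qed
  then show "u x = v x" using per_prim_sup_le[OF per_prim_diff[OF assms(1,2)], of x] z by simp
qed

text \<open>
  Two zero-mean functions with the same weak derivative agree almost everywhere.
\<close>

lemma Pi0_inv_dx_Pi0_eq:
  assumes f: "periodic f" "integrable torus f" "AE x in torus. f x = h x" and h: "bper B h"
  shows "AE x in torus. Pi0_inv_dx_Pi0 f x = zmp h x"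
proof -
  have l: "loc_bdd h" "periodic h" using h bper_loc_bdd bper_periodic by auto
  have mf: "mean f = avg h"
  proof -
    have "(\<integral>x. f x \<partial>torus) = (\<integral>x. h x \<partial>torus)"
      by (rule integral_cong_AE) (use f torus_measurable[OF l(1)] in auto)
    then show ?thesis using l by (simp add: mean_def avg_def torus_integrable)
  qed
  define h0 where "h0 x = h x - avg h" for x
  have bh: "bper (B + B) h0"
    unfolding h0_def[abs_def] by (rule bper_diff[OF h bper_const]) (rule avg_bound[OF l(1) bper_bound[OF h]])
  have zp: "per_prim (B + B) (zmp h) h0"
    unfolding per_prim_def
  proof (intro conjI allI bh zmp_periodic l)
    show "prim h0 x = zmp h x - zmp h 0" for x
      using zmp_diff_eq[OF l(1), of x 0] l(1) by (simp add: h0_def[abs_def] prim_diff)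
  qed
  have ae: "AE x in torus. h0 x = Pi0 f x" using f(3) by eventually_elim (simp add: h0_def Pi0_def mf)
  have PL: "Pi0 f \<in> L1_per" using f by (simp add: L1_per_def Pi0_def periodic_def)
  have w: "has_weak_deriv (zmp h) (Pi0 f)"
    by (rule has_weak_deriv_cong[OF per_prim_weak_deriv[OF zp] _ ae continuous_L1_per[OF per_primD(8,2)[OF zp]] PL]) simp
  have mz: "mean (zmp h) = 0" using zmp_avg[OF l(1)] l(1) by (simp add: mean_def avg_def torus_integrable)
  define g where "g = Pi0_inv_dx_Pi0 f"
  have g: "mean g = 0" "has_weak_deriv g (Pi0 f)"
    using someI[of "\<lambda>g. mean g = 0 \<and> has_weak_deriv g (Pi0 f)" "zmp h"] w mz unfolding g_def Pi0_inv_dx_Pi0_def by auto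
  have "AE x in torus. Pi0 f x = h0 x" using ae by auto
  then obtain v where v: "per_prim (B + B) v h0" "AE x in torus. g x = v x"
    by (rule weak_deriv_bounded_primitive[OF g(2) _ bh])
  note pv = per_primD[OF v(1)]
  have dz: "v x - zmp h x = v 0 - zmp h 0" for x using pv(3)[of x] per_primD(3)[OF zp, of x] by simp
  have "mean g = avg v"
  proof -
    have "(\<integral>x. g x \<partial>torus) = (\<integral>x. v x \<partial>torus)"
      by (rule integral_cong_AE) (use g(2) v(2) torus_measurable[OF pv(7)] in \<open>auto simp: has_weak_deriv_def L1_per_def\<close>)
    then show ?thesis using pv(7) by (simp add: mean_def avg_def torus_integrable)
  qed
  then have "avg (\<lambda>x. v x - zmp h x) = 0" using g(1) pv(7) l(1) by (simp add: avg_diff zmp_avg)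
  moreover have "(\<lambda>x. v x - zmp h x) = (\<lambda>x. v 0 - zmp h 0)" by (rule ext) (rule dz)
  ultimately have "v 0 - zmp h 0 = 0" by simp
  then have "v x = zmp h x" for x using dz[of x] by simp
  then show "AE x in torus. Pi0_inv_dx_Pi0 f x = zmp h x" using v(2) unfolding g_def by auto
qed

lemma L2_per_integrable: "f \<in> L2_per \<Longrightarrow> integrable torus f"
  by (rule L1_le_L2_norm(1)) (simp_all add: L2_per_def)

text \<open>
  Pairings with trigonometric polynomials are among the seminorms and determine the limit.
\<close>

lemma has_time_deriv_unique:
  assumes d: "has_time_deriv \<eta> w t" "has_time_deriv \<eta> w' t" and ev: "eventually (\<lambda>s. \<eta> s \<in> L2_per) (at t)" "\<eta> t \<in> L2_per"
  shows "AE x in torus. w x = w' x"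
proof -
  have iw: "integrable torus w" "integrable torus w'" using d by (auto simp: has_time_deriv_def L2_per_integrable)
  have "AE x in torus. w x - w' x = 0"
  proof (rule du_Bois_Reymond)
    show "integrable torus (\<lambda>x. w x - w' x)" using iw by simp
    fix \<phi> assume \<phi>: "\<phi> \<in> trig"
    have l: "loc_bdd \<phi>" by (rule trig_loc_bdd[OF \<phi>])
    have "\<phi> \<in> L1_per" using \<phi> by (simp add: L1_per_def torus_integrable(1) l trig_periodic)
    then have p: "(\<lambda>u. \<bar>pairing u \<phi>\<bar>) \<in> seminorms_L2_Linf" by (auto simp: seminorms_L2_Linf_def)
    have lim: "((\<lambda>s. pairing (\<lambda>x. (\<eta> s x - \<eta> t x) / (s - t) - z x) \<phi>) \<longlongrightarrow> 0) (at t)" if "has_time_deriv \<eta> z t" for z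
    proof -
      have "tendsto_wrt seminorms_L2_Linf (\<lambda>s x. (\<eta> s x - \<eta> t x) / (s - t)) z (at t)" using that by (simp add: has_time_deriv_def)
      from bspec[OF this[unfolded tendsto_wrt_def] p] show ?thesis by (rule tendsto_rabs_zero_cancel)
    qed
    have "((\<lambda>s. pairing (\<lambda>x. (\<eta> s x - \<eta> t x) / (s - t) - w' x) \<phi> - pairing (\<lambda>x. (\<eta> s x - \<eta> t x) / (s - t) - w x) \<phi>) \<longlongrightarrow> 0 - 0) (at t)"
      by (intro tendsto_diff lim d)
    moreover have "eventually (\<lambda>s. pairing (\<lambda>x. (\<eta> s x - \<eta> t x) / (s - t) - w' x) \<phi> - pairing (\<lambda>x. (\<eta> s x - \<eta> t x) / (s - t) - w x) \<phi>
        = (\<integral>x. (w x - w' x) * \<phi> x \<partial>torus)) (at t)"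
      using ev(1)
    proof eventually_elim
      case (elim s)
      have "integrable torus (\<lambda>x. (\<eta> s x - \<eta> t x) / (s - t))" using L2_per_integrable[OF elim] L2_per_integrable[OF ev(2)] by simp
      then have i: "integrable torus (\<lambda>x. ((\<eta> s x - \<eta> t x) / (s - t) - z x) * \<phi> x)" if "integrable torus z" for z
        using that by (intro integrable_times_bounded l) auto
      show ?case
        unfolding pairing_def Bochner_Integration.integral_diff[OF i[OF iw(2)] i[OF iw(1)], symmetric]
        by (rule Bochner_Integration.integral_cong[OF refl]) (simp add: left_diff_distrib)
    qed
    ultimately have "((\<lambda>s. \<integral>x. (w x - w' x) * \<phi> x \<partial>torus) \<longlongrightarrow> 0 - 0) (at t)"
      by (rule Lim_transform_eventually)
    then show "(\<integral>x. (w x - w' x) * \<phi> x \<partial>torus) = 0" by (simp add: tendsto_const_iff)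
  qed
  then show ?thesis by simp
qed

section \<open>Solutions and their Lipschitz representatives\<close>

lemma eventually_in_interval: "t \<in> {a<..<b} \<Longrightarrow> eventually (\<lambda>s. s \<in> {a<..<b}) (at (t::real))"
  using eventually_nhds_in_open[of "{a<..<b}" t] unfolding eventually_at_filter by (auto elim: eventually_mono)

lemma L2_le_H1: "L2_norm w \<le> H1_norm w" "L2_norm (weak_deriv w) \<le> H1_norm w" "0 \<le> L2_norm w"
proof -
  have n: "0 \<le> L2_norm f" for f by (simp add: L2_norm_def)
  show "0 \<le> L2_norm w" by (rule n)
  show "L2_norm w \<le> H1_norm w" "L2_norm (weak_deriv w) \<le> H1_norm w"
    unfolding H1_norm_def using real_sqrt_sum_squares_ge1 real_sqrt_sum_squares_ge2 by blast+
qed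

text \<open>
  Differences of functions are passed to differences of their representatives, on which the \<open>L\<^sup>1\<close> theory
  operates.
\<close>

lemma H1_diff_controls:
  assumes "per_prim B u m" "per_prim C v n" and \<zeta>: "\<zeta> \<in> L2_per" "AE x in torus. \<zeta> x = u x" and \<xi>: "\<xi> \<in> L2_per" "AE x in torus. \<xi> x = v x"
  shows "L1_dist u v \<le> sqrt (2*pi) * H1_norm (\<lambda>x. \<zeta> x - \<xi> x)"
    "L1_dist m n \<le> sqrt (2*pi) * H1_norm (\<lambda>x. \<zeta> x - \<xi> x)"
    "AE x in torus. weak_deriv (\<lambda>x. \<zeta> x - \<xi> x) x = m x - n x"
    "(\<lambda>x. \<zeta> x - \<xi> x) \<in> L1_per" "AE x in torus. \<zeta> x - \<xi> x = u x - v x"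
    "weak_deriv (\<lambda>x. \<zeta> x - \<xi> x) \<in> borel_measurable torus"
proof -
  let ?w = "\<lambda>x. \<zeta> x - \<xi> x"
  note pd = per_prim_diff[OF assms(1,2)]
  show w: "?w \<in> L1_per" using L2_per_integrable[OF \<zeta>(1)] L2_per_integrable[OF \<xi>(1)] \<zeta>(1) \<xi>(1)
    by (auto simp: L1_per_def L2_per_def intro: periodic_binop)
  show ae: "AE x in torus. ?w x = u x - v x" using \<zeta>(2) \<xi>(2) by eventually_elim simp
  show aw: "AE x in torus. weak_deriv ?w x = m x - n x" by (rule weak_deriv_eq_slope(2)[OF pd w ae])
  show mw: "weak_deriv ?w \<in> borel_measurable torus" by (rule weak_deriv_measurable[OF pd w ae])
  have m: "?w \<in> borel_measurable torus" using w by (auto simp: L1_per_def)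
  obtain K where K: "bper K (\<lambda>x. u x - v x)" by (rule per_prim_bper[OF pd])
  show "L1_dist u v \<le> sqrt (2*pi) * H1_norm ?w"
    by (rule order_trans[OF L1_norm_le_L2_norm[OF m K ae]]) (intro mult_left_mono L2_le_H1, simp)
  show "L1_dist m n \<le> sqrt (2*pi) * H1_norm ?w"
    by (rule order_trans[OF L1_norm_le_L2_norm[OF mw per_primD(1)[OF pd] aw]]) (intro mult_left_mono L2_le_H1, simp)
qed

lemma H1_norm_in_seminorms: "H1_norm \<in> seminorms_H1_W1inf"
  by (simp add: seminorms_H1_W1inf_def)

lemma solutionD:
  assumes "is_solution c \<tau> \<eta>0 \<zeta>" "t \<in> {-\<tau><..<\<tau>}"
  shows "\<zeta> t \<in> H1_per" "\<zeta> t \<in> W1inf_per" "\<zeta> t \<in> L2_per" "tendsto_wrt seminorms_H1_W1inf \<zeta> (\<zeta> t) (at t)"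
    "has_time_deriv \<zeta> (time_deriv \<zeta> t) t"
    "AE x in torus. 2 * c * time_deriv \<zeta> t x = (c\<^sup>2 - 2 * \<zeta> t x) * weak_deriv (\<zeta> t) x +
         Pi0_inv_dx_Pi0 (\<lambda>y. (weak_deriv (\<zeta> t) y)\<^sup>2 + \<zeta> t y) x"
proof -
  have C0: "\<zeta> \<in> C0_H1_W1inf {-\<tau><..<\<tau>}" and C1: "\<zeta> \<in> C1_L2_Linf {-\<tau><..<\<tau>}" using assms(1) by (auto simp: is_solution_def)
  show h: "\<zeta> t \<in> H1_per" and "\<zeta> t \<in> W1inf_per" and "tendsto_wrt seminorms_H1_W1inf \<zeta> (\<zeta> t) (at t)"
    using C0 assms(2) by (auto simp: C0_H1_W1inf_def)
  show "\<zeta> t \<in> L2_per" using h by (simp add: H1_per_def)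
  have "\<exists>w. has_time_deriv \<zeta> w t" using C1 assms(2) unfolding C1_L2_Linf_def by blast
  then show "has_time_deriv \<zeta> (time_deriv \<zeta> t) t" unfolding time_deriv_def by (rule someI_ex)
  show "AE x in torus. 2 * c * time_deriv \<zeta> t x = (c\<^sup>2 - 2 * \<zeta> t x) * weak_deriv (\<zeta> t) x +
         Pi0_inv_dx_Pi0 (\<lambda>y. (weak_deriv (\<zeta> t) y)\<^sup>2 + \<zeta> t y) x"
    using assms by (simp add: is_solution_def)
qed

lemma bracket_eq_rhs:
  assumes c: "0 < c" and p: "per_prim B u m" and z: "\<zeta> \<in> L2_per" "AE x in torus. \<zeta> x = u x"
  shows "AE x in torus. (c\<^sup>2 - 2 * \<zeta> x) * weak_deriv \<zeta> x + Pi0_inv_dx_Pi0 (\<lambda>y. (weak_deriv \<zeta> y)\<^sup>2 + \<zeta> y) x = 2 * c * rhs c u m x"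
proof -
  have zL: "\<zeta> \<in> L1_per" using L2_per_integrable[OF z(1)] z(1) by (simp add: L1_per_def L2_per_def)
  note wd = weak_deriv_eq_slope(2)[OF p zL z(2)]
  have w: "weak_deriv \<zeta> \<in> L1_per" using weak_deriv_eq_slope(1)[OF p zL z(2)] unfolding has_weak_deriv_def by blast
  obtain C where "bper C u" by (rule per_prim_bper[OF p])
  then have sb: "bper (B\<^sup>2 + C) (src u m)" by (rule src_bper[OF _ per_primD(1)[OF p]])
  let ?f = "\<lambda>y. (weak_deriv \<zeta> y)\<^sup>2 + \<zeta> y"
  have ae: "AE x in torus. ?f x = src u m x" using wd z(2) by eventually_elim (simp add: src_def)
  have "integrable torus ?f"
  proof (rule integrable_cong_AE_imp)
    show "integrable torus (src u m)" by (rule torus_integrable(1)[OF bper_loc_bdd[OF sb]])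
    show "?f \<in> borel_measurable torus" using w zL by (auto simp: L1_per_def)
    show "AE x in torus. src u m x = ?f x" using ae by auto
  qed
  moreover have "periodic ?f" using w zL by (simp add: L1_per_def periodic_def)
  ultimately have "AE x in torus. Pi0_inv_dx_Pi0 ?f x = zmp (src u m) x" using Pi0_inv_dx_Pi0_eq[OF _ _ ae sb] by blast
  then show ?thesis using wd z(2) by eventually_elim (use c in \<open>simp add: rhs_def\<close>)
qed

lemma time_deriv_rhs:
  assumes c: "0 < c" and sol: "is_solution c \<tau> \<eta>0 \<zeta>" and t: "t \<in> {-\<tau><..<\<tau>}"
    and p: "per_prim B u m" and z: "AE x in torus. \<zeta> t x = u x"
  shows "AE x in torus. time_deriv \<zeta> t x = rhs c u m x"
  using bracket_eq_rhs[OF c p solutionD(3)[OF sol t] z] solutionD(6)[OF sol t]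
  by eventually_elim (use c in simp)

text \<open>
  The seminorm of \<open>H\<^sup>1\<close> gives the \<open>L\<^sup>1\<close> limits and the pairings give weak-* continuity of the slope.
\<close>

lemma solution_limits:
  assumes c: "0 < c" and sol: "is_solution c \<tau> \<eta>0 \<zeta>" and t: "t \<in> {-\<tau><..<\<tau>}"
    and p': "\<forall>t\<in>{-\<tau><..<\<tau>}. per_prim (B t) (u t) (m t)" and z': "\<forall>t\<in>{-\<tau><..<\<tau>}. AE x in torus. \<zeta> t x = u t x"
  shows "((\<lambda>s. L1_dist (m s) (m t)) \<longlongrightarrow> 0) (at t)"
    "((\<lambda>s. L1_dist (u s) (u t)) \<longlongrightarrow> 0) (at t)"
    "((\<lambda>s. rate_error c u m t s) \<longlongrightarrow> 0) (at t)"
    "g \<in> L1_per \<Longrightarrow> ((\<lambda>s. pairing (m s) g) \<longlongrightarrow> pairing (m t) g) (at t)"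
proof -
  note p = bspec[OF p'] and z = bspec[OF z']
  note evI = eventually_in_interval[OF t]
  note tw = solutionD(4)[OF sol t, unfolded tendsto_wrt_def]
  have "((\<lambda>s. sqrt (2*pi) * H1_norm (\<lambda>x. \<zeta> s x - \<zeta> t x)) \<longlongrightarrow> sqrt (2*pi) * 0) (at t)"
    by (intro tendsto_intros bspec[OF tw H1_norm_in_seminorms])
  then have H: "((\<lambda>s. sqrt (2*pi) * H1_norm (\<lambda>x. \<zeta> s x - \<zeta> t x)) \<longlongrightarrow> 0) (at t)" by simp
  note ctl = H1_diff_controls[OF p p[OF t] solutionD(3)[OF sol] z solutionD(3)[OF sol t] z[OF t]]
  show "((\<lambda>s. L1_dist (m s) (m t)) \<longlongrightarrow> 0) (at t)"
  proof (rule Lim_null_comparison[OF _ H])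
    show "eventually (\<lambda>s. norm (L1_dist (m s) (m t)) \<le> sqrt (2*pi) * H1_norm (\<lambda>x. \<zeta> s x - \<zeta> t x)) (at t)"
      using evI
    proof eventually_elim
      case (elim s)
      then show ?case using ctl(2)[OF elim elim elim] L1_norm_nonneg[OF loc_bdd_diff[OF per_primD(4)[OF p[OF elim]] per_primD(4)[OF p[OF t]]]] by simp
    qed
  qed
  show "((\<lambda>s. L1_dist (u s) (u t)) \<longlongrightarrow> 0) (at t)"
  proof (rule Lim_null_comparison[OF _ H])
    show "eventually (\<lambda>s. norm (L1_dist (u s) (u t)) \<le> sqrt (2*pi) * H1_norm (\<lambda>x. \<zeta> s x - \<zeta> t x)) (at t)"
      using evI
    proof eventually_elim
      case (elim s)
      then show ?case using ctl(1)[OF elim elim elim] L1_norm_nonneg[OF loc_bdd_diff[OF per_primD(7)[OF p[OF elim]] per_primD(7)[OF p[OF t]]]] by simp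
    qed
  qed
  have td: "time_deriv \<zeta> t \<in> L2_per" using solutionD(5)[OF sol t] by (simp add: has_time_deriv_def)
  note tr = time_deriv_rhs[OF c sol t p[OF t] z[OF t]]
  have "((\<lambda>s. L2_norm (\<lambda>x. (\<zeta> s x - \<zeta> t x) / (s - t) - time_deriv \<zeta> t x)) \<longlongrightarrow> 0) (at t)"
    using solutionD(5)[OF sol t] by (auto simp: has_time_deriv_def tendsto_wrt_def seminorms_L2_Linf_def)
  from tendsto_mult_right_zero[OF this, of "sqrt (2*pi)"]
  show "((\<lambda>s. rate_error c u m t s) \<longlongrightarrow> 0) (at t)"
  proof (rule Lim_null_comparison[rotated])
    show "eventually (\<lambda>s. norm (rate_error c u m t s) \<le>
       sqrt (2*pi) * L2_norm (\<lambda>x. (\<zeta> s x - \<zeta> t x) / (s - t) - time_deriv \<zeta> t x)) (at t)"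
      using evI
    proof eventually_elim
      case (elim s)
      let ?g = "\<lambda>x. (u s x - u t x) / (s - t) - rhs c (u t) (m t) x"
      obtain C where C: "bper C (\<lambda>x. u s x - u t x)" by (rule per_prim_bper[OF per_prim_diff[OF p[OF elim] p[OF t]]])
      obtain D where D: "bper D (u t)" by (rule per_prim_bper[OF p[OF t]])
      have "bper (rhs_bound c (max D (B t))) (rhs c (u t) (m t))"
        by (rule rhs_bper[OF c bper_mono[OF D] bper_mono[OF per_primD(1)[OF p[OF t]]]]) auto
      from bper_diff[OF bper_mult[OF bper_const[OF order_refl, of "1/(s-t)"] C] this]
      have "bper (\<bar>1/(s-t)\<bar> * C + rhs_bound c (max D (B t))) ?g" by simp
      moreover have "(\<lambda>x. (\<zeta> s x - \<zeta> t x) / (s - t) - time_deriv \<zeta> t x) \<in> borel_measurable torus"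
        using solutionD(3)[OF sol elim] solutionD(3)[OF sol t] td by (auto simp: L2_per_def)
      moreover have "AE x in torus. (\<zeta> s x - \<zeta> t x) / (s - t) - time_deriv \<zeta> t x = ?g x"
        using z[OF elim] z[OF t] tr by eventually_elim simp
      ultimately have "L1_norm ?g \<le> sqrt (2*pi) * L2_norm (\<lambda>x. (\<zeta> s x - \<zeta> t x) / (s - t) - time_deriv \<zeta> t x)" and l: "loc_bdd ?g"
        using L1_norm_le_L2_norm bper_loc_bdd by blast+
      then show ?case using L1_norm_nonneg[OF l] by simp
    qed
  qed
  assume g: "g \<in> L1_per"
  then have gi: "integrable torus g" by (simp add: L1_per_def)
  have "(\<lambda>u. \<bar>pairing (weak_deriv u) g\<bar>) \<in> seminorms_H1_W1inf" using g by (auto simp: seminorms_H1_W1inf_def)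
  from tendsto_rabs_zero_cancel[OF bspec[OF tw this]]
  have "((\<lambda>s. pairing (weak_deriv (\<lambda>x. \<zeta> s x - \<zeta> t x)) g) \<longlongrightarrow> 0) (at t)" .
  moreover have "eventually (\<lambda>s. pairing (weak_deriv (\<lambda>x. \<zeta> s x - \<zeta> t x)) g = pairing (m s) g - pairing (m t) g) (at t)"
    using evI
  proof eventually_elim
    case (elim s)
    note b = per_primD(1)[OF p[OF elim]] per_primD(1)[OF p[OF t]]
    have "pairing (weak_deriv (\<lambda>x. \<zeta> s x - \<zeta> t x)) g = (\<integral>x. (m s x - m t x) * g x \<partial>torus)"
      unfolding pairing_def
    proof (rule integral_cong_AE)
      show "(\<lambda>x. weak_deriv (\<lambda>x. \<zeta> s x - \<zeta> t x) x * g x) \<in> borel_measurable torus"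
        using ctl(6)[OF elim elim elim] gi by auto
      show "(\<lambda>x. (m s x - m t x) * g x) \<in> borel_measurable torus"
        using torus_measurable[OF bper_loc_bdd[OF b(1)]] torus_measurable[OF bper_loc_bdd[OF b(2)]] gi by auto
      show "AE x in torus. weak_deriv (\<lambda>x. \<zeta> s x - \<zeta> t x) x * g x = (m s x - m t x) * g x"
        using ctl(3)[OF elim elim elim] by eventually_elim simp
    qed
    also have "\<dots> = pairing (m s) g - pairing (m t) g"
      unfolding pairing_def Bochner_Integration.integral_diff[OF pairing_bound_Linf(1)[OF b(1) gi] pairing_bound_Linf(1)[OF b(2) gi], symmetric]
      by (simp only: left_diff_distrib)
    finally show ?case .
  qed
  ultimately have "((\<lambda>s. pairing (m s) g - pairing (m t) g) \<longlongrightarrow> 0) (at t)" by (rule Lim_transform_eventually)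
  then show "((\<lambda>s. pairing (m s) g) \<longlongrightarrow> pairing (m t) g) (at t)" by (simp add: LIM_zero_iff)
qed

text \<open>
  Pairings are defined with periodic functions, whereas the uniform boundedness principle tests with
  arbitrary integrable ones; the two differ only in the value at an end point of the period.
\<close>

lemma periodic_version:
  assumes "integrable torus g" obtains h where "h \<in> L1_per" "AE x in torus. g x = h x"
proof -
  define h where "h x = g (wrap x)" for x
  have w2: "wrap (2*pi) = 0" using wrap_add[of 0] wrap_id[of 0] by simp
  have eq: "h x = (if x = 2*pi then g 0 else g x)" if "x \<in> space torus" for x
    using that w2 wrap_id[of x] by (auto simp: h_def)
  have ae: "AE x in torus. g x = h x"
    by (rule AE_torus_interior) (simp add: h_def wrap_id)
  have [measurable]: "g \<in> borel_measurable torus" using assms by auto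
  have ms: "{x \<in> space torus. x = 2*pi} \<in> sets torus"
  proof -
    have "{x \<in> space torus. x = 2*pi} = {2*pi} \<inter> {0..2*pi}" by auto
    then show ?thesis by (simp add: sets_restrict_space_iff)
  qed
  have "h \<in> borel_measurable torus"
    by (subst measurable_cong[OF eq], assumption) (rule measurable_If, use ms in auto)
  then have "integrable torus h" by (rule integrable_cong_AE_imp[OF assms]) (use ae in auto)
  then have "h \<in> L1_per" by (simp add: L1_per_def h_def periodic_def wrap_add)
  then show ?thesis using that ae by blast
qed

text \<open>
  Each value of a solution has a Lipschitz representative. That their Lipschitz constants are
  bounded locally in time is not part of the definition of a solution, but follows from
  weak-* continuity by \<open>uniform_boundedness\<close>.
\<close>

lemma solution_has_lipschitz_version:
  assumes c: "0 < c" and sol: "is_solution c \<tau> \<eta>0 \<zeta>"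
  obtains u m where "lipschitz_solution c \<tau> u m" "\<And>t. t \<in> {-\<tau><..<\<tau>} \<Longrightarrow> AE x in torus. \<zeta> t x = u t x"
proof -
  define B where "B t = max 0 (Linf_norm (weak_deriv (\<zeta> t)))" for t
  let ?I = "{-\<tau><..<\<tau>}"
  have "\<exists>u m. per_prim (B t) u m \<and> (AE x in torus. \<zeta> t x = u x) \<and> (AE x in torus. weak_deriv (\<zeta> t) x = m x)" if t: "t \<in> ?I" for t
  proof -
    have "AE x in torus. \<bar>weak_deriv (\<zeta> t) x\<bar> \<le> B t"
      using Linf_norm_AE[OF W1inf_per_weak_deriv(3)[OF solutionD(2)[OF sol t]]] by eventually_elim (simp add: B_def)
    then show ?thesis by (rule W1inf_per_representative[OF solutionD(2)[OF sol t]]) (auto simp: B_def)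
  qed
  then have "\<forall>t. \<exists>um. t \<in> ?I \<longrightarrow> per_prim (B t) (fst um) (snd um) \<and> (AE x in torus. \<zeta> t x = fst um x) \<and> (AE x in torus. weak_deriv (\<zeta> t) x = snd um x)"
    by force
  from choice[OF this] obtain um where
    um: "\<forall>t. t \<in> ?I \<longrightarrow> per_prim (B t) (fst (um t)) (snd (um t)) \<and> (AE x in torus. \<zeta> t x = fst (um t) x) \<and> (AE x in torus. weak_deriv (\<zeta> t) x = snd (um t) x)" ..
  define u where "u t = fst (um t)" for t
  define m where "m t = snd (um t)" for t
  have p: "per_prim (B t) (u t) (m t)" and z: "AE x in torus. \<zeta> t x = u t x" and wd: "AE x in torus. weak_deriv (\<zeta> t) x = m t x" if "t \<in> ?I" for t
    using um that by (simp_all add: u_def m_def)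
  have ps: "\<forall>t\<in>?I. per_prim (B t) (u t) (m t)" "\<forall>t\<in>?I. AE x in torus. \<zeta> t x = u t x" using p z by blast+
  note lims = solution_limits[OF c sol _ ps]
  have loc: "\<exists>R. bounded_until T R u m" if T: "T < \<tau>" for T
  proof -
    have sub: "t \<in> ?I" if "t \<in> {-T..T}" for t using that T by auto
    have within: "(f \<longlongrightarrow> l) (at t within {-T..T})" if "(f \<longlongrightarrow> l) (at t)" for f :: "real \<Rightarrow> real" and l t
      using that by (rule tendsto_within_subset) simp
    have "\<exists>K. \<forall>t\<in>{-T..T}. Linf_norm (m t) \<le> K"
    proof (rule uniform_boundedness[where B=B])
      show "bper (B t) (m t)" if "t \<in> {-T..T}" for t by (rule per_primD(1)[OF p[OF sub[OF that]]])
      fix g :: "real \<Rightarrow> real" assume g: "integrable torus g"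
      obtain h where h: "h \<in> L1_per" "AE x in torus. g x = h x" by (rule periodic_version[OF g])
      have "continuous_on {-T..T} (\<lambda>t. pairing (m t) h)"
        unfolding continuous_on_def by (intro ballI within lims(4) h sub)
      then have "bounded ((\<lambda>t. pairing (m t) h) ` {-T..T})" by (intro compact_imp_bounded compact_continuous_image) auto
      then obtain K where K: "\<forall>y\<in>(\<lambda>t. pairing (m t) h) ` {-T..T}. norm y \<le> K" unfolding bounded_iff by blast
      have "(\<integral>x. m t x * g x \<partial>torus) = pairing (m t) h" if t: "t \<in> {-T..T}" for t
        unfolding pairing_def
      proof (rule integral_cong_AE)
        have mm: "m t \<in> borel_measurable torus" by (rule torus_measurable[OF per_primD(4)[OF p[OF sub[OF t]]]])
        show "(\<lambda>x. m t x * g x) \<in> borel_measurable torus" "(\<lambda>x. m t x * h x) \<in> borel_measurable torus"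
          using mm g h(1) by (auto simp: L1_per_def)
        show "AE x in torus. m t x * g x = m t x * h x" using h(2) by eventually_elim simp
      qed
      then show "\<exists>K. \<forall>t\<in>{-T..T}. \<bar>\<integral>x. m t x * g x \<partial>torus\<bar> \<le> K" using K by (intro exI[of _ K]) auto
    qed
    then obtain K where K: "\<And>t. t \<in> {-T..T} \<Longrightarrow> Linf_norm (m t) \<le> K" by blast
    have BK: "B t \<le> max 0 K" if t: "t \<in> {-T..T}" for t
    proof -
      have "Linf_norm (weak_deriv (\<zeta> t)) \<le> max 0 K"
      proof (rule Linf_norm_leI)
        show "weak_deriv (\<zeta> t) \<in> borel_measurable torus"
          using W1inf_per_weak_deriv(3)[OF solutionD(2)[OF sol sub[OF t]]] by (simp add: Linf_per_def)
        show "AE x in torus. \<bar>weak_deriv (\<zeta> t) x\<bar> \<le> max 0 K"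
          using wd[OF sub[OF t]] Linf_norm_AE[OF bper_Linf_per[OF per_primD(1)[OF p[OF sub[OF t]]]]]
          by eventually_elim (use K[OF t] in auto)
      qed simp
      then show ?thesis by (simp add: B_def)
    qed
    have Lc: "continuous_on {-T..T} (\<lambda>t. L1_norm (u t))"
      unfolding continuous_on_def
    proof (intro ballI within)
      fix t assume t: "t \<in> {-T..T}"
      have "((\<lambda>s. L1_norm (u s) - L1_norm (u t)) \<longlongrightarrow> 0) (at t)"
      proof (rule Lim_null_comparison[OF _ lims(2)[OF sub[OF t]]])
        show "eventually (\<lambda>s. norm (L1_norm (u s) - L1_norm (u t)) \<le> L1_dist (u s) (u t)) (at t)"
          using eventually_in_interval[OF sub[OF t]]
        proof eventually_elim
          case (elim s)
          note l = per_primD(7)[OF p[OF elim]] per_primD(7)[OF p[OF sub[OF t]]]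
          have "L1_norm (u s) \<le> L1_dist (u s) (u t) + L1_norm (u t)"
            using L1_norm_triangle[of "\<lambda>x. u s x - u t x" "u t"] l by simp
          moreover have "L1_norm (u t) \<le> L1_dist (u t) (u s) + L1_norm (u s)"
            using L1_norm_triangle[of "\<lambda>x. u t x - u s x" "u s"] l by simp
          ultimately show ?case unfolding L1_norm_minus[of "u t" "u s"] by simp
        qed
      qed
      then show "((\<lambda>s. L1_norm (u s)) \<longlongrightarrow> L1_norm (u t)) (at t)" by (simp add: LIM_zero_iff)
    qed
    then have "bounded ((\<lambda>t. L1_norm (u t)) ` {-T..T})" by (intro compact_imp_bounded compact_continuous_image) auto
    then obtain A where A: "\<forall>y\<in>(\<lambda>t. L1_norm (u t)) ` {-T..T}. norm y \<le> A" unfolding bounded_iff by blast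
    \<comment> \<open>the bound for the function comes from \<open>per_prim_sup_le\<close>\<close>
    define R where "R = max 0 K + (\<bar>A\<bar> / (2*pi) + 2*pi * max 0 K)"
    show ?thesis
    proof (intro exI[of _ R] ballI conjI)
      fix t assume t: "t \<in> {-T..T}"
      have pK: "per_prim (max 0 K) (u t) (m t)" by (rule per_prim_mono[OF p[OF sub[OF t]] BK[OF t]])
      note q = per_primD[OF pK]
      have "max 0 K \<le> R" by (simp add: R_def)
      then show "per_prim R (u t) (m t)" by (rule per_prim_mono[OF pK])
      show "bper R (u t)"
      proof (rule bperI[OF q(7,2)])
        fix x
        have "\<bar>u t x\<bar> \<le> L1_norm (u t) / (2*pi) + L1_norm (m t)" by (rule per_prim_sup_le[OF pK])
        also have "L1_norm (u t) / (2*pi) \<le> \<bar>A\<bar> / (2*pi)" using A t by (intro divide_right_mono) force+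
        also have "L1_norm (m t) \<le> 2*pi * max 0 K" by (rule L1_norm_le_sup[OF q(4) bper_bound[OF q(1)]])
        finally show "\<bar>u t x\<bar> \<le> R" unfolding R_def by simp
      qed
    qed
  qed
  have "lipschitz_solution c \<tau> u m"
    unfolding lipschitz_solution_def using loc lims(1-3) by blast
  then show ?thesis using that z by blast
qed

lemma bounded_solutionI:
  assumes "0 < c" "lipschitz_solution c \<tau> u m" "0 \<le> T" "T < \<tau>" "\<And>t. t \<in> {-T..T} \<Longrightarrow> per_prim R (u t) (m t) \<and> bper R (u t)"
  shows "bounded_solution c \<tau> T R u m"
  by unfold_locales (use assms in auto)

text \<open>
  All functions involved stay bounded locally in time, so the \<open>L\<^sup>1\<close> limits give the limits in all
  seminorms. For the difference quotients in time boundedness is \<open>time_lipschitz\<close>.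
\<close>

lemma lipschitz_solution_is_solution:
  assumes c: "0 < c" and sol: "lipschitz_solution c \<tau> u m" and ini: "AE x in torus. u 0 x = \<eta>0 x"
  shows "is_solution c \<tau> \<eta>0 u"
proof -
  let ?I = "{-\<tau><..<\<tau>}"
  define w where "w t = rhs c (u t) (m t)" for t
  have *: "u t \<in> H1_per \<inter> W1inf_per \<and> tendsto_wrt seminorms_H1_W1inf u (u t) (at t) \<and>
     u t \<in> L2_per \<inter> Linf_per \<and> tendsto_wrt seminorms_L2_Linf u (u t) (at t) \<and>
     w t \<in> L2_per \<inter> Linf_per \<and> tendsto_wrt seminorms_L2_Linf w (w t) (at t) \<and> has_time_deriv u (w t) t" if t: "t \<in> ?I" for t
  proof -
    define T where "T = (\<bar>t\<bar> + \<tau>) / 2"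
    have T1: "0 \<le> T" "T < \<tau>" "t \<in> {-T<..<T}" using t unfolding T_def by (auto simp: abs_if field_simps)
    obtain R where R: "\<And>t. t \<in> {-T..T} \<Longrightarrow> per_prim R (u t) (m t) \<and> bper R (u t)" using sol T1(2) unfolding lipschitz_solution_def by blast
    interpret bounded_solution c \<tau> T R u m by (rule bounded_solutionI[OF c sol T1(1,2) R])
    have t': "t \<in> {-T..T}" using T1 by auto
    have evT: "eventually (\<lambda>s. s \<in> {-T..T}) (at t)" using eventually_in_interval[OF T1(3)] by eventually_elim auto
    have lim: "((\<lambda>s. L1_dist (m s) (m t)) \<longlongrightarrow> 0) (at t)" "((\<lambda>s. L1_dist (u s) (u t)) \<longlongrightarrow> 0) (at t)"
      "((\<lambda>s. L1_norm (\<lambda>x. (u s x - u t x) / (s - t) - w t x)) \<longlongrightarrow> 0) (at t)"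
      using sol t unfolding lipschitz_solution_def w_def by blast+
    have R0: "0 \<le> R" by (rule bper_nonneg[OF ub[OF t']])
    have wb: "bper (rhs_bound c R) (w s)" if "s \<in> {-T..T}" for s
      unfolding w_def by (rule rhs_bper[OF c ub[OF that] per_primD(1)[OF pp[OF that]]])
    have 1: "tendsto_wrt seminorms_H1_W1inf u (u t) (at t)"
      unfolding tendsto_wrt_def
    proof (intro ballI tendstoI)
      fix P and e :: real assume P: "P \<in> seminorms_H1_W1inf" and e: "0 < e"
      obtain \<delta> where \<delta>: "0 < \<delta>" and sm: "\<And>w u m. per_prim (R+R) u m \<Longrightarrow> bper (R+R) u \<Longrightarrow> w \<in> L1_per \<Longrightarrow> AE x in torus. w x = u x \<Longrightarrow>
         L1_norm u < \<delta> \<Longrightarrow> L1_norm m < \<delta> \<Longrightarrow> \<bar>P w\<bar> < e"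
        by (rule H1_W1inf_seminorm_small[OF P e, of "R+R"]) (use R0 in auto)
      have "eventually (\<lambda>s. L1_dist (m s) (m t) < \<delta>) (at t)" "eventually (\<lambda>s. L1_dist (u s) (u t) < \<delta>) (at t)"
        by (rule order_tendstoD(2)[OF lim(1) \<delta>], rule order_tendstoD(2)[OF lim(2) \<delta>])
      then show "eventually (\<lambda>s. dist (P (\<lambda>x. u s x - u t x)) 0 < e) (at t)" using evT
      proof eventually_elim
        case (elim s)
        have b: "bper (R+R) (\<lambda>x. u s x - u t x)" by (rule bper_diff[OF ub[OF elim(3)] ub[OF t']])
        show ?case
          using sm[OF per_prim_diff[OF pp[OF elim(3)] pp[OF t']] b bper_L1_per[OF b] _ elim(2,1)] by simp
      qed
    qed
    have small: "tendsto_wrt seminorms_L2_Linf f l (at t)"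
      if ev: "eventually (\<lambda>s. bper K (\<lambda>x. f s x - l x)) (at t)" and K: "0 \<le> K" and lm: "((\<lambda>s. L1_dist (f s) l) \<longlongrightarrow> 0) (at t)" for f :: "real \<Rightarrow> real \<Rightarrow> real" and l K
      unfolding tendsto_wrt_def
    proof (intro ballI tendstoI)
      fix P and e :: real assume P: "P \<in> seminorms_L2_Linf" and e: "0 < e"
      obtain \<delta> where \<delta>: "0 < \<delta>" and sm: "\<And>f. f \<in> borel_measurable torus \<Longrightarrow> AE x in torus. \<bar>f x\<bar> \<le> K \<Longrightarrow>
         (\<integral>x. \<bar>f x\<bar> \<partial>torus) < \<delta> \<Longrightarrow> \<bar>P f\<bar> < e"
        by (rule L2_Linf_seminorm_small[OF P e K]) blast
      have "eventually (\<lambda>s. L1_dist (f s) l < \<delta>) (at t)" using lm \<delta> by (rule order_tendstoD(2))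
      then show "eventually (\<lambda>s. dist (P (\<lambda>x. f s x - l x)) 0 < e) (at t)" using ev
      proof eventually_elim
        case (elim s)
        have l: "loc_bdd (\<lambda>x. f s x - l x)" by (rule bper_loc_bdd[OF elim(2)])
        have "\<bar>P (\<lambda>x. f s x - l x)\<bar> < e"
          by (rule sm[OF torus_measurable[OF l]]) (use elim bper_bound[OF elim(2)] in \<open>auto simp: L1_norm_torus[OF l, symmetric]\<close>)
        then show ?case by simp
      qed
    qed
    have 2: "tendsto_wrt seminorms_L2_Linf u (u t) (at t)"
    proof (rule small[of "R + R"])
      show "eventually (\<lambda>s. bper (R+R) (\<lambda>x. u s x - u t x)) (at t)"
        using evT by eventually_elim (rule bper_diff[OF ub ub[OF t']])
    qed (use R0 lim in auto)
    have wR: "0 \<le> rhs_bound c R" by (rule bper_nonneg[OF wb[OF t']])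
    have 3: "tendsto_wrt seminorms_L2_Linf w (w t) (at t)"
    proof (rule small[of "rhs_bound c R + rhs_bound c R"])
      show "eventually (\<lambda>s. bper (rhs_bound c R + rhs_bound c R) (\<lambda>x. w s x - w t x)) (at t)"
        using evT by eventually_elim (rule bper_diff[OF wb wb[OF t']])
      have "((\<lambda>s. rhs_lip c R * (L1_dist (m s) (m t) + L1_dist (u s) (u t))) \<longlongrightarrow> rhs_lip c R * (0 + 0)) (at t)"
        by (intro tendsto_intros lim)
      then have L: "((\<lambda>s. rhs_lip c R * (L1_dist (m s) (m t) + L1_dist (u s) (u t))) \<longlongrightarrow> 0) (at t)" by simp
      show "((\<lambda>s. L1_dist (w s) (w t)) \<longlongrightarrow> 0) (at t)"
      proof (rule Lim_null_comparison[OF _ L])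
        show "eventually (\<lambda>s. norm (L1_dist (w s) (w t)) \<le> rhs_lip c R * (L1_dist (m s) (m t) + L1_dist (u s) (u t))) (at t)"
          using evT
        proof eventually_elim
          case (elim s)
          have "0 \<le> L1_dist (w s) (w t)" by (intro L1_norm_nonneg loc_bdd_diff bper_loc_bdd[OF wb] elim t')
          then show ?case
            using rhs_L1[OF c ub[OF elim] per_primD(1)[OF pp[OF elim]] ub[OF t'] per_primD(1)[OF pp[OF t']]] by (simp add: w_def)
        qed
      qed
    qed (use wR in auto)
    define K where "K = R * ((2*R + c\<^sup>2) / (2*c)) + 8*pi*(R\<^sup>2 + R) / (2*c)"
    have K: "0 \<le> K" using R0 c by (simp add: K_def)
    have 4: "tendsto_wrt seminorms_L2_Linf (\<lambda>s x. (u s x - u t x) / (s - t)) (w t) (at t)"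
    proof (rule small[of "K + rhs_bound c R"])
      show "eventually (\<lambda>s. bper (K + rhs_bound c R) (\<lambda>x. (u s x - u t x) / (s - t) - w t x)) (at t)"
        using evT eventually_neq_at_within[of t]
      proof eventually_elim
        case (elim s)
        have "bper K (\<lambda>x. (u s x - u t x) / (s - t))"
        proof (rule bperI)
          show "loc_bdd (\<lambda>x. (u s x - u t x) / (s - t))"
            by (intro loc_bdd_divide loc_bdd_diff per_primD(7)[OF pp[OF elim(1)]] per_primD(7)[OF pp[OF t']])
          show "periodic (\<lambda>x. (u s x - u t x) / (s - t))"
            using per_primD(2)[OF pp[OF elim(1)]] per_primD(2)[OF pp[OF t']] by (simp add: periodic_def)
          fix x
          have "\<bar>u s x - u t x\<bar> / \<bar>s - t\<bar> \<le> K"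
            using time_lipschitz[OF t' elim(1), of x] elim(2) by (simp add: K_def pos_divide_le_eq)
          then show "\<bar>(u s x - u t x) / (s - t)\<bar> \<le> K" by (simp add: abs_divide)
        qed
        then show ?case by (rule bper_diff[OF _ wb[OF t']])
      qed
    qed (use K wR lim in auto)
    have wL: "w t \<in> L2_per \<inter> Linf_per" using wb[OF t'] by (auto intro: L2_perI bper_Linf_per)
    have "u t \<in> L2_per \<inter> Linf_per" using ub[OF t'] by (auto intro: L2_perI bper_Linf_per)
    then show ?thesis using 1 2 3 4 wL per_prim_spaces[OF pp[OF t']] by (simp add: has_time_deriv_def)
  qed
  have eq: "AE x in torus. 2 * c * time_deriv u t x = (c\<^sup>2 - 2 * u t x) * weak_deriv (u t) x + Pi0_inv_dx_Pi0 (\<lambda>y. (weak_deriv (u t) y)\<^sup>2 + u t y) x"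
    if t: "t \<in> ?I" for t
  proof -
    have "has_time_deriv u (time_deriv u t) t" unfolding time_deriv_def using *[OF t] someI[of "\<lambda>w. has_time_deriv u w t"] by blast
    then have "AE x in torus. time_deriv u t x = w t x"
    proof (rule has_time_deriv_unique)
      show "eventually (\<lambda>s. u s \<in> L2_per) (at t)" using eventually_in_interval[OF t] by eventually_elim (use * in blast)
    qed (use *[OF t] in auto)
    moreover obtain R where "per_prim R (u t) (m t)"
    proof -
      have "\<bar>t\<bar> < \<tau>" using t by (auto simp: abs_if)
      then obtain R where "\<forall>s\<in>{-\<bar>t\<bar>..\<bar>t\<bar>}. per_prim R (u s) (m s) \<and> bper R (u s)" using sol unfolding lipschitz_solution_def by blast
      moreover have "t \<in> {-\<bar>t\<bar>..\<bar>t\<bar>}" by (simp add: abs_if)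
      ultimately show ?thesis using that by blast
    qed
    ultimately show ?thesis
      using bracket_eq_rhs[OF c _ _ , of R "u t" "m t" "u t"] *[OF t] by (auto simp: w_def)
  qed
  show ?thesis
    unfolding is_solution_def C0_H1_W1inf_def C1_L2_Linf_def C0_L2_Linf_def
    using * eq ini by blast
qed

section \<open>Dependence on the data and uniqueness\<close>

lemma energy_difference_le:
  assumes m: "bper R m" and n: "bper R n" and x: "0 \<le> x" "x \<le> 2*pi"
  shows "\<bar>energy m x - energy n x\<bar> \<le> 2 * R * L1_dist m n"
proof -
  note lm = bper_loc_bdd[OF m] and ln = bper_loc_bdd[OF n]
  have R: "0 \<le> R" by (rule bper_nonneg[OF m])
  have lsq: "loc_bdd (\<lambda>y. (m y)\<^sup>2)" "loc_bdd (\<lambda>y. (n y)\<^sup>2)"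
    using bper_loc_bdd[OF bper_square[OF m]] bper_loc_bdd[OF bper_square[OF n]] by auto
  have ld: "loc_bdd (\<lambda>y. (m y)\<^sup>2 - (n y)\<^sup>2)" by (rule loc_bdd_diff[OF lsq])
  have la: "loc_bdd (\<lambda>y. 2 * R * (m y - n y))" using bper_loc_bdd[OF bper_mult[OF bper_const[OF order_refl, of "2*R"] bper_diff[OF m n]]] .
  have "\<bar>prim (\<lambda>y. (m y)\<^sup>2 - (n y)\<^sup>2) x - prim (\<lambda>y. (m y)\<^sup>2 - (n y)\<^sup>2) 0\<bar> \<le> L1_norm (\<lambda>y. (m y)\<^sup>2 - (n y)\<^sup>2)"
    by (rule prim_diff_le_L1[OF ld]) (use x bper_periodic[OF bper_diff[OF bper_square[OF m] bper_square[OF n]]] in auto)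
  moreover have "L1_norm (\<lambda>y. (m y)\<^sup>2 - (n y)\<^sup>2) \<le> L1_norm (\<lambda>y. 2 * R * (m y - n y))"
  proof (rule L1_norm_mono[OF ld la])
    fix y
    have "\<bar>m y + n y\<bar> * \<bar>m y - n y\<bar> \<le> (2 * R) * \<bar>m y - n y\<bar>"
      using bper_bound[OF m, of y] bper_bound[OF n, of y] by (intro mult_right_mono) auto
    then show "\<bar>(m y)\<^sup>2 - (n y)\<^sup>2\<bar> \<le> \<bar>2 * R * (m y - n y)\<bar>"
      using R by (simp add: abs_mult power2_eq_square square_diff_square_factored)
  qed
  ultimately show ?thesis using R unfolding L1_norm_cmul by (simp add: prim_diff[OF lsq])
qed

text \<open>
  The \<open>W\<^sup>1\<^sup>,\<^sup>1\<close> distance of two Lipschitz functions, given with their slopes.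
\<close>

definition data_dist :: "(real \<Rightarrow> real) \<Rightarrow> (real \<Rightarrow> real) \<Rightarrow> (real \<Rightarrow> real) \<Rightarrow> (real \<Rightarrow> real) \<Rightarrow> real"
  where "data_dist u m v n = L1_dist u v + L1_dist m n"

lemma data_dist_controls:
  assumes u: "per_prim R u m" and v: "per_prim R v n"
  shows "0 \<le> data_dist u m v n" "\<bar>u x - v x\<bar> \<le> data_dist u m v n"
    "0 \<le> y \<Longrightarrow> y \<le> 2*pi \<Longrightarrow> \<bar>energy m y - energy n y\<bar> \<le> 2 * R * data_dist u m v n"
proof -
  note p = per_primD[OF u] and q = per_primD[OF v]
  have nn: "0 \<le> L1_dist u v" "0 \<le> L1_dist m n"
    by (intro L1_norm_nonneg loc_bdd_diff p(4,7) q(4,7))+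
  then show "0 \<le> data_dist u m v n" by (simp add: data_dist_def)
  have "L1_dist u v / (2*pi) \<le> L1_dist u v / 1"
    by (rule divide_left_mono[OF _ nn(1)]) (use pi_gt3 in auto)
  then show "\<bar>u x - v x\<bar> \<le> data_dist u m v n"
    using per_prim_sup_le[OF per_prim_diff[OF u v], of x] unfolding data_dist_def by simp
  assume y: "0 \<le> y" "y \<le> 2*pi"
  have "2 * R * L1_dist m n \<le> 2 * R * data_dist u m v n"
    using nn bper_nonneg[OF p(1)] by (intro mult_left_mono) (auto simp: data_dist_def)
  then show "\<bar>energy m y - energy n y\<bar> \<le> 2 * R * data_dist u m v n"
    using energy_difference_le[OF p(1) q(1) y] by linarith
qed

text \<open>
  \<open>stability\<close> with the distance of the data measured in \<open>W\<^sup>1\<^sup>,\<^sup>1\<close>; the constant depends only on the bound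
  for the solutions and on the time.
\<close>

lemma dependence_on_data:
  assumes c: "0 < c" and T: "0 \<le> T" "T < \<tau>" and R: "0 \<le> R"
  obtains K where "0 \<le> K"
    "\<And>u m v n t. lipschitz_solution c \<tau> u m \<Longrightarrow> bounded_until T R u m \<Longrightarrow>
      lipschitz_solution c \<tau> v n \<Longrightarrow> bounded_until T R v n \<Longrightarrow> t \<in> {-T..T} \<Longrightarrow>
      (\<forall>x. \<bar>u t x - v t x\<bar> \<le> K * data_dist (u 0) (m 0) (v 0) (n 0)) \<and>
      \<bar>energy (m t) (2*pi) - energy (n t) (2*pi)\<bar> \<le> K * data_dist (u 0) (m 0) (v 0) (n 0)"
proof -
  define A where "A = 2 * (1 + 2*R) * exp (2 * two_solutions.C2 c R * T)"
  have A: "0 \<le> A" using R by (simp add: A_def)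
  show ?thesis
  proof (rule that[of "(1 + R) * A"])
    show "0 \<le> (1 + R) * A" using A R by simp
    fix u m v n t
    assume u: "lipschitz_solution c \<tau> u m" "bounded_until T R u m"
      and v: "lipschitz_solution c \<tau> v n" "bounded_until T R v n" and t: "t \<in> {-T..T}"
    interpret two_solutions c \<tau> T R u m v n
      unfolding two_solutions_def by (intro conjI bounded_solutionI[OF c u(1) T] bounded_solutionI[OF c v(1) T] bspec[OF u(2)] bspec[OF v(2)])
    have z: "0 \<in> {-T..T}" using T by simp
    define D where "D = data_dist (u 0) (m 0) (v 0) (n 0)"
    note dd = data_dist_controls[OF A.pp[OF z] B.pp[OF z], folded D_def]
    have RD: "0 \<le> R * D" using R dd(1) by simp
    have le: "2 * ((1 + 2*R) * D) * exp (2*C2*\<bar>t\<bar>) \<le> A * D"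
    proof -
      have "exp (2*C2*\<bar>t\<bar>) \<le> exp (2*C2*T)" using C2 t by (auto intro!: mult_left_mono)
      then have "(2 * ((1 + 2*R) * D)) * exp (2*C2*\<bar>t\<bar>) \<le> (2 * ((1 + 2*R) * D)) * exp (2*C2*T)"
        using dd(1) R by (intro mult_left_mono) auto
      then show ?thesis by (simp add: A_def mult_ac)
    qed
    have main: "\<bar>u t x - v t x\<bar> \<le> (1 + R) * (2 * ((1 + 2*R) * D) * exp (2*C2*\<bar>t\<bar>))"
      "\<bar>energy (m t) (2*pi) - energy (n t) (2*pi)\<bar> \<le> 2 * ((1 + 2*R) * D) * exp (2*C2*\<bar>t\<bar>)" for x
    proof (rule_tac [!] stability[OF _ _ _ t])
      show "0 \<le> (1 + 2*R) * D" using dd(1) R by simp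
      then show "0 \<le> (1 + 2*R) * D" .
      show "\<bar>u 0 x - v 0 x\<bar> \<le> (1 + 2*R) * D" for x using dd(2)[of x] RD by (simp add: distrib_right)
      then show "\<bar>u 0 x - v 0 x\<bar> \<le> (1 + 2*R) * D" for x .
      show "\<bar>energy (m 0) x - energy (n 0) x\<bar> \<le> (1 + 2*R) * D" if "0 \<le> x" "x \<le> 2*pi" for x
        using dd(3)[OF that] dd(1) by (simp add: distrib_right)
      then show "\<bar>energy (m 0) x - energy (n 0) x\<bar> \<le> (1 + 2*R) * D" if "0 \<le> x" "x \<le> 2*pi" for x using that .
    qed
    have AD: "0 \<le> A * D" using A dd(1) by simp
    have "\<bar>u t x - v t x\<bar> \<le> (1 + R) * A * D" for x
      using order_trans[OF main(1)[of x] mult_left_mono[OF le, of "1 + R"]] R by (simp only: mult.assoc)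
    moreover have "A * D \<le> (1 + R) * A * D" using mult_right_mono[of 1 "1+R", OF _ AD] R by (simp add: mult.assoc)
    ultimately show "(\<forall>x. \<bar>u t x - v t x\<bar> \<le> (1 + R) * A * data_dist (u 0) (m 0) (v 0) (n 0)) \<and>
      \<bar>energy (m t) (2*pi) - energy (n t) (2*pi)\<bar> \<le> (1 + R) * A * data_dist (u 0) (m 0) (v 0) (n 0)"
      using main(2) le unfolding D_def[symmetric] by auto
  qed
qed

text \<open>
  Initial slopes that represent the same function have distance zero in \<open>L\<^sup>1\<close>.
\<close>

lemma lipschitz_solution_unique:
  assumes c: "0 < c" and u: "lipschitz_solution c \<tau> u m" and v: "lipschitz_solution c \<tau> v n"
    and ini: "AE x in torus. u 0 x = v 0 x" and t: "t \<in> {-\<tau><..<\<tau>}"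
  shows "u t x = v t x"
proof -
  define T where "T = \<bar>t\<bar>"
  have T1: "0 \<le> T" "T < \<tau>" "t \<in> {-T..T}" "0 \<in> {-T..T}" using t by (auto simp: T_def abs_if)
  obtain Q where Q: "bounded_until T Q u m" using u T1(2) unfolding lipschitz_solution_def by blast
  obtain Q' where Q': "bounded_until T Q' v n" using v T1(2) unfolding lipschitz_solution_def by blast
  define R where "R = max Q Q'"
  have b: "bounded_until T R u m" "bounded_until T R v n"
    using Q Q' by (auto simp: R_def intro: per_prim_mono bper_mono)
  have p0: "per_prim R (u 0) (m 0)" "per_prim R (v 0) (n 0)" and R: "0 \<le> R" using b T1(4) bper_nonneg by blast+
  have "(\<lambda>x. u 0 x - v 0 x) = (\<lambda>x. 0)" using per_prim_AE_eq(1)[OF p0 ini] by auto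
  then have "data_dist (u 0) (m 0) (v 0) (n 0) = 0"
    using per_prim_AE_eq(3)[OF p0 ini] by (simp add: data_dist_def L1_norm_def)
  moreover obtain K where "(\<forall>x. \<bar>u t x - v t x\<bar> \<le> K * data_dist (u 0) (m 0) (v 0) (n 0))"
    by (rule dependence_on_data[OF c T1(1,2) R]) (use u v b T1(3) in blast)
  ultimately show ?thesis by simp
qed

lemma solution_unique:
  assumes c: "0 < c" and sol: "is_solution c \<tau> \<eta>0 \<zeta>" and u: "lipschitz_solution c \<tau> u m" and ini: "AE x in torus. u 0 x = \<eta>0 x"
    and t: "t \<in> {-\<tau><..<\<tau>}"
  shows "AE x in torus. \<zeta> t x = u t x"
proof -
  obtain v n where v: "lipschitz_solution c \<tau> v n" and z: "\<And>t. t \<in> {-\<tau><..<\<tau>} \<Longrightarrow> AE x in torus. \<zeta> t x = v t x"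
    using solution_has_lipschitz_version[OF c sol] by blast
  have "0 \<in> {-\<tau><..<\<tau>}" using t by auto
  from z[OF this] have "AE x in torus. v 0 x = u 0 x"
    using ini sol[unfolded is_solution_def, THEN conjunct2, THEN conjunct1] by eventually_elim simp
  from lipschitz_solution_unique[OF c v u this t] show ?thesis using z[OF t] by simp
qed

text \<open>
  The modulus in \<open>slope_convergence\<close> can be chosen uniformly in time, since near a fixed time \<open>s\<close> the
  modulus at \<open>s\<close> can be used and \<open>[-T,T]\<close> is compact.
\<close>

lemma uniform_slope_convergence:
  assumes u: "lipschitz_solution c \<tau> u m" and T: "0 \<le> T" "T < \<tau>"
    and b: "bounded_until T R u m" and e: "0 < e"
  obtains \<delta> where "0 < \<delta>" "\<And>t u' m'. t \<in> {-T..T} \<Longrightarrow> per_prim R u' m' \<Longrightarrow> (\<And>x. \<bar>u' x - u t x\<bar> \<le> \<delta>) \<Longrightarrow>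
      \<bar>energy m' (2*pi) - energy (m t) (2*pi)\<bar> \<le> \<delta> \<Longrightarrow> L1_dist m' (m t) \<le> e"
proof -
  let ?E = "\<lambda>m. energy m (2*pi)"
  have R: "0 \<le> R" using b T bper_nonneg by force
  have "\<exists>d r. 0 < d \<and> 0 < r \<and> (\<forall>t\<in>{-T..T} \<inter> ball s r. \<forall>u' m'. per_prim R u' m' \<longrightarrow> (\<forall>x. \<bar>u' x - u t x\<bar> \<le> d) \<longrightarrow>
      \<bar>?E m' - ?E (m t)\<bar> \<le> d \<longrightarrow> L1_dist m' (m t) \<le> e)" if s: "s \<in> {-T..T}" for s
  proof -
    have ps: "per_prim R (u s) (m s)" using b s by blast
    obtain d where d: "0 < d" and sc: "\<And>u' m'. per_prim R u' m' \<Longrightarrow> (\<And>x. \<bar>u' x - u s x\<bar> \<le> d) \<Longrightarrow>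
      \<bar>?E m' - ?E (m s)\<bar> \<le> d \<Longrightarrow> L1_dist m' (m s) \<le> e/2"
      by (rule slope_convergence[OF ps, of "e/2"]) (use e in auto)
    \<comment> \<open>times at which the solution is \<open>h\<close>-close to its state at time \<open>s\<close> can share half of the modulus \<open>d\<close> at \<open>s\<close>\<close>
    define h where "h = min (e/2) (d / (4 * (1 + R)))"
    have h: "0 < h" "h \<le> e/2" "2 * R * h \<le> d/2" "h \<le> d/2"
    proof -
      show "0 < h" "h \<le> e/2" using e d R unfolding h_def by (simp, simp only: min.cobounded1)
      have "h \<le> d / (4 * (1 + R))" by (simp add: h_def)
      then have *: "4 * h + 4 * (R * h) \<le> d" using R by (simp add: field_simps)
      have "0 \<le> R * h" using R \<open>0 < h\<close> by simp
      then show "2 * R * h \<le> d/2" "h \<le> d/2" using * \<open>0 < h\<close> by auto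
    qed
    let ?D = "\<lambda>t. data_dist (u t) (m t) (u s) (m s)"
    have "s \<in> {-\<tau><..<\<tau>}" using s T by auto
    then have "((\<lambda>t. L1_dist (u t) (u s) + L1_dist (m t) (m s)) \<longlongrightarrow> 0 + 0) (at s)"
      by (intro tendsto_add) (use u in \<open>auto simp: lipschitz_solution_def\<close>)
    then have "(?D \<longlongrightarrow> 0) (at s)" by (simp add: data_dist_def)
    from order_tendstoD(2)[OF this h(1)]
    obtain r where r: "0 < r" and near: "\<And>t. t \<noteq> s \<Longrightarrow> dist t s < r \<Longrightarrow> ?D t < h" unfolding eventually_at by auto
    have "?D s = 0" by (simp add: data_dist_def L1_norm_def)
    then have D: "?D t \<le> h" if "dist t s < r" for t using near[of t] that h(1) by (cases "t = s") auto
    have "L1_dist m' (m t) \<le> e"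
      if t: "t \<in> {-T..T} \<inter> ball s r" and p': "per_prim R u' m'" and u': "\<forall>x. \<bar>u' x - u t x\<bar> \<le> d/2" and E': "\<bar>?E m' - ?E (m t)\<bar> \<le> d/2" for t u' m'
    proof -
      have pt: "per_prim R (u t) (m t)" using b t by blast
      have Dt: "?D t \<le> h" using D[of t] t by (simp add: dist_commute)
      note dd = data_dist_controls[OF pt ps]
      have RD: "2 * R * ?D t \<le> 2 * R * h" using Dt R by (intro mult_left_mono) auto
      have "L1_dist m' (m s) \<le> e/2"
      proof (rule sc[OF p'])
        show "\<bar>u' x - u s x\<bar> \<le> d" for x using dd(2)[of x] Dt h(4) spec[OF u', of x] by linarith
        show "\<bar>?E m' - ?E (m s)\<bar> \<le> d" using order_trans[OF dd(3)[of "2*pi"] RD] h(3) E' pi_ge_zero by linarith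
      qed
      moreover have "L1_dist (m t) (m s) \<le> e/2"
        using Dt h(2) L1_norm_nonneg[OF loc_bdd_diff[OF per_primD(7)[OF pt] per_primD(7)[OF ps]]] by (simp add: data_dist_def)
      moreover have "L1_dist m' (m t) \<le> L1_dist m' (m s) + L1_dist (m s) (m t)"
        by (rule L1_norm_diff_triangle[OF per_primD(4)[OF p'] per_primD(4)[OF ps] per_primD(4)[OF pt]])
      ultimately show ?thesis unfolding L1_norm_minus[of "m s" "m t"] by linarith
    qed
    then show ?thesis using d r by (intro exI[of _ "d/2"] exI[of _ r]) simp
  qed
  then have "\<forall>s\<in>{-T..T}. \<exists>dr. 0 < fst dr \<and> 0 < snd dr \<and> (\<forall>t\<in>{-T..T} \<inter> ball s (snd dr). \<forall>u' m'. per_prim R u' m' \<longrightarrow>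
      (\<forall>x. \<bar>u' x - u t x\<bar> \<le> fst dr) \<longrightarrow> \<bar>?E m' - ?E (m t)\<bar> \<le> fst dr \<longrightarrow> L1_dist m' (m t) \<le> e)"
    by simp
  from bchoice[OF this] obtain f where
    f: "\<forall>s\<in>{-T..T}. 0 < fst (f s) \<and> 0 < snd (f s) \<and> (\<forall>t\<in>{-T..T} \<inter> ball s (snd (f s)). \<forall>u' m'. per_prim R u' m' \<longrightarrow>
      (\<forall>x. \<bar>u' x - u t x\<bar> \<le> fst (f s)) \<longrightarrow> \<bar>?E m' - ?E (m t)\<bar> \<le> fst (f s) \<longrightarrow> L1_dist m' (m t) \<le> e)" ..
  have cover: "{-T..T} \<subseteq> (\<Union>s\<in>{-T..T}. ball s (snd (f s)))"
  proof
    fix t assume "t \<in> {-T..T}"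
    then show "t \<in> (\<Union>s\<in>{-T..T}. ball s (snd (f s)))" using f by (intro UN_I[of t]) auto
  qed
  obtain C where C: "C \<subseteq> {-T..T}" "finite C" "{-T..T} \<subseteq> (\<Union>s\<in>C. ball s (snd (f s)))"
    by (rule compactE_image[OF compact_Icc _ cover]) auto
  have ne: "C \<noteq> {}" using C(3) T(1) by auto
  define \<delta> where "\<delta> = Min ((\<lambda>s. fst (f s)) ` C)"
  show ?thesis
  proof (rule that[of \<delta>])
    show "0 < \<delta>" unfolding \<delta>_def using C(1,2) ne f by (subst Min_gr_iff) auto
    fix t u' m'
    assume t: "t \<in> {-T..T}" and p': "per_prim R u' m'" and u': "\<And>x. \<bar>u' x - u t x\<bar> \<le> \<delta>" and E': "\<bar>?E m' - ?E (m t)\<bar> \<le> \<delta>"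
    obtain s where s: "s \<in> C" "t \<in> ball s (snd (f s))" using C(3) t by blast
    have le: "\<delta> \<le> fst (f s)" unfolding \<delta>_def using C(2) s(1) by (intro Min_le) auto
    have "s \<in> {-T..T}" using s(1) C(1) by blast
    from bspec[OF f this] have "(\<forall>x. \<bar>u' x - u t x\<bar> \<le> fst (f s)) \<longrightarrow> \<bar>?E m' - ?E (m t)\<bar> \<le> fst (f s) \<longrightarrow> L1_dist m' (m t) \<le> e"
      using t s(2) p' by blast
    then show "L1_dist m' (m t) \<le> e" using order_trans[OF u' le] order_trans[OF E' le] by blast
  qed
qed

text \<open>
  Uniform convergence of the values and of the total energies comes from \<open>dependence_on_data\<close>, the
  slopes follow by \<open>uniform_slope_convergence\<close>.
\<close>

lemma uniform_convergence:
  assumes c: "0 < c" and T: "0 \<le> T" "T < \<tau>"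
    and u: "lipschitz_solution c \<tau> u m" "bounded_until T R u m"
    and v: "\<And>k. lipschitz_solution c \<tau> (v k) (n k)" "\<And>k. bounded_until T R (v k) (n k)"
    and lim: "(\<lambda>k. data_dist (v k 0) (n k 0) (u 0) (m 0)) \<longlonglongrightarrow> 0" and e: "0 < e"
  shows "eventually (\<lambda>k. \<forall>t\<in>{-T..T}. L1_dist (v k t) (u t) < e \<and> L1_dist (n k t) (m t) < e) sequentially"
proof -
  let ?E = "\<lambda>m. energy m (2*pi)"
  have R: "0 \<le> R" using u(2) T bper_nonneg by force
  obtain K where K: "0 \<le> K" and dep: "\<And>k t. t \<in> {-T..T} \<Longrightarrow>
      (\<forall>x. \<bar>v k t x - u t x\<bar> \<le> K * data_dist (v k 0) (n k 0) (u 0) (m 0)) \<and>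
      \<bar>?E (n k t) - ?E (m t)\<bar> \<le> K * data_dist (v k 0) (n k 0) (u 0) (m 0)"
    by (rule dependence_on_data[OF c T R]) (use u v in blast)
  obtain \<delta> where \<delta>: "0 < \<delta>" and sc: "\<And>t u' m'. t \<in> {-T..T} \<Longrightarrow> per_prim R u' m' \<Longrightarrow> (\<And>x. \<bar>u' x - u t x\<bar> \<le> \<delta>) \<Longrightarrow>
      \<bar>?E m' - ?E (m t)\<bar> \<le> \<delta> \<Longrightarrow> L1_dist m' (m t) \<le> e/2"
    using uniform_slope_convergence[OF u(1) T u(2), of "e/2"] e by auto
  have "(\<lambda>k. K * data_dist (v k 0) (n k 0) (u 0) (m 0)) \<longlonglongrightarrow> 0" by (rule tendsto_mult_right_zero[OF lim])
  then have "eventually (\<lambda>k. K * data_dist (v k 0) (n k 0) (u 0) (m 0) < min \<delta> (e / (4*pi))) sequentially"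
    by (rule order_tendstoD(2)) (use \<delta> e in auto)
  then show ?thesis
  proof eventually_elim
    case (elim k)
    show ?case
    proof
      fix t assume t: "t \<in> {-T..T}"
      have p: "per_prim R (v k t) (n k t)" "per_prim R (u t) (m t)" using u(2) v(2) t by blast+
      note d = dep[OF t, of k]
      have d1: "\<bar>v k t x - u t x\<bar> \<le> e / (4*pi)" "\<bar>v k t x - u t x\<bar> \<le> \<delta>" for x
        using d[THEN conjunct1, THEN spec, of x] elim by linarith+
      have d2: "\<bar>?E (n k t) - ?E (m t)\<bar> \<le> \<delta>" using d[THEN conjunct2] elim by linarith
      have "L1_dist (v k t) (u t) \<le> 2*pi * (e / (4*pi))"
        by (rule L1_norm_le_sup[OF loc_bdd_diff[OF per_primD(7)[OF p(1)] per_primD(7)[OF p(2)]]]) (rule d1)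
      also have "\<dots> < e" using e by simp
      finally have "L1_dist (v k t) (u t) < e" .
      moreover have "L1_dist (n k t) (m t) \<le> e/2"
        by (rule sc[OF t p(1) d1(2) d2])
      ultimately show "L1_dist (v k t) (u t) < e \<and> L1_dist (n k t) (m t) < e" using e by simp
    qed
  qed
qed

lemma compact_in_open_interval:
  assumes "compact K" "K \<subseteq> {-\<tau><..<\<tau>}" "(0::real) < \<tau>"
  obtains T where "0 \<le> T" "T < \<tau>" "K \<subseteq> {-T..T}"
proof (cases "K = {}")
  case True
  then show ?thesis using that[of 0] assms(3) by auto
next
  case False
  have "continuous_on K abs" by (intro continuous_intros)
  from continuous_attains_sup[OF assms(1) False this] obtain k where k: "k \<in> K" "\<forall>y\<in>K. \<bar>y\<bar> \<le> \<bar>k\<bar>" by blast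
  show ?thesis
  proof (rule that[of "\<bar>k\<bar>"])
    show "\<bar>k\<bar> < \<tau>" using k(1) assms(2) by (auto simp: abs_if)
    show "K \<subseteq> {-\<bar>k\<bar>..\<bar>k\<bar>}" using k(2) by (force simp: abs_le_iff)
  qed simp
qed

text \<open>
  A ball in the norm of \<open>H\<^sup>1 \<inter> W\<^sup>1\<^sup>,\<^sup>\<infinity>\<close> lies in a set of data with a common bound, as \<open>lipschitz_solution_exists\<close>
  requires. The bound for the slope comes from the norm in \<open>W\<^sup>1\<^sup>,\<^sup>\<infinity>\<close>, the one for the function from the
  norm in \<open>H\<^sup>1\<close>.
\<close>

lemma H1_W1inf_near_representative:
  assumes p: "per_prim B u m" and U: "bper U u" and \<eta>: "\<eta> \<in> L2_per" "AE x in torus. \<eta> x = u x"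
    and \<zeta>: "\<zeta> \<in> H1_per \<inter> W1inf_per" and near: "H1_norm (\<lambda>x. \<zeta> x - \<eta> x) + W1inf_norm (\<lambda>x. \<zeta> x - \<eta> x) < 1"
    and S: "B + 1 \<le> S" "U + (1 + 2*pi * (2*B + 1)) \<le> S"
  obtains v n where "per_prim S v n" "bper S v" "AE x in torus. \<zeta> x = v x"
proof -
  have \<zeta>2: "\<zeta> \<in> L2_per" using \<zeta> by (simp add: H1_per_def)
  have B: "0 \<le> B" by (rule bper_nonneg[OF per_primD(1)[OF p]])
  obtain B1 where "0 \<le> B1" "AE x in torus. \<bar>weak_deriv \<zeta> x\<bar> \<le> B1" using W1inf_per_weak_deriv(2) \<zeta> by blast
  then obtain w k where w: "per_prim B1 w k" "AE x in torus. \<zeta> x = w x" "AE x in torus. weak_deriv \<zeta> x = k x"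
    using W1inf_per_representative[of \<zeta> B1] \<zeta> by blast
  let ?d = "\<lambda>x. \<zeta> x - \<eta> x"
  note ctl = H1_diff_controls[OF w(1) p \<zeta>2 w(2) \<eta>]
  note pd = per_prim_diff[OF w(1) p]
  have "has_weak_deriv ?d (\<lambda>x. k x - m x)"
    by (rule has_weak_deriv_cong[OF per_prim_weak_deriv[OF pd] _ _ ctl(4) bper_L1_per[OF per_primD(1)[OF pd]]]) (use ctl(5) in auto)
  moreover have "?d \<in> Linf_per"
  proof -
    obtain C where C: "bper C (\<lambda>x. w x - u x)" by (rule per_prim_bper[OF pd])
    show ?thesis
    proof (rule Linf_perI[of _ C])
      show "AE x in torus. \<bar>?d x\<bar> \<le> C" using ctl(5) by eventually_elim (use bper_bound[OF C] in simp)
    qed (use ctl(4) in \<open>auto simp: L1_per_def\<close>)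
  qed
  ultimately have dW: "?d \<in> W1inf_per" unfolding W1inf_per_def using bper_Linf_per[OF per_primD(1)[OF pd]] by blast
  have H0: "0 \<le> H1_norm ?d" by (simp add: H1_norm_def)
  have L1: "Linf_norm (weak_deriv ?d) \<le> 1"
    using near H0 unfolding W1inf_norm_def by linarith
  have "0 \<le> L2_norm ?d" by (simp add: L2_norm_def)
  have "AE x in torus. \<bar>weak_deriv \<zeta> x\<bar> \<le> B + 1"
    using Linf_norm_AE[OF W1inf_per_weak_deriv(3)[OF dW]] ctl(3) w(3)
  proof eventually_elim
    case (elim x)
    then show ?case using bper_bound[OF per_primD(1)[OF p], of x] L1 by linarith
  qed
  then obtain v n where v: "per_prim (B + 1) v n" "AE x in torus. \<zeta> x = v x"
    using W1inf_per_representative[of \<zeta> "B + 1"] \<zeta> B by (smt (verit) Int_iff)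
  note ctl' = H1_diff_controls[OF v(1) p \<zeta>2 v(2) \<eta>]
  have H1: "H1_norm ?d \<le> 1"
  proof -
    have "0 \<le> W1inf_norm ?d"
    proof -
      have "AE x in torus. \<bar>?d x\<bar> \<le> Linf_norm ?d" using Linf_norm_AE dW by (simp add: W1inf_per_def)
      then have "AE x in torus. 0 \<le> Linf_norm ?d" by eventually_elim linarith
      moreover have "ae_filter torus \<noteq> bot"
        unfolding ae_filter_eq_bot_iff by (simp add: emeasure_restrict_space)
      ultimately have "0 \<le> Linf_norm ?d" by (simp add: eventually_const_iff)
      then show ?thesis by (simp add: W1inf_norm_def)
    qed
    then show ?thesis using near by linarith
  qed
  have vb: "bper S v"
  proof (rule bperI[OF per_primD(7,2)[OF v(1)]])
    fix x
    note pd' = per_prim_diff[OF v(1) p]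
    have "L1_dist v u \<le> sqrt (2*pi) * 1"
      by (rule order_trans[OF ctl'(1)]) (intro mult_left_mono H1, simp)
    also have "\<dots> \<le> 2*pi"
    proof -
      have "2*pi * 1 \<le> 2*pi * (2*pi)" using pi_gt3 by (intro mult_left_mono) auto
      then have "sqrt (2*pi) \<le> 2*pi" by (intro real_le_lsqrt) (simp_all add: power2_eq_square)
      then show ?thesis by simp
    qed
    finally have "L1_dist v u / (2*pi) \<le> 1" by simp
    moreover have "L1_dist n m \<le> 2*pi * (B + 1 + B)"
      by (rule L1_norm_le_sup[OF per_primD(4)[OF pd'] bper_bound[OF per_primD(1)[OF pd']]])
    ultimately have "\<bar>v x - u x\<bar> \<le> 1 + 2*pi * (B + 1 + B)" using per_prim_sup_le[OF pd', of x] by linarith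
    then have "\<bar>v x - u x\<bar> \<le> 1 + 2*pi * (2*B + 1)" by (simp add: algebra_simps)
    then show "\<bar>v x\<bar> \<le> S" using bper_bound[OF U, of x] S(2) by linarith
  qed
  show ?thesis by (rule that[OF per_prim_mono[OF v(1) S(1)] vb v(2)])
qed

section \<open>Local well-posedness\<close>

lemma converges_C0I:
  assumes \<tau>: "0 < \<tau>"
    and conv: "\<And>P T e. P \<in> Q \<Longrightarrow> 0 \<le> T \<Longrightarrow> T < \<tau> \<Longrightarrow> 0 < e \<Longrightarrow>
      eventually (\<lambda>k. \<forall>t\<in>{-T..T}. \<bar>P (\<lambda>x. \<zeta> k t x - \<eta> t x)\<bar> < e) sequentially"
  shows "converges_C0 Q {-\<tau><..<\<tau>} \<zeta> \<eta>"
  unfolding converges_C0_def uniform_limit_iff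
proof (intro ballI allI impI)
  fix P K and e :: real assume P: "P \<in> Q" and K: "compact K \<and> K \<subseteq> {-\<tau><..<\<tau>}" and e: "0 < e"
  obtain T where T: "0 \<le> T" "T < \<tau>" "K \<subseteq> {-T..T}" using compact_in_open_interval K \<tau> by blast
  show "eventually (\<lambda>k. \<forall>t\<in>K. dist (P (\<lambda>x. \<zeta> k t x - \<eta> t x)) 0 < e) sequentially"
    using conv[OF P T(1,2) e] by eventually_elim (use T(3) in auto)
qed

text \<open>
  The Lipschitz solutions with the given data share one bound and converge by \<open>uniform_convergence\<close>;
  by uniqueness they represent the given solutions. The time derivatives are the right-hand sides of
  the equation, which depend continuously on function and slope by \<open>rhs_L1\<close>.
\<close>

lemma solutions_converge:
  assumes c: "0 < c" and \<tau>: "0 < \<tau>" and R: "0 \<le> R"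
    and u: "lipschitz_solution c \<tau> u m" "bounded_until \<tau> R u m" "AE x in torus. u 0 x = \<eta>0 x"
    and v: "\<And>k. lipschitz_solution c \<tau> (v k) (n k)" "\<And>k. bounded_until \<tau> R (v k) (n k)" "\<And>k. AE x in torus. v k 0 x = \<zeta>0 k x"
    and \<zeta>: "\<And>k. is_solution c \<tau> (\<zeta>0 k) (\<zeta> k)" and \<eta>0: "\<eta>0 \<in> L2_per" and \<zeta>0: "\<And>k. \<zeta>0 k \<in> L2_per"
    and lim: "tendsto_wrt seminorms_H1_W1inf \<zeta>0 \<eta>0 sequentially"
  shows "converges_C0 seminorms_H1_W1inf {-\<tau><..<\<tau>} \<zeta> u"
    "converges_C0 seminorms_L2_Linf {-\<tau><..<\<tau>} (\<lambda>k. time_deriv (\<zeta> k)) (time_deriv u)"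
proof -
  let ?I = "{-\<tau><..<\<tau>}"
  have z: "0 \<in> {-\<tau>..\<tau>}" and I: "t \<in> {-\<tau>..\<tau>}" if "t \<in> ?I" for t using \<tau> that by auto
  have z: "0 \<in> {-\<tau>..\<tau>}" using \<tau> by simp
  have pu: "per_prim R (u t) (m t)" "bper R (u t)" and pv: "per_prim R (v k t) (n k t)" "bper R (v k t)" if "t \<in> {-\<tau>..\<tau>}" for t k
    using u(2) v(2) that by blast+
  note us = lipschitz_solution_is_solution[OF c u(1,3)]
  have ae: "AE x in torus. \<zeta> k t x = v k t x" if "t \<in> ?I" for k t
    by (rule solution_unique[OF c \<zeta> v(1,3) that])
  have D: "(\<lambda>k. data_dist (v k 0) (n k 0) (u 0) (m 0)) \<longlonglongrightarrow> 0"
  proof (rule Lim_null_comparison)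
    have "(\<lambda>k. 2 * sqrt (2*pi) * H1_norm (\<lambda>x. \<zeta>0 k x - \<eta>0 x)) \<longlonglongrightarrow> 0"
      by (rule tendsto_mult_right_zero) (rule bspec[OF lim[unfolded tendsto_wrt_def] H1_norm_in_seminorms])
    then show "(\<lambda>k. 2 * sqrt (2*pi) * H1_norm (\<lambda>x. \<zeta>0 k x - \<eta>0 x)) \<longlonglongrightarrow> 0" .
    have "norm (data_dist (v k 0) (n k 0) (u 0) (m 0)) \<le> 2 * sqrt (2*pi) * H1_norm (\<lambda>x. \<zeta>0 k x - \<eta>0 x)" for k
    proof -
      have a: "AE x in torus. \<zeta>0 k x = v k 0 x" "AE x in torus. \<eta>0 x = u 0 x" using v(3)[of k] u(3) by auto
      note h = H1_diff_controls[OF pv(1)[OF z] pu(1)[OF z] \<zeta>0 a(1) \<eta>0 a(2)]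
      show ?thesis using h(1,2) data_dist_controls(1)[OF pv(1)[OF z, of k] pu(1)[OF z]] by (simp add: data_dist_def)
    qed
    then show "eventually (\<lambda>k. norm (data_dist (v k 0) (n k 0) (u 0) (m 0)) \<le> 2 * sqrt (2*pi) * H1_norm (\<lambda>x. \<zeta>0 k x - \<eta>0 x)) sequentially"
      by (rule always_eventually[OF allI])
  qed
  have sub: "\<forall>t\<in>{-T..T}. P t" if "\<forall>t\<in>{-\<tau>..\<tau>}. P t" "T < \<tau>" for T and P :: "real \<Rightarrow> bool" using that by auto
  have conv: "eventually (\<lambda>k. \<forall>t\<in>{-T..T}. L1_dist (v k t) (u t) < e \<and> L1_dist (n k t) (m t) < e) sequentially"
    if T: "0 \<le> T" "T < \<tau>" and e: "0 < e" for T e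
    by (rule uniform_convergence[OF c T u(1) sub[OF u(2) T(2)] v(1) sub[OF v(2) T(2)] D e])
  show "converges_C0 seminorms_H1_W1inf ?I \<zeta> u"
  proof (rule converges_C0I[OF \<tau>])
    fix P and T e :: real assume P: "P \<in> seminorms_H1_W1inf" and T: "0 \<le> T" "T < \<tau>" and e: "0 < e"
    obtain \<delta> where \<delta>: "0 < \<delta>" and sm: "\<And>w u m. per_prim (R+R) u m \<Longrightarrow> bper (R+R) u \<Longrightarrow> w \<in> L1_per \<Longrightarrow> AE x in torus. w x = u x \<Longrightarrow>
         L1_norm u < \<delta> \<Longrightarrow> L1_norm m < \<delta> \<Longrightarrow> \<bar>P w\<bar> < e"
      by (rule H1_W1inf_seminorm_small[OF P e, of "R+R"]) (use R in auto)
    show "eventually (\<lambda>k. \<forall>t\<in>{-T..T}. \<bar>P (\<lambda>x. \<zeta> k t x - u t x)\<bar> < e) sequentially"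
      using conv[OF T \<delta>]
    proof eventually_elim
      case (elim k)
      show ?case
      proof
        fix t assume t': "t \<in> {-T..T}"
        then have t: "t \<in> ?I" using T by auto
        have a: "AE x in torus. u t x = u t x" by simp
        note p = pv[OF I[OF t], of k] pu[OF I[OF t]]
        note h = H1_diff_controls[OF p(1,3) solutionD(3)[OF \<zeta> t] ae[OF t] solutionD(3)[OF us t] a]
        show "\<bar>P (\<lambda>x. \<zeta> k t x - u t x)\<bar> < e"
          by (rule sm[OF per_prim_diff[OF p(1,3)] bper_diff[OF p(2,4)] h(4,5)]) (use elim t' in blast)+
      qed
    qed
  qed
  show "converges_C0 seminorms_L2_Linf ?I (\<lambda>k. time_deriv (\<zeta> k)) (time_deriv u)"
  proof (rule converges_C0I[OF \<tau>])
    fix P and T e :: real assume P: "P \<in> seminorms_L2_Linf" and T: "0 \<le> T" "T < \<tau>" and e: "0 < e"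
    let ?B = "rhs_bound c R + rhs_bound c R"
    have bb: "bper ?B (\<lambda>x. rhs c (v k t) (n k t) x - rhs c (u t) (m t) x)" if "t \<in> {-\<tau>..\<tau>}" for k t
      by (intro bper_diff rhs_bper[OF c] pv(2) pu(2) per_primD(1)[OF pv(1)] per_primD(1)[OF pu(1)] that)
    obtain \<delta> where \<delta>: "0 < \<delta>" and sm: "\<And>f. f \<in> borel_measurable torus \<Longrightarrow> AE x in torus. \<bar>f x\<bar> \<le> ?B \<Longrightarrow>
         (\<integral>x. \<bar>f x\<bar> \<partial>torus) < \<delta> \<Longrightarrow> \<bar>P f\<bar> < e"
      by (rule L2_Linf_seminorm_small[OF P e bper_nonneg[OF bb[OF z]]]) blast
    define \<Lambda> where "\<Lambda> = max 1 (rhs_lip c R)"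
    have \<Lambda>: "1 \<le> \<Lambda>" "rhs_lip c R \<le> \<Lambda>" by (auto simp: \<Lambda>_def)
    have "0 < \<delta> / (2 * \<Lambda>)" using \<delta> \<Lambda> by simp
    from conv[OF T this]
    show "eventually (\<lambda>k. \<forall>t\<in>{-T..T}. \<bar>P (\<lambda>x. time_deriv (\<zeta> k) t x - time_deriv u t x)\<bar> < e) sequentially"
    proof eventually_elim
      case (elim k)
      show ?case
      proof
        fix t assume t': "t \<in> {-T..T}"
        then have t: "t \<in> ?I" using T by auto
        note p = pv[OF I[OF t], of k] pu[OF I[OF t]]
        let ?g = "\<lambda>x. rhs c (v k t) (n k t) x - rhs c (u t) (m t) x"
        let ?m = "L1_dist (n k t) (m t)" and ?u = "L1_dist (v k t) (u t)"
        have nn: "0 \<le> ?m" "0 \<le> ?u" by (intro L1_norm_nonneg loc_bdd_diff per_primD(4,7)[OF p(1)] per_primD(4,7)[OF p(3)])+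
        have "L1_norm ?g \<le> rhs_lip c R * (?m + ?u)"
          by (rule rhs_L1[OF c p(2) per_primD(1)[OF p(1)] p(4) per_primD(1)[OF p(3)]])
        also have "\<dots> \<le> \<Lambda> * (?m + ?u)" using \<Lambda> nn by (intro mult_right_mono) auto
        also have "\<dots> < \<Lambda> * (\<delta> / (2 * \<Lambda>) + \<delta> / (2 * \<Lambda>))"
          using bspec[OF elim t'] \<Lambda> by (intro mult_strict_left_mono add_strict_mono) auto
        also have "\<dots> = \<delta>" using \<Lambda> by (simp add: field_simps)
        finally have small: "L1_norm ?g < \<delta>" .
        have "time_deriv (\<zeta> k) t \<in> L2_per" "time_deriv u t \<in> L2_per"
          using solutionD(5)[OF \<zeta> t] solutionD(5)[OF us t] by (auto simp: has_time_deriv_def)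
        then have meas: "(\<lambda>x. time_deriv (\<zeta> k) t x - time_deriv u t x) \<in> borel_measurable torus" by (auto simp: L2_per_def)
        have a: "AE x in torus. u t x = u t x" by simp
        have eq: "AE x in torus. time_deriv (\<zeta> k) t x - time_deriv u t x = ?g x"
          using time_deriv_rhs[OF c \<zeta> t p(1) ae[OF t]] time_deriv_rhs[OF c us t p(3) a] by eventually_elim simp
        show "\<bar>P (\<lambda>x. time_deriv (\<zeta> k) t x - time_deriv u t x)\<bar> < e"
        proof (rule sm[OF meas])
          show "AE x in torus. \<bar>time_deriv (\<zeta> k) t x - time_deriv u t x\<bar> \<le> ?B"
            using eq by eventually_elim (simp only: bper_bound[OF bb[OF I[OF t]]])
          show "(\<integral>x. \<bar>time_deriv (\<zeta> k) t x - time_deriv u t x\<bar> \<partial>torus) < \<delta>"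
            using small by (simp only: integral_abs_cong_AE[OF meas bper_loc_bdd[OF bb[OF I[OF t]]] eq])
        qed
      qed
    qed
  qed
qed

theorem theorem1:
  fixes c :: real and \<eta>0 :: "real \<Rightarrow> real"
  assumes "c > 0"
    and "\<eta>0 \<in> H1_per \<inter> W1inf_per"
  shows "\<exists>\<tau>0>0. \<exists>\<eta>.
           is_solution c \<tau>0 \<eta>0 \<eta> \<and>
           (\<forall>\<zeta>. is_solution c \<tau>0 \<eta>0 \<zeta> \<longrightarrow>
              (\<forall>t\<in>{-\<tau>0<..<\<tau>0}. AE x in torus. \<zeta> t x = \<eta> t x)) \<and>
           continuous_dependence c \<tau>0 \<eta>0 \<eta>"
proof -
  note c = assms(1)
  have \<eta>2: "\<eta>0 \<in> L2_per" using assms(2) by (simp add: H1_per_def)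
  obtain B where "0 \<le> B" "AE x in torus. \<bar>weak_deriv \<eta>0 x\<bar> \<le> B" using W1inf_per_weak_deriv(2) assms(2) by blast
  then obtain u0 m0 where u0: "per_prim B u0 m0" "AE x in torus. \<eta>0 x = u0 x"
    using W1inf_per_representative[of \<eta>0 B] assms(2) by blast
  have B: "0 \<le> B" by fact
  obtain U where U: "bper U u0" by (rule per_prim_bper[OF u0(1)])
  have U0: "0 \<le> U" by (rule bper_nonneg[OF U])
  \<comment> \<open>the common bound of \<open>H1_W1inf_near_representative\<close> for the data in the unit ball\<close>
  define S where "S = (B + 1) + (U + (1 + 2*pi * (2*B + 1)))"
  have pb: "0 \<le> 2*pi * (2*B + 1)" using B by simp
  have S: "B + 1 \<le> S" "U + (1 + 2*pi * (2*B + 1)) \<le> S" "0 \<le> S" "B \<le> S" "U \<le> S" unfolding S_def using B U0 pb by linarith+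
  obtain \<tau> R where \<tau>: "0 < \<tau>" and ex: "\<And>u0 m0. per_prim S u0 m0 \<Longrightarrow> bper S u0 \<Longrightarrow>
    \<exists>u m. lipschitz_solution c \<tau> u m \<and> (\<forall>x. u 0 x = u0 x) \<and> bounded_until \<tau> R u m"
    by (rule lipschitz_solution_exists[OF c S(3)]) blast
  obtain u m where u: "lipschitz_solution c \<tau> u m" "\<forall>x. u 0 x = u0 x" "bounded_until \<tau> R u m"
    using ex[OF per_prim_mono[OF u0(1) S(4)] bper_mono[OF U S(5)]] by blast
  have ini: "AE x in torus. u 0 x = \<eta>0 x" using u0(2) by eventually_elim (simp add: u(2))
  have "0 \<in> {-\<tau>..\<tau>}" using \<tau> by simp
  from bspec[OF u(3) this] have R: "0 \<le> R" using bper_nonneg by blast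
  let ?B = "{\<zeta>0 \<in> H1_per \<inter> W1inf_per. H1_norm (\<lambda>x. \<zeta>0 x - \<eta>0 x) + W1inf_norm (\<lambda>x. \<zeta>0 x - \<eta>0 x) < 1}"
  have near: "\<exists>vn. lipschitz_solution c \<tau> (fst vn) (snd vn) \<and> bounded_until \<tau> R (fst vn) (snd vn) \<and>
      (AE x in torus. fst vn 0 x = \<zeta>0 x)" if \<zeta>0: "\<zeta>0 \<in> ?B" for \<zeta>0
  proof -
    obtain v0 n0 where v0: "per_prim S v0 n0" "bper S v0" "AE x in torus. \<zeta>0 x = v0 x"
      by (rule H1_W1inf_near_representative[OF u0(1) U \<eta>2 u0(2) _ _ S(1,2)]) (use \<zeta>0 in auto)
    obtain v n where v: "lipschitz_solution c \<tau> v n" "\<forall>x. v 0 x = v0 x" "bounded_until \<tau> R v n"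
      using ex[OF v0(1,2)] by blast
    have "AE x in torus. v 0 x = \<zeta>0 x" using v0(3) by eventually_elim (simp add: v(2))
    then show ?thesis using v by (intro exI[of _ "(v, n)"]) simp
  qed
  have "continuous_dependence c \<tau> \<eta>0 u"
    unfolding continuous_dependence_def Let_def
  proof (intro exI[of _ 1] conjI ballI allI impI)
    show "\<exists>\<zeta>. is_solution c \<tau> \<zeta>0 \<zeta>" if "\<zeta>0 \<in> ?B" for \<zeta>0
      using near[OF that] lipschitz_solution_is_solution[OF c] by blast
  next
    fix \<zeta>0 \<zeta>
    assume a: "(\<forall>n. \<zeta>0 n \<in> ?B \<and> is_solution c \<tau> (\<zeta>0 n) (\<zeta> n)) \<and> tendsto_wrt seminorms_H1_W1inf \<zeta>0 \<eta>0 sequentially"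
    have "\<forall>k. \<exists>vn. lipschitz_solution c \<tau> (fst vn) (snd vn) \<and> bounded_until \<tau> R (fst vn) (snd vn) \<and>
      (AE x in torus. fst vn 0 x = \<zeta>0 k x)" using near a by blast
    from choice[OF this] obtain vn where
      vn: "\<forall>k. lipschitz_solution c \<tau> (fst (vn k)) (snd (vn k)) \<and> bounded_until \<tau> R (fst (vn k)) (snd (vn k)) \<and>
      (AE x in torus. fst (vn k) 0 x = \<zeta>0 k x)" ..
    have v: "lipschitz_solution c \<tau> (fst (vn k)) (snd (vn k))" "bounded_until \<tau> R (fst (vn k)) (snd (vn k))"
      "AE x in torus. fst (vn k) 0 x = \<zeta>0 k x" for k using vn by blast+
    have \<zeta>: "is_solution c \<tau> (\<zeta>0 k) (\<zeta> k)" "\<zeta>0 k \<in> L2_per" for k using a by (auto simp: H1_per_def)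
    note conv = solutions_converge[OF c \<tau> R u(1,3) ini v \<zeta>(1) \<eta>2 \<zeta>(2) a[THEN conjunct2]]
    show "converges_C0 seminorms_H1_W1inf {-\<tau><..<\<tau>} \<zeta> u" by (rule conv(1))
    show "converges_C0 seminorms_L2_Linf {-\<tau><..<\<tau>} (\<lambda>n. time_deriv (\<zeta> n)) (time_deriv u)" by (rule conv(2))
  qed simp
  then show ?thesis
    using \<tau> lipschitz_solution_is_solution[OF c u(1) ini] solution_unique[OF c _ u(1) ini] by blast
qed

end
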